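(* Let $\beta>0$ and suppose: (1) for every $N\in\mathbb N$ and $x_1,\dots,x_N\in\mathbb R^d$, $\mu\mapsto c(\mu,\rho)$ is continuous on $\mathcal P(\{x_1,\dots,x_N\})$ uniformly in $\rho\in\mathbb H$; (2) for every $x\in\mathbb R^d$, the set $\{\rho(x)-\rho(0):\rho\in\mathbb H\}$ is a bounded subset of $\mathbb R$. Let $u,w\in C(\mathcal P_p)$ be, respectively, a viscosity subsolution and a viscosity supersolution of $\beta u(\mu)+\sup_{\rho\in\mathbb H}\{-c(\mu,\rho)-Lu(\mu,\rho)\}=0$, $\mu\in\mathcal P_p$, for some $q\in[1,p]\cup\{0\}$. Then $u\le w$ on $\mathcal P_p$.
   Context: Fix $d\in\mathbb N$. $\mathcal P$: Borel probability measures on $\mathbb R^d$ (weak topology); for $r\in[1,\infty)$, $\mathcal P_r$: those with finite $r$-th moment, with Wasserstein-$r$ metric; $\mathcal P_0:=\mathcal P$; $|x|^0:=1$; $\mathcal P(\{x_1,\dots,x_N\})$ denotes probability measures supported in $\{x_1,\dots,x_N\}$; $\mu(\varphi)=\int\varphi\,d\mu$. Fix $p\in[1,\infty)\cup\{0\}$, a Polish space $\mathbb H$ of measurable real functions on $\mathbb R^d$, a measurable $c:\mathcal P_p\times\mathbb H\to\mathbb R\cup\{+\infty\}$ and $\beta\ge0$. $C^2(\mathcal P_q)$: functions $f:\mathcal P_q\to\mathbb R$ with continuous $\frac{\partial f}{\partial\mu}$ on $\mathbb R^d\times\mathcal P_q$ and continuous $\frac{\partial^2 f}{\partial\mu^2}$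 on $\mathbb R^d\times\mathbb R^d\times\mathcal P_q$ (symmetric in $x,y$), with $|\frac{\partial f}{\partial\mu}(x,\mu)|\le c_K(1+|x|^q)$, $|\frac{\partial^2 f}{\partial\mu^2}(x,y,\mu)|\le c_K(1+|x|^q+|y|^q)$ for $\mu$ in any compact $K\subset\mathcal P_q$, and for all $\mu,\nu\in\mathcal P_q$: $f(\nu)-f(\mu)=\int_0^1\int\frac{\partial f}{\partial\mu}(x,t\nu+(1-t)\mu)(\nu-\mu)(dx)dt$, $f(\nu)-f(\mu)-\int\frac{\partial f}{\partial\mu}(x,\mu)(\nu-\mu)(dx)=\int_0^1\int_0^t\iint\frac{\partial^2f}{\partial\mu^2}(x,y,s\nu+(1-s)\mu)(\nu-\mu)^{\otimes2}(dx,dy)ds\,dt$. For $\mu\in\mathcal P_p$, $\rho\in\mathbb H$: $Lf(\mu,\rho)=\frac12\iint\frac{\partial^2f}{\partial\mu^2}(x,y,\mu)\sigma(dx)\sigma(dy)$, $\sigma(dx)=(\rho(x)-\mu(\rho))\mu(dx)$, when $\rho\in L^1(\mu)$ and the integrand lies in $L^1(|\sigma|\otimes|\sigma|)$, else $+\infty$. $H(\mu;f)=\beta f(\mu)+\sup_{\rho\in\mathbb H}\{-c(\mu,\rho)-Lf(\mu,\rho)\}$. $\mu\preceq\nu$ iff $\operatorname{supp}\mu\subseteq\operatorname{supp}\nu$; $D_{\bar\mu}=\{\mu\in\mathcal P_p:\mu\preceq\bar\mu\}$; limits in $\mathcal P_p$. $u:\mathcal P_p\to\overline{\mathbb R}$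 is a viscosity subsolution if $\liminf_{\mu\to\bar\mu,\mu\preceq\bar\mu}H(\mu;f)\le0$ for all $\bar\mu\in\mathcal P_p$, $f\in C^2(\mathcal P_q)$ with $f(\bar\mu)=\limsup_{\mu\to\bar\mu,\mu\preceq\bar\mu}u(\mu)$ and $f\ge u$ on $D_{\bar\mu}$; a viscosity supersolution if $\limsup_{\mu\to\bar\mu,\mu\preceq\bar\mu}H(\mu;f)\ge0$ for all $\bar\mu$, $f$ with $f(\bar\mu)=\liminf_{\mu\to\bar\mu,\mu\preceq\bar\mu}u(\mu)$ and $f\le u$ on $D_{\bar\mu}$. *)

theory Defs
  imports "HOL-Probability.Probability"
begin

definition Prob :: "'a::euclidean_space measure set" where
  "Prob = {\<mu>. prob_space \<mu> \<and> sets \<mu> = sets borel}"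

text \<open>The convention |x|^0 = 1 (note: in Isabelle 0 powr 0 = 0, so we make it explicit).\<close>
definition pw :: "'a::euclidean_space \<Rightarrow> real \<Rightarrow> real" where
  "pw x r = (if r = 0 then 1 else norm x powr r)"

definition Pp :: "real \<Rightarrow> 'a::euclidean_space measure set" where
  "Pp r = {\<mu>\<in>Prob. r = 0 \<or> (\<integral>\<^sup>+ x. ennreal (norm x powr r) \<partial>\<mu>) < \<infinity>}"

definition couplings :: "'a::euclidean_space measure \<Rightarrow> 'a measure \<Rightarrow> ('a \<times> 'a) measure set" where
  "couplings \<mu> \<nu> = {\<pi>. prob_space \<pi> \<and> sets \<pi> = sets (borel \<Otimes>\<^sub>M borel)
      \<and> distr \<pi> borel fst = \<mu> \<and> distr \<pi> borel snd = \<nu>}"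

definition Wass :: "real \<Rightarrow> 'a::euclidean_space measure \<Rightarrow> 'a measure \<Rightarrow> real" where
  "Wass r \<mu> \<nu> = enn2real (INF \<pi>\<in>couplings \<mu> \<nu>. \<integral>\<^sup>+ z. ennreal (dist (fst z) (snd z) powr r) \<partial>\<pi>)
                  powr (1 / r)"

definition convP :: "real \<Rightarrow> (nat \<Rightarrow> 'a::euclidean_space measure) \<Rightarrow> 'a measure \<Rightarrow> bool" where
  "convP p \<mu>s \<mu> \<longleftrightarrow>
     (if p = 0 then
        (\<forall>f::'a \<Rightarrow> real. continuous_on UNIV f \<and> bounded (range f) \<longrightarrow>
            (\<lambda>n. \<integral>x. f x \<partial>(\<mu>s n)) \<longlonglongrightarrow> (\<integral>x. f x \<partial>\<mu>))
      else (\<lambda>n. Wass p (\<mu>s n) \<mu>) \<longlonglongrightarrow> 0)"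

text \<open>The topology of P_p (both topologies are metrizable, so they are determined by
  their convergent sequences: open = sequentially open).\<close>
definition TP :: "real \<Rightarrow> 'a::euclidean_space measure topology" where
  "TP p = topology (\<lambda>U. U \<subseteq> Pp p \<and>
      (\<forall>\<mu>s \<mu>. \<mu> \<in> U \<and> range \<mu>s \<subseteq> Pp p \<and> convP p \<mu>s \<mu> \<longrightarrow> (\<forall>\<^sub>F n in sequentially. \<mu>s n \<in> U)))"

definition borel_of :: "'b topology \<Rightarrow> 'b measure" where
  "borel_of T = sigma (topspace T) {U. openin T U}"

definition Polish :: "'b topology \<Rightarrow> bool" where
  "Polish T \<longleftrightarrow> completely_metrizable_space T \<and> separable_space T"

definition supp :: "'a::euclidean_space measure \<Rightarrow> 'a set" where
  "supp \<mu> = {x. \<forall>e>0. emeasure \<mu> (ball x e) > 0}"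

definition Dset :: "real \<Rightarrow> 'a::euclidean_space measure \<Rightarrow> 'a measure set" where
  "Dset p \<mu>b = {\<mu>\<in>Pp p. supp \<mu> \<subseteq> supp \<mu>b}"

definition ulimsup :: "real \<Rightarrow> 'a::euclidean_space measure set \<Rightarrow> ('a measure \<Rightarrow> ereal) \<Rightarrow> 'a measure \<Rightarrow> ereal" where
  "ulimsup p D g \<mu>b = (INF U\<in>{U. openin (TP p) U \<and> \<mu>b \<in> U}. SUP \<mu>\<in>U \<inter> D. g \<mu>)"

definition uliminf :: "real \<Rightarrow> 'a::euclidean_space measure set \<Rightarrow> ('a measure \<Rightarrow> ereal) \<Rightarrow> 'a measure \<Rightarrow> ereal" where
  "uliminf p D g \<mu>b = (SUP U\<in>{U. openin (TP p) U \<and> \<mu>b \<in> U}. INF \<mu>\<in>U \<inter> D. g \<mu>)"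

definition mixm :: "real \<Rightarrow> 'a::euclidean_space measure \<Rightarrow> 'a measure \<Rightarrow> 'a measure" where
  "mixm t \<nu> \<mu> = measure_of UNIV (sets borel)
      (\<lambda>A. ennreal t * emeasure \<nu> A + ennreal (1 - t) * emeasure \<mu> A)"

definition sint :: "'a::euclidean_space measure \<Rightarrow> 'a measure \<Rightarrow> ('a \<Rightarrow> real) \<Rightarrow> real" where
  "sint \<mu> \<nu> \<phi> = (\<integral>x. \<phi> x \<partial>\<nu>) - (\<integral>x. \<phi> x \<partial>\<mu>)"

text \<open>C2 q f Df D2f: f is in C^2(P_q) with first and second linear functional
  derivatives Df and D2f.\<close>
definition C2 :: "real \<Rightarrow> ('a::euclidean_space measure \<Rightarrow> real) \<Rightarrow> ('a \<Rightarrow> 'a measure \<Rightarrow> real)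
    \<Rightarrow> ('a \<Rightarrow> 'a \<Rightarrow> 'a measure \<Rightarrow> real) \<Rightarrow> bool" where
  "C2 q f Df D2f \<longleftrightarrow>
     continuous_map (prod_topology euclidean (TP q)) euclideanreal (\<lambda>(x, \<mu>). Df x \<mu>) \<and>
     continuous_map (prod_topology (prod_topology euclidean euclidean) (TP q)) euclideanreal
        (\<lambda>((x, y), \<mu>). D2f x y \<mu>) \<and>
     (\<forall>\<mu>\<in>Pp q. \<forall>x y. D2f x y \<mu> = D2f y x \<mu>) \<and>
     (\<forall>K. compactin (TP q) K \<longrightarrow>
        (\<exists>C. \<forall>\<mu>\<in>K. \<forall>x. \<bar>Df x \<mu>\<bar> \<le> C * (1 + pw x q)) \<and>
        (\<exists>C. \<forall>\<mu>\<in>K. \<forall>x y. \<bar>D2f x y \<mu>\<bar> \<le> C * (1 + pw x q + pw y q))) \<and>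
     (\<forall>\<mu>\<in>Pp q. \<forall>\<nu>\<in>Pp q.
        f \<nu> - f \<mu> = integral {0..1} (\<lambda>t. sint \<mu> \<nu> (\<lambda>x. Df x (mixm t \<nu> \<mu>))) \<and>
        f \<nu> - f \<mu> - sint \<mu> \<nu> (\<lambda>x. Df x \<mu>) =
          integral {0..1} (\<lambda>t. integral {0..t} (\<lambda>s.
             sint \<mu> \<nu> (\<lambda>x. sint \<mu> \<nu> (\<lambda>y. D2f x y (mixm s \<nu> \<mu>))))))"

text \<open>Lf(mu, rho), with sigma(dx) = (rho x - mu(rho)) mu(dx); +\<infinity> if not well defined.\<close>
definition Lop :: "('a::euclidean_space \<Rightarrow> 'a \<Rightarrow> 'a measure \<Rightarrow> real) \<Rightarrow> 'a measure \<Rightarrow> ('a \<Rightarrow> real) \<Rightarrow> ereal" where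
  "Lop D2f \<mu> \<rho> =
     (let m = (\<integral>x. \<rho> x \<partial>\<mu>);
          g = (\<lambda>(x, y). D2f x y \<mu> * (\<rho> x - m) * (\<rho> y - m))
      in if integrable \<mu> \<rho> \<and> integrable (\<mu> \<Otimes>\<^sub>M \<mu>) g
         then ereal (1 / 2 * (\<integral>z. g z \<partial>(\<mu> \<Otimes>\<^sub>M \<mu>))) else \<infinity>)"

definition Ham :: "('a::euclidean_space measure \<Rightarrow> ('a \<Rightarrow> real) \<Rightarrow> ereal) \<Rightarrow> ('a \<Rightarrow> real) set \<Rightarrow> real
    \<Rightarrow> ('a measure \<Rightarrow> real) \<Rightarrow> ('a \<Rightarrow> 'a \<Rightarrow> 'a measure \<Rightarrow> real) \<Rightarrow> 'a measure \<Rightarrow> ereal" where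
  "Ham c Hs \<beta> f D2f \<mu> = ereal (\<beta> * f \<mu>) + (SUP \<rho>\<in>Hs. - c \<mu> \<rho> - Lop D2f \<mu> \<rho>)"

definition visc_sub :: "real \<Rightarrow> real \<Rightarrow> ('a::euclidean_space measure \<Rightarrow> ('a \<Rightarrow> real) \<Rightarrow> ereal)
    \<Rightarrow> ('a \<Rightarrow> real) set \<Rightarrow> real \<Rightarrow> ('a measure \<Rightarrow> ereal) \<Rightarrow> bool" where
  "visc_sub p q c Hs \<beta> u \<longleftrightarrow>
     (\<forall>\<mu>b\<in>Pp p. \<forall>f Df D2f.
        C2 q f Df D2f \<and> ereal (f \<mu>b) = ulimsup p (Dset p \<mu>b) u \<mu>b \<and>
        (\<forall>\<mu>\<in>Dset p \<mu>b. u \<mu> \<le> ereal (f \<mu>))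
        \<longrightarrow> uliminf p (Dset p \<mu>b) (Ham c Hs \<beta> f D2f) \<mu>b \<le> 0)"

definition visc_super :: "real \<Rightarrow> real \<Rightarrow> ('a::euclidean_space measure \<Rightarrow> ('a \<Rightarrow> real) \<Rightarrow> ereal)
    \<Rightarrow> ('a \<Rightarrow> real) set \<Rightarrow> real \<Rightarrow> ('a measure \<Rightarrow> ereal) \<Rightarrow> bool" where
  "visc_super p q c Hs \<beta> u \<longleftrightarrow>
     (\<forall>\<mu>b\<in>Pp p. \<forall>f Df D2f.
        C2 q f Df D2f \<and> ereal (f \<mu>b) = uliminf p (Dset p \<mu>b) u \<mu>b \<and>
        (\<forall>\<mu>\<in>Dset p \<mu>b. ereal (f \<mu>) \<le> u \<mu>)
        \<longrightarrow> ulimsup p (Dset p \<mu>b) (Ham c Hs \<beta> f D2f) \<mu>b \<ge> 0)"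

definition PX :: "'a::euclidean_space set \<Rightarrow> 'a measure set" where
  "PX X = {\<mu>\<in>Prob. emeasure \<mu> (UNIV - X) = 0}"

end

theory Submission
  imports Defs "HOL-Library.Function_Algebras" "HOL-Real_Asymp.Real_Asymp"
begin

text \<open>
  Finitely supported measures are dense in every \<open>P_p\<close>, so it is enough to compare u and w on the simplex over a
  finite set X. Maximise u - w there and shrink X to the support of the maximiser, which then is an interior point.
  Write the weights as \<open>m i = exp (z i) / N z\<close> with \<open>N z\<close> the sum of the \<open>exp (z i)\<close>, and replace u by its lift
  \<open>U z = N z * u m\<close>. In these coordinates the operator \<open>L(\<cdot>, \<rho>)\<close> acts on U with constant coefficients: it is the
  generator A of a random walk with step \<open>\<plusminus> h * \<rho> - h\<^sup>2 * \<rho>\<^sup>2 / 2\<close>, and A N = 0. The maximum principle,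
  applied step by step along the walk, turns the viscosity inequality \<open>A U \<ge> - K * N\<close> into a mean value inequality,
  which survives translation invariant averaging; hence mollified lifts are classical subsolutions, with N only
  multiplied by a constant. A smooth function touching w from below near the maximiser then gives the comparison
  directly, and no Crandall-Ishii lemma is needed.
\<close>

section \<open>Local averages of functions of finitely many coordinates\<close>

text \<open>On the simplex the operator at m differentiates twice in the direction
  \<open>(\<rho> - mean) * m\<close>. Its coefficients vary with m and degenerate at the boundary,
  and averaging a subsolution is compatible only with constant coefficients. The degree-one lift
  removes the mean, the logarithm removes the factor m, and what is left over is the drift of the
  walk.

  The two functions are treated asymmetrically because the Hamiltonian is a supremum. The
  subsolution inequality holds for each fixed \<rho>; it is linear and survives averaging. The
  supersolution inequality is used at one contact point and only for the single \<rho> that it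
  supplies there. The mollification is fixed before this \<rho> is known, so it must not depend on
  \<rho>, and the cost has to be continuous at the maximiser uniformly in \<rho>. Then
  \<open>c\<close> and \<open>\<beta> * u\<close> can be frozen there, up to a small error, into the
  one constant K of the linear inequality.

  The barrier that localises the maximum principle costs an error of order \<open>T\<^sup>2\<close>
  over n steps with \<open>n * h\<^sup>2 = T\<close>. It disappears when the inequality is divided
  by T and T tends to 0.\<close>

text \<open>Functions on the type of all maps are compared only through the coordinates in the finite set X;
  the norm l1 and the filter nz below see just these, so no topology on the function type is involved.\<close>

definition l1 :: "'i set \<Rightarrow> ('i \<Rightarrow> real) \<Rightarrow> real" where
  "l1 X \<zeta> = (\<Sum>i\<in>X. \<bar>\<zeta> i\<bar>)"

definition unit :: "'i \<Rightarrow> real \<Rightarrow> 'i \<Rightarrow> real" where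
  "unit i s = (\<lambda>j. if j = i then s else 0)"

text \<open>Boundedness and one modulus for all base points, both measured by \<open>l1 X\<close>.
  An increment that vanishes on X has seminorm 0, so such functions depend on the coordinates in X
  alone.\<close>

definition ucont :: "'i set \<Rightarrow> (('i \<Rightarrow> real) \<Rightarrow> real) \<Rightarrow> bool" where
  "ucont X F \<longleftrightarrow> (\<exists>B. \<forall>z. \<bar>F z\<bar> \<le> B) \<and>
     (\<forall>e>0. \<exists>d>0. \<forall>z \<zeta>. l1 X \<zeta> < d \<longrightarrow> \<bar>F (z + \<zeta>) - F z\<bar> \<le> e)"

text \<open>Shifts, random walk steps and mollifiers are all translation invariant averages over a cube of radius r,
  hence they commute with one another and with differentiation.\<close>

definition avg :: "'i set \<Rightarrow> real \<Rightarrow> ((('i \<Rightarrow> real) \<Rightarrow> real) \<Rightarrow> ('i \<Rightarrow> real) \<Rightarrow> real) \<Rightarrow> bool" where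
  "avg X r E \<longleftrightarrow>
     (\<forall>F G a b. ucont X F \<longrightarrow> ucont X G \<longrightarrow> E (\<lambda>z. a * F z + b * G z) = (\<lambda>z. a * E F z + b * E G z)) \<and>
     (\<forall>c. E (\<lambda>z. c) = (\<lambda>z. c)) \<and>
     (\<forall>F v. ucont X F \<longrightarrow> E (\<lambda>z. F (z + v)) = (\<lambda>z. E F (z + v))) \<and>
     (\<forall>F G z. ucont X F \<longrightarrow> ucont X G \<longrightarrow>
        (\<forall>v. (\<forall>i\<in>X. \<bar>v i\<bar> \<le> r) \<longrightarrow> F (z + v) \<le> G (z + v)) \<longrightarrow> E F z \<le> E G z)"

text \<open>Differentiability is uniform in the base point and restricted to increments in the directions I:
  a Steklov average in direction i adds i to this set.\<close>

definition diff_on :: "'i set \<Rightarrow> 'i set \<Rightarrow> (('i \<Rightarrow> real) \<Rightarrow> real) \<Rightarrow> ('i \<Rightarrow> ('i \<Rightarrow> real) \<Rightarrow> real) \<Rightarrow> bool" where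
  "diff_on X I F G \<longleftrightarrow> (\<forall>e>0. \<exists>d>0. \<forall>z \<zeta>. l1 X \<zeta> < d \<longrightarrow> (\<forall>i\<in>X - I. \<zeta> i = 0) \<longrightarrow>
      \<bar>F (z + \<zeta>) - F z - (\<Sum>i\<in>I. \<zeta> i * G i z)\<bar> \<le> e * l1 X \<zeta>)"

text \<open>Differentiability is expressed through witnesses G for the partial derivatives, with a
  remainder uniform in the base point. Every average inherits this form, because the averages of the
  witnesses are again witnesses.\<close>

primrec Ck :: "'i set \<Rightarrow> nat \<Rightarrow> (('i \<Rightarrow> real) \<Rightarrow> real) \<Rightarrow> bool" where
  "Ck X 0 F = ucont X F"
| "Ck X (Suc k) F = (ucont X F \<and> (\<exists>G. diff_on X X F G \<and> (\<forall>i\<in>X. Ck X k (G i))))"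

lemma l1_nonneg [simp]: "0 \<le> l1 X \<zeta>"
  by (simp add: l1_def sum_nonneg)

lemma abs_le_l1: "finite X \<Longrightarrow> i \<in> X \<Longrightarrow> \<bar>\<zeta> i\<bar> \<le> l1 X \<zeta>"
  unfolding l1_def by (rule member_le_sum) auto

lemma l1_scale: "l1 X (\<lambda>i. t * \<zeta> i) = \<bar>t\<bar> * l1 X \<zeta>"
  by (simp add: l1_def abs_mult sum_distrib_left)

lemma l1_unit: "finite X \<Longrightarrow> i \<in> X \<Longrightarrow> l1 X (unit i s) = \<bar>s\<bar>"
  by (simp add: l1_def unit_def if_distrib[of abs] cong: if_cong)

lemma unit_add: "unit i s + unit i t = unit i (s + t)"
  by (auto simp: unit_def)

lemma unit_0 [simp]: "unit i 0 = 0"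
  by (auto simp: unit_def)

lemma l1_bound: "finite X \<Longrightarrow> (\<And>i. i \<in> X \<Longrightarrow> \<bar>\<zeta> i\<bar> \<le> r) \<Longrightarrow> l1 X \<zeta> \<le> real (card X) * r"
  unfolding l1_def using sum_bounded_above[of X "\<lambda>i. \<bar>\<zeta> i\<bar>" r] by simp

lemma ucont_bound: "ucont X F \<Longrightarrow> \<exists>B>0. \<forall>z. \<bar>F z\<bar> \<le> B"
proof -
  assume "ucont X F"
  then obtain B where B: "\<And>z. \<bar>F z\<bar> \<le> B" unfolding ucont_def by auto
  then have "\<bar>F z\<bar> \<le> \<bar>B\<bar> + 1" for z using B[of z] by linarith
  then show ?thesis by (intro exI[of _ "\<bar>B\<bar> + 1"]) auto
qed

lemma ucont_modulus: "ucont X F \<Longrightarrow> 0 < e \<Longrightarrow> \<exists>d>0. \<forall>z \<zeta>. l1 X \<zeta> < d \<longrightarrow> \<bar>F (z + \<zeta>) - F z\<bar> \<le> e"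
  unfolding ucont_def by blast

lemma ucont_const [simp]: "ucont X (\<lambda>z. c)"
  unfolding ucont_def by (auto intro: exI[of _ 1])

lemma ucont_lincomb:
  assumes "ucont X F" "ucont X G"
  shows "ucont X (\<lambda>z. a * F z + b * G z)"
  unfolding ucont_def
proof (intro conjI allI impI)
  obtain B1 B2 where B: "\<And>z. \<bar>F z\<bar> \<le> B1" "\<And>z. \<bar>G z\<bar> \<le> B2"
    using assms unfolding ucont_def by auto
  have "\<bar>a * F z + b * G z\<bar> \<le> \<bar>a\<bar> * B1 + \<bar>b\<bar> * B2" for z
    using abs_triangle_ineq[of "a * F z" "b * G z"]
      mult_left_mono[OF B(1)[of z], of "\<bar>a\<bar>"] mult_left_mono[OF B(2)[of z], of "\<bar>b\<bar>"]
    by (auto simp: abs_mult)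
  then show "\<exists>B. \<forall>z. \<bar>a * F z + b * G z\<bar> \<le> B" by blast
next
  fix e :: real assume e: "e > 0"
  define e' where "e' = e / (\<bar>a\<bar> + \<bar>b\<bar> + 1)"
  have e': "e' > 0" "(\<bar>a\<bar> + \<bar>b\<bar> + 1) * e' = e"
    using e by (auto simp: e'_def add_nonneg_pos intro!: divide_pos_pos)
  obtain d1 d2 where d: "d1 > 0" "d2 > 0"
      "\<And>z \<zeta>. l1 X \<zeta> < d1 \<Longrightarrow> \<bar>F (z + \<zeta>) - F z\<bar> \<le> e'"
      "\<And>z \<zeta>. l1 X \<zeta> < d2 \<Longrightarrow> \<bar>G (z + \<zeta>) - G z\<bar> \<le> e'"
    using ucont_modulus[OF assms(1) e'(1)] ucont_modulus[OF assms(2) e'(1)] by blast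
  have "\<bar>(a * F (z + \<zeta>) + b * G (z + \<zeta>)) - (a * F z + b * G z)\<bar> \<le> e"
    if "l1 X \<zeta> < min d1 d2" for z \<zeta>
  proof -
    have "\<bar>(a * F (z + \<zeta>) + b * G (z + \<zeta>)) - (a * F z + b * G z)\<bar>
        = \<bar>a * (F (z + \<zeta>) - F z) + b * (G (z + \<zeta>) - G z)\<bar>" by (simp add: algebra_simps)
    also have "\<dots> \<le> \<bar>a\<bar> * \<bar>F (z + \<zeta>) - F z\<bar> + \<bar>b\<bar> * \<bar>G (z + \<zeta>) - G z\<bar>"
      by (rule order_trans[OF abs_triangle_ineq]) (simp add: abs_mult)
    also have "\<dots> \<le> \<bar>a\<bar> * e' + \<bar>b\<bar> * e'"
      using d(3)[of \<zeta> z] d(4)[of \<zeta> z] that by (intro add_mono mult_left_mono) auto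
    also have "\<dots> \<le> e" using e' by (simp add: algebra_simps)
    finally show ?thesis .
  qed
  then show "\<exists>d>0. \<forall>z \<zeta>. l1 X \<zeta> < d \<longrightarrow> \<bar>a * F (z + \<zeta>) + b * G (z + \<zeta>) - (a * F z + b * G z)\<bar> \<le> e"
    using d(1,2) by (intro exI[of _ "min d1 d2"]) auto
qed

lemma ucont_scale: "ucont X F \<Longrightarrow> ucont X (\<lambda>z. a * F z)"
  using ucont_lincomb[of X F F a 0] by simp

lemma ucont_diff: "ucont X F \<Longrightarrow> ucont X G \<Longrightarrow> ucont X (\<lambda>z. F z - G z)"
  using ucont_lincomb[of X F G 1 "-1"] by simp

lemma ucont_add: "ucont X F \<Longrightarrow> ucont X G \<Longrightarrow> ucont X (\<lambda>z. F z + G z)"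
  using ucont_lincomb[of X F G 1 1] by simp

lemma ucont_sum: "(\<And>i. i \<in> I \<Longrightarrow> ucont X (F i)) \<Longrightarrow> ucont X (\<lambda>z. \<Sum>i\<in>I. F i z)"
  by (induction I rule: infinite_finite_induct) (auto intro: ucont_add)

lemma ucont_translate: "ucont X F \<Longrightarrow> ucont X (\<lambda>z. F (z + v))"
  unfolding ucont_def
proof (elim conjE, intro conjI allI impI)
  fix e :: real assume *: "\<forall>e>0. \<exists>d>0. \<forall>z \<zeta>. l1 X \<zeta> < d \<longrightarrow> \<bar>F (z + \<zeta>) - F z\<bar> \<le> e" and "e > 0"
  then obtain d where d: "d > 0" "\<And>z \<zeta>. l1 X \<zeta> < d \<Longrightarrow> \<bar>F (z + \<zeta>) - F z\<bar> \<le> e" by blast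
  have "\<bar>F (z + \<zeta> + v) - F (z + v)\<bar> \<le> e" if "l1 X \<zeta> < d" for z \<zeta>
    using d(2)[OF that, of "z + v"] by (simp add: ac_simps)
  then show "\<exists>d>0. \<forall>z \<zeta>. l1 X \<zeta> < d \<longrightarrow> \<bar>F (z + \<zeta> + v) - F (z + v)\<bar> \<le> e" using d(1) by blast
qed blast

lemma avg_linear: "avg X r E \<Longrightarrow> ucont X F \<Longrightarrow> ucont X G \<Longrightarrow>
    E (\<lambda>z. a * F z + b * G z) = (\<lambda>z. a * E F z + b * E G z)"
  and avg_const: "avg X r E \<Longrightarrow> E (\<lambda>z. c) = (\<lambda>z. c)"
  and avg_translate: "avg X r E \<Longrightarrow> ucont X F \<Longrightarrow> E (\<lambda>z. F (z + v)) = (\<lambda>z. E F (z + v))"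
  and avg_mono: "avg X r E \<Longrightarrow> ucont X F \<Longrightarrow> ucont X G \<Longrightarrow>
        (\<And>v. (\<forall>i\<in>X. \<bar>v i\<bar> \<le> r) \<Longrightarrow> F (z + v) \<le> G (z + v)) \<Longrightarrow> E F z \<le> E G z"
  unfolding avg_def by blast+

lemma avg_scale: "avg X r E \<Longrightarrow> ucont X F \<Longrightarrow> E (\<lambda>z. a * F z) = (\<lambda>z. a * E F z)"
  using avg_linear[of X r E F F a 0] by simp

lemma avg_add: "avg X r E \<Longrightarrow> ucont X F \<Longrightarrow> ucont X G \<Longrightarrow> E (\<lambda>z. F z + G z) = (\<lambda>z. E F z + E G z)"
  using avg_linear[of X r E F G 1 1] by simp

lemma avg_diff: "avg X r E \<Longrightarrow> ucont X F \<Longrightarrow> ucont X G \<Longrightarrow> E (\<lambda>z. F z - G z) = (\<lambda>z. E F z - E G z)"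
  using avg_linear[of X r E F G 1 "-1"] by simp

lemma avg_sum:
  assumes "avg X r E" "\<And>i. i \<in> I \<Longrightarrow> ucont X (F i)"
  shows "E (\<lambda>z. \<Sum>i\<in>I. F i z) = (\<lambda>z. \<Sum>i\<in>I. E (F i) z)"
  using assms(2)
proof (induction I rule: infinite_finite_induct)
  case (insert i I)
  then show ?case
    using avg_add[OF assms(1), of "F i" "\<lambda>z. \<Sum>i\<in>I. F i z"] by (simp add: ucont_sum)
qed (simp_all add: avg_const[OF assms(1)])

lemma avg_abs_bound:
  assumes "avg X r E" "ucont X F" "\<And>v. (\<forall>i\<in>X. \<bar>v i\<bar> \<le> r) \<Longrightarrow> \<bar>F (z + v)\<bar> \<le> B"
  shows "\<bar>E F z\<bar> \<le> B"
proof -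
  have "E F z \<le> E (\<lambda>z. B) z" "E (\<lambda>z. - B) z \<le> E F z"
    using avg_mono[OF assms(1,2) ucont_const, of z B] avg_mono[OF assms(1) ucont_const assms(2), of "- B" z] assms(3)
    by (simp_all add: abs_le_iff minus_le_iff)
  then show ?thesis by (simp add: avg_const[OF assms(1)])
qed

text \<open>Translation invariance writes the increment of \<open>E F\<close> as the average of the
  increment of F, so bound and modulus carry over unchanged.\<close>

lemma avg_ucont:
  assumes "avg X r E" "ucont X F"
  shows "ucont X (E F)"
  unfolding ucont_def
proof (intro conjI allI impI)
  obtain B where "\<And>z. \<bar>F z\<bar> \<le> B" using assms(2) unfolding ucont_def by auto
  then show "\<exists>B. \<forall>z. \<bar>E F z\<bar> \<le> B" using avg_abs_bound[OF assms] by blast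
next
  fix e :: real assume "e > 0"
  then obtain d where d: "d > 0" "\<And>z \<zeta>. l1 X \<zeta> < d \<Longrightarrow> \<bar>F (z + \<zeta>) - F z\<bar> \<le> e"
    using ucont_modulus[OF assms(2)] by blast
  have "\<bar>E F (z + \<zeta>) - E F z\<bar> \<le> e" if "l1 X \<zeta> < d" for z \<zeta>
  proof -
    have "E (\<lambda>z. F (z + \<zeta>) - F z) z = E F (z + \<zeta>) - E F z"
      using avg_diff[OF assms(1) ucont_translate[OF assms(2)] assms(2)] avg_translate[OF assms]
      by (simp add: fun_eq_iff)
    moreover have "\<bar>E (\<lambda>z. F (z + \<zeta>) - F z) z\<bar> \<le> e"
      using d(2)[OF that] assms by (intro avg_abs_bound[OF assms(1)] ucont_diff ucont_translate) auto
    ultimately show ?thesis by simp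
  qed
  then show "\<exists>d>0. \<forall>z \<zeta>. l1 X \<zeta> < d \<longrightarrow> \<bar>E F (z + \<zeta>) - E F z\<bar> \<le> e" using d(1) by blast
qed

lemma avg_id: "0 \<le> r \<Longrightarrow> avg X r (\<lambda>F. F)"
  unfolding avg_def
proof (intro conjI allI impI)
  fix F G :: "('a \<Rightarrow> real) \<Rightarrow> real" and z
  assume "0 \<le> r" "\<forall>v. (\<forall>i\<in>X. \<bar>v i\<bar> \<le> r) \<longrightarrow> F (z + v) \<le> G (z + v)"
  then show "F z \<le> G z" by (elim allE[of _ 0]) simp
qed simp_all

lemma avg_comp:
  assumes "avg X r E" "avg X s E'" "0 \<le> r" "0 \<le> s"
  shows "avg X (r + s) (\<lambda>F. E (E' F))"
  unfolding avg_def
proof (intro conjI allI impI)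
  fix F G :: "('a \<Rightarrow> real) \<Rightarrow> real" and z
  assume FG: "ucont X F" "ucont X G"
    and le: "\<forall>v. (\<forall>i\<in>X. \<bar>v i\<bar> \<le> r + s) \<longrightarrow> F (z + v) \<le> G (z + v)"
  show "E (E' F) z \<le> E (E' G) z"
  proof (rule avg_mono[OF assms(1)])
    fix v assume v: "\<forall>i\<in>X. \<bar>v i\<bar> \<le> r"
    show "E' F (z + v) \<le> E' G (z + v)"
    proof (rule avg_mono[OF assms(2) FG])
      fix v' assume v': "\<forall>i\<in>X. \<bar>v' i\<bar> \<le> s"
      have "\<bar>(v + v') i\<bar> \<le> r + s" if "i \<in> X" for i
        using v[rule_format, OF that] v'[rule_format, OF that] abs_triangle_ineq[of "v i" "v' i"]
        by simp
      then show "F (z + v + v') \<le> G (z + v + v')" using le[rule_format, of "v + v'"] by (simp add: ac_simps)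
    qed
  qed (use FG avg_ucont[OF assms(2)] in auto)
next
  fix F G :: "('a \<Rightarrow> real) \<Rightarrow> real" and a b
  assume "ucont X F" "ucont X G"
  then show "E (E' (\<lambda>z. a * F z + b * G z)) = (\<lambda>z. a * E (E' F) z + b * E (E' G) z)"
    by (simp add: avg_linear[OF assms(2)] avg_linear[OF assms(1)] avg_ucont[OF assms(2)])
next
  fix F :: "('a \<Rightarrow> real) \<Rightarrow> real" and v
  assume "ucont X F"
  then show "E (E' (\<lambda>z. F (z + v))) = (\<lambda>z. E (E' F) (z + v))"
    by (simp add: avg_translate[OF assms(2)] avg_translate[OF assms(1)] avg_ucont[OF assms(2)])
qed (simp add: avg_const[OF assms(1)] avg_const[OF assms(2)])

lemma avg_funpow:
  assumes "avg X r E" "0 \<le> r"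
  shows "avg X (real n * r) (E ^^ n)"
proof (induction n)
  case 0
  show ?case using avg_id[of 0] by (simp add: id_def)
next
  case (Suc n)
  show ?case using avg_comp[OF assms(1) Suc assms(2)] assms(2) by (simp add: o_def algebra_simps)
qed

text \<open>For a fixed increment the Taylor remainder is a linear combination of translates, so E
  maps the remainder of F to that of \<open>E F\<close>, and the estimate passes through the average
  with the same d.\<close>

lemma avg_diff_on:
  assumes "avg X r E" "ucont X F" "diff_on X I F G" "\<And>i. i \<in> I \<Longrightarrow> ucont X (G i)"
  shows "diff_on X I (E F) (\<lambda>i. E (G i))"
  unfolding diff_on_def
proof (intro allI impI)
  fix e :: real assume "e > 0"
  then obtain d where d: "d > 0" "\<And>z \<zeta>. l1 X \<zeta> < d \<Longrightarrow> (\<forall>i\<in>X - I. \<zeta> i = 0) \<Longrightarrow>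
      \<bar>F (z + \<zeta>) - F z - (\<Sum>i\<in>I. \<zeta> i * G i z)\<bar> \<le> e * l1 X \<zeta>"
    using assms(3) unfolding diff_on_def by blast
  have "\<bar>E F (z + \<zeta>) - E F z - (\<Sum>i\<in>I. \<zeta> i * E (G i) z)\<bar> \<le> e * l1 X \<zeta>"
    if "l1 X \<zeta> < d" "\<forall>i\<in>X - I. \<zeta> i = 0" for z \<zeta>
  proof -
    have "E (\<lambda>z. (F (z + \<zeta>) - F z) - (\<Sum>i\<in>I. \<zeta> i * G i z)) z
        = E F (z + \<zeta>) - E F z - (\<Sum>i\<in>I. \<zeta> i * E (G i) z)"
      using assms
      by (simp add: avg_diff[OF assms(1)] avg_sum[OF assms(1)] avg_scale[OF assms(1)]
          avg_translate[OF assms(1)] ucont_diff ucont_translate ucont_sum ucont_scale)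
    moreover have "\<bar>E (\<lambda>z. (F (z + \<zeta>) - F z) - (\<Sum>i\<in>I. \<zeta> i * G i z)) z\<bar> \<le> e * l1 X \<zeta>"
      using d(2)[OF that] assms
      by (intro avg_abs_bound[OF assms(1)] ucont_diff ucont_translate ucont_sum ucont_scale) auto
    ultimately show ?thesis by simp
  qed
  then show "\<exists>d>0. \<forall>z \<zeta>. l1 X \<zeta> < d \<longrightarrow> (\<forall>i\<in>X - I. \<zeta> i = 0) \<longrightarrow>
     \<bar>E F (z + \<zeta>) - E F z - (\<Sum>i\<in>I. \<zeta> i * E (G i) z)\<bar> \<le> e * l1 X \<zeta>" using d(1) by blast
qed

lemma Ck_ucont: "Ck X k F \<Longrightarrow> ucont X F"
  by (cases k) auto

lemma avg_Ck:
  assumes "avg X r E"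
  shows "Ck X k F \<Longrightarrow> Ck X k (E F)"
proof (induction k arbitrary: F)
  case 0
  then show ?case using avg_ucont[OF assms] by simp
next
  case (Suc k)
  then obtain G where G: "ucont X F" "diff_on X X F G" "\<forall>i\<in>X. Ck X k (G i)" by auto
  have "diff_on X X (E F) (\<lambda>i. E (G i))"
    using avg_diff_on[OF assms G(1,2)] G(3) Ck_ucont by blast
  then show ?case using Suc.IH G avg_ucont[OF assms] unfolding Ck.simps by (intro conjI exI[of _ "\<lambda>i. E (G i)"]) auto
qed

lemma avg_shift: "avg X (\<bar>s\<bar>) (\<lambda>F z. F (z + unit i s))"
  unfolding avg_def
proof (intro conjI allI impI)
  fix F G :: "('a \<Rightarrow> real) \<Rightarrow> real" and z
  assume "\<forall>v. (\<forall>i\<in>X. \<bar>v i\<bar> \<le> \<bar>s\<bar>) \<longrightarrow> F (z + v) \<le> G (z + v)"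
  then show "F (z + unit i s) \<le> G (z + unit i s)" by (rule allE[of _ "unit i s"]) (simp add: unit_def)
qed (simp_all add: ac_simps)

lemma diff_on_lincomb:
  assumes F: "diff_on X I F F'" and G: "diff_on X I G G'"
  shows "diff_on X I (\<lambda>z. a * F z + b * G z) (\<lambda>i z. a * F' i z + b * G' i z)"
  unfolding diff_on_def
proof (intro allI impI)
  fix e :: real assume e: "e > 0"
  define e' where "e' = e / (\<bar>a\<bar> + \<bar>b\<bar> + 1)"
  have e': "e' > 0" "(\<bar>a\<bar> + \<bar>b\<bar> + 1) * e' = e"
    using e by (auto simp: e'_def add_nonneg_pos intro!: divide_pos_pos)
  obtain d1 where d1: "d1 > 0"
      "\<And>z \<zeta>. l1 X \<zeta> < d1 \<Longrightarrow> (\<forall>i\<in>X - I. \<zeta> i = 0) \<Longrightarrow> \<bar>F (z + \<zeta>) - F z - (\<Sum>i\<in>I. \<zeta> i * F' i z)\<bar> \<le> e' * l1 X \<zeta>"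
    using F[unfolded diff_on_def, rule_format, OF e'(1)] by blast
  obtain d2 where d2: "d2 > 0"
      "\<And>z \<zeta>. l1 X \<zeta> < d2 \<Longrightarrow> (\<forall>i\<in>X - I. \<zeta> i = 0) \<Longrightarrow> \<bar>G (z + \<zeta>) - G z - (\<Sum>i\<in>I. \<zeta> i * G' i z)\<bar> \<le> e' * l1 X \<zeta>"
    using G[unfolded diff_on_def, rule_format, OF e'(1)] by blast
  note d = d1(1) d2(1) d1(2) d2(2)
  have "\<bar>(a * F (z + \<zeta>) + b * G (z + \<zeta>)) - (a * F z + b * G z)
        - (\<Sum>i\<in>I. \<zeta> i * (a * F' i z + b * G' i z))\<bar> \<le> e * l1 X \<zeta>"
    if "l1 X \<zeta> < min d1 d2" "\<forall>i\<in>X - I. \<zeta> i = 0" for z \<zeta>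
  proof -
    have eq: "(a * F (z + \<zeta>) + b * G (z + \<zeta>)) - (a * F z + b * G z)
        - (\<Sum>i\<in>I. \<zeta> i * (a * F' i z + b * G' i z))
      = a * (F (z + \<zeta>) - F z - (\<Sum>i\<in>I. \<zeta> i * F' i z)) + b * (G (z + \<zeta>) - G z - (\<Sum>i\<in>I. \<zeta> i * G' i z))"
    proof -
      have "(\<Sum>i\<in>I. \<zeta> i * (a * F' i z + b * G' i z))
          = a * (\<Sum>i\<in>I. \<zeta> i * F' i z) + b * (\<Sum>i\<in>I. \<zeta> i * G' i z)"
        unfolding sum_distrib_left sum.distrib[symmetric] by (rule sum.cong) (auto simp: algebra_simps)
      then show ?thesis by (simp only: right_diff_distrib)
    qed
    have "\<bar>a * (F (z + \<zeta>) - F z - (\<Sum>i\<in>I. \<zeta> i * F' i z)) + b * (G (z + \<zeta>) - G z - (\<Sum>i\<in>I. \<zeta> i * G' i z))\<bar>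
       \<le> \<bar>a\<bar> * \<bar>F (z + \<zeta>) - F z - (\<Sum>i\<in>I. \<zeta> i * F' i z)\<bar> + \<bar>b\<bar> * \<bar>G (z + \<zeta>) - G z - (\<Sum>i\<in>I. \<zeta> i * G' i z)\<bar>"
      by (rule order_trans[OF abs_triangle_ineq]) (simp add: abs_mult)
    also have "\<dots> \<le> \<bar>a\<bar> * (e' * l1 X \<zeta>) + \<bar>b\<bar> * (e' * l1 X \<zeta>)"
      using that by (intro add_mono mult_left_mono d(3,4)) simp_all
    also have "\<dots> \<le> (\<bar>a\<bar> + \<bar>b\<bar> + 1) * e' * l1 X \<zeta>" 
      using mult_nonneg_nonneg[OF less_imp_le[OF e'(1)] l1_nonneg[of X \<zeta>]] by (simp only: distrib_right mult.assoc)
    finally show ?thesis unfolding e'(2) eq .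
  qed
  then show "\<exists>d>0. \<forall>z \<zeta>. l1 X \<zeta> < d \<longrightarrow> (\<forall>i\<in>X - I. \<zeta> i = 0) \<longrightarrow>
     \<bar>a * F (z + \<zeta>) + b * G (z + \<zeta>) - (a * F z + b * G z) - (\<Sum>i\<in>I. \<zeta> i * (a * F' i z + b * G' i z))\<bar> \<le> e * l1 X \<zeta>"
    using d(1,2) by (intro exI[of _ "min d1 d2"] conjI allI impI) (simp, blast)
qed

lemma Ck_lincomb: "Ck X k F \<Longrightarrow> Ck X k G \<Longrightarrow> Ck X k (\<lambda>z. a * F z + b * G z)"
proof (induction k arbitrary: F G)
  case 0
  then show ?case by (simp add: ucont_lincomb)
next
  case (Suc k)
  then obtain F' G' where "diff_on X X F F'" "\<forall>i\<in>X. Ck X k (F' i)" "diff_on X X G G'" "\<forall>i\<in>X. Ck X k (G' i)"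
     "ucont X F" "ucont X G"
    by auto
  then have "ucont X (\<lambda>z. a * F z + b * G z)" "diff_on X X (\<lambda>z. a * F z + b * G z) (\<lambda>i z. a * F' i z + b * G' i z)"
      "\<forall>i\<in>X. Ck X k (\<lambda>z. a * F' i z + b * G' i z)"
    using Suc.IH by (auto intro: ucont_lincomb diff_on_lincomb)
  then show ?case unfolding Ck.simps by (intro conjI exI[of _ "\<lambda>i z. a * F' i z + b * G' i z"])
qed

lemma Ck_scale: "Ck X k F \<Longrightarrow> Ck X k (\<lambda>z. a * F z)"
  using Ck_lincomb[of X k F F a 0] by simp

lemma Ck_const: "Ck X k (\<lambda>z. c)"
proof (induction k arbitrary: c)
  case (Suc k)
  have "diff_on X X (\<lambda>z. c) (\<lambda>i z. 0)" by (auto simp: diff_on_def intro!: exI[of _ 1])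
  then show ?case using Suc unfolding Ck.simps by (intro conjI exI[of _ "\<lambda>i z. 0"]) auto
qed simp

lemma Ck_sum: "(\<And>i. i \<in> I \<Longrightarrow> Ck X k (F i)) \<Longrightarrow> Ck X k (\<lambda>z. \<Sum>i\<in>I. F i z)"
proof (induction I rule: infinite_finite_induct)
  case (insert i I)
  then show ?case using Ck_lincomb[of X k "F i" "\<lambda>z. \<Sum>i\<in>I. F i z" 1 1] by simp
qed (simp_all add: Ck_const)

section \<open>Smoothing by Steklov averages\<close>

definition steklov :: "real \<Rightarrow> 'i \<Rightarrow> (('i \<Rightarrow> real) \<Rightarrow> real) \<Rightarrow> ('i \<Rightarrow> real) \<Rightarrow> real" where
  "steklov \<epsilon> i F z = integral {0..1} (\<lambda>s. F (z + unit i (\<epsilon> * s)))"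

lemma ucont_continuous_on_line:
  assumes "finite X" "i \<in> X" "ucont X F"
  shows "continuous_on A (\<lambda>s. F (z + unit i s))"
  unfolding continuous_on_iff
proof (intro ballI allI impI)
  fix s e :: real assume "e > 0"
  then obtain d where d: "d > 0" "\<And>z \<zeta>. l1 X \<zeta> < d \<Longrightarrow> \<bar>F (z + \<zeta>) - F z\<bar> \<le> e / 2"
    using ucont_modulus[OF assms(3), of "e / 2"] by auto
  have "dist (F (z + unit i t)) (F (z + unit i s)) < e" if "dist t s < d" for t
  proof -
    have "z + unit i t = (z + unit i s) + unit i (t - s)" by (simp add: add.assoc unit_add)
    then show ?thesis
      using d(2)[of "unit i (t - s)" "z + unit i s"] that \<open>e > 0\<close> assms
      by (simp only:) (simp add: l1_unit dist_real_def)
  qed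
  then show "\<exists>d>0. \<forall>t\<in>A. dist t s < d \<longrightarrow> dist (F (z + unit i t)) (F (z + unit i s)) < e"
    using d(1) by blast
qed

lemma steklov_integrable:
  assumes "finite X" "i \<in> X" "ucont X F"
  shows "(\<lambda>s. F (z + unit i (\<epsilon> * s))) integrable_on {0..1}"
proof -
  have "continuous_on {0..1} ((\<lambda>s. F (z + unit i s)) \<circ> (\<lambda>s. \<epsilon> * s))"
    by (intro continuous_on_compose continuous_intros ucont_continuous_on_line[OF assms])
  then show ?thesis unfolding o_def by (rule integrable_continuous_real)
qed

lemma avg_steklov:
  assumes "finite X" "i \<in> X" "0 \<le> \<epsilon>"
  shows "avg X \<epsilon> (steklov \<epsilon> i)"
  unfolding avg_def
proof (intro conjI allI impI)
  fix F G :: "('a \<Rightarrow> real) \<Rightarrow> real" and a b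
  assume "ucont X F" "ucont X G"
  then show "steklov \<epsilon> i (\<lambda>z. a * F z + b * G z) = (\<lambda>z. a * steklov \<epsilon> i F z + b * steklov \<epsilon> i G z)"
    using steklov_integrable[OF assms(1,2)]
    by (simp add: steklov_def fun_eq_iff integral_add integrable_on_mult_right)
next
  fix F G :: "('a \<Rightarrow> real) \<Rightarrow> real" and z
  assume FG: "ucont X F" "ucont X G"
    and le: "\<forall>v. (\<forall>i\<in>X. \<bar>v i\<bar> \<le> \<epsilon>) \<longrightarrow> F (z + v) \<le> G (z + v)"
  have "F (z + unit i (\<epsilon> * s)) \<le> G (z + unit i (\<epsilon> * s))" if "s \<in> {0..1}" for s
  proof -
    have "\<bar>\<epsilon> * s\<bar> \<le> \<epsilon>" using that assms(3) by (auto simp: abs_mult intro: mult_left_le)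
    then have "\<forall>j\<in>X. \<bar>unit i (\<epsilon> * s) j\<bar> \<le> \<epsilon>" using assms(3) by (auto simp: unit_def)
    then show ?thesis using le by blast
  qed
  then show "steklov \<epsilon> i F z \<le> steklov \<epsilon> i G z"
    unfolding steklov_def using FG by (intro integral_le steklov_integrable[OF assms(1,2)])
qed (simp_all add: steklov_def fun_eq_iff ac_simps)

lemma MVT_abs:
  fixes f f' :: "real \<Rightarrow> real"
  assumes "\<And>x. (f has_real_derivative f' x) (at x)"
  shows "\<exists>\<xi>. \<bar>\<xi> - a\<bar> \<le> \<bar>h\<bar> \<and> f (a + h) - f a = h * f' \<xi>"
proof -
  consider "h = 0" | "h > 0" | "h < 0" by linarith
  then show ?thesis
  proof cases
    case 2
    then obtain \<xi> where "a < \<xi>" "\<xi> < a + h" "f (a + h) - f a = (a + h - a) * f' \<xi>"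
      using MVT2[of a "a + h" f f'] assms by auto
    then show ?thesis by (intro exI[of _ \<xi>]) auto
  next
    case 3
    then obtain \<xi> where "a + h < \<xi>" "\<xi> < a" "f a - f (a + h) = (a - (a + h)) * f' \<xi>"
      using MVT2[of "a + h" a f f'] assms by auto
    then show ?thesis by (intro exI[of _ \<xi>]) auto
  qed auto
qed

text \<open>With an antiderivative P the integral is
  \<open>(P (k + \<epsilon>) - P k) / \<epsilon>\<close>. The mean value theorem at both end points
  turns its increment into a difference of values of g; no derivative of g appears, which is the
  gain of one order.\<close>

lemma steklov_increment_1d:
  fixes g :: "real \<Rightarrow> real"
  assumes g: "continuous_on UNIV g" and \<epsilon>: "0 < \<epsilon>"
  shows "\<exists>\<xi> \<xi>'. \<bar>\<xi>\<bar> \<le> \<bar>h\<bar> \<and> \<bar>\<xi>' - \<epsilon>\<bar> \<le> \<bar>h\<bar> \<and>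
     integral {0..1} (\<lambda>s. g (h + \<epsilon> * s)) - integral {0..1} (\<lambda>s. g (\<epsilon> * s)) = h * ((g \<xi>' - g \<xi>) / \<epsilon>)"
proof -
  have "\<exists>P. \<forall>x::real. -\<infinity> < ereal x \<longrightarrow> ereal x < \<infinity> \<longrightarrow> (P has_vector_derivative g x) (at x)"
    using g by (intro einterval_antiderivative) (auto simp: continuous_on_eq_continuous_at)
  then obtain P where P: "\<And>x. (P has_real_derivative g x) (at x)"
    by (auto simp: has_real_derivative_iff_has_vector_derivative)
  have int: "integral {0..1} (\<lambda>s. g (k + \<epsilon> * s)) = (P (k + \<epsilon>) - P k) / \<epsilon>" for k
  proof -
    have "((\<lambda>s. P (k + \<epsilon> * s) / \<epsilon>) has_real_derivative g (k + \<epsilon> * s)) (at s within {0..1})" for s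
      using \<epsilon> by (auto intro!: derivative_eq_intros DERIV_chain2[OF P, THEN DERIV_subset])
    then have "((\<lambda>s. g (k + \<epsilon> * s)) has_integral (P (k + \<epsilon> * 1) / \<epsilon> - P (k + \<epsilon> * 0) / \<epsilon>)) {0..1}"
      by (intro fundamental_theorem_of_calculus) (auto simp: has_real_derivative_iff_has_vector_derivative)
    then show ?thesis by (simp add: integral_unique diff_divide_distrib)
  qed
  obtain \<xi> where \<xi>: "\<bar>\<xi> - 0\<bar> \<le> \<bar>h\<bar>" "P (0 + h) - P 0 = h * g \<xi>" using MVT_abs[OF P] by metis
  obtain \<xi>' where \<xi>': "\<bar>\<xi>' - \<epsilon>\<bar> \<le> \<bar>h\<bar>" "P (\<epsilon> + h) - P \<epsilon> = h * g \<xi>'" using MVT_abs[OF P] by metis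
  have "integral {0..1} (\<lambda>s. g (h + \<epsilon> * s)) - integral {0..1} (\<lambda>s. g (\<epsilon> * s))
      = ((P (\<epsilon> + h) - P \<epsilon>) - (P (0 + h) - P 0)) / \<epsilon>"
    using int[of h] int[of 0] by (simp add: add.commute diff_divide_distrib)
  also have "\<dots> = h * ((g \<xi>' - g \<xi>) / \<epsilon>)" unfolding \<xi>(2) \<xi>'(2) by (simp add: right_diff_distrib)
  finally show ?thesis using \<xi>(1) \<xi>'(1) by (intro exI[of _ \<xi>] exI[of _ \<xi>']) simp
qed

text \<open>The intermediate points lie within \<open>\<bar>h\<bar>\<close> of the end points 0 and
  \<epsilon>, so the modulus of F replaces them by the end points, uniformly in z.\<close>

lemma steklov_increment:
  assumes X: "finite X" "j \<in> X" and F: "ucont X F" and \<epsilon>: "0 < \<epsilon>" and e: "0 < e"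
  shows "\<exists>d>0. \<forall>z h. \<bar>h\<bar> < d \<longrightarrow>
    \<bar>steklov \<epsilon> j F (z + unit j h) - steklov \<epsilon> j F z - h * ((F (z + unit j \<epsilon>) - F z) / \<epsilon>)\<bar> \<le> e * \<bar>h\<bar>"
proof -
  obtain d where d: "d > 0" "\<And>z \<zeta>. l1 X \<zeta> < d \<Longrightarrow> \<bar>F (z + \<zeta>) - F z\<bar> \<le> e * \<epsilon> / 2"
    using ucont_modulus[OF F, of "e * \<epsilon> / 2"] e \<epsilon> by auto
  have "\<bar>steklov \<epsilon> j F (z + unit j h) - steklov \<epsilon> j F z - h * ((F (z + unit j \<epsilon>) - F z) / \<epsilon>)\<bar> \<le> e * \<bar>h\<bar>"
    if h: "\<bar>h\<bar> < d" for z h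
  proof -
    define g where "g s = F (z + unit j s)" for s
    have near: "\<bar>g s - g t\<bar> \<le> e * \<epsilon> / 2" if "\<bar>s - t\<bar> \<le> \<bar>h\<bar>" for s t
    proof -
      have "z + unit j s = (z + unit j t) + unit j (s - t)" by (simp add: add.assoc unit_add)
      then show ?thesis using d(2)[of "unit j (s - t)" "z + unit j t"] that h X unfolding g_def by (simp only:) (simp add: l1_unit)
    qed
    obtain \<xi> \<xi>' where \<xi>: "\<bar>\<xi>\<bar> \<le> \<bar>h\<bar>" "\<bar>\<xi>' - \<epsilon>\<bar> \<le> \<bar>h\<bar>" and
      eq: "integral {0..1} (\<lambda>s. g (h + \<epsilon> * s)) - integral {0..1} (\<lambda>s. g (\<epsilon> * s)) = h * ((g \<xi>' - g \<xi>) / \<epsilon>)"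
      using steklov_increment_1d[of g \<epsilon> h] ucont_continuous_on_line[OF X F] \<epsilon> unfolding g_def by blast
    have "steklov \<epsilon> j F (z + unit j h) - steklov \<epsilon> j F z = h * ((g \<xi>' - g \<xi>) / \<epsilon>)"
      using eq by (simp add: steklov_def g_def add.assoc unit_add)
    then have "steklov \<epsilon> j F (z + unit j h) - steklov \<epsilon> j F z - h * ((F (z + unit j \<epsilon>) - F z) / \<epsilon>)
        = h * (((g \<xi>' - g \<epsilon>) - (g \<xi> - g 0)) / \<epsilon>)"
      by (simp add: g_def algebra_simps diff_divide_distrib add_divide_distrib)
    moreover have "\<bar>((g \<xi>' - g \<epsilon>) - (g \<xi> - g 0)) / \<epsilon>\<bar> \<le> e"
    proof -
      have "\<bar>(g \<xi>' - g \<epsilon>) - (g \<xi> - g 0)\<bar> \<le> e * \<epsilon>"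
        using abs_triangle_ineq4[of "g \<xi>' - g \<epsilon>" "g \<xi> - g 0"] near[OF \<xi>(2)] near[of \<xi> 0] \<xi>(1)
        by (simp add: field_simps)
      then show ?thesis using \<epsilon> by (simp add: abs_divide divide_le_eq)
    qed
    ultimately show ?thesis
      using mult_left_mono[of "\<bar>((g \<xi>' - g \<epsilon>) - (g \<xi> - g 0)) / \<epsilon>\<bar>" e "\<bar>h\<bar>"]
      by (simp only: abs_mult mult.commute[of e])
  qed
  then show ?thesis using d(1) by blast
qed

lemma ucont_common_modulus:
  assumes "finite I" "\<And>i. i \<in> I \<Longrightarrow> ucont X (G i)" "0 < e"
  shows "\<exists>d>0. \<forall>i\<in>I. \<forall>z \<zeta>. l1 X \<zeta> < d \<longrightarrow> \<bar>G i (z + \<zeta>) - G i z\<bar> \<le> e"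
  using assms(1,2)
proof (induction I)
  case empty
  show ?case by (auto intro: exI[of _ 1])
next
  case (insert j I)
  obtain d1 where d1: "d1 > 0" "\<forall>i\<in>I. \<forall>z \<zeta>. l1 X \<zeta> < d1 \<longrightarrow> \<bar>G i (z + \<zeta>) - G i z\<bar> \<le> e"
    using insert by blast
  obtain d2 where d2: "d2 > 0" "\<forall>z \<zeta>. l1 X \<zeta> < d2 \<longrightarrow> \<bar>G j (z + \<zeta>) - G j z\<bar> \<le> e"
    using ucont_modulus[OF _ assms(3), of X "G j"] insert by blast
  have "\<forall>i\<in>insert j I. \<forall>z \<zeta>. l1 X \<zeta> < min d1 d2 \<longrightarrow> \<bar>G i (z + \<zeta>) - G i z\<bar> \<le> e"
    using d1(2) d2(2) unfolding min_less_iff_conj by blast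
  then show ?case using d1(1) d2(1) by (intro exI[of _ "min d1 d2"] conjI) simp
qed

text \<open>In the old directions the derivative passes under the average; in direction j it is a
  difference quotient of F. A general increment first moves along j and then along I, and the common
  modulus of the derivatives carries them from the intermediate point back to z.\<close>

lemma diff_on_steklov:
  assumes X: "finite X" "I \<subseteq> X" "j \<in> X" "j \<notin> I" and \<epsilon>: "0 < \<epsilon>"
    and F: "ucont X F" "diff_on X I F G" and G: "\<And>i. i \<in> I \<Longrightarrow> ucont X (G i)"
  shows "diff_on X (insert j I) (steklov \<epsilon> j F)
    (\<lambda>i. if i = j then (\<lambda>z. (F (z + unit j \<epsilon>) - F z) / \<epsilon>) else steklov \<epsilon> j (G i))"
  unfolding diff_on_def
proof (intro allI impI)
  fix e :: real assume "e > 0"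
  then have e3: "e / 2 > 0" by simp
  define SF where "SF = steklov \<epsilon> j F"
  define SG where "SG i = steklov \<epsilon> j (G i)" for i
  define D where "D z = (F (z + unit j \<epsilon>) - F z) / \<epsilon>" for z
  have av: "avg X \<epsilon> (steklov \<epsilon> j)" using avg_steklov[OF X(1,3)] \<epsilon> by simp
  have fI: "finite I" using X finite_subset by blast
  have dSF: "diff_on X I SF SG" unfolding SF_def SG_def using avg_diff_on[OF av F G] .
  obtain d1 where d1: "d1 > 0" "\<And>z \<zeta>. l1 X \<zeta> < d1 \<Longrightarrow> (\<forall>i\<in>X - I. \<zeta> i = 0) \<Longrightarrow>
      \<bar>SF (z + \<zeta>) - SF z - (\<Sum>i\<in>I. \<zeta> i * SG i z)\<bar> \<le> e / 2 * l1 X \<zeta>"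
    using dSF[unfolded diff_on_def, rule_format, OF e3] by blast
  obtain d2 where d2: "d2 > 0" "\<And>i z \<zeta>. i \<in> I \<Longrightarrow> l1 X \<zeta> < d2 \<Longrightarrow> \<bar>SG i (z + \<zeta>) - SG i z\<bar> \<le> e / 2"
    using ucont_common_modulus[OF fI _ e3, of X SG] avg_ucont[OF av G] unfolding SG_def by blast
  obtain d3 where d3: "d3 > 0" "\<And>z h. \<bar>h\<bar> < d3 \<Longrightarrow>
      \<bar>SF (z + unit j h) - SF z - h * D z\<bar> \<le> e / 2 * \<bar>h\<bar>"
    using steklov_increment[OF X(1,3) F(1) \<epsilon> e3] unfolding SF_def D_def by blast
  have "\<bar>SF (z + \<zeta>) - SF z - (\<Sum>i\<in>insert j I. \<zeta> i * (if i = j then D else SG i) z)\<bar> \<le> e * l1 X \<zeta>"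
    if small: "l1 X \<zeta> < min d1 (min d2 d3)" and supp: "\<forall>i\<in>X - insert j I. \<zeta> i = 0" for z \<zeta>
  proof -
    define h where "h = \<zeta> j"
    define \<xi> where "\<xi> = \<zeta>(j := 0)"
    have split: "\<zeta> = unit j h + \<xi>" by (auto simp: h_def \<xi>_def unit_def)
    have l: "l1 X \<zeta> = \<bar>h\<bar> + l1 X \<xi>"
      using sum.remove[OF X(1,3), of "\<lambda>i. \<bar>\<zeta> i\<bar>"] sum.remove[OF X(1,3), of "\<lambda>i. \<bar>\<xi> i\<bar>"]
      by (simp add: l1_def h_def \<xi>_def)
    have lh: "l1 X (unit j h) = \<bar>h\<bar>" using X by (simp add: l1_unit)
    have x1: "l1 X \<xi> < d1" "\<bar>h\<bar> < d2" "\<bar>h\<bar> < d3"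
      using small l l1_nonneg[of X \<xi>] by linarith+
    have xI: "(\<Sum>i\<in>I. \<bar>\<zeta> i\<bar>) \<le> l1 X \<xi>"
      unfolding l1_def \<xi>_def using X by (intro order_trans[OF _ sum_mono2[of X I]]) (auto intro!: sum_mono)
    have s: "(\<Sum>i\<in>insert j I. \<zeta> i * (if i = j then D else SG i) z) = h * D z + (\<Sum>i\<in>I. \<zeta> i * SG i z)"
      using fI X(4) by (auto simp: h_def intro!: sum.cong)
    have sI: "(\<Sum>i\<in>I. \<xi> i * SG i w) = (\<Sum>i\<in>I. \<zeta> i * SG i w)" for w
      using X(4) by (intro sum.cong) (auto simp: \<xi>_def)
    have a: "\<bar>SF (z + unit j h + \<xi>) - SF (z + unit j h) - (\<Sum>i\<in>I. \<zeta> i * SG i (z + unit j h))\<bar> \<le> e / 2 * l1 X \<xi>"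
      using d1(2)[OF x1(1), of "z + unit j h"] supp X(4) unfolding sI by (auto simp: \<xi>_def)
    have b: "\<bar>(\<Sum>i\<in>I. \<zeta> i * SG i (z + unit j h)) - (\<Sum>i\<in>I. \<zeta> i * SG i z)\<bar> \<le> e / 2 * l1 X \<xi>"
    proof -
      have "\<bar>(\<Sum>i\<in>I. \<zeta> i * SG i (z + unit j h)) - (\<Sum>i\<in>I. \<zeta> i * SG i z)\<bar>
          = \<bar>\<Sum>i\<in>I. \<zeta> i * (SG i (z + unit j h) - SG i z)\<bar>"
        by (simp add: right_diff_distrib sum_subtractf)
      also have "\<dots> \<le> (\<Sum>i\<in>I. \<bar>\<zeta> i\<bar> * (e / 2))"
        using d2(2) x1(2) lh
        by (intro order_trans[OF sum_abs] sum_mono) (simp only: abs_mult, intro mult_left_mono, auto)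
      also have "\<dots> \<le> e / 2 * l1 X \<xi>"
        using xI e3 unfolding sum_distrib_right[symmetric] by (simp only: mult.commute[of _ "e / 2"] mult_left_mono)
      finally show ?thesis .
    qed
    have c: "\<bar>SF (z + unit j h) - SF z - h * D z\<bar> \<le> e / 2 * \<bar>h\<bar>" using d3(2)[OF x1(3)] .
    have "SF (z + \<zeta>) = SF (z + unit j h + \<xi>)" by (simp only: split add.assoc)
    \<comment> \<open>The estimates a and b share the part of the bound that belongs to \<xi>; c
      uses one half of the part that belongs to h.\<close>
    moreover have "e * l1 X \<zeta> = e / 2 * l1 X \<xi> + e / 2 * l1 X \<xi> + e / 2 * \<bar>h\<bar> + e / 2 * \<bar>h\<bar>"
      by (simp add: l algebra_simps)
    moreover have "0 \<le> e / 2 * \<bar>h\<bar>" using e3 by simp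
    ultimately show ?thesis using a b c unfolding s abs_le_iff by (intro conjI; linarith)
  qed
  then have *: "\<exists>d>0. \<forall>z \<zeta>. l1 X \<zeta> < d \<longrightarrow> (\<forall>i\<in>X - insert j I. \<zeta> i = 0) \<longrightarrow>
      \<bar>SF (z + \<zeta>) - SF z - (\<Sum>i\<in>insert j I. \<zeta> i * (if i = j then D else SG i) z)\<bar> \<le> e * l1 X \<zeta>"
    using d1(1) d2(1) d3(1) by (intro exI[of _ "min d1 (min d2 d3)"] conjI allI impI) (simp, blast)
  then show "\<exists>d>0. \<forall>z \<zeta>. l1 X \<zeta> < d \<longrightarrow> (\<forall>i\<in>X - insert j I. \<zeta> i = 0) \<longrightarrow>
      \<bar>steklov \<epsilon> j F (z + \<zeta>) - steklov \<epsilon> j F z - (\<Sum>i\<in>insert j I. \<zeta> i *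
         (if i = j then \<lambda>z. (F (z + unit j \<epsilon>) - F z) / \<epsilon> else steklov \<epsilon> j (G i)) z)\<bar> \<le> e * l1 X \<zeta>"
    unfolding SF_def SG_def D_def .
qed

definition steklovs :: "real \<Rightarrow> 'i list \<Rightarrow> (('i \<Rightarrow> real) \<Rightarrow> real) \<Rightarrow> ('i \<Rightarrow> real) \<Rightarrow> real" where
  "steklovs \<epsilon> xs F = foldr (steklov \<epsilon>) xs F"

lemma avg_steklovs:
  fixes \<epsilon> :: real
  assumes "finite X" "0 \<le> \<epsilon>"
  shows "set xs \<subseteq> X \<Longrightarrow> avg X (\<epsilon> * real (length xs)) (steklovs \<epsilon> xs)"
proof (induction xs)
  case Nil
  show ?case using avg_id[of 0 X] by (simp add: steklovs_def[abs_def])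
next
  case (Cons x xs)
  then show ?case
    using avg_comp[OF avg_steklov[OF assms(1) _ assms(2)] Cons.IH, of x] assms(2)
    by (simp add: steklovs_def[abs_def] algebra_simps)
qed

lemma diff_on_empty: "ucont X F \<Longrightarrow> diff_on X {} F G"
  unfolding diff_on_def
proof (intro allI impI)
  fix e :: real assume F: "ucont X F" "e > 0"
  have "\<bar>F (z + \<zeta>) - F z\<bar> \<le> 0" if "\<forall>i\<in>X - {}. \<zeta> i = 0" for z \<zeta>
  proof (rule field_le_epsilon)
    fix e' :: real assume "e' > 0"
    then obtain d where "d > 0" "\<And>z \<zeta>. l1 X \<zeta> < d \<Longrightarrow> \<bar>F (z + \<zeta>) - F z\<bar> \<le> e'"
      using ucont_modulus[OF F(1)] by blast
    moreover have "l1 X \<zeta> = 0" using that by (simp add: l1_def)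
    ultimately show "\<bar>F (z + \<zeta>) - F z\<bar> \<le> 0 + e'" by simp
  qed
  then show "\<exists>d>0. \<forall>z \<zeta>. l1 X \<zeta> < d \<longrightarrow> (\<forall>i\<in>X - {}. \<zeta> i = 0) \<longrightarrow>
       \<bar>F (z + \<zeta>) - F z - (\<Sum>i\<in>{}. \<zeta> i * G i z)\<bar> \<le> e * l1 X \<zeta>"
    using F(2) by (intro exI[of _ 1]) (force intro: order_trans)
qed

text \<open>Each Steklov average adds its own direction to those already differentiable. The new
  derivative combines a shift with the function itself and the old derivatives are averaged once
  more, so all of them keep the class \<open>Ck X k\<close>.\<close>

lemma steklovs_diff_on:
  assumes "finite X" "0 < \<epsilon>" "Ck X k F"
  shows "distinct xs \<Longrightarrow> set xs \<subseteq> X \<Longrightarrow>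
    \<exists>G. diff_on X (set xs) (steklovs \<epsilon> xs F) G \<and> (\<forall>i\<in>set xs. Ck X k (G i))"
proof (induction xs)
  case Nil
  show ?case using diff_on_empty[OF Ck_ucont[OF assms(3)]] by (auto simp: steklovs_def)
next
  case (Cons x xs)
  then obtain G where G: "diff_on X (set xs) (steklovs \<epsilon> xs F) G" "\<forall>i\<in>set xs. Ck X k (G i)" by auto
  have x: "x \<in> X" "x \<notin> set xs" "set xs \<subseteq> X" using Cons by auto
  have k: "Ck X k (steklovs \<epsilon> xs F)"
    using avg_Ck[OF avg_steklovs[OF assms(1) _ x(3)] assms(3)] assms(2) by simp
  have av: "avg X \<epsilon> (steklov \<epsilon> x)" using avg_steklov[OF assms(1) x(1)] assms(2) by simp
  let ?G = "\<lambda>i. if i = x then (\<lambda>z. (steklovs \<epsilon> xs F (z + unit x \<epsilon>) - steklovs \<epsilon> xs F z) / \<epsilon>) else steklov \<epsilon> x (G i)"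
  have "diff_on X (insert x (set xs)) (steklov \<epsilon> x (steklovs \<epsilon> xs F)) ?G"
    using G(2) Ck_ucont k by (intro diff_on_steklov assms x G) blast+
  moreover have "Ck X k (?G i)" if "i \<in> set (x # xs)" for i
  proof (cases "i = x")
    case True
    have "Ck X k (\<lambda>z. 1 / \<epsilon> * steklovs \<epsilon> xs F (z + unit x \<epsilon>) + (- 1 / \<epsilon>) * steklovs \<epsilon> xs F z)"
      by (intro Ck_lincomb avg_Ck[OF avg_shift] k)
    then show ?thesis using True by (simp add: diff_divide_distrib)
  qed (use that G(2) avg_Ck[OF av] in auto)
  ultimately show ?case by (intro exI[of _ ?G]) (simp add: steklovs_def)
qed

text \<open>One pass over all coordinates gains one derivative. Two passes are used for the
  comparison function of the maximum principle, four for the final mollification.\<close>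

lemma steklovs_Ck:
  assumes "finite X" "0 < \<epsilon>" "Ck X k F" "distinct xs" "set xs = X"
  shows "Ck X (Suc k) (steklovs \<epsilon> xs F)"
proof -
  have "ucont X (steklovs \<epsilon> xs F)"
    using avg_ucont[OF avg_steklovs] assms Ck_ucont by (metis less_imp_le order_refl)
  then show ?thesis using steklovs_diff_on[OF assms(1-3), of xs] assms by auto
qed

lemma avg_close:
  assumes "avg X r E" "ucont X F" "\<And>v. (\<forall>i\<in>X. \<bar>v i\<bar> \<le> r) \<Longrightarrow> \<bar>F (z + v) - F z\<bar> \<le> e"
  shows "\<bar>E F z - F z\<bar> \<le> e"
proof -
  have "E (\<lambda>w. F w - F z) z = E F z - F z"
    by (simp add: avg_diff[OF assms(1,2)] avg_const[OF assms(1)])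
  moreover have "\<bar>E (\<lambda>w. F w - F z) z\<bar> \<le> e"
    using assms by (intro avg_abs_bound[OF assms(1)] ucont_diff) auto
  ultimately show ?thesis by simp
qed

section \<open>Uniform Taylor expansion\<close>

lemma diff_on_deriv:
  assumes "diff_on X X F G"
  shows "((\<lambda>t. F (z + (\<lambda>i. t * \<zeta> i))) has_real_derivative (\<Sum>i\<in>X. \<zeta> i * G i (z + (\<lambda>i. t * \<zeta> i)))) (at t)"
  unfolding DERIV_def LIM_eq
proof (intro allI impI)
  fix r :: real assume r: "r > 0"
  define e where "e = r / (2 * (l1 X \<zeta> + 1))"
  have l: "l1 X \<zeta> + 1 > 0" using l1_nonneg[of X \<zeta>] by linarith
  have e: "e > 0" using r l by (simp add: e_def)
  have "e * (l1 X \<zeta> + 1) = r / 2" using l unfolding e_def by (simp add: divide_simps)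
  then have er: "e * l1 X \<zeta> < r" using e r by (simp add: distrib_left)
  obtain d where d: "d > 0" "\<And>z \<xi>. l1 X \<xi> < d \<Longrightarrow> (\<forall>i\<in>X - X. \<xi> i = 0) \<Longrightarrow>
      \<bar>F (z + \<xi>) - F z - (\<Sum>i\<in>X. \<xi> i * G i z)\<bar> \<le> e * l1 X \<xi>"
    using assms[unfolded diff_on_def, rule_format, OF e] by blast
  let ?w = "z + (\<lambda>i. t * \<zeta> i)"
  have "norm ((F (z + (\<lambda>i. (t + k) * \<zeta> i)) - F ?w) / k - (\<Sum>i\<in>X. \<zeta> i * G i ?w)) < r"
    if k: "k \<noteq> 0" "norm (k - 0) < d / (l1 X \<zeta> + 1)" for k
  proof -
    have "\<bar>k\<bar> * (l1 X \<zeta> + 1) < d" using k l by (simp add: field_simps)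
    then have sm: "l1 X (\<lambda>i. k * \<zeta> i) < d" unfolding l1_scale by (simp add: algebra_simps)
    have eq: "z + (\<lambda>i. (t + k) * \<zeta> i) = ?w + (\<lambda>i. k * \<zeta> i)" by (auto simp: algebra_simps)
    have s: "(\<Sum>i\<in>X. k * \<zeta> i * G i ?w) = k * (\<Sum>i\<in>X. \<zeta> i * G i ?w)"
      by (simp add: sum_distrib_left mult.assoc)
    have "\<bar>F (z + (\<lambda>i. (t + k) * \<zeta> i)) - F ?w - k * (\<Sum>i\<in>X. \<zeta> i * G i ?w)\<bar> \<le> e * (\<bar>k\<bar> * l1 X \<zeta>)"
      using d(2)[OF sm, of ?w] unfolding eq s l1_scale by simp
    then have "\<bar>(F (z + (\<lambda>i. (t + k) * \<zeta> i)) - F ?w - k * (\<Sum>i\<in>X. \<zeta> i * G i ?w)) / k\<bar> \<le> e * l1 X \<zeta>"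
      using k(1) unfolding abs_divide by (subst pos_divide_le_eq) (auto simp: ac_simps)
    then show ?thesis using k(1) er by (simp add: diff_divide_distrib)
  qed
  then show "\<exists>s>0. \<forall>k. k \<noteq> 0 \<and> norm (k - 0) < s \<longrightarrow>
      norm ((F (z + (\<lambda>i. (t + k) * \<zeta> i)) - F ?w) / k - (\<Sum>i\<in>X. \<zeta> i * G i ?w)) < r"
    using d(1) l by (intro exI[of _ "d / (l1 X \<zeta> + 1)"] conjI allI impI) auto
qed

lemma diff_on_common:
  assumes "finite I" "\<And>i. i \<in> I \<Longrightarrow> diff_on X X (G i) (H i)" "0 < e"
  shows "\<exists>d>0. \<forall>i\<in>I. \<forall>z \<zeta>. l1 X \<zeta> < d \<longrightarrow> \<bar>G i (z + \<zeta>) - G i z - (\<Sum>j\<in>X. \<zeta> j * H i j z)\<bar> \<le> e * l1 X \<zeta>"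
  using assms(1,2)
proof (induction I)
  case empty
  show ?case by (auto intro: exI[of _ 1])
next
  case (insert k I)
  obtain d1 where d1: "d1 > 0"
    "\<forall>i\<in>I. \<forall>z \<zeta>. l1 X \<zeta> < d1 \<longrightarrow> \<bar>G i (z + \<zeta>) - G i z - (\<Sum>j\<in>X. \<zeta> j * H i j z)\<bar> \<le> e * l1 X \<zeta>"
    using insert by blast
  have "diff_on X X (G k) (H k)" using insert by blast
  then obtain d2 where d2: "d2 > 0"
    "\<forall>z \<zeta>. l1 X \<zeta> < d2 \<longrightarrow> \<bar>G k (z + \<zeta>) - G k z - (\<Sum>j\<in>X. \<zeta> j * H k j z)\<bar> \<le> e * l1 X \<zeta>"
    unfolding diff_on_def using assms(3) by (metis Diff_cancel empty_iff)
  have "\<forall>i\<in>insert k I. \<forall>z \<zeta>. l1 X \<zeta> < min d1 d2 \<longrightarrow>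
      \<bar>G i (z + \<zeta>) - G i z - (\<Sum>j\<in>X. \<zeta> j * H i j z)\<bar> \<le> e * l1 X \<zeta>"
    using d1(2) d2(2) unfolding min_less_iff_conj by blast
  then show ?case using d1(1) d2(1) by (intro exI[of _ "min d1 d2"] conjI) simp
qed

text \<open>On the segment to \<zeta>, subtract the linear and the quadratic part and apply the mean
  value theorem once. The derivative left over is the first-order remainder of the
  \<open>G i\<close> paired with \<zeta>, and each of the two factors contributes one power of
  \<open>l1 X \<zeta>\<close>.\<close>

lemma taylor2:
  assumes X: "finite X" and F: "diff_on X X F G" and G: "\<And>i. i \<in> X \<Longrightarrow> diff_on X X (G i) (H i)"
    and e: "0 < e"
  shows "\<exists>d>0. \<forall>z \<zeta>. l1 X \<zeta> < d \<longrightarrow> \<bar>F (z + \<zeta>) - F z - (\<Sum>i\<in>X. \<zeta> i * G i z)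
     - (\<Sum>i\<in>X. \<Sum>j\<in>X. \<zeta> i * \<zeta> j * H i j z) / 2\<bar> \<le> e * (l1 X \<zeta>)\<^sup>2"
proof -
  obtain d where d: "d > 0" "\<And>i z \<zeta>. i \<in> X \<Longrightarrow> l1 X \<zeta> < d \<Longrightarrow>
      \<bar>G i (z + \<zeta>) - G i z - (\<Sum>j\<in>X. \<zeta> j * H i j z)\<bar> \<le> e * l1 X \<zeta>"
    using diff_on_common[OF X, where X = X and G = G and H = H, OF G e] by blast
  have "\<bar>F (z + \<zeta>) - F z - (\<Sum>i\<in>X. \<zeta> i * G i z) - (\<Sum>i\<in>X. \<Sum>j\<in>X. \<zeta> i * \<zeta> j * H i j z) / 2\<bar> \<le> e * (l1 X \<zeta>)\<^sup>2"
    if small: "l1 X \<zeta> < d" for z \<zeta>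
  proof -
    define a where "a = (\<Sum>i\<in>X. \<zeta> i * G i z)"
    define b where "b = (\<Sum>i\<in>X. \<Sum>j\<in>X. \<zeta> i * \<zeta> j * H i j z)"
    define \<phi> where "\<phi> t = F (z + (\<lambda>i. t * \<zeta> i)) - t * a - t\<^sup>2 / 2 * b" for t
    define \<phi>' where "\<phi>' t = (\<Sum>i\<in>X. \<zeta> i * G i (z + (\<lambda>i. t * \<zeta> i))) - a - t * b" for t
    have der: "(\<phi> has_real_derivative \<phi>' t) (at t)" for t
      unfolding \<phi>_def \<phi>'_def by (auto intro!: derivative_eq_intros diff_on_deriv[OF F])
    obtain \<xi> where \<xi>: "0 < \<xi>" "\<xi> < 1" "\<phi> 1 - \<phi> 0 = (1 - 0) * \<phi>' \<xi>" using MVT2[of 0 1 \<phi> \<phi>'] der by auto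
    have l: "l1 X (\<lambda>i. \<xi> * \<zeta> i) \<le> l1 X \<zeta>"
      unfolding l1_scale using \<xi> l1_nonneg[of X \<zeta>] mult_right_mono[of \<xi> 1 "l1 X \<zeta>"] by simp
    have eq: "\<phi>' \<xi> = (\<Sum>i\<in>X. \<zeta> i * (G i (z + (\<lambda>i. \<xi> * \<zeta> i)) - G i z - (\<Sum>j\<in>X. \<xi> * \<zeta> j * H i j z)))"
      unfolding \<phi>'_def a_def b_def
      by (simp add: right_diff_distrib sum_subtractf sum_distrib_left ac_simps)
    have bd: "\<bar>\<zeta> i * (G i (z + (\<lambda>i. \<xi> * \<zeta> i)) - G i z - (\<Sum>j\<in>X. \<xi> * \<zeta> j * H i j z))\<bar> \<le> \<bar>\<zeta> i\<bar> * (e * l1 X \<zeta>)"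
      if "i \<in> X" for i
    proof -
      have "\<bar>G i (z + (\<lambda>i. \<xi> * \<zeta> i)) - G i z - (\<Sum>j\<in>X. \<xi> * \<zeta> j * H i j z)\<bar> \<le> e * l1 X (\<lambda>i. \<xi> * \<zeta> i)"
        using d(2)[OF that] l small by auto
      also have "\<dots> \<le> e * l1 X \<zeta>" using l e by simp
      finally show ?thesis unfolding abs_mult by (rule mult_left_mono) simp
    qed
    have "\<bar>\<phi>' \<xi>\<bar> \<le> (\<Sum>i\<in>X. \<bar>\<zeta> i\<bar> * (e * l1 X \<zeta>))"
      unfolding eq by (rule order_trans[OF sum_abs sum_mono[OF bd]])
    also have "\<dots> = e * (l1 X \<zeta>)\<^sup>2" by (simp add: l1_def sum_distrib_right[symmetric] power2_eq_square)
    finally have "\<bar>\<phi> 1 - \<phi> 0\<bar> \<le> e * (l1 X \<zeta>)\<^sup>2" using \<xi>(3) by simp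
    moreover have "\<phi> 1 - \<phi> 0 = F (z + \<zeta>) - F z - a - b / 2"
      by (simp add: \<phi>_def zero_fun_def[symmetric])
    ultimately show ?thesis unfolding a_def b_def by simp
  qed
  then show ?thesis using d(1) by blast
qed

section \<open>The random walk\<close>

text \<open>The drift makes gen the generator of the walk, and gen annihilates every exponential exp (z i).\<close>

definition rw_step :: "('i \<Rightarrow> real) \<Rightarrow> real \<Rightarrow> 'i \<Rightarrow> real" where
  "rw_step \<rho> h = (\<lambda>i. h * \<rho> i - h\<^sup>2 / 2 * (\<rho> i)\<^sup>2)"

definition rw :: "('i \<Rightarrow> real) \<Rightarrow> real \<Rightarrow> (('i \<Rightarrow> real) \<Rightarrow> real) \<Rightarrow> ('i \<Rightarrow> real) \<Rightarrow> real" where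
  "rw \<rho> h F z = (F (z + rw_step \<rho> h) + F (z + rw_step \<rho> (- h))) / 2"

definition gen :: "'i set \<Rightarrow> ('i \<Rightarrow> real) \<Rightarrow> ('i \<Rightarrow> real) \<Rightarrow> ('i \<Rightarrow> 'i \<Rightarrow> real) \<Rightarrow> real" where
  "gen X \<rho> p Q = (\<Sum>i\<in>X. \<Sum>j\<in>X. \<rho> i * \<rho> j * Q i j) / 2 - (\<Sum>i\<in>X. (\<rho> i)\<^sup>2 * p i) / 2"

lemma l1_rw_step:
  assumes "\<bar>h\<bar> \<le> 1"
  shows "l1 X (rw_step \<rho> h) \<le> \<bar>h\<bar> * (\<Sum>i\<in>X. \<bar>\<rho> i\<bar> + (\<rho> i)\<^sup>2)"
  unfolding l1_def rw_step_def sum_distrib_left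
proof (rule sum_mono)
  fix i
  have "h\<^sup>2 / 2 * (\<rho> i)\<^sup>2 \<le> \<bar>h\<bar> * (\<rho> i)\<^sup>2"
  proof (rule mult_right_mono)
    have "h\<^sup>2 = \<bar>h\<bar> * \<bar>h\<bar>" by (simp add: power2_eq_square)
    also have "\<dots> \<le> \<bar>h\<bar> * 1" using assms by (intro mult_left_mono) auto
    finally show "h\<^sup>2 / 2 \<le> \<bar>h\<bar>" by simp
  qed simp
  moreover have "\<bar>h * \<rho> i - h\<^sup>2 / 2 * (\<rho> i)\<^sup>2\<bar> \<le> \<bar>h * \<rho> i\<bar> + \<bar>h\<^sup>2 / 2 * (\<rho> i)\<^sup>2\<bar>" by (rule abs_triangle_ineq4)
  ultimately show "\<bar>h * \<rho> i - h\<^sup>2 / 2 * (\<rho> i)\<^sup>2\<bar> \<le> \<bar>h\<bar> * (\<bar>\<rho> i\<bar> + (\<rho> i)\<^sup>2)"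
    by (simp add: abs_mult distrib_left)
qed

lemma avg_rw:
  assumes "finite X"
  shows "\<exists>r\<ge>0. avg X r (rw \<rho> h)"
proof -
  define r where "r = l1 X (rw_step \<rho> h) + l1 X (rw_step \<rho> (- h))"
  have b: "\<bar>rw_step \<rho> h i\<bar> \<le> r" "\<bar>rw_step \<rho> (- h) i\<bar> \<le> r" if "i \<in> X" for i
    using abs_le_l1[OF assms that, of "rw_step \<rho> h"] abs_le_l1[OF assms that, of "rw_step \<rho> (- h)"]
      l1_nonneg[of X "rw_step \<rho> h"] l1_nonneg[of X "rw_step \<rho> (- h)"]
    unfolding r_def by linarith+
  have "avg X r (rw \<rho> h)"
    unfolding avg_def
  proof (intro conjI allI impI)
    fix F G :: "('a \<Rightarrow> real) \<Rightarrow> real" and z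
    assume *: "\<forall>v. (\<forall>i\<in>X. \<bar>v i\<bar> \<le> r) \<longrightarrow> F (z + v) \<le> G (z + v)"
    have "F (z + rw_step \<rho> h) \<le> G (z + rw_step \<rho> h)" "F (z + rw_step \<rho> (- h)) \<le> G (z + rw_step \<rho> (- h))"
      using * b by blast+
    then show "rw \<rho> h F z \<le> rw \<rho> h G z" by (simp add: rw_def add_mono)
  qed (simp_all add: rw_def fun_eq_iff ac_simps field_simps)
  then show ?thesis by (intro exI[of _ r]) (simp add: r_def add_nonneg_nonneg)
qed

text \<open>Odd powers of h cancel between the two signs. The drift enters at order two, where it
  produces the first-order part of \<open>gen\<close>, and its square leaves the term of order
  four.\<close>

lemma rw_quadratic:
  assumes X: "finite X"
  shows "((\<Sum>i\<in>X. rw_step \<rho> h i * p i) + (\<Sum>i\<in>X. \<Sum>j\<in>X. rw_step \<rho> h i * rw_step \<rho> h j * Q i j) / 2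
     + ((\<Sum>i\<in>X. rw_step \<rho> (- h) i * p i) + (\<Sum>i\<in>X. \<Sum>j\<in>X. rw_step \<rho> (- h) i * rw_step \<rho> (- h) j * Q i j) / 2)) / 2
     = h\<^sup>2 * gen X \<rho> p Q + h ^ 4 / 8 * (\<Sum>i\<in>X. \<Sum>j\<in>X. (\<rho> i)\<^sup>2 * (\<rho> j)\<^sup>2 * Q i j)"
proof -
  have a: "(\<Sum>i\<in>X. rw_step \<rho> h i * p i) + (\<Sum>i\<in>X. rw_step \<rho> (- h) i * p i) = - h\<^sup>2 * (\<Sum>i\<in>X. (\<rho> i)\<^sup>2 * p i)"
    unfolding sum.distrib[symmetric] sum_distrib_left
    by (intro sum.cong refl) (simp add: rw_step_def field_simps)
  have b: "(\<Sum>i\<in>X. \<Sum>j\<in>X. rw_step \<rho> h i * rw_step \<rho> h j * Q i j) + (\<Sum>i\<in>X. \<Sum>j\<in>X. rw_step \<rho> (- h) i * rw_step \<rho> (- h) j * Q i j)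
     = 2 * h\<^sup>2 * (\<Sum>i\<in>X. \<Sum>j\<in>X. \<rho> i * \<rho> j * Q i j) + h ^ 4 / 2 * (\<Sum>i\<in>X. \<Sum>j\<in>X. (\<rho> i)\<^sup>2 * (\<rho> j)\<^sup>2 * Q i j)"
    unfolding sum.distrib[symmetric] sum_distrib_left
    by (intro sum.cong refl) (simp add: rw_step_def field_simps power2_eq_square power4_eq_xxxx)
  show ?thesis using a b unfolding gen_def by (simp add: field_simps)
qed

lemma ucont_gen:
  assumes "\<And>i. i \<in> X \<Longrightarrow> ucont X (G i)" "\<And>i j. i \<in> X \<Longrightarrow> j \<in> X \<Longrightarrow> ucont X (H i j)"
  shows "ucont X (\<lambda>z. gen X \<rho> (\<lambda>i. G i z) (\<lambda>i j. H i j z))"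
proof -
  have "ucont X (\<lambda>z. 1 / 2 * (\<Sum>i\<in>X. \<Sum>j\<in>X. \<rho> i * \<rho> j * H i j z) + (- 1 / 2) * (\<Sum>i\<in>X. (\<rho> i)\<^sup>2 * G i z))"
    by (intro ucont_lincomb ucont_sum ucont_scale assms)
  then show ?thesis by (simp add: gen_def)
qed

lemma Ck_gen:
  assumes "\<And>i. i \<in> X \<Longrightarrow> Ck X k (G i)" "\<And>i j. i \<in> X \<Longrightarrow> j \<in> X \<Longrightarrow> Ck X k (H i j)"
  shows "Ck X k (\<lambda>z. gen X \<rho> (\<lambda>i. G i z) (\<lambda>i j. H i j z))"
proof -
  have "Ck X k (\<lambda>z. 1 / 2 * (\<Sum>i\<in>X. \<Sum>j\<in>X. \<rho> i * \<rho> j * H i j z) + (- 1 / 2) * (\<Sum>i\<in>X. (\<rho> i)\<^sup>2 * G i z))"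
    by (intro Ck_lincomb Ck_sum Ck_scale assms)
  then show ?thesis by (simp add: gen_def)
qed

lemma avg_gen:
  assumes "avg X r E" "\<And>i. i \<in> X \<Longrightarrow> ucont X (G i)" "\<And>i j. i \<in> X \<Longrightarrow> j \<in> X \<Longrightarrow> ucont X (H i j)"
  shows "E (\<lambda>z. gen X \<rho> (\<lambda>i. G i z) (\<lambda>i j. H i j z)) = (\<lambda>z. gen X \<rho> (\<lambda>i. E (G i) z) (\<lambda>i j. E (H i j) z))"
proof -
  have "E (\<lambda>z. 1 / 2 * (\<Sum>i\<in>X. \<Sum>j\<in>X. \<rho> i * \<rho> j * H i j z) + (- 1 / 2) * (\<Sum>i\<in>X. (\<rho> i)\<^sup>2 * G i z))
    = (\<lambda>z. 1 / 2 * (\<Sum>i\<in>X. \<Sum>j\<in>X. \<rho> i * \<rho> j * E (H i j) z) + (- 1 / 2) * (\<Sum>i\<in>X. (\<rho> i)\<^sup>2 * E (G i) z))"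
    using assms(2,3)
    by (simp add: avg_linear[OF assms(1)] avg_sum[OF assms(1)] avg_scale[OF assms(1)] avg_diff[OF assms(1)]
        ucont_sum ucont_scale ucont_diff del: times_divide_eq_left times_divide_eq_right cong: sum.cong)
  then show ?thesis by (simp add: gen_def)
qed

lemma rw_expand:
  assumes X: "finite X" and F: "diff_on X X F G" and G: "\<And>i. i \<in> X \<Longrightarrow> diff_on X X (G i) (H i)"
    and H: "\<And>i j. i \<in> X \<Longrightarrow> j \<in> X \<Longrightarrow> ucont X (H i j)" and e: "0 < e"
  shows "\<exists>h0>0. \<forall>h z. 0 < h \<longrightarrow> h < h0 \<longrightarrow>
      \<bar>rw \<rho> h F z - F z - h\<^sup>2 * gen X \<rho> (\<lambda>i. G i z) (\<lambda>i j. H i j z)\<bar> \<le> e * h\<^sup>2"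
proof -
  define c where "c = (\<Sum>i\<in>X. \<bar>\<rho> i\<bar> + (\<rho> i)\<^sup>2) + 1"
  have c: "c > 0" "\<And>h. \<bar>h\<bar> \<le> 1 \<Longrightarrow> l1 X (rw_step \<rho> h) \<le> \<bar>h\<bar> * c"
  proof -
    show "c > 0" unfolding c_def by (intro add_nonneg_pos sum_nonneg) auto
    show "l1 X (rw_step \<rho> h) \<le> \<bar>h\<bar> * c" if "\<bar>h\<bar> \<le> 1" for h
      using l1_rw_step[OF that, of X \<rho>] unfolding c_def by (simp add: distrib_left)
  qed
  have "ucont X (\<lambda>z. \<Sum>i\<in>X. \<Sum>j\<in>X. (\<rho> i)\<^sup>2 * (\<rho> j)\<^sup>2 * H i j z)"
    by (intro ucont_sum ucont_scale H)
  then obtain B where B: "B > 0" "\<And>z. \<bar>\<Sum>i\<in>X. \<Sum>j\<in>X. (\<rho> i)\<^sup>2 * (\<rho> j)\<^sup>2 * H i j z\<bar> \<le> B"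
    using ucont_bound by blast
  define e' where "e' = e / (2 * c\<^sup>2)"
  have e': "e' > 0" "e' * c\<^sup>2 = e / 2" using e c by (auto simp: e'_def field_simps)
  obtain d where d: "d > 0" "\<And>z \<zeta>. l1 X \<zeta> < d \<Longrightarrow> \<bar>F (z + \<zeta>) - F z - (\<Sum>i\<in>X. \<zeta> i * G i z)
     - (\<Sum>i\<in>X. \<Sum>j\<in>X. \<zeta> i * \<zeta> j * H i j z) / 2\<bar> \<le> e' * (l1 X \<zeta>)\<^sup>2"
    using taylor2[OF X F G e'(1)] by blast
  \<comment> \<open>The entry 1 makes the length of a step linear in h, \<open>d / c\<close> keeps
    both steps inside the Taylor radius, and \<open>e / B\<close> absorbs the term of order
    four.\<close>
  define h0 where "h0 = min 1 (min (d / c) (e / B))"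
  have h0: "h0 > 0" using d(1) c(1) e B(1) by (simp add: h0_def)
  have "\<bar>rw \<rho> h F z - F z - h\<^sup>2 * gen X \<rho> (\<lambda>i. G i z) (\<lambda>i j. H i j z)\<bar> \<le> e * h\<^sup>2"
    if h: "0 < h" "h < h0" for h z
  proof -
    have hb: "h < 1" "h * c < d" "h * B < e" using h c(1) B(1) by (auto simp: h0_def field_simps)
    define R where "R \<zeta> = F (z + \<zeta>) - F z - (\<Sum>i\<in>X. \<zeta> i * G i z) - (\<Sum>i\<in>X. \<Sum>j\<in>X. \<zeta> i * \<zeta> j * H i j z) / 2" for \<zeta>
    have R: "\<bar>R (rw_step \<rho> k)\<bar> \<le> e / 2 * h\<^sup>2" if "\<bar>k\<bar> = h" for k
    proof -
      have l: "l1 X (rw_step \<rho> k) \<le> h * c" using c(2)[of k] that hb by simp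
      have "\<bar>R (rw_step \<rho> k)\<bar> \<le> e' * (l1 X (rw_step \<rho> k))\<^sup>2" unfolding R_def using l hb by (intro d(2)) simp
      also have "\<dots> \<le> e' * (h * c)\<^sup>2" using l e'(1) by (intro mult_left_mono power_mono) auto
      also have "\<dots> = e / 2 * h\<^sup>2" using e'(2) by (simp add: power_mult_distrib ac_simps)
      finally show ?thesis .
    qed
    define q where "q = (\<Sum>i\<in>X. \<Sum>j\<in>X. (\<rho> i)\<^sup>2 * (\<rho> j)\<^sup>2 * H i j z)"
    have "rw \<rho> h F z - F z - h\<^sup>2 * gen X \<rho> (\<lambda>i. G i z) (\<lambda>i j. H i j z)
      = (R (rw_step \<rho> h) + R (rw_step \<rho> (- h))) / 2 + h ^ 4 / 8 * q"
      using rw_quadratic[OF X, of \<rho> h "\<lambda>i. G i z" "\<lambda>i j. H i j z"]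
      unfolding R_def rw_def q_def by (simp add: field_simps)
    moreover have "\<bar>h ^ 4 / 8 * q\<bar> \<le> e / 2 * h\<^sup>2"
    proof -
      have "\<bar>h ^ 4 / 8 * q\<bar> = h\<^sup>2 * (h * h * \<bar>q\<bar> / 8)"
        using h by (simp add: abs_mult power2_eq_square power4_eq_xxxx)
      also have "\<dots> \<le> h\<^sup>2 * (e / 2)"
      proof (intro mult_left_mono)
        have "h * h * \<bar>q\<bar> \<le> 1 * (h * B)"
          unfolding mult.assoc using B(2)[of z] h hb by (intro mult_mono) (auto simp: q_def)
        then show "h * h * \<bar>q\<bar> / 8 \<le> e / 2" using hb(3) e by simp
      qed simp
      finally show ?thesis by (simp add: mult.commute)
    qed
    moreover have "\<bar>R (rw_step \<rho> h)\<bar> \<le> e / 2 * h\<^sup>2" "\<bar>R (rw_step \<rho> (- h))\<bar> \<le> e / 2 * h\<^sup>2"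
      using R[of h] R[of "- h"] h(1) by simp_all
    moreover have "\<bar>D\<bar> \<le> 2 * w" if "D = (r + s) / 2 + t" "\<bar>t\<bar> \<le> w" "\<bar>r\<bar> \<le> w" "\<bar>s\<bar> \<le> w" for D r s t w :: real
      using that by argo
    ultimately have "\<bar>rw \<rho> h F z - F z - h\<^sup>2 * gen X \<rho> (\<lambda>i. G i z) (\<lambda>i j. H i j z)\<bar> \<le> 2 * (e / 2 * h\<^sup>2)"
      by blast
    then show ?thesis by simp
  qed
  then show ?thesis using h0 by blast
qed

lemma Ck2_derivs:
  assumes "Ck X (Suc (Suc k)) F"
  shows "\<exists>G H. diff_on X X F G \<and> (\<forall>i\<in>X. Ck X (Suc k) (G i) \<and> diff_on X X (G i) (H i) \<and> (\<forall>j\<in>X. Ck X k (H i j)))"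
proof -
  obtain G where G: "diff_on X X F G" "\<forall>i\<in>X. Ck X (Suc k) (G i)" using assms by auto
  then have "\<forall>i\<in>X. \<exists>Hi. diff_on X X (G i) Hi \<and> (\<forall>j\<in>X. Ck X k (Hi j))" by auto
  then obtain H where "\<forall>i\<in>X. diff_on X X (G i) (H i) \<and> (\<forall>j\<in>X. Ck X k (H i j))" by metis
  then show ?thesis using G by blast
qed

lemma rw_bound_C2:
  assumes X: "finite X" and F: "Ck X 2 F"
  shows "\<exists>C>0. \<exists>h0>0. \<forall>h z. 0 < h \<longrightarrow> h < h0 \<longrightarrow> \<bar>rw \<rho> h F z - F z\<bar> \<le> C * h\<^sup>2"
proof -
  obtain G H where GH: "diff_on X X F G" "\<And>i. i \<in> X \<Longrightarrow> diff_on X X (G i) (H i)"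
    "\<And>i. i \<in> X \<Longrightarrow> ucont X (G i)" "\<And>i j. i \<in> X \<Longrightarrow> j \<in> X \<Longrightarrow> ucont X (H i j)"
    using Ck2_derivs[of X 0 F] F Ck_ucont unfolding numeral_2_eq_2 by (metis Ck.simps(1))
  obtain h0 where h0: "h0 > 0" "\<And>h z. 0 < h \<Longrightarrow> h < h0 \<Longrightarrow>
      \<bar>rw \<rho> h F z - F z - h\<^sup>2 * gen X \<rho> (\<lambda>i. G i z) (\<lambda>i j. H i j z)\<bar> \<le> 1 * h\<^sup>2"
    using rw_expand[OF X GH(1,2,4), of 1 \<rho>] by auto
  obtain B where B: "B > 0" "\<And>z. \<bar>gen X \<rho> (\<lambda>i. G i z) (\<lambda>i j. H i j z)\<bar> \<le> B"
    using ucont_bound[OF ucont_gen[of X G H \<rho>]] GH by blast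
  have "\<bar>rw \<rho> h F z - F z\<bar> \<le> (1 + B) * h\<^sup>2" if "0 < h" "h < h0" for h z
  proof -
    have "\<bar>h\<^sup>2 * gen X \<rho> (\<lambda>i. G i z) (\<lambda>i j. H i j z)\<bar> \<le> h\<^sup>2 * B"
      unfolding abs_mult using B(2)[of z] by (intro mult_mono) auto
    then show ?thesis using h0(2)[OF that, of z] by (simp add: abs_le_iff algebra_simps)
  qed
  then show ?thesis using B(1) h0(1) by (intro exI[of _ "1 + B"]) auto
qed

text \<open>The increments telescope: each step adds \<open>h\<^sup>2\<close> times the generator
  carried along by the walk, which after time t differs from the generator at z by at most
  \<open>C * t\<close>. Hence the generator must itself be of class \<open>Ck X 2\<close>, which in
  the application costs four derivatives of F.\<close>

lemma rw_pow_expand: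
  assumes X: "finite X" and F: "diff_on X X F G" "ucont X F" and G: "\<And>i. i \<in> X \<Longrightarrow> diff_on X X (G i) (H i)"
    and H: "\<And>i j. i \<in> X \<Longrightarrow> j \<in> X \<Longrightarrow> ucont X (H i j)"
    and g: "Ck X 2 (\<lambda>z. gen X \<rho> (\<lambda>i. G i z) (\<lambda>i j. H i j z))" and e: "0 < e"
  shows "\<exists>T0>0. \<exists>h0>0. \<forall>h n z. 0 < h \<longrightarrow> h < h0 \<longrightarrow> real n * h\<^sup>2 \<le> T0 \<longrightarrow>
      \<bar>(rw \<rho> h ^^ n) F z - F z - real n * h\<^sup>2 * gen X \<rho> (\<lambda>i. G i z) (\<lambda>i j. H i j z)\<bar> \<le> e * (real n * h\<^sup>2)"
proof -
  define g where "g z = gen X \<rho> (\<lambda>i. G i z) (\<lambda>i j. H i j z)" for z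
  have ug: "Ck X 2 g" "ucont X g" using g Ck_ucont unfolding g_def[abs_def] by blast+
  obtain C h1 where C: "C > 0" "h1 > 0" "\<And>h z. 0 < h \<Longrightarrow> h < h1 \<Longrightarrow> \<bar>rw \<rho> h g z - g z\<bar> \<le> C * h\<^sup>2"
    using rw_bound_C2[OF X ug(1)] by blast
  obtain h2 where h2: "h2 > 0" "\<And>h z. 0 < h \<Longrightarrow> h < h2 \<Longrightarrow> \<bar>rw \<rho> h F z - F z - h\<^sup>2 * g z\<bar> \<le> e / 2 * h\<^sup>2"
    using rw_expand[OF X F(1) G H, of "e / 2" \<rho>] e unfolding g_def by auto
  \<comment> \<open>Up to this time the generator moves by at most e / 2; the other half pays for
    the consistency error of the steps.\<close>
  define T0 where "T0 = e / (2 * C)"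
  have T0: "T0 > 0" "C * T0 = e / 2" using e C(1) by (auto simp: T0_def)
  have main: "\<bar>(rw \<rho> h ^^ n) F z - F z - real n * h\<^sup>2 * g z\<bar> \<le> e * (real n * h\<^sup>2)"
    if h: "0 < h" "h < min h1 h2" and T: "real n * h\<^sup>2 \<le> T0" for h n z
  proof -
    obtain r where r: "r \<ge> 0" "avg X r (rw \<rho> h)" using avg_rw[OF X] by blast
    have av: "avg X (real k * r) (rw \<rho> h ^^ k)" for k using avg_funpow[OF r(2,1)] .
    have gk: "\<bar>(rw \<rho> h ^^ k) g z - g z\<bar> \<le> C * (real k * h\<^sup>2)" for k z
    proof (induction k arbitrary: z)
      case (Suc k)
      have "(rw \<rho> h ^^ k) (\<lambda>z. rw \<rho> h g z - g z) z = (rw \<rho> h ^^ Suc k) g z - (rw \<rho> h ^^ k) g z"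
        using avg_diff[OF av[of k] avg_ucont[OF r(2) ug(2)] ug(2)] by (simp add: funpow_swap1)
      moreover have "\<bar>(rw \<rho> h ^^ k) (\<lambda>z. rw \<rho> h g z - g z) z\<bar> \<le> C * h\<^sup>2"
        using C(3) h by (intro avg_abs_bound[OF av[of k]] ucont_diff avg_ucont[OF r(2)] ug) auto
      ultimately show ?case using Suc[of z] by (simp add: abs_le_iff algebra_simps)
    qed simp
    have "\<bar>(rw \<rho> h ^^ k) F z - F z - real k * h\<^sup>2 * g z\<bar> \<le> e * (real k * h\<^sup>2)" if "k \<le> n" for k
      using that
    proof (induction k)
      case (Suc k)
      define D where "D z = rw \<rho> h F z - F z - h\<^sup>2 * g z" for z
      have uD: "ucont X D" unfolding D_def
        by (intro ucont_diff ucont_scale avg_ucont[OF r(2)] F ug)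
      have "(rw \<rho> h ^^ k) D z = (rw \<rho> h ^^ Suc k) F z - (rw \<rho> h ^^ k) F z - h\<^sup>2 * (rw \<rho> h ^^ k) g z"
        unfolding D_def[abs_def]
        using F ug avg_ucont[OF r(2) F(2)]
        by (simp add: avg_diff[OF av[of k]] avg_scale[OF av[of k]] ucont_diff ucont_scale funpow_swap1)
      moreover have "\<bar>(rw \<rho> h ^^ k) D z\<bar> \<le> e / 2 * h\<^sup>2"
        using h2(2) h by (intro avg_abs_bound[OF av[of k] uD]) (auto simp: D_def)
      moreover have "\<bar>h\<^sup>2 * (rw \<rho> h ^^ k) g z - h\<^sup>2 * g z\<bar> \<le> e / 2 * h\<^sup>2"
      proof -
        have "real k * h\<^sup>2 \<le> real n * h\<^sup>2" using Suc.prems by (intro mult_right_mono) auto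
        then have "C * (real k * h\<^sup>2) \<le> C * T0" using T C(1) by (intro mult_left_mono) auto
        then have "\<bar>(rw \<rho> h ^^ k) g z - g z\<bar> \<le> e / 2" using gk[of k z] T0(2) by linarith
        then have "h\<^sup>2 * \<bar>(rw \<rho> h ^^ k) g z - g z\<bar> \<le> h\<^sup>2 * (e / 2)" by (intro mult_left_mono) auto
        moreover have "\<bar>h\<^sup>2 * (rw \<rho> h ^^ k) g z - h\<^sup>2 * g z\<bar> = h\<^sup>2 * \<bar>(rw \<rho> h ^^ k) g z - g z\<bar>"
          unfolding right_diff_distrib[symmetric] abs_mult by simp
        ultimately show ?thesis by (simp add: mult.commute)
      qed
      moreover have "real (Suc k) * h\<^sup>2 * g z = real k * h\<^sup>2 * g z + h\<^sup>2 * g z"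
        "e * (real (Suc k) * h\<^sup>2) = e * (real k * h\<^sup>2) + e / 2 * h\<^sup>2 + e / 2 * h\<^sup>2" by (simp_all add: algebra_simps)
      ultimately show ?case using Suc unfolding abs_le_iff by force
    qed simp
    then show ?thesis by simp
  qed
  show ?thesis using main T0(1) C(2) h2(1) unfolding g_def
    by (intro exI[of _ T0] exI[of _ "min h1 h2"] conjI allI impI) auto
qed

section \<open>Second order jets and semicontinuous comparison\<close>

definition nz :: "'i set \<Rightarrow> ('i \<Rightarrow> real) filter" where
  "nz X = filtercomap (l1 X) (nhds 0)"

definition jet2 :: "'i set \<Rightarrow> (('i \<Rightarrow> real) \<Rightarrow> real) \<Rightarrow> ('i \<Rightarrow> real) \<Rightarrow> ('i \<Rightarrow> real) \<Rightarrow> ('i \<Rightarrow> 'i \<Rightarrow> real) \<Rightarrow> bool" where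
  "jet2 X \<phi> z p Q \<longleftrightarrow> (\<lambda>\<zeta>. \<phi> (z + \<zeta>) - \<phi> z - (\<Sum>i\<in>X. \<zeta> i * p i) - (\<Sum>i\<in>X. \<Sum>j\<in>X. \<zeta> i * \<zeta> j * Q i j) / 2)
     \<in> o[nz X](\<lambda>\<zeta>. (l1 X \<zeta>)\<^sup>2)"

lemma eventually_nz: "eventually P (nz X) \<longleftrightarrow> (\<exists>d>0. \<forall>\<zeta>. l1 X \<zeta> < d \<longrightarrow> P \<zeta>)"
proof
  assume "eventually P (nz X)"
  then obtain Q where Q: "eventually Q (nhds (0::real))" "\<And>\<zeta>. Q (l1 X \<zeta>) \<Longrightarrow> P \<zeta>"
    unfolding nz_def eventually_filtercomap by blast
  then obtain d where "d > 0" "\<And>x. dist x 0 < d \<Longrightarrow> Q x" unfolding eventually_nhds_metric by blast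
  then show "\<exists>d>0. \<forall>\<zeta>. l1 X \<zeta> < d \<longrightarrow> P \<zeta>" using Q(2) by (auto simp: dist_real_def)
next
  assume "\<exists>d>0. \<forall>\<zeta>. l1 X \<zeta> < d \<longrightarrow> P \<zeta>"
  then obtain d where d: "d > 0" "\<And>\<zeta>. l1 X \<zeta> < d \<Longrightarrow> P \<zeta>" by blast
  have "eventually (\<lambda>x. x < d) (nhds (0::real))" using d(1) by (rule eventually_nhds_in_open[of "{..<d}", simplified])
  then show "eventually P (nz X)" unfolding nz_def eventually_filtercomap using d(2) by blast
qed

lemma filterlim_l1_nz: "(l1 X \<longlongrightarrow> 0) (nz X)"
  unfolding nz_def by (rule filterlim_filtercomap)

lemma coord_bigo_nz: "finite X \<Longrightarrow> i \<in> X \<Longrightarrow> (\<lambda>\<zeta>. \<zeta> i) \<in> O[nz X](l1 X)"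
  by (rule bigoI[of _ 1]) (simp add: abs_le_l1)

lemma coord_tendsto_nz: "finite X \<Longrightarrow> i \<in> X \<Longrightarrow> ((\<lambda>\<zeta>. \<zeta> i) \<longlongrightarrow> 0) (nz X)"
  by (rule Lim_null_comparison[OF _ filterlim_l1_nz]) (simp add: abs_le_l1)

lemma smallo_nz_iff:
  "f \<in> o[nz X](\<lambda>\<zeta>. (l1 X \<zeta>)\<^sup>2) \<longleftrightarrow> (\<forall>e>0. \<exists>d>0. \<forall>\<zeta>. l1 X \<zeta> < d \<longrightarrow> \<bar>f \<zeta>\<bar> \<le> e * (l1 X \<zeta>)\<^sup>2)"
  unfolding smallo_def eventually_nz by simp

lemma jet2_taylor:
  assumes "finite X" "diff_on X X F G" "\<And>i. i \<in> X \<Longrightarrow> diff_on X X (G i) (H i)"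
  shows "jet2 X F z (\<lambda>i. G i z) (\<lambda>i j. H i j z)"
  unfolding jet2_def smallo_nz_iff using taylor2[OF assms] by blast

lemma jet2_add:
  assumes "jet2 X \<phi> z p Q" "jet2 X \<psi> z p' Q'"
  shows "jet2 X (\<lambda>z. \<phi> z + \<psi> z) z (\<lambda>i. p i + p' i) (\<lambda>i j. Q i j + Q' i j)"
proof -
  have "(\<lambda>\<zeta>. (\<phi> (z + \<zeta>) - \<phi> z - (\<Sum>i\<in>X. \<zeta> i * p i) - (\<Sum>i\<in>X. \<Sum>j\<in>X. \<zeta> i * \<zeta> j * Q i j) / 2)
      + (\<psi> (z + \<zeta>) - \<psi> z - (\<Sum>i\<in>X. \<zeta> i * p' i) - (\<Sum>i\<in>X. \<Sum>j\<in>X. \<zeta> i * \<zeta> j * Q' i j) / 2))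
     \<in> o[nz X](\<lambda>\<zeta>. (l1 X \<zeta>)\<^sup>2)"
    using assms unfolding jet2_def by (rule sum_in_smallo)
  moreover have "(\<phi> (z + \<zeta>) - \<phi> z - (\<Sum>i\<in>X. \<zeta> i * p i) - (\<Sum>i\<in>X. \<Sum>j\<in>X. \<zeta> i * \<zeta> j * Q i j) / 2)
      + (\<psi> (z + \<zeta>) - \<psi> z - (\<Sum>i\<in>X. \<zeta> i * p' i) - (\<Sum>i\<in>X. \<Sum>j\<in>X. \<zeta> i * \<zeta> j * Q' i j) / 2)
    = (\<phi> (z + \<zeta>) + \<psi> (z + \<zeta>)) - (\<phi> z + \<psi> z) - (\<Sum>i\<in>X. \<zeta> i * (p i + p' i))
      - (\<Sum>i\<in>X. \<Sum>j\<in>X. \<zeta> i * \<zeta> j * (Q i j + Q' i j)) / 2" for \<zeta>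
    unfolding distrib_left sum.distrib add_divide_distrib by linarith
  ultimately show ?thesis unfolding jet2_def by simp
qed

text \<open>Exponentials and barriers are sums of functions of one coordinate, so their jets reduce
  to one-variable expansions and a diagonal Hessian.\<close>

lemma jet2_separable:
  assumes X: "finite X" and \<psi>: "\<And>i. i \<in> X \<Longrightarrow>
    (\<lambda>t. \<psi> i (z i + t) - \<psi> i (z i) - t * a i - t\<^sup>2 * b i / 2) \<in> o[nhds 0](\<lambda>t::real. t\<^sup>2)"
  shows "jet2 X (\<lambda>z. \<Sum>i\<in>X. \<psi> i (z i)) z a (\<lambda>i j. if i = j then b i else 0)"
proof -
  have "(\<lambda>\<zeta>. \<Sum>i\<in>X. \<psi> i (z i + \<zeta> i) - \<psi> i (z i) - \<zeta> i * a i - (\<zeta> i)\<^sup>2 * b i / 2) \<in> o[nz X](\<lambda>\<zeta>. (l1 X \<zeta>)\<^sup>2)"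
  proof (rule big_sum_in_smallo)
    fix i assume i: "i \<in> X"
    have "(\<lambda>\<zeta>. \<psi> i (z i + \<zeta> i) - \<psi> i (z i) - \<zeta> i * a i - (\<zeta> i)\<^sup>2 * b i / 2) \<in> o[nz X](\<lambda>\<zeta>. (\<zeta> i)\<^sup>2)"
      using landau_o.small.compose[OF \<psi>[OF i] coord_tendsto_nz[OF X i]] .
    also have "(\<lambda>\<zeta>. (\<zeta> i)\<^sup>2) \<in> O[nz X](\<lambda>\<zeta>. (l1 X \<zeta>)\<^sup>2)"
      using coord_bigo_nz[OF X i] by (rule landau_o.big_power)
    finally show "(\<lambda>\<zeta>. \<psi> i (z i + \<zeta> i) - \<psi> i (z i) - \<zeta> i * a i - (\<zeta> i)\<^sup>2 * b i / 2) \<in> o[nz X](\<lambda>\<zeta>. (l1 X \<zeta>)\<^sup>2)" .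
  qed
  moreover have "(\<Sum>i\<in>X. \<Sum>j\<in>X. \<zeta> i * \<zeta> j * (if i = j then b i else 0)) = (\<Sum>i\<in>X. (\<zeta> i)\<^sup>2 * b i)" for \<zeta>
    using X by (intro sum.cong refl) (simp add: if_distrib[of "\<lambda>x. _ * x"] power2_eq_square cong: if_cong)
  ultimately show ?thesis
    unfolding jet2_def by (simp add: sum_subtractf sum_divide_distrib)
qed

lemma gen_add: "gen X \<rho> (\<lambda>i. p i + p' i) (\<lambda>i j. Q i j + Q' i j) = gen X \<rho> p Q + gen X \<rho> p' Q'"
  unfolding gen_def by (simp add: distrib_left sum.distrib add_divide_distrib)

lemma gen_diag: "finite X \<Longrightarrow> gen X \<rho> a (\<lambda>i j. if i = j then b i else 0) = (\<Sum>i\<in>X. (\<rho> i)\<^sup>2 * (b i - a i)) / 2"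
  unfolding gen_def
  by (simp add: if_distrib[of "\<lambda>x. _ * x"] power2_eq_square right_diff_distrib sum_subtractf diff_divide_distrib cong: if_cong)

lemma smallo_exp: "(\<lambda>t. \<alpha> * exp (s + t) - \<alpha> * exp s - t * (\<alpha> * exp s) - t\<^sup>2 * (\<alpha> * exp s) / 2) \<in> o[nhds 0](\<lambda>t::real. t\<^sup>2)"
proof -
  have "(\<lambda>t::real. exp t - 1 - t - t\<^sup>2 / 2) \<in> o[at 0](\<lambda>t. t\<^sup>2)" by real_asymp
  \<comment> \<open>The remainder is 0 at 0, so the punctured estimate extends to the point
    itself.\<close>
  then have "(\<lambda>t::real. exp t - 1 - t - t\<^sup>2 / 2) \<in> o[nhds 0](\<lambda>t. t\<^sup>2)"
    unfolding smallo_def eventually_nhds_conv_at by simp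
  then have "(\<lambda>t::real. \<alpha> * exp s * (exp t - 1 - t - t\<^sup>2 / 2)) \<in> o[nhds 0](\<lambda>t. t\<^sup>2)"
    by (cases "\<alpha> = 0") auto
  moreover have "\<alpha> * exp (s + t) - \<alpha> * exp s - t * (\<alpha> * exp s) - t\<^sup>2 * (\<alpha> * exp s) / 2
      = \<alpha> * exp s * (exp t - 1 - t - t\<^sup>2 / 2)" for t
    by (simp add: exp_add field_simps)
  ultimately show ?thesis by simp
qed

lemma smallo_quartic: "(\<lambda>t. (\<alpha> * (s + t) ^ 4 + \<beta> * (s + t)\<^sup>2) - (\<alpha> * s ^ 4 + \<beta> * s\<^sup>2) - t * (\<alpha> * (4 * s ^ 3) + \<beta> * (2 * s))
    - t\<^sup>2 * (\<alpha> * (12 * s\<^sup>2) + \<beta> * 2) / 2) \<in> o[nhds 0](\<lambda>t::real. t\<^sup>2)"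
proof -
  have "(\<lambda>t::real. \<alpha> * (4 * s * t ^ 3 + t ^ 4)) \<in> o[at 0](\<lambda>t. t\<^sup>2)"
  proof -
    have "(\<lambda>t::real. t ^ 3) \<in> o[at 0](\<lambda>t. t\<^sup>2)" "(\<lambda>t::real. t ^ 4) \<in> o[at 0](\<lambda>t. t\<^sup>2)" by real_asymp+
    then have "(\<lambda>t::real. \<alpha> * 4 * s * t ^ 3 + \<alpha> * t ^ 4) \<in> o[at 0](\<lambda>t. t\<^sup>2)"
      by (intro sum_in_smallo) auto
    then show ?thesis by (simp add: algebra_simps)
  qed
  then have "(\<lambda>t::real. \<alpha> * (4 * s * t ^ 3 + t ^ 4)) \<in> o[nhds 0](\<lambda>t. t\<^sup>2)"
    unfolding smallo_def eventually_nhds_conv_at by simp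
  moreover have "(\<alpha> * (s + t) ^ 4 + \<beta> * (s + t)\<^sup>2) - (\<alpha> * s ^ 4 + \<beta> * s\<^sup>2) - t * (\<alpha> * (4 * s ^ 3) + \<beta> * (2 * s))
    - t\<^sup>2 * (\<alpha> * (12 * s\<^sup>2) + \<beta> * 2) / 2 = \<alpha> * (4 * s * t ^ 3 + t ^ 4)" for t
    by (simp add: power4_eq_xxxx power3_eq_cube power2_eq_square field_simps)
  ultimately show ?thesis by simp
qed

section \<open>Sequential compactness in finitely many coordinates\<close>

lemma bounded_subsequence:
  fixes s :: "nat \<Rightarrow> 'i \<Rightarrow> real"
  assumes "finite X" "\<And>i. i \<in> X \<Longrightarrow> \<exists>B. \<forall>n. \<bar>s n i\<bar> \<le> B"
  shows "\<exists>r l. strict_mono r \<and> (\<forall>i\<in>X. (\<lambda>n. s (r n) i) \<longlonglongrightarrow> l i)"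
  using assms
proof (induction X)
  case empty
  show ?case by (auto intro: exI[of _ id] strict_mono_id)
next
  case (insert j X)
  then obtain r l where r: "strict_mono r" "\<forall>i\<in>X. (\<lambda>n. s (r n) i) \<longlonglongrightarrow> l i" by blast
  obtain B where "\<forall>n. \<bar>s n j\<bar> \<le> B" using insert by blast
  then have "bounded (range (\<lambda>n. s (r n) j))" by (auto simp: bounded_iff)
  then obtain lj r' where r': "strict_mono r'" "((\<lambda>n. s (r n) j) \<circ> r') \<longlonglongrightarrow> lj"
    using bounded_imp_convergent_subsequence by blast
  have "(\<lambda>n. s ((r \<circ> r') n) i) \<longlonglongrightarrow> (l(j := lj)) i" if "i \<in> insert j X" for i
  proof (cases "i = j")
    case True
    then show ?thesis using r'(2) by (simp add: o_def)
  next
    case False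
    then have "(\<lambda>n. s (r n) i) \<longlonglongrightarrow> l i" using r(2) that by blast
    from LIMSEQ_subseq_LIMSEQ[OF this r'(1)] show ?thesis using False by (simp add: o_def)
  qed
  then show ?case using strict_mono_o[OF r(1) r'(1)] by blast
qed

definition seqcomp :: "'i set \<Rightarrow> ('i \<Rightarrow> real) set \<Rightarrow> bool" where
  "seqcomp X B \<longleftrightarrow> (\<forall>s::nat \<Rightarrow> 'i \<Rightarrow> real. range s \<subseteq> B \<longrightarrow> (\<exists>r. \<exists>l\<in>B. strict_mono r \<and> (\<forall>i\<in>X. (\<lambda>n. s (r n) i) \<longlonglongrightarrow> l i)))"

definition seqcont :: "'i set \<Rightarrow> ('i \<Rightarrow> real) set \<Rightarrow> (('i \<Rightarrow> real) \<Rightarrow> real) \<Rightarrow> bool" where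
  "seqcont X B f \<longleftrightarrow> (\<forall>s l. range s \<subseteq> B \<longrightarrow> l \<in> B \<longrightarrow> (\<forall>i\<in>X. (\<lambda>n. s n i) \<longlonglongrightarrow> l i) \<longrightarrow> (\<lambda>n. f (s n)) \<longlonglongrightarrow> f l)"

lemma seqcont_D: "seqcont X B f \<Longrightarrow> (\<And>n. s n \<in> B) \<Longrightarrow> l \<in> B \<Longrightarrow> (\<And>i. i \<in> X \<Longrightarrow> (\<lambda>n. s n i) \<longlonglongrightarrow> l i)
   \<Longrightarrow> (\<lambda>n. f (s n)) \<longlonglongrightarrow> f l"
  unfolding seqcont_def by blast

lemma seqcont_diff: "seqcont X B f \<Longrightarrow> seqcont X B g \<Longrightarrow> seqcont X B (\<lambda>z. f z - g z)"
  unfolding seqcont_def by (intro allI impI tendsto_diff) simp_all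

lemma seqcont_add: "seqcont X B f \<Longrightarrow> seqcont X B g \<Longrightarrow> seqcont X B (\<lambda>z. f z + g z)"
  unfolding seqcont_def by (intro allI impI tendsto_add) simp_all

lemma seqcont_cmult: "seqcont X B f \<Longrightarrow> seqcont X B (\<lambda>z. c * f z)"
  unfolding seqcont_def by (intro allI impI tendsto_mult_left) simp_all

lemma seqcont_subset: "seqcont X B f \<Longrightarrow> A \<subseteq> B \<Longrightarrow> seqcont X A f"
  unfolding seqcont_def by blast

lemma seqcont_separable:
  assumes "\<And>i x. i \<in> X \<Longrightarrow> isCont (\<psi> i) x"
  shows "seqcont X B (\<lambda>z. \<Sum>i\<in>X. \<psi> i (z i))"
  unfolding seqcont_def using assms
  by (intro allI impI tendsto_sum) (rule isCont_tendsto_compose, simp_all)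

lemma seqcont_ucont:
  assumes "ucont X F" "finite X"
  shows "seqcont X B F"
  unfolding seqcont_def
proof (intro allI impI)
  fix s :: "nat \<Rightarrow> 'a \<Rightarrow> real" and l assume s: "\<forall>i\<in>X. (\<lambda>n. s n i) \<longlonglongrightarrow> l i"
  have "(\<lambda>n. \<Sum>i\<in>X. \<bar>s n i - l i\<bar>) \<longlonglongrightarrow> (\<Sum>i\<in>X. \<bar>l i - l i\<bar>)"
    using s by (intro tendsto_sum tendsto_rabs tendsto_diff tendsto_const) simp
  then have "(\<lambda>n. l1 X (s n - l)) \<longlonglongrightarrow> (\<Sum>i\<in>X. \<bar>l i - l i\<bar>)"
    unfolding l1_def by simp
  then have l0: "(\<lambda>n. l1 X (s n - l)) \<longlonglongrightarrow> 0" by simp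
  show "(\<lambda>n. F (s n)) \<longlonglongrightarrow> F l"
  proof (rule LIMSEQ_I)
    fix e :: real assume "e > 0"
    then obtain d where d: "d > 0" "\<And>z \<zeta>. l1 X \<zeta> < d \<Longrightarrow> \<bar>F (z + \<zeta>) - F z\<bar> \<le> e / 2"
      using ucont_modulus[OF assms(1), of "e / 2"] by auto
    obtain n0 where n0: "\<And>n. n \<ge> n0 \<Longrightarrow> l1 X (s n - l) < d"
      using LIMSEQ_D[OF l0 d(1)] by auto
    have "norm (F (s n) - F l) < e" if "n \<ge> n0" for n
      using d(2)[OF n0[OF that], of l] \<open>e > 0\<close> by simp
    then show "\<exists>n0. \<forall>n\<ge>n0. norm (F (s n) - F l) < e" by blast
  qed
qed

lemma seqcont_bounded:
  assumes "seqcomp X B" "seqcont X B f"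
  shows "\<exists>M. \<forall>z\<in>B. \<bar>f z\<bar> \<le> M"
proof (rule ccontr)
  assume "\<not> ?thesis"
  then have "\<exists>z. z \<in> B \<and> \<bar>f z\<bar> > real n" for n using not_le by blast
  then obtain s where s: "\<And>n. s n \<in> B" "\<And>n. \<bar>f (s n)\<bar> > real n"
    using choice[of "\<lambda>n z. z \<in> B \<and> \<bar>f z\<bar> > real n"] by blast
  then obtain r l where r: "strict_mono r" "l \<in> B" "\<forall>i\<in>X. (\<lambda>n. s (r n) i) \<longlonglongrightarrow> l i"
    using assms(1)[unfolded seqcomp_def, rule_format, of s] by blast
  have "(\<lambda>n. f (s (r n))) \<longlonglongrightarrow> f l"
    using r s by (intro seqcont_D[OF assms(2), of "\<lambda>n. s (r n)"]) auto
  then obtain M where M: "\<And>n. \<bar>f (s (r n))\<bar> \<le> M"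
    using convergent_imp_Bseq[OF convergentI, of "\<lambda>n. f (s (r n))"] unfolding Bseq_def real_norm_def by blast
  obtain n :: nat where "real n > M" using reals_Archimedean2 by blast
  moreover have "real n \<le> real (r n)" using seq_suble[OF r(1)] by simp
  ultimately show False using s(2)[of "r n"] M[of n] by linarith
qed

lemma seqcont_attains_sup:
  assumes "seqcomp X B" "B \<noteq> {}" "seqcont X B f"
  shows "\<exists>z\<in>B. \<forall>y\<in>B. f y \<le> f z"
proof -
  obtain M where M: "\<forall>z\<in>B. \<bar>f z\<bar> \<le> M" using seqcont_bounded[OF assms(1,3)] by blast
  have bdd: "bdd_above (f ` B)" using M by (auto simp: bdd_above_def abs_le_iff)
  define S where "S = Sup (f ` B)"
  have "\<exists>z. z \<in> B \<and> f z > S - 1 / real (Suc n)" for n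
    using less_cSup_iff[of "f ` B" "S - 1 / real (Suc n)"] assms(2) bdd unfolding S_def by auto
  then obtain s where s: "\<And>n. s n \<in> B" "\<And>n. f (s n) > S - 1 / real (Suc n)"
    using choice[of "\<lambda>n z. z \<in> B \<and> f z > S - 1 / real (Suc n)"] by blast
  then obtain r l where r: "strict_mono r" "l \<in> B" "\<forall>i\<in>X. (\<lambda>n. s (r n) i) \<longlonglongrightarrow> l i"
    using assms(1)[unfolded seqcomp_def, rule_format, of s] by blast
  have "(\<lambda>n. f (s (r n))) \<longlonglongrightarrow> f l"
    using r s by (intro seqcont_D[OF assms(3), of "\<lambda>n. s (r n)"]) auto
  moreover have "(\<lambda>n. S - 1 / Suc (r n)) \<longlonglongrightarrow> S - 0"
    using LIMSEQ_subseq_LIMSEQ[OF LIMSEQ_inverse_real_of_nat r(1)]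
    by (intro tendsto_diff tendsto_const) (simp add: o_def inverse_eq_divide)
  ultimately have "S \<le> f l"
    using s(2) by (intro LIMSEQ_le[of "\<lambda>n. S - 1 / Suc (r n)" S "\<lambda>n. f (s (r n))"]) (auto intro: less_imp_le)
  then show ?thesis using r(2) cSup_upper[OF _ bdd] unfolding S_def by force
qed

definition cube :: "'i set \<Rightarrow> ('i \<Rightarrow> real) \<Rightarrow> real \<Rightarrow> ('i \<Rightarrow> real) set" where
  "cube X z r = {y. \<forall>i\<in>X. \<bar>y i - z i\<bar> \<le> r}"

lemma seqcomp_cube:
  assumes "finite X"
  shows "seqcomp X (cube X z r)"
  unfolding seqcomp_def
proof (intro allI impI)
  fix s :: "nat \<Rightarrow> 'a \<Rightarrow> real" assume s: "range s \<subseteq> cube X z r"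
  then have b: "\<bar>s n i - z i\<bar> \<le> r" if "i \<in> X" for n i using that by (auto simp: cube_def)
  have "\<exists>B. \<forall>n. \<bar>s n i\<bar> \<le> B" if "i \<in> X" for i
  proof -
    have "\<bar>s n i\<bar> \<le> r + \<bar>z i\<bar>" for n using b[OF that, of n] by linarith
    then show ?thesis by blast
  qed
  then obtain q l where q: "strict_mono q" "\<And>i. i \<in> X \<Longrightarrow> (\<lambda>n. s (q n) i) \<longlonglongrightarrow> l i"
    using bounded_subsequence[OF assms, of s] by blast
  have "\<bar>l i - z i\<bar> \<le> r" if "i \<in> X" for i
  proof -
    have "(\<lambda>n. \<bar>s (q n) i - z i\<bar>) \<longlonglongrightarrow> \<bar>l i - z i\<bar>" using q(2)[OF that] by (intro tendsto_intros)
    then show ?thesis using b[OF that] by (intro LIMSEQ_le_const2) auto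
  qed
  then show "\<exists>r'. \<exists>l\<in>cube X z r. strict_mono r' \<and> (\<forall>i\<in>X. (\<lambda>n. s (r' n) i) \<longlonglongrightarrow> l i)"
    using q by (intro exI[of _ q] bexI[of _ l]) (auto simp: cube_def)
qed

text \<open>The left side is how \<open>gen\<close> acts on the barrier
  \<open>\<zeta> ^ 4 + a * t * \<zeta>\<^sup>2\<close>: half of second minus first derivative. For
  \<open>\<bar>\<zeta>\<bar> \<le> 1\<close> the cubic term raises the coefficient 12 by at most 4,
  and the linear term at most doubles the coefficient of \<open>a * t\<close>.\<close>

lemma quartic_penalty_bound:
  fixes \<zeta> t a \<rho> :: real
  assumes "\<bar>\<zeta>\<bar> \<le> 1" "0 \<le> t" "0 \<le> a"
  shows "\<rho>\<^sup>2 * ((12 * \<zeta>\<^sup>2 + a * t * 2) - (4 * \<zeta> ^ 3 + a * t * (2 * \<zeta>))) / 2 \<le> \<rho>\<^sup>2 * (8 * \<zeta>\<^sup>2 + 2 * a * t)"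
proof -
  have "- (\<zeta> ^ 3) \<le> \<zeta>\<^sup>2"
  proof -
    have "\<zeta>\<^sup>2 * (- \<zeta>) \<le> \<zeta>\<^sup>2 * 1" using assms(1) by (intro mult_left_mono) auto
    then show ?thesis by (simp add: power2_eq_square power3_eq_cube algebra_simps)
  qed
  moreover have "a * t * (- \<zeta>) \<le> a * t * 1" using assms by (intro mult_left_mono) auto
  ultimately have "((12 * \<zeta>\<^sup>2 + a * t * 2) - (4 * \<zeta> ^ 3 + a * t * (2 * \<zeta>))) / 2 \<le> 8 * \<zeta>\<^sup>2 + 2 * a * t"
    by (simp add: algebra_simps)
  from mult_left_mono[OF this, of "\<rho>\<^sup>2"] show ?thesis by simp
qed

section \<open>A discrete parabolic maximum principle\<close>

definition expsum :: "'i set \<Rightarrow> ('i \<Rightarrow> real) \<Rightarrow> real" where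
  "expsum X z = (\<Sum>i\<in>X. exp (z i))"

text \<open>Viscosity form of \<open>gen V \<ge> - K * expsum\<close> in the open cube around zb.
  The direction \<rho> is fixed, so the inequality is linear. The right-hand side is a multiple of
  \<open>expsum\<close> because the lift produces this factor and \<open>gen\<close> annihilates
  it.\<close>

definition local_subsol :: "'i set \<Rightarrow> ('i \<Rightarrow> real) \<Rightarrow> real \<Rightarrow> ('i \<Rightarrow> real) \<Rightarrow> real \<Rightarrow> (('i \<Rightarrow> real) \<Rightarrow> real) \<Rightarrow> bool" where
  "local_subsol X zb R \<rho> K V \<longleftrightarrow> (\<forall>z \<phi> p Q. (\<forall>i\<in>X. \<bar>z i - zb i\<bar> < R) \<longrightarrow> jet2 X \<phi> z p Q \<longrightarrow>
     eventually (\<lambda>\<zeta>. V (z + \<zeta>) - V z \<le> \<phi> (z + \<zeta>) - \<phi> z) (nz X) \<longrightarrow> - K * expsum X z \<le> gen X \<rho> p Q)"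

text \<open>A barrier forcing the maximum of the comparison function into the interior of the cube;
  its time dependent part compensates what gen does to the quartic.\<close>

definition pen :: "'i set \<Rightarrow> real \<Rightarrow> real \<Rightarrow> real \<Rightarrow> real \<Rightarrow> ('i \<Rightarrow> real) \<Rightarrow> real" where
  "pen X C a b t \<zeta> = C * ((\<Sum>i\<in>X. (\<zeta> i) ^ 4 + a * t * (\<zeta> i)\<^sup>2) + b * t\<^sup>2)"

lemma pen_split: "pen X C a b t \<zeta> = C * ((\<Sum>i\<in>X. (\<zeta> i) ^ 4) + a * t * (\<Sum>i\<in>X. (\<zeta> i)\<^sup>2) + b * t\<^sup>2)"
  unfolding pen_def by (simp add: sum.distrib sum_distrib_left)

text \<open>One implicit time step. If the bound fails at t', the point where V minus the comparison
  function is maximal is an admissible contact point, and the viscosity inequality there contradicts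
  the bound at \<open>t' - h\<^sup>2\<close>. The constants a and b are chosen so that the time
  derivative \<open>C * (a * W + 2 * b * t')\<close> of the barrier, with W the squared distance to
  z0, dominates what \<open>gen\<close> makes of the barrier; \<theta> supplies the strict
  gap.\<close>

lemma comparison_step:
  assumes X: "finite X" and sub: "local_subsol X zb R \<rho> K V" and V: "ucont X V"
    and VS: "\<And>z. \<bar>V z\<bar> \<le> S" and \<Psi>S: "\<And>z. \<bar>\<Psi>' z\<bar> \<le> S"
    and \<Psi>': "diff_on X X \<Psi>' G" "\<And>i. i \<in> X \<Longrightarrow> diff_on X X (G i) (H i)" "ucont X \<Psi>'"
    and r: "0 < r" "r \<le> 1" "r \<le> R / 4" and z0: "z0 \<in> cube X zb (R / 2)"
    and Nm: "\<And>z. z \<in> cube X zb R \<Longrightarrow> expsum X z \<le> Nm" and t: "0 < t'" "t' \<le> 1"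
    and a: "a = 8 * (\<Sum>i\<in>X. (\<rho> i)\<^sup>2)" and b: "b = a * (\<Sum>i\<in>X. (\<rho> i)\<^sup>2)"
    and C: "0 \<le> C" "2 * S + \<bar>K\<bar> * Nm < C * r ^ 4"
    and \<omega>: "0 \<le> \<omega>" and \<theta>: "0 < \<theta>" and e: "3 * e < \<theta>"
    and h: "0 < h" "h\<^sup>2 \<le> t'" "C * b * h\<^sup>2 \<le> e"
    and prev: "\<And>z. z \<in> cube X z0 r \<Longrightarrow> V z - \<Psi> z - K * (t' - h\<^sup>2) * expsum X z - \<theta> * (t' - h\<^sup>2) - pen X C a b (t' - h\<^sup>2) (z - z0) \<le> \<omega>"
    and step: "\<And>z. \<Psi>' z - \<Psi> z \<ge> h\<^sup>2 * gen X \<rho> (\<lambda>i. G i z) (\<lambda>i j. H i j z) - 2 * e * h\<^sup>2"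
    and z: "z \<in> cube X z0 r"
  shows "V z - \<Psi>' z - K * t' * expsum X z - \<theta> * t' - pen X C a b t' (z - z0) \<le> \<omega>"
proof (rule ccontr)
  assume neg: "\<not> ?thesis"
  \<comment> \<open>Apart from \<Psi>' and the constant \<open>C * b * t'\<^sup>2\<close> the
    comparison function is separable, so its jet can be computed coordinate by coordinate.\<close>
  define \<psi> where "\<psi> i s = K * t' * exp s + (C * (s - z0 i) ^ 4 + C * a * t' * (s - z0 i)\<^sup>2)" for i s
  define \<Phi> where "\<Phi> z = \<Psi>' z + (\<Sum>i\<in>X. \<psi> i (z i))" for z
  have \<Phi>_eq: "\<Phi> z + C * b * t'\<^sup>2 = \<Psi>' z + K * t' * expsum X z + pen X C a b t' (z - z0)" for z
    unfolding \<Phi>_def \<psi>_def pen_def expsum_def by (simp add: sum.distrib sum_distrib_left algebra_simps)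
  have "seqcont X (cube X z0 r) (\<lambda>z. V z - \<Phi> z)"
    unfolding \<Phi>_def \<psi>_def
    by (intro seqcont_diff seqcont_add seqcont_ucont[OF V X] seqcont_ucont[OF \<Psi>'(3) X] seqcont_separable)
      (intro continuous_intros)
  then obtain zh where zh: "zh \<in> cube X z0 r" "\<And>y. y \<in> cube X z0 r \<Longrightarrow> V y - \<Phi> y \<le> V zh - \<Phi> zh"
    using seqcont_attains_sup[OF seqcomp_cube[OF X], of z0 r] z by blast
  have gt: "V zh - \<Psi>' zh - K * t' * expsum X zh - \<theta> * t' - pen X C a b t' (zh - z0) > \<omega>"
    using neg zh(2)[OF z] \<Phi>_eq[of z] \<Phi>_eq[of zh] by linarith
  have near: "\<bar>y i - zb i\<bar> \<le> R / 2 + r" if "y \<in> cube X z0 r" "i \<in> X" for y i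
  proof -
    have "\<bar>y i - z0 i\<bar> \<le> r" "\<bar>z0 i - zb i\<bar> \<le> R / 2" using that z0 by (auto simp: cube_def)
    then show ?thesis by linarith
  qed
  have R: "R > 0" "R / 2 + r < R" using r by auto
  have b0: "(\<rho> i)\<^sup>2 \<le> (\<Sum>i\<in>X. (\<rho> i)\<^sup>2)" if "i \<in> X" for i
    using X that by (intro member_le_sum) auto
  have s0: "0 \<le> (\<Sum>i\<in>X. (\<rho> i)\<^sup>2)" by (intro sum_nonneg) auto
  have ab: "0 \<le> a" "0 \<le> b" unfolding b a using s0 by auto
  \<comment> \<open>On a face of the cube the quartic alone reaches \<open>C * r ^ 4\<close>, more
    than V, \<Psi>' and the exponential term can balance.\<close>
  have int: "\<bar>zh i - z0 i\<bar> < r" if i: "i \<in> X" for i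
  proof (rule ccontr)
    assume "\<not> ?thesis"
    then have ri: "\<bar>zh i - z0 i\<bar> = r" using zh(1) i by (force simp: cube_def)
    have "(zh i - z0 i) ^ 4 = r ^ 4" unfolding ri[symmetric] by simp
    moreover have "(zh i - z0 i) ^ 4 + a * t' * (zh i - z0 i)\<^sup>2 \<le> (\<Sum>i\<in>X. (zh i - z0 i) ^ 4 + a * t' * (zh i - z0 i)\<^sup>2)"
      using X i ab t by (intro member_le_sum) auto
    moreover have "0 \<le> a * t' * (zh i - z0 i)\<^sup>2" "0 \<le> b * t'\<^sup>2" using ab t by auto
    ultimately have "r ^ 4 \<le> (\<Sum>i\<in>X. (zh i - z0 i) ^ 4 + a * t' * (zh i - z0 i)\<^sup>2) + b * t'\<^sup>2" by linarith
    then have "C * r ^ 4 \<le> pen X C a b t' (zh - z0)" unfolding pen_def using C(1) by (simp add: mult_left_mono)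
    moreover have "- (K * t' * expsum X zh) \<le> \<bar>K\<bar> * Nm"
    proof -
      have "zh \<in> cube X zb R" using near[OF zh(1)] R(2) unfolding cube_def by force
      then have "expsum X zh \<le> Nm" by (rule Nm)
      moreover have "0 \<le> expsum X zh" unfolding expsum_def by (intro sum_nonneg) auto
      ultimately have "t' * expsum X zh \<le> 1 * Nm" "0 \<le> t' * expsum X zh" using t by (intro mult_mono, auto)
      then have "\<bar>K\<bar> * (t' * expsum X zh) \<le> \<bar>K\<bar> * Nm" by (intro mult_left_mono) auto
      moreover have "- (K * t' * expsum X zh) \<le> \<bar>K\<bar> * (t' * expsum X zh)"
        using \<open>0 \<le> t' * expsum X zh\<close> mult_right_mono[of "- K" "\<bar>K\<bar>" "t' * expsum X zh"] by (simp add: mult.assoc)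
      ultimately show ?thesis by linarith
    qed
    moreover have "V zh - \<Psi>' zh \<le> 2 * S" using VS[of zh] \<Psi>S[of zh] by linarith
    moreover have "0 \<le> \<theta> * t'" using \<theta> t by simp
    ultimately show False using gt C(2) \<omega> by linarith
  qed
  define p where "p i = G i zh + (K * t' * exp (zh i) + (C * (4 * (zh i - z0 i) ^ 3) + C * a * t' * (2 * (zh i - z0 i))))" for i
  define bb where "bb i = K * t' * exp (zh i) + (C * (12 * (zh i - z0 i)\<^sup>2) + C * a * t' * 2)" for i
  define Q where "Q i j = H i j zh + (if i = j then bb i else 0)" for i j
  have jet: "jet2 X \<Phi> zh p Q"
  proof -
    have j1: "jet2 X \<Psi>' zh (\<lambda>i. G i zh) (\<lambda>i j. H i j zh)" by (rule jet2_taylor[OF X \<Psi>'(1,2)])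
    have j2: "jet2 X (\<lambda>z. \<Sum>i\<in>X. \<psi> i (z i)) zh
       (\<lambda>i. K * t' * exp (zh i) + (C * (4 * (zh i - z0 i) ^ 3) + C * a * t' * (2 * (zh i - z0 i))))
       (\<lambda>i j. if i = j then bb i else 0)"
    proof (rule jet2_separable[OF X])
    fix i assume "i \<in> X"
    have "(\<lambda>t. (K * t' * exp (zh i + t) - K * t' * exp (zh i) - t * (K * t' * exp (zh i)) - t\<^sup>2 * (K * t' * exp (zh i)) / 2)
      + ((C * ((zh i - z0 i) + t) ^ 4 + C * a * t' * ((zh i - z0 i) + t)\<^sup>2) - (C * (zh i - z0 i) ^ 4 + C * a * t' * (zh i - z0 i)\<^sup>2)
      - t * (C * (4 * (zh i - z0 i) ^ 3) + C * a * t' * (2 * (zh i - z0 i))) - t\<^sup>2 * (C * (12 * (zh i - z0 i)\<^sup>2) + C * a * t' * 2) / 2))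
      \<in> o[nhds 0](\<lambda>t. t\<^sup>2)"
      by (intro sum_in_smallo smallo_exp smallo_quartic)
    moreover have "zh i + t - z0 i = zh i - z0 i + t" for t by simp
    ultimately show "(\<lambda>t. \<psi> i (zh i + t) - \<psi> i (zh i) - t * (K * t' * exp (zh i) + (C * (4 * (zh i - z0 i) ^ 3) + C * a * t' * (2 * (zh i - z0 i))))
        - t\<^sup>2 * bb i / 2) \<in> o[nhds 0](\<lambda>t. t\<^sup>2)"
      unfolding \<psi>_def bb_def distrib_left[of "_ ^ 2"] distrib_left[of "_::real" "K * t' * exp (zh i)"] add_divide_distrib
      by (simp add: algebra_simps)
    qed
    show ?thesis using jet2_add[OF j1 j2] unfolding \<Phi>_def p_def Q_def .
  qed
  have ev: "eventually (\<lambda>\<zeta>. V (zh + \<zeta>) - V zh \<le> \<Phi> (zh + \<zeta>) - \<Phi> zh) (nz X)"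
  proof -
    have "eventually (\<lambda>\<zeta>. \<forall>i\<in>X. \<bar>zh i + \<zeta> i - z0 i\<bar> \<le> r) (nz X)"
    proof (rule eventually_ball_finite[OF X], rule ballI)
      fix i assume i: "i \<in> X"
      have "((\<lambda>\<zeta>. \<bar>zh i + \<zeta> i - z0 i\<bar>) \<longlongrightarrow> \<bar>zh i + 0 - z0 i\<bar>) (nz X)"
        by (intro tendsto_intros coord_tendsto_nz X i)
      then have "eventually (\<lambda>\<zeta>. \<bar>zh i + \<zeta> i - z0 i\<bar> < r) (nz X)" using int[OF i] by (intro order_tendstoD(2)) auto
      then show "eventually (\<lambda>\<zeta>. \<bar>zh i + \<zeta> i - z0 i\<bar> \<le> r) (nz X)" by (rule eventually_mono) simp
    qed
    then show ?thesis
    proof (rule eventually_mono)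
      fix \<zeta> assume "\<forall>i\<in>X. \<bar>zh i + \<zeta> i - z0 i\<bar> \<le> r"
      then have "zh + \<zeta> \<in> cube X z0 r" by (simp add: cube_def)
      from zh(2)[OF this] show "V (zh + \<zeta>) - V zh \<le> \<Phi> (zh + \<zeta>) - \<Phi> zh" by linarith
    qed
  qed
  have "\<bar>zh i - zb i\<bar> < R" if "i \<in> X" for i using near[OF zh(1) that] R(2) by linarith
  then have visc: "- K * expsum X zh \<le> gen X \<rho> p Q"
    using sub jet ev unfolding local_subsol_def by blast
  \<comment> \<open>The exponential parts of first and second derivative are equal and cancel in
    this difference, so A comes from the barrier alone.\<close>
  define A where "A = (\<Sum>i\<in>X. (\<rho> i)\<^sup>2 * (bb i - (K * t' * exp (zh i) + (C * (4 * (zh i - z0 i) ^ 3) + C * a * t' * (2 * (zh i - z0 i)))))) / 2"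
  define g where "g = gen X \<rho> (\<lambda>i. G i zh) (\<lambda>i j. H i j zh)"
  have "gen X \<rho> p Q = g + A"
    unfolding p_def Q_def gen_add gen_diag[OF X] g_def A_def ..
  define W where "W = (\<Sum>i\<in>X. (zh i - z0 i)\<^sup>2)"
  have "A \<le> C * (a * W + 2 * b * t')"
  proof -
    have "A = C * (\<Sum>i\<in>X. (\<rho> i)\<^sup>2 * ((12 * (zh i - z0 i)\<^sup>2 + a * t' * 2) - (4 * (zh i - z0 i) ^ 3 + a * t' * (2 * (zh i - z0 i)))) / 2)"
      unfolding A_def bb_def sum_distrib_left sum_divide_distrib by (intro sum.cong refl) (simp add: field_simps)
    also have "\<dots> \<le> C * (\<Sum>i\<in>X. (\<rho> i)\<^sup>2 * (8 * (zh i - z0 i)\<^sup>2 + 2 * a * t'))"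
    proof (intro mult_left_mono[OF _ C(1)] sum_mono quartic_penalty_bound)
      fix i assume "i \<in> X"
      then show "\<bar>zh i - z0 i\<bar> \<le> 1" using int[of i] r(2) by linarith
    qed (use t ab in auto)
    also have "(\<Sum>i\<in>X. (\<rho> i)\<^sup>2 * (8 * (zh i - z0 i)\<^sup>2 + 2 * a * t')) \<le> a * W + 2 * b * t'"
    proof -
      have gs: "(\<Sum>i\<in>X. s * (8 * (zh i - z0 i)\<^sup>2)) = 8 * s * W" for s
        unfolding W_def sum_distrib_left by (intro sum.cong refl) simp
      have "(\<Sum>i\<in>X. (\<rho> i)\<^sup>2 * (8 * (zh i - z0 i)\<^sup>2)) \<le> (\<Sum>i\<in>X. (\<Sum>i\<in>X. (\<rho> i)\<^sup>2) * (8 * (zh i - z0 i)\<^sup>2))"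
        using b0 by (intro sum_mono mult_right_mono) auto
      then have "(\<Sum>i\<in>X. (\<rho> i)\<^sup>2 * (8 * (zh i - z0 i)\<^sup>2)) \<le> a * W"
        using gs[of "\<Sum>i\<in>X. (\<rho> i)\<^sup>2"] unfolding a by linarith
      moreover have "(\<Sum>i\<in>X. (\<rho> i)\<^sup>2 * (2 * a * t')) = 2 * b * t'"
        unfolding b sum_distrib_right[symmetric] by simp
      ultimately show ?thesis by (simp add: distrib_left sum.distrib)
    qed
    finally show ?thesis using C(1) by (simp add: mult_left_mono)
  qed
  \<comment> \<open>The barrier is quadratic in time, so its backward difference is
    \<open>h\<^sup>2\<close> times the time derivative minus exactly
    \<open>C * b * h ^ 4\<close>.\<close>
  moreover have "pen X C a b t' (zh - z0) - pen X C a b (t' - h\<^sup>2) (zh - z0) = h\<^sup>2 * (C * (a * W + 2 * b * t')) - h\<^sup>2 * (C * b * h\<^sup>2)"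
  proof -
    have "C * (q + a * t' * W + b * t'\<^sup>2) - C * (q + a * (t' - h\<^sup>2) * W + b * (t' - h\<^sup>2)\<^sup>2)
       = h\<^sup>2 * (C * (a * W + 2 * b * t')) - h\<^sup>2 * (C * b * h\<^sup>2)" for q
      by (simp add: algebra_simps power2_eq_square)
    then show ?thesis unfolding pen_split W_def by simp
  qed
  moreover have "h\<^sup>2 * (C * b * h\<^sup>2) \<le> h\<^sup>2 * e" using h(3) by (intro mult_left_mono) auto
  ultimately have pd: "pen X C a b t' (zh - z0) - pen X C a b (t' - h\<^sup>2) (zh - z0) \<ge> h\<^sup>2 * A - h\<^sup>2 * e"
    using mult_left_mono[of A "C * (a * W + 2 * b * t')" "h\<^sup>2"] by simp
  have "h\<^sup>2 * (- K * expsum X zh) \<le> h\<^sup>2 * (g + A)"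
    using visc \<open>gen X \<rho> p Q = g + A\<close> by (intro mult_left_mono) auto
  moreover have "\<Psi>' zh - \<Psi> zh \<ge> h\<^sup>2 * g - 2 * e * h\<^sup>2" using step[of zh] unfolding g_def .
  moreover have "\<Psi>' zh - \<Psi> zh + K * h\<^sup>2 * expsum X zh + \<theta> * h\<^sup>2 + (pen X C a b t' (zh - z0) - pen X C a b (t' - h\<^sup>2) (zh - z0)) < 0"
    using gt prev[OF zh(1)] by (simp add: algebra_simps)
  \<comment> \<open>Two of the three e come from the step inequality for \<Psi>', the third from the
    time discretisation of the barrier.\<close>
  ultimately have "(\<theta> - 3 * e) * h\<^sup>2 < 0" using pd by (simp add: algebra_simps)
  then show False using e h(1) by (simp add: mult_less_0_iff)
qed

text \<open>The maximum principle is applied once per step of the walk, with the walk acting on a mollification of V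
  as comparison function; this replaces the doubling of variables.\<close>

lemma mean_value_inequality:
  assumes X: "finite X" and sub: "local_subsol X zb R \<rho> K V" and V: "ucont X V" and R: "0 < R"
  shows "\<exists>C. \<forall>T \<theta>. 0 < T \<longrightarrow> T \<le> 1 \<longrightarrow> 0 < \<theta> \<longrightarrow> (\<exists>h0>0. \<forall>h n z0. 0 < h \<longrightarrow> h < h0 \<longrightarrow> real n * h\<^sup>2 \<le> T \<longrightarrow>
     z0 \<in> cube X zb (R / 2) \<longrightarrow> V z0 \<le> (rw \<rho> h ^^ n) V z0 + K * (real n * h\<^sup>2) * expsum X z0 + \<theta> + C * T\<^sup>2)"
proof -
  obtain xs where xs: "distinct xs" "set xs = X" using finite_distinct_list[OF X] by blast
  obtain S where S: "S > 0" "\<And>z. \<bar>V z\<bar> \<le> S" using ucont_bound[OF V] by blast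
  define r where "r = min 1 (R / 4)"
  have r: "0 < r" "r \<le> 1" "r \<le> R / 4" using R by (auto simp: r_def)
  define Nm where "Nm = (\<Sum>i\<in>X. exp (zb i + R))"
  have Nm: "expsum X z \<le> Nm" if "z \<in> cube X zb R" for z
    unfolding expsum_def Nm_def
  proof (rule sum_mono)
    fix i assume "i \<in> X"
    then have "\<bar>z i - zb i\<bar> \<le> R" using that by (auto simp: cube_def)
    then show "exp (z i) \<le> exp (zb i + R)" by simp
  qed
  have Nm0: "0 \<le> Nm" unfolding Nm_def by (intro sum_nonneg) auto
  define s0 where "s0 = (\<Sum>i\<in>X. (\<rho> i)\<^sup>2)"
  define a where "a = 8 * s0"
  define b where "b = a * s0"
  have s0: "0 \<le> s0" unfolding s0_def by (intro sum_nonneg) auto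
  have ab: "0 \<le> a" "0 \<le> b" using s0 by (auto simp: a_def b_def)
  \<comment> \<open>Makes the barrier on the faces exceed all competing terms by 1; it depends on
    neither T nor \<theta>.\<close>
  define C where "C = (2 * S + \<bar>K\<bar> * Nm + 1) / r ^ 4"
  have C: "0 < C" "C * r ^ 4 = 2 * S + \<bar>K\<bar> * Nm + 1"
    using r S(1) Nm0 by (auto simp: C_def intro!: divide_pos_pos add_nonneg_pos mult_nonneg_nonneg)
  have main: "\<exists>h0>0. \<forall>h n z0. 0 < h \<longrightarrow> h < h0 \<longrightarrow> real n * h\<^sup>2 \<le> T \<longrightarrow>
     z0 \<in> cube X zb (R / 2) \<longrightarrow> V z0 \<le> (rw \<rho> h ^^ n) V z0 + K * (real n * h\<^sup>2) * expsum X z0 + \<theta> + C * b * T\<^sup>2"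
    if T: "0 < T" "T \<le> 1" and \<theta>: "0 < \<theta>" for T \<theta>
  proof -
    \<comment> \<open>One third each for replacing V by \<Psi> at the start, for the slack per unit
      of time, and for returning from \<Psi> to V at the end.\<close>
    define \<theta>' where "\<theta>' = \<theta> / 3"
    define e where "e = \<theta>' / 4"
    have e: "0 < \<theta>'" "0 < e" "3 * e < \<theta>'" using \<theta> by (auto simp: \<theta>'_def e_def)
    obtain d where d: "d > 0" "\<And>z \<zeta>. l1 X \<zeta> < d \<Longrightarrow> \<bar>V (z + \<zeta>) - V z\<bar> \<le> \<theta>'"
      using ucont_modulus[OF V e(1)] by blast
    define L where "L = real (card X) + 1"
    have L: "L > 0" "real (card X) \<le> L" "real (length xs) \<le> L" using distinct_card[OF xs(1)] xs(2) by (auto simp: L_def)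
    \<comment> \<open>Two passes move each coordinate by at most \<open>2 * \<epsilon> * L\<close>,
      hence the argument by at most d / 2 in \<open>l1 X\<close>.\<close>
    define \<epsilon> where "\<epsilon> = d / (4 * L * L)"
    have \<epsilon>: "\<epsilon> > 0" using d(1) L by (simp add: \<epsilon>_def)
    define \<Psi> where "\<Psi> = (steklovs \<epsilon> xs ^^ 2) V"
    have avs: "avg X (real 2 * (\<epsilon> * real (length xs))) (steklovs \<epsilon> xs ^^ 2)"
      using avg_funpow[OF avg_steklovs[OF X, of \<epsilon> xs], of 2] \<epsilon> xs(2) by simp
    have \<Psi>V: "\<bar>\<Psi> z - V z\<bar> \<le> \<theta>'" for z
      unfolding \<Psi>_def
    proof (rule avg_close[OF avs V])
      fix v assume v: "\<forall>i\<in>X. \<bar>v i\<bar> \<le> real 2 * (\<epsilon> * real (length xs))"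
      have "l1 X v \<le> real (card X) * (real 2 * (\<epsilon> * real (length xs)))" using v by (intro l1_bound[OF X]) auto
      also have "\<dots> \<le> L * (2 * (\<epsilon> * L))" using L \<epsilon> by (intro mult_mono mult_left_mono) auto
      also have "\<dots> = d / 2" using L(1) by (simp add: \<epsilon>_def field_simps)
      also have "\<dots> < d" using d(1) by simp
      finally show "\<bar>V (z + v) - V z\<bar> \<le> \<theta>'" by (rule d(2))
    qed
    have "Ck X (Suc (Suc 0)) \<Psi>"
      unfolding \<Psi>_def using V xs \<epsilon> by (simp add: numeral_2_eq_2 del: Ck.simps(2))
        (intro steklovs_Ck[OF X \<epsilon>], simp_all)
    note Ck\<Psi> = this
    obtain G H where GH0: "diff_on X X \<Psi> G"
      "\<forall>i\<in>X. Ck X (Suc 0) (G i) \<and> diff_on X X (G i) (H i) \<and> (\<forall>j\<in>X. Ck X 0 (H i j))"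
      using Ck2_derivs[OF Ck\<Psi>] by blast
    have GH: "ucont X \<Psi>" "diff_on X X \<Psi> G" "\<And>i. i \<in> X \<Longrightarrow> diff_on X X (G i) (H i)"
      "\<And>i. i \<in> X \<Longrightarrow> ucont X (G i)" "\<And>i j. i \<in> X \<Longrightarrow> j \<in> X \<Longrightarrow> ucont X (H i j)"
      using GH0 Ck_ucont[OF Ck\<Psi>] by simp_all
    define g where "g z = gen X \<rho> (\<lambda>i. G i z) (\<lambda>i j. H i j z)" for z
    have ug: "ucont X g" unfolding g_def by (intro ucont_gen GH)
    obtain h1 where h1: "h1 > 0" "\<And>h z. 0 < h \<Longrightarrow> h < h1 \<Longrightarrow> \<bar>rw \<rho> h \<Psi> z - \<Psi> z - h\<^sup>2 * g z\<bar> \<le> e * h\<^sup>2"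
      using rw_expand[OF X GH(2,3,5) e(2), of \<rho>] unfolding g_def by blast
    obtain d' where d': "d' > 0" "\<And>z \<zeta>. l1 X \<zeta> < d' \<Longrightarrow> \<bar>g (z + \<zeta>) - g z\<bar> \<le> e"
      using ucont_modulus[OF ug e(2)] by blast
    define c where "c = (\<Sum>i\<in>X. \<bar>\<rho> i\<bar> + (\<rho> i)\<^sup>2) + 1"
    have c: "c > 0" unfolding c_def by (intro add_nonneg_pos sum_nonneg) auto
    \<comment> \<open>The entries 1 and \<open>d' / c\<close> keep the change of the generator over
      one step below e, h1 is the consistency bound, and the last entry makes the time
      discretisation of the barrier cost at most e.\<close>
    define h0 where "h0 = Min {1, h1, d' / c, e / (C * b + 1)}"
    have Cb: "C * b + 1 > 0" using C(1) ab by (intro add_nonneg_pos) auto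
    have h0: "h0 > 0" using h1(1) d'(1) c e(2) Cb by (simp add: h0_def)
    have "V z0 \<le> (rw \<rho> h ^^ n) V z0 + K * (real n * h\<^sup>2) * expsum X z0 + \<theta> + C * b * T\<^sup>2"
      if h: "0 < h" "h < h0" and n: "real n * h\<^sup>2 \<le> T" and z0: "z0 \<in> cube X zb (R / 2)" for h n z0
    proof -
      have hb: "h < 1" "h < h1" "h < d' / c" "h < e / (C * b + 1)" using h(2) by (auto simp: h0_def)
      have hh: "h\<^sup>2 \<le> h" using h(1) hb(1) by (simp add: power2_eq_square)
      have Cbh: "C * b * h\<^sup>2 \<le> e"
      proof -
        have "C * b * h\<^sup>2 \<le> (C * b + 1) * h" using hh C(1) ab by (intro mult_mono) auto
        also have "\<dots> \<le> e" using hb(4) Cb by (simp add: field_simps)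
        finally show ?thesis .
      qed
      obtain rr where rr: "rr \<ge> 0" "avg X rr (rw \<rho> h)" using avg_rw[OF X] by blast
      have av: "avg X (real k * rr) (rw \<rho> h ^^ k)" for k using avg_funpow[OF rr(2,1)] .
      have gclose: "\<bar>rw \<rho> h g z - g z\<bar> \<le> e" for z
      proof -
        have "l1 X (rw_step \<rho> k) < d'" if "\<bar>k\<bar> = h" for k
        proof -
          have "l1 X (rw_step \<rho> k) \<le> h * c"
            using l1_rw_step[of k X \<rho>] that hb(1) h(1) unfolding c_def by (simp add: distrib_left)
          also have "\<dots> < d'" using hb(3) c by (simp add: field_simps)
          finally show ?thesis .
        qed
        then have "\<bar>g (z + rw_step \<rho> h) - g z\<bar> \<le> e" "\<bar>g (z + rw_step \<rho> (- h)) - g z\<bar> \<le> e"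
          using d'(2) h(1) by simp_all
        then show ?thesis unfolding rw_def by argo
      qed
      define P where "P k = (rw \<rho> h ^^ k) \<Psi>" for k
      have \<Psi>S: "\<bar>\<Psi> z\<bar> \<le> S" for z unfolding \<Psi>_def using S(2) by (intro avg_abs_bound[OF avs V]) auto
      have PS: "\<bar>P k z\<bar> \<le> S" for k z unfolding P_def using \<Psi>S by (intro avg_abs_bound[OF av GH(1)]) auto
      \<comment> \<open>The viscosity inequality is used at the new time, so the generator is needed
        after \<open>Suc k\<close> steps; moving it there costs the second e.\<close>
      have step: "P (Suc k) z - P k z \<ge> h\<^sup>2 * (rw \<rho> h ^^ Suc k) g z - 2 * e * h\<^sup>2" for k z
      proof -
        define D where "D z = rw \<rho> h \<Psi> z - \<Psi> z - h\<^sup>2 * g z" for z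
        have uD: "ucont X D" unfolding D_def by (intro ucont_diff ucont_scale avg_ucont[OF rr(2)] GH ug)
        have "(rw \<rho> h ^^ k) D z = P (Suc k) z - P k z - h\<^sup>2 * (rw \<rho> h ^^ k) g z"
          unfolding D_def[abs_def] P_def using GH(1) ug avg_ucont[OF rr(2) GH(1)]
          by (simp add: avg_diff[OF av[of k]] avg_scale[OF av[of k]] ucont_diff ucont_scale funpow_swap1)
        moreover have "\<bar>(rw \<rho> h ^^ k) D z\<bar> \<le> e * h\<^sup>2"
          using h1(2) h(1) hb by (intro avg_abs_bound[OF av[of k] uD]) (auto simp: D_def)
        moreover have "h\<^sup>2 * (rw \<rho> h ^^ Suc k) g z \<le> h\<^sup>2 * ((rw \<rho> h ^^ k) g z + e)"
        proof (intro mult_left_mono)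
          have "(rw \<rho> h ^^ k) (\<lambda>z. rw \<rho> h g z - g z) z = (rw \<rho> h ^^ Suc k) g z - (rw \<rho> h ^^ k) g z"
            using avg_diff[OF av[of k] avg_ucont[OF rr(2) ug] ug] by (simp add: funpow_swap1)
          moreover have "\<bar>(rw \<rho> h ^^ k) (\<lambda>z. rw \<rho> h g z - g z) z\<bar> \<le> e"
            using gclose by (intro avg_abs_bound[OF av[of k]] ucont_diff avg_ucont[OF rr(2)] ug) auto
          ultimately show "(rw \<rho> h ^^ Suc k) g z \<le> (rw \<rho> h ^^ k) g z + e" by linarith
        qed simp
        ultimately show ?thesis by (simp add: algebra_simps abs_le_iff)
      qed
      have ind: "\<forall>z\<in>cube X z0 r. V z - P k z - K * (real k * h\<^sup>2) * expsum X z - \<theta>' * (real k * h\<^sup>2)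
           - pen X C a b (real k * h\<^sup>2) (z - z0) \<le> \<theta>'" if "k \<le> n" for k
        using that
      proof (induction k)
        case 0
        show ?case
        proof
          fix z
          have "0 \<le> pen X C a b 0 (z - z0)" unfolding pen_def using C(1) by (simp add: sum_nonneg)
          moreover have "\<bar>P 0 z - V z\<bar> \<le> \<theta>'" using \<Psi>V[of z] unfolding P_def by simp
          ultimately have "V z - P 0 z - 0 - 0 - pen X C a b 0 (z - z0) \<le> \<theta>'" by linarith
          then show "V z - P 0 z - K * (real 0 * h\<^sup>2) * expsum X z - \<theta>' * (real 0 * h\<^sup>2) - pen X C a b (real 0 * h\<^sup>2) (z - z0) \<le> \<theta>'"
            by (simp only: of_nat_0 mult_zero_left mult_zero_right)
        qed
      next
        case (Suc k)
        define t' where "t' = real (Suc k) * h\<^sup>2"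
        have t': "t' - h\<^sup>2 = real k * h\<^sup>2" by (simp add: t'_def algebra_simps)
        have t0: "0 < t'" "h\<^sup>2 \<le> t'" 
          using h(1) unfolding t'_def by (simp, simp add: distrib_right)
        have "t' \<le> real n * h\<^sup>2" unfolding t'_def using Suc.prems by (intro mult_right_mono) auto
        then have t1: "t' \<le> 1" using n T(2) by linarith
        have d1: "diff_on X X (P (Suc k)) (\<lambda>i. (rw \<rho> h ^^ Suc k) (G i))"
          unfolding P_def by (intro avg_diff_on[OF av] GH)
        have d2: "diff_on X X ((rw \<rho> h ^^ Suc k) (G i)) (\<lambda>j. (rw \<rho> h ^^ Suc k) (H i j))" if "i \<in> X" for i
          using that by (intro avg_diff_on[OF av] GH)
        have geq: "gen X \<rho> (\<lambda>i. (rw \<rho> h ^^ Suc k) (G i) z) (\<lambda>i j. (rw \<rho> h ^^ Suc k) (H i j) z) = (rw \<rho> h ^^ Suc k) g z" for z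
        proof -
          have "(rw \<rho> h ^^ Suc k) (\<lambda>z. gen X \<rho> (\<lambda>i. G i z) (\<lambda>i j. H i j z))
              = (\<lambda>z. gen X \<rho> (\<lambda>i. (rw \<rho> h ^^ Suc k) (G i) z) (\<lambda>i j. (rw \<rho> h ^^ Suc k) (H i j) z))"
            by (rule avg_gen[OF av]) (use GH(4,5) in auto)
          from fun_cong[OF this, of z] show ?thesis unfolding g_def[abs_def] by (rule sym)
        qed
        have st: "P (Suc k) z - P k z \<ge> h\<^sup>2 * gen X \<rho> (\<lambda>i. (rw \<rho> h ^^ Suc k) (G i) z) (\<lambda>i j. (rw \<rho> h ^^ Suc k) (H i j) z) - 2 * e * h\<^sup>2" for z
          unfolding geq by (rule step)
        have prev: "V z - P k z - K * (t' - h\<^sup>2) * expsum X z - \<theta>' * (t' - h\<^sup>2) - pen X C a b (t' - h\<^sup>2) (z - z0) \<le> \<theta>'"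
          if "z \<in> cube X z0 r" for z
          unfolding t' by (rule Suc.IH[OF Suc_leD[OF Suc.prems], rule_format, OF that])
        have CS: "2 * S + \<bar>K\<bar> * Nm < C * r ^ 4" using C(2) by simp
        have "V z - P (Suc k) z - K * t' * expsum X z - \<theta>' * t' - pen X C a b t' (z - z0) \<le> \<theta>'"
          if "z \<in> cube X z0 r" for z
          by (rule comparison_step[where X = X and zb = zb and R = R and \<rho> = \<rho> and K = K and V = V and S = S
                and \<Psi>' = "P (Suc k)" and \<Psi> = "P k" and G = "\<lambda>i. (rw \<rho> h ^^ Suc k) (G i)" and H = "\<lambda>i j. (rw \<rho> h ^^ Suc k) (H i j)"
                and r = r and ?z0.0 = z0 and Nm = Nm and t' = t' and a = a and b = b and C = C and \<omega> = \<theta>' and \<theta> = \<theta>'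
                and e = e and h = h and z = z, OF X sub V S(2) PS d1 d2 _ r z0 Nm t0(1) t1 a_def[unfolded s0_def] b_def[unfolded s0_def]
                less_imp_le[OF C(1)] CS less_imp_le[OF e(1)] e(1) e(3) h(1) t0(2) Cbh prev st that])
            (simp_all add: P_def avg_ucont[OF av GH(1)] del: funpow.simps)
        then show ?case unfolding t'_def by blast
      qed
      have z00: "z0 \<in> cube X z0 r" using r by (simp add: cube_def)
      \<comment> \<open>At the centre only the pure time part of the barrier remains; this is the
        error of order \<open>T\<^sup>2\<close>.\<close>
      have pen0: "pen X C a b (real n * h\<^sup>2) (z0 - z0) \<le> C * b * T\<^sup>2"
      proof -
        have "(real n * h\<^sup>2)\<^sup>2 \<le> T\<^sup>2" using n by (intro power_mono) auto
        then have "C * b * (real n * h\<^sup>2)\<^sup>2 \<le> C * b * T\<^sup>2" using C(1) ab by (intro mult_left_mono) auto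
        then show ?thesis by (simp add: pen_def)
      qed
      have "\<theta>' * (real n * h\<^sup>2) \<le> \<theta>' * 1" using n T e(1) by (intro mult_left_mono) auto
      moreover have "P n z0 \<le> (rw \<rho> h ^^ n) V z0 + \<theta>'"
      proof -
        have "P n z0 \<le> (rw \<rho> h ^^ n) (\<lambda>z. V z + \<theta>') z0"
          unfolding P_def
        proof (rule avg_mono[OF av GH(1)])
          show "\<Psi> (z0 + v) \<le> V (z0 + v) + \<theta>'" for v using \<Psi>V[of "z0 + v"] by linarith
        qed (intro ucont_add V ucont_const)
        then show ?thesis by (simp add: avg_add[OF av V ucont_const] avg_const[OF av])
      qed
      moreover have "\<theta> = \<theta>' + \<theta>' + \<theta>'" by (simp add: \<theta>'_def)
      ultimately show ?thesis using ind[OF order_refl, rule_format, OF z00] pen0 by linarith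
    qed
    then show ?thesis using h0 by (intro exI[of _ h0] conjI allI impI) assumption+
  qed
  show ?thesis by (intro exI[of _ "C * b"] allI impI main)
qed

lemma avg_local_eq:
  assumes "avg X r E" "ucont X F" "ucont X G" "\<And>v. (\<forall>i\<in>X. \<bar>v i\<bar> \<le> r) \<Longrightarrow> F (z + v) = G (z + v)"
  shows "E F z = E G z"
  using assms by (intro order_antisym avg_mono[OF assms(1)]) auto

lemma ucont_coord:
  assumes X: "finite X" "i \<in> X" and b: "\<And>x. \<bar>\<psi> x\<bar> \<le> B" and u: "uniformly_continuous_on UNIV (\<psi> :: real \<Rightarrow> real)"
  shows "ucont X (\<lambda>z. \<psi> (z i))"
  unfolding ucont_def
proof (intro conjI allI impI)
  show "\<exists>B. \<forall>z. \<bar>\<psi> (z i)\<bar> \<le> B" using b by blast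
  fix e :: real assume "e > 0"
  then obtain d where d: "d > 0" "\<And>x y. dist y x < d \<Longrightarrow> dist (\<psi> y) (\<psi> x) < e"
    using u unfolding uniformly_continuous_on_def by (metis UNIV_I)
  have "\<bar>\<psi> ((z + \<zeta>) i) - \<psi> (z i)\<bar> \<le> e" if "l1 X \<zeta> < d" for z \<zeta>
    using d(2)[of "(z + \<zeta>) i" "z i"] abs_le_l1[OF X, of \<zeta>] that by (simp add: dist_real_def)
  then show "\<exists>d>0. \<forall>z \<zeta>. l1 X \<zeta> < d \<longrightarrow> \<bar>\<psi> ((z + \<zeta>) i) - \<psi> (z i)\<bar> \<le> e" using d(1) by blast
qed

definition clamp1 :: "real \<Rightarrow> real \<Rightarrow> real \<Rightarrow> real" where
  "clamp1 c R x = max (c - R) (min (c + R) x)"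

lemma clamp1_eq: "\<bar>x - c\<bar> \<le> R \<Longrightarrow> clamp1 c R x = x"
  and clamp1_range: "0 \<le> R \<Longrightarrow> \<bar>clamp1 c R x - c\<bar> \<le> R"
  and clamp1_lip: "\<bar>clamp1 c R x - clamp1 c R y\<bar> \<le> \<bar>x - y\<bar>"
  unfolding clamp1_def by (auto simp: max_def min_def)

section \<open>Mollified subsolutions\<close>

text \<open>Clamping makes the exponentials bounded and uniformly continuous; near zb nothing changes.\<close>

definition cexp :: "'i set \<Rightarrow> ('i \<Rightarrow> real) \<Rightarrow> real \<Rightarrow> ('i \<Rightarrow> real) \<Rightarrow> ('i \<Rightarrow> real) \<Rightarrow> real" where
  "cexp X zb R c z = (\<Sum>i\<in>X. c i * exp (clamp1 (zb i) R (z i)))"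

lemma ucont_cexp:
  assumes X: "finite X" and R: "0 \<le> R"
  shows "ucont X (cexp X zb R c)"
  unfolding cexp_def[abs_def]
proof (intro ucont_sum ucont_scale)
  fix i assume i: "i \<in> X"
  have u: "uniformly_continuous_on {zb i - R..zb i + R} (exp :: real \<Rightarrow> real)"
    by (intro compact_uniformly_continuous continuous_intros) auto
  show "ucont X (\<lambda>z. exp (clamp1 (zb i) R (z i)))"
  proof (rule ucont_coord[OF X i, where \<psi> = "\<lambda>x. exp (clamp1 (zb i) R x)" and B = "exp (zb i + R)"])
    fix x show "\<bar>exp (clamp1 (zb i) R x)\<bar> \<le> exp (zb i + R)"
      using clamp1_range[OF R, of "zb i" x] by (simp add: abs_le_iff)
  next
    show "uniformly_continuous_on UNIV (\<lambda>x. exp (clamp1 (zb i) R x))"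
      unfolding uniformly_continuous_on_def
    proof (intro allI impI)
      fix e :: real assume "e > 0"
      then obtain d where d: "d > 0" "\<And>x y. x \<in> {zb i - R..zb i + R} \<Longrightarrow> y \<in> {zb i - R..zb i + R} \<Longrightarrow> dist y x < d \<Longrightarrow> dist (exp y) (exp x) < e"
        using u unfolding uniformly_continuous_on_def by blast
      have "dist (exp (clamp1 (zb i) R y)) (exp (clamp1 (zb i) R x)) < e" if "dist y x < d" for x y
        using clamp1_range[OF R, of "zb i" x] clamp1_range[OF R, of "zb i" y] clamp1_lip[of "zb i" R y x] that
        by (intro d(2)) (auto simp: dist_real_def abs_le_iff)
      then show "\<exists>d>0. \<forall>x\<in>UNIV. \<forall>y\<in>UNIV. dist y x < d \<longrightarrow> dist (exp (clamp1 (zb i) R y)) (exp (clamp1 (zb i) R x)) < e"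
        using d(1) by blast
    qed
  qed
qed

text \<open>A Steklov average multiplies exp (z i) by kap, so it preserves the right-hand side up to a factor tending to 1.\<close>

definition kap :: "real \<Rightarrow> real" where
  "kap \<epsilon> = (exp \<epsilon> - 1) / \<epsilon>"

lemma integral_exp_scaled:
  assumes "0 < \<epsilon>"
  shows "((\<lambda>s. exp (\<epsilon> * s)) has_integral kap \<epsilon>) {0..1}"
proof -
  have "((\<lambda>s. exp (\<epsilon> * s) / \<epsilon>) has_real_derivative exp (\<epsilon> * s)) (at s within {0..1})" for s
    using assms by (auto intro!: derivative_eq_intros)
  then have "((\<lambda>s. exp (\<epsilon> * s)) has_integral (exp (\<epsilon> * 1) / \<epsilon> - exp (\<epsilon> * 0) / \<epsilon>)) {0..1}"
    by (intro fundamental_theorem_of_calculus) (auto simp: has_real_derivative_iff_has_vector_derivative)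
  then show ?thesis by (simp add: kap_def diff_divide_distrib)
qed

lemma steklov_cexp:
  assumes X: "finite X" "i \<in> X" and \<epsilon>: "0 < \<epsilon>" and z: "z \<in> cube X zb (R - \<epsilon>)"
  shows "steklov \<epsilon> i (cexp X zb R c) z = cexp X zb R (c(i := c i * kap \<epsilon>)) z"
proof -
  define A where "A = (\<Sum>j\<in>X - {i}. c j * exp (z j))"
  have zj: "\<bar>z j - zb j\<bar> \<le> R - \<epsilon>" if "j \<in> X" for j using z that by (auto simp: cube_def)
  have cl: "clamp1 (zb j) R (z j) = z j" if "j \<in> X" for j using zj[OF that] \<epsilon> by (intro clamp1_eq) auto
  have eq: "cexp X zb R c (z + unit i (\<epsilon> * s)) = A + c i * exp (z i) * exp (\<epsilon> * s)" if "s \<in> {0..1}" for s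
  proof -
    have "0 \<le> \<epsilon> * s" "\<epsilon> * s \<le> \<epsilon>" using that \<epsilon> by (auto simp: mult_left_le)
    then have "clamp1 (zb i) R (z i + \<epsilon> * s) = z i + \<epsilon> * s" using zj[OF X(2)] by (intro clamp1_eq) auto
    then have "cexp X zb R c (z + unit i (\<epsilon> * s)) = c i * exp (z i + \<epsilon> * s) + (\<Sum>j\<in>X - {i}. c j * exp (clamp1 (zb j) R (z j + unit i (\<epsilon> * s) j)))"
      unfolding cexp_def using sum.remove[OF X, of "\<lambda>j. c j * exp (clamp1 (zb j) R ((z + unit i (\<epsilon> * s)) j))"] by (simp add: unit_def)
    also have "(\<Sum>j\<in>X - {i}. c j * exp (clamp1 (zb j) R (z j + unit i (\<epsilon> * s) j))) = A"
      unfolding A_def by (intro sum.cong) (auto simp: unit_def cl)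
    finally show ?thesis unfolding exp_add mult.assoc add.commute[of A] .
  qed
  have "((\<lambda>s. A + c i * exp (z i) * exp (\<epsilon> * s)) has_integral (A * (1 - 0) + c i * exp (z i) * kap \<epsilon>)) {0..1}"
    using has_integral_const_real[of A 0 1]
    by (intro has_integral_add has_integral_mult_right integral_exp_scaled[OF \<epsilon>]) (simp add: mult.commute)
  then have "((\<lambda>s. cexp X zb R c (z + unit i (\<epsilon> * s))) has_integral (A + c i * exp (z i) * kap \<epsilon>)) {0..1}"
    using eq by (subst has_integral_cong[where g = "\<lambda>s. A + c i * exp (z i) * exp (\<epsilon> * s)"]) auto
  then have "steklov \<epsilon> i (cexp X zb R c) z = A + c i * exp (z i) * kap \<epsilon>"
    unfolding steklov_def by (rule integral_unique)
  moreover have "cexp X zb R (c(i := c i * kap \<epsilon>)) z = A + c i * exp (z i) * kap \<epsilon>"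
  proof -
    have "(\<Sum>j\<in>X - {i}. (c(i := c i * kap \<epsilon>)) j * exp (clamp1 (zb j) R (z j))) = A"
      unfolding A_def by (intro sum.cong) (auto simp: cl)
    then show ?thesis unfolding cexp_def
      using sum.remove[OF X, of "\<lambda>j. (c(i := c i * kap \<epsilon>)) j * exp (clamp1 (zb j) R (z j))"] cl[OF X(2)] by simp
  qed
  ultimately show ?thesis by simp
qed

lemma cube_shift: "z \<in> cube X zb r \<Longrightarrow> \<forall>i\<in>X. \<bar>v i\<bar> \<le> s \<Longrightarrow> r + s \<le> t \<Longrightarrow> z + v \<in> cube X zb t"
  unfolding cube_def
proof (intro CollectI ballI)
  fix i assume "z \<in> {y. \<forall>i\<in>X. \<bar>y i - zb i\<bar> \<le> r}" "\<forall>i\<in>X. \<bar>v i\<bar> \<le> s" "r + s \<le> t" "i \<in> X"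
  then have "\<bar>z i - zb i\<bar> \<le> r" "\<bar>v i\<bar> \<le> s" "r + s \<le> t" by auto
  then show "\<bar>(z + v) i - zb i\<bar> \<le> t" by simp
qed

lemma cube_mono: "z \<in> cube X zb r \<Longrightarrow> r \<le> t \<Longrightarrow> z \<in> cube X zb t"
  unfolding cube_def by force

text \<open>Each coordinate exponential meets exactly one Steklov average of the pass. The cube
  shrinks by \<epsilon> per average, so that the clamping stays inactive at every point that is
  averaged over.\<close>

lemma steklovs_cexp:
  assumes X: "finite X" and \<epsilon>: "0 < \<epsilon>" and R: "0 \<le> R"
  shows "distinct xs \<Longrightarrow> set xs \<subseteq> X \<Longrightarrow> z \<in> cube X zb (R - \<epsilon> * real (length xs)) \<Longrightarrow>
    steklovs \<epsilon> xs (cexp X zb R c) z = cexp X zb R (\<lambda>i. if i \<in> set xs then c i * kap \<epsilon> else c i) z"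
proof (induction xs arbitrary: z)
  case Nil
  then show ?case by (simp add: steklovs_def)
next
  case (Cons x xs)
  let ?c = "\<lambda>i. if i \<in> set xs then c i * kap \<epsilon> else c i"
  have x: "x \<in> X" "x \<notin> set xs" "distinct xs" "set xs \<subseteq> X" using Cons.prems by auto
  have z: "z \<in> cube X zb (R - \<epsilon> * real (length xs) - \<epsilon>)" using Cons.prems(3) by (simp add: algebra_simps)
  have "steklovs \<epsilon> (x # xs) (cexp X zb R c) z = steklov \<epsilon> x (steklovs \<epsilon> xs (cexp X zb R c)) z"
    by (simp add: steklovs_def)
  also have "\<dots> = steklov \<epsilon> x (cexp X zb R ?c) z"
  proof (rule avg_local_eq[OF avg_steklov[OF X x(1)]])
    show "ucont X (steklovs \<epsilon> xs (cexp X zb R c))"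
      using avg_ucont[OF avg_steklovs[OF X _ x(4)] ucont_cexp[OF X R]] \<epsilon> by simp
    fix v assume "\<forall>i\<in>X. \<bar>v i\<bar> \<le> \<epsilon>"
    then have "z + v \<in> cube X zb (R - \<epsilon> * real (length xs))" using cube_shift[OF z] by simp
    then show "steklovs \<epsilon> xs (cexp X zb R c) (z + v) = cexp X zb R ?c (z + v)" by (rule Cons.IH[OF x(3,4)])
  qed (use \<epsilon> ucont_cexp[OF X R] in auto)
  also have "\<dots> = cexp X zb R (?c(x := ?c x * kap \<epsilon>)) z"
  proof (rule steklov_cexp[OF X x(1) \<epsilon>])
    have "0 \<le> \<epsilon> * real (length xs)" using \<epsilon> by simp
    then show "z \<in> cube X zb (R - \<epsilon>)" using cube_mono[OF z, of "R - \<epsilon>"] by simp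
  qed
  also have "\<dots> = cexp X zb R (\<lambda>i. if i \<in> set (x # xs) then c i * kap \<epsilon> else c i) z"
    unfolding cexp_def using x(2) by (intro sum.cong) auto
  finally show ?case .
qed

text \<open>After a full pass all coefficients have gained the same factor, so away from the faces
  of the cube the sum of exponentials behaves as an eigenfunction of the pass.\<close>

lemma steklovs_pow_cexp:
  assumes X: "finite X" and \<epsilon>: "0 < \<epsilon>" and R: "0 \<le> R" and xs: "distinct xs" "set xs = X"
  shows "z \<in> cube X zb (R - real n * (\<epsilon> * real (length xs))) \<Longrightarrow>
    (steklovs \<epsilon> xs ^^ n) (cexp X zb R (\<lambda>i. 1)) z = kap \<epsilon> ^ n * expsum X z"
proof -
  have av: "avg X (\<epsilon> * real (length xs)) (steklovs \<epsilon> xs)" using avg_steklovs[OF X, of \<epsilon> xs] \<epsilon> xs by simp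
  have r0: "0 \<le> \<epsilon> * real (length xs)" using \<epsilon> by simp
  have avn: "avg X (real n * (\<epsilon> * real (length xs))) (steklovs \<epsilon> xs ^^ n)" for n by (rule avg_funpow[OF av r0])
  have "z \<in> cube X zb (R - real n * (\<epsilon> * real (length xs))) \<Longrightarrow>
      (steklovs \<epsilon> xs ^^ n) (cexp X zb R (\<lambda>i. 1)) z = cexp X zb R (\<lambda>i. kap \<epsilon> ^ n) z" for n z
  proof (induction n arbitrary: z)
    case (Suc n)
    have z: "z \<in> cube X zb (R - real n * (\<epsilon> * real (length xs)) - \<epsilon> * real (length xs))" using Suc.prems by (simp add: algebra_simps)
    have "steklovs \<epsilon> xs ((steklovs \<epsilon> xs ^^ n) (cexp X zb R (\<lambda>i. 1))) z = steklovs \<epsilon> xs (cexp X zb R (\<lambda>i. kap \<epsilon> ^ n)) z"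
    proof (rule avg_local_eq[OF av avg_ucont[OF avn ucont_cexp[OF X R]] ucont_cexp[OF X R]])
      fix v assume "\<forall>i\<in>X. \<bar>v i\<bar> \<le> \<epsilon> * real (length xs)"
      then have "z + v \<in> cube X zb (R - real n * (\<epsilon> * real (length xs)))" using cube_shift[OF z] by simp
      then show "(steklovs \<epsilon> xs ^^ n) (cexp X zb R (\<lambda>i. 1)) (z + v) = cexp X zb R (\<lambda>i. kap \<epsilon> ^ n) (z + v)" by (rule Suc.IH)
    qed
    also have "\<dots> = cexp X zb R (\<lambda>i. if i \<in> set xs then kap \<epsilon> ^ n * kap \<epsilon> else kap \<epsilon> ^ n) z"
    proof (rule steklovs_cexp[OF X \<epsilon> R xs(1)])
      have "0 \<le> real n * (\<epsilon> * real (length xs))" using r0 by simp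
      then show "z \<in> cube X zb (R - \<epsilon> * real (length xs))" using cube_mono[OF z] by simp
    qed (simp add: xs)
    also have "\<dots> = cexp X zb R (\<lambda>i. kap \<epsilon> ^ Suc n) z" unfolding cexp_def using xs by (intro sum.cong) auto
    finally show ?case by simp
  qed simp
  moreover assume z: "z \<in> cube X zb (R - real n * (\<epsilon> * real (length xs)))"
  moreover have "cexp X zb R (\<lambda>i. kap \<epsilon> ^ n) z = kap \<epsilon> ^ n * expsum X z"
  proof -
    have "z \<in> cube X zb R" using cube_mono[OF z, of R] r0 by simp
    then have "clamp1 (zb i) R (z i) = z i" if "i \<in> X" for i using that by (intro clamp1_eq) (auto simp: cube_def)
    then show ?thesis unfolding cexp_def expsum_def by (simp add: sum_distrib_left)
  qed
  ultimately show ?thesis by simp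
qed

text \<open>The walk is a mean of two translates, and every \<open>avg\<close> commutes with
  translations and linear combinations.\<close>

lemma avg_rw_commute:
  assumes X: "finite X" and av: "avg X r E" and F: "ucont X F"
  shows "E ((rw \<rho> h ^^ n) F) = (rw \<rho> h ^^ n) (E F)"
proof (induction n)
  case (Suc n)
  obtain rr where rr: "rr \<ge> 0" "avg X rr (rw \<rho> h)" using avg_rw[OF X] by blast
  define F' where "F' = (rw \<rho> h ^^ n) F"
  have uF': "ucont X F'" unfolding F'_def by (rule avg_ucont[OF avg_funpow[OF rr(2,1)] F])
  have "rw \<rho> h F' = (\<lambda>z. 1 / 2 * F' (z + rw_step \<rho> h) + 1 / 2 * F' (z + rw_step \<rho> (- h)))"
    by (simp add: rw_def fun_eq_iff add_divide_distrib)
  then have "E (rw \<rho> h F') = (\<lambda>z. 1 / 2 * E F' (z + rw_step \<rho> h) + 1 / 2 * E F' (z + rw_step \<rho> (- h)))"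
    by (simp only: avg_linear[OF av ucont_translate[OF uF'] ucont_translate[OF uF']] avg_translate[OF av uF'])
  also have "\<dots> = rw \<rho> h (E F')" by (simp add: rw_def fun_eq_iff add_divide_distrib)
  finally show ?case using Suc unfolding F'_def by simp
qed simp

text \<open>The averages E commute with the walk, so applying E to the mean value inequality gives
  the same inequality for \<open>E V\<close>, with \<open>expsum\<close> scaled. There the walk
  expands to first order in T, and after division by T the error \<open>C * T\<^sup>2\<close> has
  become \<open>C * T\<close>.\<close>

lemma smooth_subsolution:
  assumes X: "finite X" and sub: "local_subsol X zb R \<rho> K V" and V: "ucont X V" and R: "0 < R"
    and xs: "distinct xs" "set xs = X" and \<epsilon>: "0 < \<epsilon>" "4 * (\<epsilon> * real (length xs)) \<le> R / 4"
    and F: "diff_on X X ((steklovs \<epsilon> xs ^^ 4) V) G" and G: "\<And>i. i \<in> X \<Longrightarrow> diff_on X X (G i) (H i)"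
    and Gk: "\<And>i. i \<in> X \<Longrightarrow> Ck X 2 (G i)" and Hk: "\<And>i j. i \<in> X \<Longrightarrow> j \<in> X \<Longrightarrow> Ck X 2 (H i j)"
    and z: "z \<in> cube X zb (R / 4)"
  shows "- K * (kap \<epsilon> ^ 4 * expsum X z) \<le> gen X \<rho> (\<lambda>i. G i z) (\<lambda>i j. H i j z)"
proof -
  define E where "E = steklovs \<epsilon> xs ^^ 4"
  define g where "g = gen X \<rho> (\<lambda>i. G i z) (\<lambda>i j. H i j z)"
  have "avg X (\<epsilon> * real (length xs)) (steklovs \<epsilon> xs)" using avg_steklovs[OF X, of \<epsilon> xs] \<epsilon> xs by simp
  then have av: "avg X (real 4 * (\<epsilon> * real (length xs))) E" unfolding E_def using \<epsilon> by (intro avg_funpow) auto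
  have uF: "ucont X (E V)" by (rule avg_ucont[OF av V])
  obtain C where C: "\<And>T \<theta>. 0 < T \<Longrightarrow> T \<le> 1 \<Longrightarrow> 0 < \<theta> \<Longrightarrow> (\<exists>h0>0. \<forall>h n z0. 0 < h \<longrightarrow> h < h0 \<longrightarrow> real n * h\<^sup>2 \<le> T \<longrightarrow>
     z0 \<in> cube X zb (R / 2) \<longrightarrow> V z0 \<le> (rw \<rho> h ^^ n) V z0 + K * (real n * h\<^sup>2) * expsum X z0 + \<theta> + C * T\<^sup>2)"
    using mean_value_inequality[OF X sub V R] by blast
  have gk: "Ck X 2 (\<lambda>z. gen X \<rho> (\<lambda>i. G i z) (\<lambda>i j. H i j z))" by (intro Ck_gen Gk Hk)
  have "- K * (kap \<epsilon> ^ 4 * expsum X z) \<le> g + e" if "e > 0" for e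
  proof -
    define e' where "e' = e / 3"
    have e': "e' > 0" using that by (simp add: e'_def)
    obtain T0 h1 where T0: "T0 > 0" "h1 > 0" "\<And>h n z. 0 < h \<Longrightarrow> h < h1 \<Longrightarrow> real n * h\<^sup>2 \<le> T0 \<Longrightarrow>
        \<bar>(rw \<rho> h ^^ n) (E V) z - E V z - real n * h\<^sup>2 * gen X \<rho> (\<lambda>i. G i z) (\<lambda>i j. H i j z)\<bar> \<le> e' * (real n * h\<^sup>2)"
      using rw_pow_expand[OF X F uF[unfolded E_def] G Ck_ucont[OF Hk] gk e'] unfolding E_def by blast
    define T where "T = Min {1, T0, e' / (\<bar>C\<bar> + 1)}"
    have T: "0 < T" "T \<le> 1" "T \<le> T0" "T \<le> e' / (\<bar>C\<bar> + 1)" using T0(1) e' by (auto simp: T_def)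
    have CT: "C * T \<le> e'"
    proof -
      have "C * T \<le> (\<bar>C\<bar> + 1) * T" using T(1) by (intro mult_right_mono) auto
      also have "\<dots> \<le> e'" using T(4) by (simp add: field_simps)
      finally show ?thesis .
    qed
    \<comment> \<open>The tolerance is taken proportional to T so that it stays small after the
      division by T; the bound h0 on the steps may depend on it.\<close>
    have "e' * T > 0" using e' T by simp
    then obtain h0 where h0: "h0 > 0" "\<And>h n z0. 0 < h \<Longrightarrow> h < h0 \<Longrightarrow> real n * h\<^sup>2 \<le> T \<Longrightarrow>
       z0 \<in> cube X zb (R / 2) \<Longrightarrow> V z0 \<le> (rw \<rho> h ^^ n) V z0 + K * (real n * h\<^sup>2) * expsum X z0 + e' * T + C * T\<^sup>2"
      using C[OF T(1,2)] by blast
    define hm where "hm = min h0 h1"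
    have hm: "hm > 0" using h0(1) T0(2) by (simp add: hm_def)
    \<comment> \<open>With this n the step \<open>sqrt (T / n)\<close> is below both bounds and the
      elapsed time is exactly T.\<close>
    obtain n :: nat where n: "real n > T / hm\<^sup>2" "n > 0"
      using reals_Archimedean2[of "max 0 (T / hm\<^sup>2)"] by auto
    define h where "h = sqrt (T / real n)"
    have h2: "h\<^sup>2 = T / real n" "0 < h" using T(1) n(2) by (auto simp: h_def)
    have nh: "real n * h\<^sup>2 = T" using h2 n(2) by simp
    have "T < real n * hm\<^sup>2" using n(1) hm by (simp add: pos_divide_less_eq)
    then have "h\<^sup>2 < hm\<^sup>2" unfolding h2(1) using n(2) by (simp add: pos_divide_less_eq mult.commute)
    then have "h < hm" using hm by (simp add: power2_less_imp_less)
    then have hh: "h < h0" "h < h1" by (auto simp: hm_def)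
    obtain rr where rr: "rr \<ge> 0" "avg X rr (rw \<rho> h)" using avg_rw[OF X] by blast
    have avn: "avg X (real n * rr) (rw \<rho> h ^^ n)" by (rule avg_funpow[OF rr(2,1)])
    define M where "M = rw \<rho> h ^^ n"
    let ?N = "cexp X zb (R / 2) (\<lambda>i. 1)"
    have uM: "ucont X (M V)" unfolding M_def by (rule avg_ucont[OF avn V])
    have uN: "ucont X ?N" using R by (intro ucont_cexp X) auto
    have Nloc: "?N y = expsum X y" if "y \<in> cube X zb (R / 2)" for y
      using that unfolding cexp_def expsum_def by (intro sum.cong) (auto simp: cube_def clamp1_eq)
    have "E V z \<le> E (\<lambda>z. (M V z + K * T * ?N z) + (e' * T + C * T\<^sup>2)) z"
    proof (rule avg_mono[OF av V])
      fix v assume "\<forall>i\<in>X. \<bar>v i\<bar> \<le> real 4 * (\<epsilon> * real (length xs))"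
      then have c: "z + v \<in> cube X zb (R / 2)" using cube_shift[OF z, of v] \<epsilon>(2) by simp
      show "V (z + v) \<le> (M V (z + v) + K * T * ?N (z + v)) + (e' * T + C * T\<^sup>2)"
        using h0(2)[OF h2(2) hh(1) eq_refl[OF nh] c] unfolding nh Nloc[OF c] M_def by simp
    qed (intro ucont_add ucont_scale uM uN ucont_const)
    also have "E (\<lambda>z. (M V z + K * T * ?N z) + (e' * T + C * T\<^sup>2)) z = E (M V) z + K * T * E ?N z + (e' * T + C * T\<^sup>2)"
      using uM uN by (simp add: avg_add[OF av] avg_scale[OF av] avg_const[OF av] ucont_add ucont_scale)
    also have "E ?N z = kap \<epsilon> ^ 4 * expsum X z"
      unfolding E_def
    proof (rule steklovs_pow_cexp[OF X \<epsilon>(1) _ xs])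
      show "z \<in> cube X zb (R / 2 - real 4 * (\<epsilon> * real (length xs)))"
        using \<epsilon>(2) by (intro cube_mono[OF z]) simp
    qed (use R in simp)
    also have "E (M V) z = M (E V) z" unfolding M_def by (simp only: avg_rw_commute[OF X av V])
    finally have "E V z \<le> M (E V) z + K * T * (kap \<epsilon> ^ 4 * expsum X z) + (e' * T + C * T\<^sup>2)" .
    moreover have "M (E V) z - E V z \<le> T * g + e' * T"
      using T0(3)[OF h2(2) hh(2), of n z] T(3) unfolding nh M_def g_def by (simp add: abs_le_iff)
    ultimately have "0 \<le> T * (g + e' + K * (kap \<epsilon> ^ 4 * expsum X z) + e' + C * T)"
      by (simp add: algebra_simps power2_eq_square)
    then have "0 \<le> g + e' + K * (kap \<epsilon> ^ 4 * expsum X z) + e' + C * T" using T(1) by (simp add: zero_le_mult_iff)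
    then show ?thesis using CT unfolding e'_def by argo
  qed
  then show ?thesis unfolding g_def by (rule field_le_epsilon)
qed

section \<open>Logarithmic coordinates on the simplex\<close>

text \<open>Superjets relative to the simplex, in the coordinates x of the perturbation m (1 + x).\<close>

definition rsup :: "'i set \<Rightarrow> (('i \<Rightarrow> real) \<Rightarrow> real) \<Rightarrow> ('i \<Rightarrow> real) \<Rightarrow> ('i \<Rightarrow> real) \<Rightarrow> ('i \<Rightarrow> 'i \<Rightarrow> real) \<Rightarrow> bool" where
  "rsup X u m p P \<longleftrightarrow> (\<exists>r. r \<in> o[nz X](\<lambda>x. (l1 X x)\<^sup>2) \<and>
     eventually (\<lambda>x. (\<Sum>i\<in>X. m i * x i) = 0 \<longrightarrow>
        u (\<lambda>i. m i * (1 + x i)) \<le> u m + (\<Sum>i\<in>X. x i * p i) + (\<Sum>i\<in>X. \<Sum>j\<in>X. x i * x j * P i j) / 2 + r x) (nz X))"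

lemma filterlim_nz: "filterlim f (nz X) F \<longleftrightarrow> ((\<lambda>x. l1 X (f x)) \<longlongrightarrow> 0) F"
  unfolding nz_def filterlim_filtercomap_iff by (simp add: o_def)

lemma smallo_1_iff: "f \<in> o[F](\<lambda>x. 1 :: real) \<longleftrightarrow> (f \<longlongrightarrow> 0) F" for f :: "_ \<Rightarrow> real"
  using smalloI_tendsto[of f "\<lambda>x. 1" F] smalloD_tendsto[of f F "\<lambda>x. 1"] by auto

lemma tendsto_imp_bigo_1: "(f \<longlongrightarrow> c) F \<Longrightarrow> f \<in> O[F](\<lambda>x. 1 :: real)" for f :: "_ \<Rightarrow> real"
  by (rule bigoI_tendsto[of f "\<lambda>x. 1" c]) auto

lemma l1_smallo_one: "l1 X \<in> o[nz X](\<lambda>x. 1)"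
  using filterlim_l1_nz by (simp add: smallo_1_iff)

lemma smallo_ln1: "(\<lambda>t::real. ln (1 + t) - t) \<in> o[nhds 0](\<lambda>t. t)"
  and smallo_ln2: "(\<lambda>t::real. ln (1 + t) - t + t\<^sup>2 / 2) \<in> o[nhds 0](\<lambda>t. t\<^sup>2)"
proof -
  have "(\<lambda>t::real. ln (1 + t) - t) \<in> o[at 0](\<lambda>t. t)" "(\<lambda>t::real. ln (1 + t) - t + t\<^sup>2 / 2) \<in> o[at 0](\<lambda>t. t\<^sup>2)"
    by real_asymp+
  then show "(\<lambda>t::real. ln (1 + t) - t) \<in> o[nhds 0](\<lambda>t. t)" "(\<lambda>t::real. ln (1 + t) - t + t\<^sup>2 / 2) \<in> o[nhds 0](\<lambda>t. t\<^sup>2)"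
    unfolding smallo_def eventually_nhds_conv_at by simp_all
qed

text \<open>Second-order chain rule for \<open>\<zeta> i = ln (1 + y i)\<close>: the term
  \<open>- (y i)\<^sup>2 / 2\<close> of the logarithm moves the gradient into the diagonal of the
  Hessian.\<close>

lemma log_jet:
  assumes X: "finite X" and j: "jet2 X \<phi> z p Q"
  shows "(\<lambda>y. \<phi> (z + (\<lambda>i. ln (1 + y i))) - \<phi> z - (\<Sum>i\<in>X. y i * p i)
      - (\<Sum>i\<in>X. \<Sum>j\<in>X. y i * y j * (Q i j - (if i = j then p i else 0))) / 2) \<in> o[nz X](\<lambda>y. (l1 X y)\<^sup>2)"
proof -
  define \<zeta> where "\<zeta> y = (\<lambda>i. ln (1 + y i))" for y :: "'a \<Rightarrow> real"
  note crd = coord_tendsto_nz[OF X] and crdO = coord_bigo_nz[OF X]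
  have z1: "(\<lambda>y. \<zeta> y i - y i) \<in> o[nz X](l1 X)" if "i \<in> X" for i
    unfolding \<zeta>_def using landau_o.small.compose[OF smallo_ln1 crd[OF that]] crdO[OF that]
    by (rule landau_o.small_big_trans)
  have z2: "(\<lambda>y. \<zeta> y i - y i + (y i)\<^sup>2 / 2) \<in> o[nz X](\<lambda>y. (l1 X y)\<^sup>2)" if "i \<in> X" for i
    unfolding \<zeta>_def using landau_o.small.compose[OF smallo_ln2 crd[OF that]] landau_o.big_power[OF crdO[OF that]]
    by (rule landau_o.small_big_trans)
  have zO: "(\<lambda>y. \<zeta> y i) \<in> O[nz X](l1 X)" if "i \<in> X" for i
  proof -
    have "(\<lambda>y. (\<zeta> y i - y i) + y i) \<in> O[nz X](l1 X)"
      using landau_o.small_imp_big[OF z1[OF that]] crdO[OF that] by (rule sum_in_bigo)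
    then show ?thesis by simp
  qed
  have zl: "(\<lambda>y. l1 X (\<zeta> y)) \<in> O[nz X](l1 X)"
    unfolding l1_def[of X "\<zeta> _"] using zO by (intro big_sum_in_bigo) simp
  have "filterlim \<zeta> (nz X) (nz X)"
    unfolding filterlim_nz
    using landau_o.big_small_trans[OF zl l1_smallo_one] by (simp add: smallo_1_iff)
  then have "(\<lambda>y. \<phi> (z + \<zeta> y) - \<phi> z - (\<Sum>i\<in>X. \<zeta> y i * p i) - (\<Sum>i\<in>X. \<Sum>j\<in>X. \<zeta> y i * \<zeta> y j * Q i j) / 2)
     \<in> o[nz X](\<lambda>y. (l1 X (\<zeta> y))\<^sup>2)"
    using j unfolding jet2_def by (rule landau_o.small.compose[rotated])
  then have a: "(\<lambda>y. \<phi> (z + \<zeta> y) - \<phi> z - (\<Sum>i\<in>X. \<zeta> y i * p i) - (\<Sum>i\<in>X. \<Sum>j\<in>X. \<zeta> y i * \<zeta> y j * Q i j) / 2)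
     \<in> o[nz X](\<lambda>y. (l1 X y)\<^sup>2)"
    by (rule landau_o.small_big_trans) (rule landau_o.big_power[OF zl])
  have b: "(\<lambda>y. \<Sum>i\<in>X. p i * (\<zeta> y i - y i + (y i)\<^sup>2 / 2)) \<in> o[nz X](\<lambda>y. (l1 X y)\<^sup>2)"
  proof (rule big_sum_in_smallo)
    fix i assume "i \<in> X"
    then show "(\<lambda>y. p i * (\<zeta> y i - y i + (y i)\<^sup>2 / 2)) \<in> o[nz X](\<lambda>y. (l1 X y)\<^sup>2)"
      using z2[of i] by (cases "p i = 0") auto
  qed
  have c: "(\<lambda>y. \<Sum>i\<in>X. \<Sum>j\<in>X. (Q i j / 2) * (\<zeta> y i * \<zeta> y j - y i * y j)) \<in> o[nz X](\<lambda>y. (l1 X y)\<^sup>2)"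
  proof (intro big_sum_in_smallo)
    fix i j assume i: "i \<in> X" and j: "j \<in> X"
    have "(\<lambda>y. (\<zeta> y i - y i) * \<zeta> y j + y i * (\<zeta> y j - y j)) \<in> o[nz X](\<lambda>y. l1 X y * l1 X y)"
      by (intro sum_in_smallo landau_o.small_big_mult landau_o.big_small_mult z1 zO crdO i j)
    then have "(\<lambda>y. \<zeta> y i * \<zeta> y j - y i * y j) \<in> o[nz X](\<lambda>y. (l1 X y)\<^sup>2)"
      by (simp add: algebra_simps power2_eq_square)
    then show "(\<lambda>y. (Q i j / 2) * (\<zeta> y i * \<zeta> y j - y i * y j)) \<in> o[nz X](\<lambda>y. (l1 X y)\<^sup>2)"
      by (cases "Q i j = 0") auto
  qed
  have diag: "(\<Sum>i\<in>X. \<Sum>j\<in>X. y i * y j * (Q i j - (if i = j then p i else 0)))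
      = (\<Sum>i\<in>X. \<Sum>j\<in>X. y i * y j * Q i j) - (\<Sum>i\<in>X. (y i)\<^sup>2 * p i)" for y
    using X by (simp add: right_diff_distrib sum_subtractf if_distrib[of "\<lambda>x. _ * x"] power2_eq_square cong: if_cong)
  have eq: "\<phi> (z + \<zeta> y) - \<phi> z - (\<Sum>i\<in>X. y i * p i) - (\<Sum>i\<in>X. \<Sum>j\<in>X. y i * y j * (Q i j - (if i = j then p i else 0))) / 2
     = (\<phi> (z + \<zeta> y) - \<phi> z - (\<Sum>i\<in>X. \<zeta> y i * p i) - (\<Sum>i\<in>X. \<Sum>j\<in>X. \<zeta> y i * \<zeta> y j * Q i j) / 2)
       + (\<Sum>i\<in>X. p i * (\<zeta> y i - y i + (y i)\<^sup>2 / 2)) + (\<Sum>i\<in>X. \<Sum>j\<in>X. (Q i j / 2) * (\<zeta> y i * \<zeta> y j - y i * y j))" for y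
  proof -
    have "(\<Sum>i\<in>X. p i * (\<zeta> y i - y i + (y i)\<^sup>2 / 2)) = (\<Sum>i\<in>X. \<zeta> y i * p i) - (\<Sum>i\<in>X. y i * p i) + (\<Sum>i\<in>X. (y i)\<^sup>2 * p i) / 2"
      by (simp add: sum_subtractf[symmetric] sum.distrib[symmetric] sum_divide_distrib algebra_simps)
    moreover have "(\<Sum>i\<in>X. \<Sum>j\<in>X. (Q i j / 2) * (\<zeta> y i * \<zeta> y j - y i * y j))
       = (\<Sum>i\<in>X. \<Sum>j\<in>X. \<zeta> y i * \<zeta> y j * Q i j) / 2 - (\<Sum>i\<in>X. \<Sum>j\<in>X. y i * y j * Q i j) / 2"
      unfolding sum_divide_distrib sum_subtractf[symmetric] by (intro sum.cong refl) (simp add: field_simps)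
    ultimately show ?thesis unfolding diag diff_divide_distrib by linarith
  qed
  have "(\<lambda>y. \<phi> (z + \<zeta> y) - \<phi> z - (\<Sum>i\<in>X. y i * p i) - (\<Sum>i\<in>X. \<Sum>j\<in>X. y i * y j * (Q i j - (if i = j then p i else 0))) / 2)
      \<in> o[nz X](\<lambda>y. (l1 X y)\<^sup>2)"
    unfolding eq by (rule sum_in_smallo(1)[OF sum_in_smallo(1)[OF a b] c])
  then show ?thesis unfolding \<zeta>_def .
qed

text \<open>The drift of the walk is exactly the correction found in \<open>log_jet\<close>: in
  multiplicative coordinates the generator is half the Hessian form evaluated at \<rho>.\<close>

lemma gen_as_quad:
  assumes "finite X"
  shows "gen X \<rho> p Q = (\<Sum>i\<in>X. \<Sum>j\<in>X. \<rho> i * \<rho> j * (Q i j - (if i = j then p i else 0))) / 2"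
  using assms unfolding gen_def
  by (simp add: right_diff_distrib sum_subtractf if_distrib[of "\<lambda>x. _ * x"] power2_eq_square diff_divide_distrib cong: if_cong)

lemma quad_compose:
  fixes E :: "'i \<Rightarrow> 'i \<Rightarrow> real"
  assumes "finite X"
  shows "(\<Sum>i\<in>X. \<Sum>j\<in>X. (\<Sum>k\<in>X. E i k * x k) * (\<Sum>l\<in>X. E j l * x l) * P i j)
     = (\<Sum>k\<in>X. \<Sum>l\<in>X. x k * x l * (\<Sum>i\<in>X. \<Sum>j\<in>X. E i k * E j l * P i j))"
proof -
  have "(\<Sum>i\<in>X. \<Sum>j\<in>X. (\<Sum>k\<in>X. E i k * x k) * (\<Sum>l\<in>X. E j l * x l) * P i j)
     = (\<Sum>i\<in>X. \<Sum>j\<in>X. \<Sum>k\<in>X. \<Sum>l\<in>X. x k * x l * (E i k * E j l * P i j))"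
    unfolding sum_product unfolding sum_distrib_right by (intro sum.cong refl) (simp add: ac_simps)
  also have "\<dots> = (\<Sum>i\<in>X. \<Sum>k\<in>X. \<Sum>j\<in>X. \<Sum>l\<in>X. x k * x l * (E i k * E j l * P i j))"
    by (rule sum.cong[OF refl], rule sum.swap)
  also have "\<dots> = (\<Sum>k\<in>X. \<Sum>i\<in>X. \<Sum>j\<in>X. \<Sum>l\<in>X. x k * x l * (E i k * E j l * P i j))" by (rule sum.swap)
  also have "\<dots> = (\<Sum>k\<in>X. \<Sum>i\<in>X. \<Sum>l\<in>X. \<Sum>j\<in>X. x k * x l * (E i k * E j l * P i j))"
    by (rule sum.cong[OF refl], rule sum.cong[OF refl], rule sum.swap)
  also have "\<dots> = (\<Sum>k\<in>X. \<Sum>l\<in>X. \<Sum>i\<in>X. \<Sum>j\<in>X. x k * x l * (E i k * E j l * P i j))"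
    by (rule sum.cong[OF refl], rule sum.swap)
  finally show ?thesis by (simp add: sum_distrib_left)
qed

text \<open>The softmax of z.\<close>

definition mz :: "'i set \<Rightarrow> ('i \<Rightarrow> real) \<Rightarrow> 'i \<Rightarrow> real" where
  "mz X z = (\<lambda>i. exp (z i) / expsum X z)"

text \<open>The positively homogeneous extension of u of degree one, in logarithmic coordinates:
  adding a constant to all \<open>z i\<close> rescales the mass and leaves \<open>mz\<close>
  fixed.\<close>

definition homog :: "'i set \<Rightarrow> (('i \<Rightarrow> real) \<Rightarrow> real) \<Rightarrow> ('i \<Rightarrow> real) \<Rightarrow> real" where
  "homog X u z = expsum X z * u (mz X z)"

lemma expsum_pos: "finite X \<Longrightarrow> X \<noteq> {} \<Longrightarrow> 0 < expsum X z"
  unfolding expsum_def by (intro sum_pos) auto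

text \<open>The displacement multiplies \<open>exp (z i)\<close> by
  \<open>(1 + x i) / (1 - s)\<close>. As x has mean 0, the total mass changes by the factor
  \<open>1 / (1 - s)\<close> only, and the normalised weights are
  \<open>mz X z i * (1 + x i)\<close>.\<close>

lemma homog_lift:
  assumes X: "finite X" "X \<noteq> {}" and s: "s < 1" and x: "(\<Sum>i\<in>X. mz X z i * x i) = 0" "\<And>i. i \<in> X \<Longrightarrow> -1 < x i"
    and dep: "\<And>m m'. (\<forall>i\<in>X. m i = m' i) \<Longrightarrow> u m = u m'"
  shows "homog X u (z + (\<lambda>i. ln (1 + (x i + s) / (1 - s)))) = expsum X z / (1 - s) * u (\<lambda>i. mz X z i * (1 + x i))"
proof -
  let ?y = "z + (\<lambda>i. ln (1 + (x i + s) / (1 - s)))"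
  have N: "expsum X z > 0" by (rule expsum_pos[OF X])
  have ez: "exp (z i) = expsum X z * mz X z i" for i using N by (simp add: mz_def)
  have e: "exp (?y i) = expsum X z / (1 - s) * (mz X z i * (1 + x i))" if "i \<in> X" for i
  proof -
    have "1 + (x i + s) / (1 - s) = (1 + x i) / (1 - s)" using s by (simp add: field_simps)
    moreover have "0 < (1 + x i) / (1 - s)" using x(2)[OF that] s by simp
    ultimately have "exp (?y i) = exp (z i) * ((1 + x i) / (1 - s))" by (simp add: exp_add)
    then show ?thesis unfolding ez by simp
  qed
  have s1: "(\<Sum>i\<in>X. mz X z i) = 1" using N unfolding mz_def sum_divide_distrib[symmetric] expsum_def by simp
  have "expsum X ?y = (\<Sum>i\<in>X. expsum X z / (1 - s) * (mz X z i * (1 + x i)))"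
    unfolding expsum_def[of X ?y] by (intro sum.cong refl e)
  also have "\<dots> = expsum X z / (1 - s) * (\<Sum>i\<in>X. mz X z i * (1 + x i))" by (simp only: sum_distrib_left)
  also have "(\<Sum>i\<in>X. mz X z i * (1 + x i)) = 1" using s1 x(1) by (simp add: distrib_left sum.distrib)
  finally have es: "expsum X ?y = expsum X z / (1 - s)" by (simp only: mult_1_right)
  have "mz X ?y i = mz X z i * (1 + x i)" if "i \<in> X" for i
    unfolding mz_def[of X ?y] es e[OF that] using N s by simp
  then have "u (mz X ?y) = u (\<lambda>i. mz X z i * (1 + x i))" by (intro dep) simp
  then show ?thesis unfolding homog_def es by simp
qed

text \<open>A test function touching the homogeneous lift can be restricted along any lift 1 / (1 - s) of the simplex with
  s linear. Choosing s to take the value rb on the centred direction turns that direction into rho.\<close>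

lemma homog_superjet:
  fixes u :: "('i \<Rightarrow> real) \<Rightarrow> real"
  assumes X: "finite X" "X \<noteq> {}" and j: "jet2 X \<phi> z p Q"
    and touch: "eventually (\<lambda>\<zeta>. homog X u (z + \<zeta>) - homog X u z \<le> \<phi> (z + \<zeta>) - \<phi> z) (nz X)"
    and dep: "\<And>m m'. (\<forall>i\<in>X. m i = m' i) \<Longrightarrow> u m = u m'"
    and l: "(\<Sum>i\<in>X. \<rho> i * mz X z i) = rb" "(\<Sum>i\<in>X. l i * (\<rho> i - rb)) = rb"
  shows "\<exists>p' P'. rsup X u (mz X z) p' P' \<and>
     expsum X z * ((\<Sum>i\<in>X. \<Sum>j\<in>X. (\<rho> i - rb) * (\<rho> j - rb) * P' i j) / 2) = gen X \<rho> p Q"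
proof -
  define N where "N = expsum X z"
  have N: "N > 0" unfolding N_def by (rule expsum_pos[OF X])
  define m where "m = mz X z"
  define s where "s x = (\<Sum>k\<in>X. l k * x k)" for x
  \<comment> \<open>The relative displacement whose lift is the measure with weights
    \<open>m i * (1 + x i)\<close>, taken with total mass \<open>N / (1 - s x)\<close>.\<close>
  define y where "y x = (\<lambda>i. (x i + s x) / (1 - s x))" for x :: "'i \<Rightarrow> real"
  define P where "P i j = Q i j - (if i = j then p i else 0)" for i j
  define E where "E i k = (if i = k then 1 else 0) + l k" for i k :: 'i
  have Ex: "(\<Sum>k\<in>X. E i k * x k) = x i + s x" if "i \<in> X" for i x
    using X(1) that by (simp add: E_def distrib_right sum.distrib s_def if_distrib[of "\<lambda>a. a * _"] cong: if_cong)
  have s0: "(s \<longlongrightarrow> 0) (nz X)"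
  proof -
    have "((\<lambda>x. \<Sum>k\<in>X. l k * x k) \<longlongrightarrow> (\<Sum>k\<in>X. l k * 0)) (nz X)"
      by (intro tendsto_intros coord_tendsto_nz X) auto
    then show ?thesis by (simp add: s_def[abs_def])
  qed
  have sO: "s \<in> O[nz X](l1 X)"
    unfolding s_def[abs_def]
  proof (intro big_sum_in_bigo)
    fix k assume "k \<in> X"
    then show "(\<lambda>x. l k * x k) \<in> O[nz X](l1 X)" using coord_bigo_nz[OF X(1), of k] by (cases "l k = 0") auto
  qed
  have lim1: "((\<lambda>x. 1 / (1 - s x)) \<longlongrightarrow> 1) (nz X)"
    using tendsto_divide[OF tendsto_const[of 1] tendsto_diff[OF tendsto_const[of 1] s0]] by simp
  have O1: "(\<lambda>x. 1 / (1 - s x)) \<in> O[nz X](\<lambda>x. 1)" using lim1 by (rule tendsto_imp_bigo_1)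
  have o1: "(\<lambda>x. 1 / (1 - s x) - 1) \<in> o[nz X](\<lambda>x. 1)"
    using tendsto_diff[OF lim1 tendsto_const[of 1]] by (simp add: smallo_1_iff)
  have xsO: "(\<lambda>x. x i + s x) \<in> O[nz X](l1 X)" if "i \<in> X" for i
    by (intro sum_in_bigo coord_bigo_nz X that sO)
  have yO: "(\<lambda>x. y x i) \<in> O[nz X](l1 X)" if "i \<in> X" for i
    unfolding y_def using landau_o.big.mult[OF xsO[OF that] O1] by simp
  have ylO: "(\<lambda>x. l1 X (y x)) \<in> O[nz X](l1 X)"
    unfolding l1_def[of X "y _"] using yO by (intro big_sum_in_bigo) simp
  have ylim: "filterlim y (nz X) (nz X)"
    unfolding filterlim_nz using landau_o.big_small_trans[OF ylO l1_smallo_one] by (simp add: smallo_1_iff)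
  define A where "A x = \<phi> (z + (\<lambda>i. ln (1 + y x i))) - \<phi> z - (\<Sum>i\<in>X. y x i * p i) - (\<Sum>i\<in>X. \<Sum>j\<in>X. y x i * y x j * P i j) / 2" for x
  have "A \<in> o[nz X](\<lambda>x. (l1 X (y x))\<^sup>2)"
    unfolding A_def P_def using landau_o.small.compose[OF log_jet[OF X(1) j] ylim] .
  then have Ao: "A \<in> o[nz X](\<lambda>x. (l1 X x)\<^sup>2)"
    by (rule landau_o.small_big_trans) (rule landau_o.big_power[OF ylO])
  \<comment> \<open>Multiplying the touching inequality by \<open>1 - s x\<close> makes its linear
    part exact, since \<open>(1 - s x) * y x i = x i + s x\<close>, but leaves a factor
    \<open>1 / (1 - s x)\<close> on the quadratic part. B is the excess due to this factor and is
    small against the quadratic order.\<close>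
  define B where "B x = (1 / (1 - s x) - 1) * ((\<Sum>i\<in>X. \<Sum>j\<in>X. (x i + s x) * (x j + s x) * P i j) / 2)" for x
  have "(\<lambda>x. (\<Sum>i\<in>X. \<Sum>j\<in>X. (x i + s x) * (x j + s x) * P i j) / 2) \<in> O[nz X](\<lambda>x. l1 X x * l1 X x)"
  proof -
    have "(\<lambda>x. \<Sum>i\<in>X. \<Sum>j\<in>X. (x i + s x) * (x j + s x) * P i j) \<in> O[nz X](\<lambda>x. l1 X x * l1 X x)"
    proof (intro big_sum_in_bigo)
      fix i j assume "i \<in> X" "j \<in> X"
      then have "(\<lambda>x. (x i + s x) * (x j + s x)) \<in> O[nz X](\<lambda>x. l1 X x * l1 X x)"
        by (intro landau_o.big.mult xsO)
      then show "(\<lambda>x. (x i + s x) * (x j + s x) * P i j) \<in> O[nz X](\<lambda>x. l1 X x * l1 X x)"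
        by (cases "P i j = 0") auto
    qed
    then show ?thesis by simp
  qed
  from landau_o.small_big_mult[OF o1 this] have Bo: "B \<in> o[nz X](\<lambda>x. (l1 X x)\<^sup>2)"
    unfolding B_def by (simp add: power2_eq_square)
  define r where "r x = (1 / N) * ((1 - s x) * A x + B x)" for x
  have ro: "r \<in> o[nz X](\<lambda>x. (l1 X x)\<^sup>2)"
  proof -
    have "((\<lambda>x. 1 - s x) \<longlongrightarrow> 1) (nz X)" using tendsto_diff[OF tendsto_const[of 1] s0] by simp
    then have "(\<lambda>x. 1 - s x) \<in> O[nz X](\<lambda>x. 1)" by (rule tendsto_imp_bigo_1)
    from landau_o.big_small_mult[OF this Ao] have "(\<lambda>x. (1 - s x) * A x + B x) \<in> o[nz X](\<lambda>x. (l1 X x)\<^sup>2)"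
      using Bo by (intro sum_in_smallo) simp_all
    then show ?thesis unfolding r_def using N by simp
  qed
  \<comment> \<open>E is the matrix of the map adding \<open>s x\<close> to every coordinate;
    gradient and Hessian are pulled back through it. The term \<open>- l k * u m\<close> comes from
    \<open>(1 - s x) * u m\<close>.\<close>
  define p' where "p' k = - l k * u m + (1 / N) * (\<Sum>i\<in>X. E i k * p i)" for k
  define P' where "P' k q = (1 / N) * (\<Sum>i\<in>X. \<Sum>j\<in>X. E i k * E j q * P i j)" for k q
  have lin: "(\<Sum>k\<in>X. x k * p' k) = - s x * u m + (1 / N) * (\<Sum>i\<in>X. (x i + s x) * p i)" for x
  proof -
    have "(\<Sum>i\<in>X. (x i + s x) * p i) = (\<Sum>i\<in>X. \<Sum>k\<in>X. E i k * x k * p i)"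
      using Ex by (simp add: sum_distrib_right[symmetric])
    also have "\<dots> = (\<Sum>k\<in>X. \<Sum>i\<in>X. E i k * x k * p i)" by (rule sum.swap)
    also have "\<dots> = (\<Sum>k\<in>X. x k * (\<Sum>i\<in>X. E i k * p i))" by (simp add: sum_distrib_left ac_simps)
    finally have eq: "(\<Sum>i\<in>X. (x i + s x) * p i) = (\<Sum>k\<in>X. x k * (\<Sum>i\<in>X. E i k * p i))" .
    have "(\<Sum>k\<in>X. x k * p' k) = (\<Sum>k\<in>X. - u m * (l k * x k)) + (\<Sum>k\<in>X. (1 / N) * (x k * (\<Sum>i\<in>X. E i k * p i)))"
      unfolding p'_def sum.distrib[symmetric] by (intro sum.cong refl) (simp add: field_simps)
    then show ?thesis unfolding eq unfolding s_def sum_distrib_left[symmetric] by simp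
  qed
  have quad: "(\<Sum>k\<in>X. \<Sum>q\<in>X. x k * x q * P' k q) = (1 / N) * (\<Sum>i\<in>X. \<Sum>j\<in>X. (x i + s x) * (x j + s x) * P i j)" for x
  proof -
    have "(\<Sum>i\<in>X. \<Sum>j\<in>X. (x i + s x) * (x j + s x) * P i j) = (\<Sum>i\<in>X. \<Sum>j\<in>X. (\<Sum>k\<in>X. E i k * x k) * (\<Sum>q\<in>X. E j q * x q) * P i j)"
      using Ex by simp
    also have "\<dots> = (\<Sum>k\<in>X. \<Sum>q\<in>X. x k * x q * (\<Sum>i\<in>X. \<Sum>j\<in>X. E i k * E j q * P i j))" by (rule quad_compose[OF X(1)])
    finally show ?thesis unfolding P'_def by (simp only: sum_distrib_left ac_simps)
  qed
  have "eventually (\<lambda>x. s x < 1) (nz X)" using s0 by (rule order_tendstoD(2)) simp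
  moreover have "eventually (\<lambda>x. \<forall>i\<in>X. -1 < x i) (nz X)"
    using coord_tendsto_nz[OF X(1)]
    by (intro eventually_ball_finite[OF X(1)] ballI) (rule order_tendstoD(1)[where y = 0], auto)
  moreover have "eventually (\<lambda>x. homog X u (z + (\<lambda>i. ln (1 + y x i))) - homog X u z \<le> \<phi> (z + (\<lambda>i. ln (1 + y x i))) - \<phi> z) (nz X)"
  proof -
    have "filterlim (\<lambda>v i. ln (1 + v i)) (nz X) (nz X)"
      unfolding filterlim_nz l1_def
    proof (rule tendsto_null_sum)
      fix i assume "i \<in> X"
      then have "((\<lambda>v. \<bar>ln (1 + v i)\<bar>) \<longlongrightarrow> \<bar>ln (1 + 0)\<bar>) (nz X)"
        by (intro tendsto_intros coord_tendsto_nz X) auto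
      then show "((\<lambda>v. \<bar>ln (1 + v i)\<bar>) \<longlongrightarrow> 0) (nz X)" by simp
    qed
    from filterlim_compose[OF this ylim] have "filterlim (\<lambda>x i. ln (1 + y x i)) (nz X) (nz X)" .
    from eventually_compose_filterlim[OF touch this] show ?thesis .
  qed
  ultimately have "eventually (\<lambda>x. (\<Sum>i\<in>X. m i * x i) = 0 \<longrightarrow>
        u (\<lambda>i. m i * (1 + x i)) \<le> u m + (\<Sum>i\<in>X. x i * p' i) + (\<Sum>i\<in>X. \<Sum>j\<in>X. x i * x j * P' i j) / 2 + r x) (nz X)"
  proof eventually_elim
    case (elim x)
    show ?case
    proof
      assume x0: "(\<Sum>i\<in>X. m i * x i) = 0"
      define q where "q = (\<Sum>i\<in>X. \<Sum>j\<in>X. (x i + s x) * (x j + s x) * P i j)"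
      define ln' where "ln' = (\<Sum>i\<in>X. (x i + s x) * p i)"
      define D where "D = \<phi> (z + (\<lambda>i. ln (1 + y x i))) - \<phi> z"
      have s1: "1 - s x > 0" using elim by simp
      have "homog X u (z + (\<lambda>i. ln (1 + y x i))) = N / (1 - s x) * u (\<lambda>i. m i * (1 + x i))"
        unfolding y_def N_def m_def using elim x0 by (intro homog_lift[OF X _ _ _ dep]) (auto simp: m_def)
      moreover have "homog X u z = N * u m" by (simp add: homog_def N_def m_def)
      ultimately have "N / (1 - s x) * u (\<lambda>i. m i * (1 + x i)) \<le> N * u m + D" using elim(3) unfolding D_def by linarith
      then have "(1 - s x) * (N / (1 - s x) * u (\<lambda>i. m i * (1 + x i))) \<le> (1 - s x) * (N * u m + D)"
        using s1 by (intro mult_left_mono) auto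
      then have c1: "N * u (\<lambda>i. m i * (1 + x i)) \<le> (1 - s x) * (N * u m) + (1 - s x) * D"
        using s1 by (simp add: distrib_left)
      have yl: "(1 - s x) * (\<Sum>i\<in>X. y x i * p i) = ln'"
        unfolding y_def ln'_def sum_distrib_left using s1 by (intro sum.cong refl) simp
      have yq: "(1 - s x) * (\<Sum>i\<in>X. \<Sum>j\<in>X. y x i * y x j * P i j) = 1 / (1 - s x) * q"
      proof -
        have kk: "k * (a / k * (b / k) * c) = 1 / k * (a * b * c)" if "k > 0" for k a b c :: real
          using that by simp
        show ?thesis unfolding y_def q_def sum_distrib_left by (intro sum.cong refl kk s1)
      qed
      have "D = A x + (\<Sum>i\<in>X. y x i * p i) + (\<Sum>i\<in>X. \<Sum>j\<in>X. y x i * y x j * P i j) / 2"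
        unfolding A_def D_def by simp
      then have "(1 - s x) * D = (1 - s x) * A x + (1 - s x) * (\<Sum>i\<in>X. y x i * p i) + (1 - s x) * (\<Sum>i\<in>X. \<Sum>j\<in>X. y x i * y x j * P i j) / 2"
        by (simp add: distrib_left)
      then have c2: "(1 - s x) * D = (1 - s x) * A x + ln' + 1 / (1 - s x) * q / 2" unfolding yl yq .
      have "(1 - s x) * A x + ln' + 1 / (1 - s x) * q / 2 = ((1 - s x) * A x + B x) + ln' + q / 2"
      proof -
        have "a' + b' + v * q / 2 = (a' + (v - 1) * (q / 2)) + b' + q / 2" for a' b' v :: real by (simp add: field_simps)
        then show ?thesis unfolding B_def q_def[symmetric] .
      qed
      then have "N * u (\<lambda>i. m i * (1 + x i)) \<le> N * (u m - s x * u m + (1 / N) * ln' + (1 / N) * q / 2 + r x)"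
        using c1 c2 N unfolding r_def by (simp add: algebra_simps)
      then have "u (\<lambda>i. m i * (1 + x i)) \<le> u m - s x * u m + (1 / N) * ln' + (1 / N) * q / 2 + r x"
        using N by (simp only: mult_le_cancel_left_pos)
      then show "u (\<lambda>i. m i * (1 + x i)) \<le> u m + (\<Sum>i\<in>X. x i * p' i) + (\<Sum>i\<in>X. \<Sum>j\<in>X. x i * x j * P' i j) / 2 + r x"
        unfolding lin quad ln'_def q_def by simp
    qed
  qed
  then have "rsup X u m p' P'" unfolding rsup_def using ro by blast
  moreover have "N * ((\<Sum>i\<in>X. \<Sum>j\<in>X. (\<rho> i - rb) * (\<rho> j - rb) * P' i j) / 2) = gen X \<rho> p Q"
  proof -
    \<comment> \<open>In the centred direction \<open>x i + s x\<close> is thus \<rho> itself, and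
      the pulled back form becomes the one of \<open>gen\<close>.\<close>
    have "s (\<lambda>i. \<rho> i - rb) = rb" unfolding s_def using l(2) .
    then show ?thesis using N unfolding quad gen_as_quad[OF X(1)] P_def by simp
  qed
  ultimately show ?thesis unfolding m_def N_def by blast
qed

section \<open>The simplex and the lift of a subsolution\<close>

definition psimplex :: "'i set \<Rightarrow> ('i \<Rightarrow> real) set" where
  "psimplex X = {m. (\<forall>i\<in>X. 0 \<le> m i) \<and> (\<Sum>i\<in>X. m i) = 1}"

lemma simplex_le_1: "finite X \<Longrightarrow> m \<in> psimplex X \<Longrightarrow> i \<in> X \<Longrightarrow> m i \<le> 1"
  unfolding psimplex_def using member_le_sum[of i X m] by auto

lemma seqcomp_simplex_slice:
  assumes X: "finite X"
  shows "seqcomp X {m \<in> psimplex X. \<forall>i\<in>X. a i \<le> m i \<and> m i \<le> b i}"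
  unfolding seqcomp_def
proof (intro allI impI)
  let ?K = "{m \<in> psimplex X. \<forall>i\<in>X. a i \<le> m i \<and> m i \<le> b i}"
  fix s :: "nat \<Rightarrow> 'a \<Rightarrow> real" assume s: "range s \<subseteq> ?K"
  then have sn: "s n \<in> ?K" for n by blast
  have "\<exists>B. \<forall>n. \<bar>s n i\<bar> \<le> B" if "i \<in> X" for i
    using sn that simplex_le_1[OF X] by (intro exI[of _ 1]) (auto simp: psimplex_def abs_le_iff intro: order_trans[of _ 0])
  then obtain q l where q: "strict_mono q" "\<And>i. i \<in> X \<Longrightarrow> (\<lambda>n. s (q n) i) \<longlonglongrightarrow> l i"
    using bounded_subsequence[OF X, of s] by blast
  have "0 \<le> l i \<and> a i \<le> l i \<and> l i \<le> b i" if i: "i \<in> X" for i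
    using sn i by (intro conjI LIMSEQ_le_const[OF q(2)[OF i]] LIMSEQ_le_const2[OF q(2)[OF i]]) (auto simp: psimplex_def)
  moreover have "(\<Sum>i\<in>X. l i) = 1"
  proof -
    have "(\<lambda>n. \<Sum>i\<in>X. s (q n) i) \<longlonglongrightarrow> (\<Sum>i\<in>X. l i)" using q(2) by (intro tendsto_sum)
    moreover have "(\<lambda>n. \<Sum>i\<in>X. s (q n) i) = (\<lambda>n. 1)" using sn by (auto simp: psimplex_def)
    ultimately show ?thesis using LIMSEQ_unique[of "\<lambda>n. 1"] by auto
  qed
  ultimately have "l \<in> ?K" by (auto simp: psimplex_def)
  then show "\<exists>r. \<exists>l\<in>?K. strict_mono r \<and> (\<forall>i\<in>X. (\<lambda>n. s (r n) i) \<longlonglongrightarrow> l i)" using q by blast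
qed

lemma seqcomp_simplex: "finite X \<Longrightarrow> seqcomp X (psimplex X)"
proof -
  assume X: "finite X"
  have "{m \<in> psimplex X. \<forall>i\<in>X. 0 \<le> m i \<and> m i \<le> 1} = psimplex X"
    using simplex_le_1[OF X] by (auto simp: psimplex_def)
  then show ?thesis using seqcomp_simplex_slice[OF X, of "\<lambda>_. 0" "\<lambda>_. 1"] by simp
qed

lemma ucont_dep: "ucont X F \<Longrightarrow> (\<And>i. i \<in> X \<Longrightarrow> z i = z' i) \<Longrightarrow> F z = F z'"
proof -
  assume F: "ucont X F" and eq: "\<And>i. i \<in> X \<Longrightarrow> z i = z' i"
  have l0: "l1 X (z' - z) = 0" unfolding l1_def using eq by simp
  have "\<bar>F z' - F z\<bar> \<le> 0"
  proof (rule field_le_epsilon)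
    fix e :: real assume "e > 0"
    then obtain d where "d > 0" "\<And>z \<zeta>. l1 X \<zeta> < d \<Longrightarrow> \<bar>F (z + \<zeta>) - F z\<bar> \<le> e" using ucont_modulus[OF F] by blast
    from this(2)[of "z' - z" z] show "\<bar>F z' - F z\<bar> \<le> 0 + e" using l0 \<open>d > 0\<close> by simp
  qed
  then show ?thesis by simp
qed

text \<open>Uniform continuity by compactness: two sequences of clamped points whose distance tends
  to 0 have a common limit in the cube along a subsequence.\<close>

lemma ucont_clamped:
  assumes X: "finite X" and R: "0 \<le> R" and U: "seqcont X (cube X zb R) U"
  shows "ucont X (\<lambda>z. U (\<lambda>i. clamp1 (zb i) R (z i)))"
proof -
  define cl where "cl z = (\<lambda>i. clamp1 (zb i) R (z i))" for z
  have cl: "cl z \<in> cube X zb R" for z using clamp1_range[OF R] by (simp add: cube_def cl_def)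
  show ?thesis unfolding ucont_def cl_def[symmetric]
  proof (intro conjI)
    obtain M where "\<forall>z\<in>cube X zb R. \<bar>U z\<bar> \<le> M" using seqcont_bounded[OF seqcomp_cube[OF X] U] by blast
    then show "\<exists>B. \<forall>z. \<bar>U (cl z)\<bar> \<le> B" using cl by blast
    show "\<forall>e>0. \<exists>d>0. \<forall>z \<zeta>. l1 X \<zeta> < d \<longrightarrow> \<bar>U (cl (z + \<zeta>)) - U (cl z)\<bar> \<le> e"
    proof (rule ccontr)
      assume "\<not> ?thesis"
      then obtain e where e: "e > 0" "\<And>d. d > 0 \<Longrightarrow> \<exists>z \<zeta>. l1 X \<zeta> < d \<and> \<bar>U (cl (z + \<zeta>)) - U (cl z)\<bar> > e"
        by (auto simp: not_le)
      have "\<exists>q. l1 X (snd q) < 1 / real (Suc n) \<and> \<bar>U (cl (fst q + snd q)) - U (cl (fst q))\<bar> > e" for n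
        using e(2)[of "1 / real (Suc n)"] by auto
      then obtain q where q: "\<And>n. l1 X (snd (q n)) < 1 / real (Suc n)"
          "\<And>n. \<bar>U (cl (fst (q n) + snd (q n))) - U (cl (fst (q n)))\<bar> > e"
        using choice[of "\<lambda>n q. l1 X (snd q) < 1 / real (Suc n) \<and> \<bar>U (cl (fst q + snd q)) - U (cl (fst q))\<bar> > e"] by blast
      define a where "a n = cl (fst (q n) + snd (q n))" for n
      define b where "b n = cl (fst (q n))" for n
      have "range b \<subseteq> cube X zb R" using cl by (auto simp: b_def)
      then obtain r l where r: "strict_mono r" "l \<in> cube X zb R" "\<forall>i\<in>X. (\<lambda>n. b (r n) i) \<longlonglongrightarrow> l i"
        using seqcomp_cube[OF X, of zb R, unfolded seqcomp_def, rule_format, of b] by blast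
      have inv: "(\<lambda>n. 1 / real (Suc (r n))) \<longlonglongrightarrow> 0"
        using LIMSEQ_subseq_LIMSEQ[OF LIMSEQ_inverse_real_of_nat r(1)] by (simp add: o_def inverse_eq_divide)
      have al: "(\<lambda>n. a (r n) i) \<longlonglongrightarrow> l i" if i: "i \<in> X" for i
      proof -
        have bd: "\<bar>a (r n) i - b (r n) i\<bar> \<le> 1 / real (Suc (r n))" for n
        proof -
          have "\<bar>a (r n) i - b (r n) i\<bar> \<le> \<bar>(fst (q (r n)) + snd (q (r n))) i - fst (q (r n)) i\<bar>"
            unfolding a_def b_def cl_def by (rule clamp1_lip)
          also have "\<dots> = \<bar>snd (q (r n)) i\<bar>" by simp
          also have "\<dots> \<le> l1 X (snd (q (r n)))" by (rule abs_le_l1[OF X i])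
          also have "\<dots> \<le> 1 / real (Suc (r n))" using q(1)[of "r n"] by simp
          finally show ?thesis .
        qed
        have "(\<lambda>n. a (r n) i - b (r n) i) \<longlonglongrightarrow> 0"
          by (rule Lim_null_comparison[OF _ inv]) (use bd in simp)
        from tendsto_add[OF this r(3)[rule_format, OF i]] show ?thesis by simp
      qed
      have "(\<lambda>n. U (a (r n))) \<longlonglongrightarrow> U l" using al cl r(2) by (intro seqcont_D[OF U]) (auto simp: a_def)
      moreover have "(\<lambda>n. U (b (r n))) \<longlonglongrightarrow> U l" using r(2,3) cl by (intro seqcont_D[OF U]) (auto simp: b_def)
      ultimately have "(\<lambda>n. \<bar>U (a (r n)) - U (b (r n))\<bar>) \<longlonglongrightarrow> \<bar>U l - U l\<bar>" by (intro tendsto_intros)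
      then have "e \<le> \<bar>U l - U l\<bar>" using q(2) by (intro LIMSEQ_le_const) (auto simp: a_def b_def intro: less_imp_le)
      then show False using e(1) by simp
    qed
  qed
qed

lemma mz_simplex: "finite X \<Longrightarrow> X \<noteq> {} \<Longrightarrow> mz X z \<in> psimplex X"
  and mz_pos: "finite X \<Longrightarrow> X \<noteq> {} \<Longrightarrow> 0 < mz X z i"
proof -
  assume X: "finite X" "X \<noteq> {}"
  have N: "expsum X z > 0" by (rule expsum_pos[OF X])
  then show "0 < mz X z i" by (simp add: mz_def)
  have "(\<Sum>i\<in>X. mz X z i) = 1" using N unfolding mz_def sum_divide_distrib[symmetric] expsum_def by simp
  then show "mz X z \<in> psimplex X" using N by (simp add: psimplex_def mz_def)
qed

lemma homog_dep:
  assumes dep: "\<And>m m'. (\<forall>i\<in>X. m i = m' i) \<Longrightarrow> u m = u m'" and eq: "\<And>i. i \<in> X \<Longrightarrow> z i = z' i"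
  shows "homog X u z = homog X u z'"
proof -
  have "expsum X z = expsum X z'" unfolding expsum_def using eq by simp
  moreover from this have "u (mz X z) = u (mz X z')" using eq by (intro dep) (simp add: mz_def)
  ultimately show ?thesis by (simp add: homog_def)
qed

lemma seqcont_homog:
  assumes X: "finite X" "X \<noteq> {}" and u: "seqcont X (psimplex X) u"
  shows "seqcont X B (homog X u)"
  unfolding seqcont_def
proof (intro allI impI)
  fix s :: "nat \<Rightarrow> 'a \<Rightarrow> real" and l assume s: "\<forall>i\<in>X. (\<lambda>n. s n i) \<longlonglongrightarrow> l i"
  have e: "(\<lambda>n. expsum X (s n)) \<longlonglongrightarrow> expsum X l" unfolding expsum_def using s by (intro tendsto_intros) auto
  have "(\<lambda>n. mz X (s n) i) \<longlonglongrightarrow> mz X l i" if "i \<in> X" for i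
    unfolding mz_def using e s that expsum_pos[OF X, of l] by (intro tendsto_intros) auto
  then have "(\<lambda>n. u (mz X (s n))) \<longlonglongrightarrow> u (mz X l)" by (intro seqcont_D[OF u] mz_simplex[OF X])
  then show "(\<lambda>n. homog X u (s n)) \<longlonglongrightarrow> homog X u l" unfolding homog_def using e by (intro tendsto_intros)
qed

text \<open>\<open>homog_superjet\<close> needs some l with value rb on the centred direction. If
  \<rho> is not constant on X, a multiple of \<open>\<rho> - rb\<close> works. If it is constant,
  only rb = 0 is possible, and this is ensured by normalising \<rho> to mean 0 at one reference
  point z0.\<close>

lemma homog_local_subsol:
  assumes X: "finite X" "X \<noteq> {}"
    and dep: "\<And>m m'. (\<forall>i\<in>X. m i = m' i) \<Longrightarrow> u m = u m'"
    and sub: "\<And>z p P. z \<in> cube X zb R \<Longrightarrow> rsup X u (mz X z) p P \<Longrightarrow>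
      - K \<le> (\<Sum>i\<in>X. \<Sum>j\<in>X. (\<rho> i - (\<Sum>k\<in>X. \<rho> k * mz X z k)) * (\<rho> j - (\<Sum>k\<in>X. \<rho> k * mz X z k)) * P i j) / 2"
    and zm: "(\<Sum>k\<in>X. \<rho> k * mz X z0 k) = 0"
  shows "local_subsol X zb R \<rho> K (\<lambda>z. homog X u (\<lambda>i. clamp1 (zb i) R (z i)))"
  unfolding local_subsol_def
proof (intro allI impI)
  fix z \<phi> p Q
  assume z: "\<forall>i\<in>X. \<bar>z i - zb i\<bar> < R" and j: "jet2 X \<phi> z p Q"
    and ev: "\<forall>\<^sub>F \<zeta> in nz X. homog X u (\<lambda>i. clamp1 (zb i) R ((z + \<zeta>) i)) - homog X u (\<lambda>i. clamp1 (zb i) R (z i)) \<le> \<phi> (z + \<zeta>) - \<phi> z"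
  have N: "expsum X z > 0" by (rule expsum_pos[OF X])
  have zc: "z \<in> cube X zb R" using z by (auto simp: cube_def intro: less_imp_le)
  have hz: "homog X u (\<lambda>i. clamp1 (zb i) R (z i)) = homog X u z"
    using z by (intro homog_dep[OF dep]) (auto intro!: clamp1_eq less_imp_le)
  have "eventually (\<lambda>\<zeta>. \<forall>i\<in>X. \<bar>z i + \<zeta> i - zb i\<bar> < R) (nz X)"
  proof (rule eventually_ball_finite[OF X(1)], rule ballI)
    fix i assume i: "i \<in> X"
    have "((\<lambda>\<zeta>. \<bar>z i + \<zeta> i - zb i\<bar>) \<longlongrightarrow> \<bar>z i + 0 - zb i\<bar>) (nz X)" by (intro tendsto_intros coord_tendsto_nz X i)
    then show "eventually (\<lambda>\<zeta>. \<bar>z i + \<zeta> i - zb i\<bar> < R) (nz X)" using z i by (intro order_tendstoD(2)) auto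
  qed
  with ev have touch: "\<forall>\<^sub>F \<zeta> in nz X. homog X u (z + \<zeta>) - homog X u z \<le> \<phi> (z + \<zeta>) - \<phi> z"
  proof eventually_elim
    case (elim \<zeta>)
    have "homog X u (\<lambda>i. clamp1 (zb i) R ((z + \<zeta>) i)) = homog X u (z + \<zeta>)"
      using elim(2) by (intro homog_dep[OF dep]) (auto intro!: clamp1_eq less_imp_le)
    then show ?case using elim(1) hz by simp
  qed
  define rb where "rb = (\<Sum>k\<in>X. \<rho> k * mz X z k)"
  define S where "S = (\<Sum>i\<in>X. (\<rho> i - rb)\<^sup>2)"
  define l where "l i = rb * (\<rho> i - rb) / S" for i
  have l: "(\<Sum>i\<in>X. l i * (\<rho> i - rb)) = rb"
  proof (cases "S = 0")
    case True
    then have "\<rho> i = rb" if "i \<in> X" for i using that X(1) unfolding S_def by (simp add: sum_nonneg_eq_0_iff)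
    then have "rb * (\<Sum>k\<in>X. mz X z0 k) = 0" using zm by (simp add: sum_distrib_left)
    then have "rb = 0" using mz_simplex[OF X, of z0] by (simp add: psimplex_def)
    then show ?thesis by (simp add: l_def)
  next
    case False
    have "(\<Sum>i\<in>X. l i * (\<rho> i - rb)) = rb / S * (\<Sum>i\<in>X. (\<rho> i - rb)\<^sup>2)"
      unfolding sum_distrib_left l_def by (intro sum.cong refl) (simp add: power2_eq_square)
    then show ?thesis using False unfolding S_def[symmetric] by simp
  qed
  obtain p' P' where P': "rsup X u (mz X z) p' P'"
     "expsum X z * ((\<Sum>i\<in>X. \<Sum>j\<in>X. (\<rho> i - rb) * (\<rho> j - rb) * P' i j) / 2) = gen X \<rho> p Q"
    using homog_superjet[OF X j touch dep rb_def[symmetric] l] by blast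
  have "- K \<le> (\<Sum>i\<in>X. \<Sum>j\<in>X. (\<rho> i - rb) * (\<rho> j - rb) * P' i j) / 2"
    unfolding rb_def by (rule sub[OF zc P'(1)])
  then have "expsum X z * (- K) \<le> expsum X z * ((\<Sum>i\<in>X. \<Sum>j\<in>X. (\<rho> i - rb) * (\<rho> j - rb) * P' i j) / 2)"
    using N by (intro mult_left_mono) auto
  then show "- K * expsum X z \<le> gen X \<rho> p Q" unfolding P'(2) by (simp add: mult.commute)
qed

text \<open>In the box each weight changes by a factor between \<open>exp (- R)\<close> and
  \<open>exp R\<close>, and so does the total mass, which is 1 at the centre. The quotients change
  by factors of at most \<open>exp (2 * R)\<close>, and R is chosen to keep this below 1 +
  d.\<close>

lemma mz_near:
  assumes X: "finite X" "X \<noteq> {}" and mb: "mb \<in> psimplex X" "\<And>i. i \<in> X \<Longrightarrow> 0 < mb i" and d: "0 < d"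
  shows "\<exists>R>0. \<forall>z\<in>cube X (\<lambda>i. ln (mb i)) R. \<forall>i\<in>X. \<bar>mz X z i - mb i\<bar> < d"
proof -
  define R where "R = ln (1 + d) / 4"
  have R: "0 < R" using d by (simp add: R_def)
  have "\<bar>mz X z i - mb i\<bar> < d" if z: "z \<in> cube X (\<lambda>i. ln (mb i)) R" and i: "i \<in> X" for z i
  proof -
    have zi: "mb k * exp (- R) \<le> exp (z k)" "exp (z k) \<le> mb k * exp R" if "k \<in> X" for k
    proof -
      have "\<bar>z k - ln (mb k)\<bar> \<le> R" using z that by (simp add: cube_def)
      then have "exp (ln (mb k) + - R) \<le> exp (z k)" "exp (z k) \<le> exp (ln (mb k) + R)" unfolding exp_le_cancel_iff by linarith+
      then show "mb k * exp (- R) \<le> exp (z k)" "exp (z k) \<le> mb k * exp R" using mb(2)[OF that] by (simp_all only: exp_add exp_ln)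
    qed
    have s1: "(\<Sum>i\<in>X. mb i) = 1" using mb(1) by (simp add: psimplex_def)
    have N: "exp (- R) \<le> expsum X z" "expsum X z \<le> exp R"
    proof -
      have "(\<Sum>i\<in>X. mb i * exp (- R)) \<le> expsum X z" "expsum X z \<le> (\<Sum>i\<in>X. mb i * exp R)"
        unfolding expsum_def using zi by (auto intro: sum_mono)
      then show "exp (- R) \<le> expsum X z" "expsum X z \<le> exp R"
        unfolding sum_distrib_right[symmetric] s1 by auto
    qed
    have Np: "0 < expsum X z" by (rule expsum_pos[OF X])
    have mi: "0 < mb i" "mb i \<le> 1" using mb(2)[OF i] simplex_le_1[OF X(1) mb(1) i] by auto
    have e2: "exp (2 * R) < 1 + d"
    proof -
      have "2 * R < ln (1 + d)" using R unfolding R_def by linarith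
      then have "exp (2 * R) < exp (ln (1 + d))" by simp
      then show ?thesis using d by simp
    qed
    have "mz X z i \<le> mb i * exp R / exp (- R)" unfolding mz_def
      using zi(2)[OF i] N Np mi by (intro frac_le) auto
    also have "\<dots> = mb i * exp (2 * R)" by (simp add: exp_minus field_simps exp_add[symmetric])
    finally have up: "mz X z i \<le> mb i * exp (2 * R)" .
    have "mb i * exp (- R) / exp R \<le> mz X z i" unfolding mz_def
      using zi(1)[OF i] N Np mi by (intro frac_le) auto
    moreover have "mb i * exp (- R) / exp R = mb i * exp (- (2 * R))" by (simp add: exp_minus field_simps exp_add[symmetric])
    ultimately have lo: "mb i * exp (- (2 * R)) \<le> mz X z i" by simp
    have "mb i * exp (2 * R) - mb i \<le> exp (2 * R) - 1"
      using mult_right_mono[of "mb i" 1 "exp (2 * R) - 1"] mi R by (simp add: algebra_simps)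
    moreover have "mb i - mb i * exp (- (2 * R)) \<le> exp (2 * R) - 1"
    proof -
      have "mb i - mb i * exp (- (2 * R)) \<le> 1 - exp (- (2 * R))"
        using mult_right_mono[of "mb i" 1 "1 - exp (- (2 * R))"] mi R by (simp add: algebra_simps)
      moreover have "1 - exp (- (2 * R)) \<le> exp (2 * R) - 1"
      proof -
        have "1 + 2 * R \<le> exp (2 * R)" "1 + (- (2 * R)) \<le> exp (- (2 * R))" by (rule exp_ge_add_one_self)+
        then show ?thesis by linarith
      qed
      ultimately show ?thesis by linarith
    qed
    ultimately show ?thesis using up lo e2 by linarith
  qed
  then show ?thesis using R by blast
qed

lemma kap_ge_1: "0 < \<epsilon> \<Longrightarrow> 1 \<le> kap \<epsilon>"
  unfolding kap_def using exp_ge_add_one_self[of \<epsilon>] by (simp add: field_simps)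

lemma kap_tendsto: "(kap \<longlongrightarrow> 1) (at_right 0)"
  unfolding kap_def[abs_def] by real_asymp

text \<open>Division by \<open>kap \<epsilon> ^ 4\<close> undoes the factor that mollification puts
  on the right-hand side of the subsolution inequality. One half of \<eta> pays for the averaging,
  the other for this factor, which tends to 1.\<close>

lemma mollified_approx:
  assumes X: "finite X" and V: "ucont X V" and xs: "distinct xs" "set xs = X" and R: "0 < R" and \<eta>: "0 < \<eta>"
  shows "\<exists>\<epsilon>>0. 4 * (\<epsilon> * real (length xs)) \<le> R \<and> (\<forall>z. \<bar>(steklovs \<epsilon> xs ^^ 4) V z / kap \<epsilon> ^ 4 - V z\<bar> \<le> \<eta>)"
proof -
  obtain S where S: "S > 0" "\<And>z. \<bar>V z\<bar> \<le> S" using ucont_bound[OF V] by blast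
  obtain d where d: "d > 0" "\<And>z \<zeta>. l1 X \<zeta> < d \<Longrightarrow> \<bar>V (z + \<zeta>) - V z\<bar> \<le> \<eta> / 2"
    using ucont_modulus[OF V, of "\<eta> / 2"] \<eta> by auto
  define L where "L = real (card X) + 1"
  have L: "L > 0" "real (card X) \<le> L" "real (length xs) \<le> L" using distinct_card[OF xs(1)] xs(2) by (auto simp: L_def)
  have "((\<lambda>\<epsilon>. 1 - 1 / kap \<epsilon> ^ 4) \<longlongrightarrow> 1 - 1 / 1 ^ 4) (at_right 0)"
    by (intro tendsto_intros kap_tendsto) auto
  then have "eventually (\<lambda>\<epsilon>. 1 - 1 / kap \<epsilon> ^ 4 < \<eta> / (2 * S)) (at_right 0)"
    using \<eta> S(1) by (intro order_tendstoD(2)) auto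
  then obtain e0 where e0: "e0 > 0" "\<And>\<epsilon>. 0 < \<epsilon> \<Longrightarrow> \<epsilon> < e0 \<Longrightarrow> 1 - 1 / kap \<epsilon> ^ 4 < \<eta> / (2 * S)"
    unfolding eventually_at_right_field by blast
  define \<epsilon> where "\<epsilon> = Min {e0 / 2, d / (8 * L * L), R / (4 * L)}"
  have \<epsilon>: "0 < \<epsilon>" "\<epsilon> < e0" "\<epsilon> \<le> d / (8 * L * L)" "\<epsilon> \<le> R / (4 * L)"
    using e0(1) d(1) L(1) R by (auto simp: \<epsilon>_def min_less_iff_disj)
  have r1: "4 * (\<epsilon> * real (length xs)) \<le> R"
  proof -
    have "4 * (\<epsilon> * real (length xs)) \<le> 4 * (\<epsilon> * L)" using L \<epsilon> by (intro mult_left_mono) auto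
    also have "\<dots> \<le> R" using \<epsilon>(4) L(1) by (simp add: field_simps)
    finally show ?thesis .
  qed
  have "\<bar>(steklovs \<epsilon> xs ^^ 4) V z / kap \<epsilon> ^ 4 - V z\<bar> \<le> \<eta>" for z
  proof -
    have "avg X (\<epsilon> * real (length xs)) (steklovs \<epsilon> xs)" using avg_steklovs[OF X, of \<epsilon> xs] \<epsilon> xs by simp
    then have av: "avg X (real 4 * (\<epsilon> * real (length xs))) (steklovs \<epsilon> xs ^^ 4)" using \<epsilon> by (intro avg_funpow) auto
    have cl: "\<bar>(steklovs \<epsilon> xs ^^ 4) V z - V z\<bar> \<le> \<eta> / 2"
    proof (rule avg_close[OF av V])
      fix v assume v: "\<forall>i\<in>X. \<bar>v i\<bar> \<le> real 4 * (\<epsilon> * real (length xs))"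
      have "l1 X v \<le> real (card X) * (real 4 * (\<epsilon> * real (length xs)))" using v by (intro l1_bound[OF X]) auto
      also have "\<dots> \<le> L * (4 * (\<epsilon> * L))" using L \<epsilon> by (intro mult_mono mult_left_mono) auto
      also have "\<dots> \<le> d / 2" using \<epsilon>(3) L(1) by (simp add: field_simps)
      also have "\<dots> < d" using d(1) by simp
      finally show "\<bar>V (z + v) - V z\<bar> \<le> \<eta> / 2" by (rule d(2))
    qed
    define k where "k = kap \<epsilon> ^ 4"
    have k: "1 \<le> k" unfolding k_def using kap_ge_1[OF \<epsilon>(1)] by (rule one_le_power)
    define F where "F = (steklovs \<epsilon> xs ^^ 4) V z"
    have "F / k - V z = (F - V z) / k - (1 - 1 / k) * V z" using k by (simp add: field_simps)
    moreover have "\<bar>(F - V z) / k\<bar> \<le> \<eta> / 2"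
    proof -
      have "\<bar>(F - V z) / k\<bar> \<le> \<bar>F - V z\<bar> / 1" unfolding abs_divide using k by (intro divide_left_mono) auto
      then show ?thesis using cl unfolding F_def[symmetric] div_by_1 by (rule order_trans)
    qed
    moreover have "\<bar>(1 - 1 / k) * V z\<bar> \<le> \<eta> / 2"
    proof -
      have "0 \<le> 1 - 1 / k" using k by simp
      then have "\<bar>(1 - 1 / k) * V z\<bar> \<le> \<eta> / (2 * S) * S"
        unfolding abs_mult using S e0(2)[OF \<epsilon>(1,2)] unfolding k_def[symmetric] by (intro mult_mono) auto
      then show ?thesis using S(1) by simp
    qed
    ultimately show ?thesis unfolding F_def[symmetric] k_def[symmetric] by argo
  qed
  then show ?thesis using \<epsilon>(1) r1 by blast
qed

lemma quad_penalty:
  fixes x :: "'i \<Rightarrow> real"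
  assumes X: "finite X"
  shows "(\<Sum>i\<in>X. \<Sum>j\<in>X. x i * x j * (- (P i j / k) + (if i = j then 2 * e * (m i)\<^sup>2 else 0))) / 2
    = - ((\<Sum>i\<in>X. \<Sum>j\<in>X. x i * x j * P i j) / 2 / k) + e * (\<Sum>i\<in>X. (x i)\<^sup>2 * (m i)\<^sup>2)"
proof -
  have "(\<Sum>j\<in>X. x i * x j * (- (P i j / k) + (if i = j then 2 * e * (m i)\<^sup>2 else 0)))
      = - ((\<Sum>j\<in>X. x i * x j * P i j) / k) + 2 * e * ((x i)\<^sup>2 * (m i)\<^sup>2)" if "i \<in> X" for i
  proof -
    have "(\<Sum>j\<in>X. x i * x j * (- (P i j / k) + (if i = j then 2 * e * (m i)\<^sup>2 else 0)))
       = (\<Sum>j\<in>X. - (x i * x j * P i j / k) + (if i = j then 2 * e * ((x i)\<^sup>2 * (m i)\<^sup>2) else 0))"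
      by (intro sum.cong refl) (simp add: power2_eq_square algebra_simps)
    also have "\<dots> = - ((\<Sum>j\<in>X. x i * x j * P i j) / k) + 2 * e * ((x i)\<^sup>2 * (m i)\<^sup>2)"
      using X that unfolding sum.distrib sum_negf sum_divide_distrib by simp
    finally show ?thesis .
  qed
  then have "(\<Sum>i\<in>X. \<Sum>j\<in>X. x i * x j * (- (P i j / k) + (if i = j then 2 * e * (m i)\<^sup>2 else 0)))
      = (\<Sum>i\<in>X. - ((\<Sum>j\<in>X. x i * x j * P i j) / k) + 2 * e * ((x i)\<^sup>2 * (m i)\<^sup>2))" by (rule sum.cong[OF refl])
  also have "\<dots> = - ((\<Sum>i\<in>X. \<Sum>j\<in>X. x i * x j * P i j) / k) + 2 * e * (\<Sum>i\<in>X. (x i)\<^sup>2 * (m i)\<^sup>2)"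
    unfolding sum.distrib sum_negf sum_divide_distrib[symmetric] sum_distrib_left[symmetric] ..
  finally show ?thesis by simp
qed

text \<open>The mollified lift, divided by k, is uniformly close to V, which equals u on the part of
  the simplex near mb. Where its difference to w, minus a small square, is maximal, it touches w
  from below up to a constant, and the supersolution property supplies one r. The subsolution
  property for this same r bounds the generator of the mollified lift from below at the same point.
  Combining the two leaves only errors of order e.\<close>

lemma simplex_comparison:
  fixes u w :: "('i \<Rightarrow> real) \<Rightarrow> real" and c :: "('i \<Rightarrow> real) \<Rightarrow> 'r \<Rightarrow> ereal" and \<rho> :: "'r \<Rightarrow> 'i \<Rightarrow> real"
  assumes X: "finite X" "X \<noteq> {}" and mb: "mb \<in> psimplex X" "\<And>i. i \<in> X \<Longrightarrow> 0 < mb i"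
    and uc: "seqcont X (psimplex X) u" and wc: "seqcont X (psimplex X) w"
    and du: "\<And>m m'. (\<forall>i\<in>X. m i = m' i) \<Longrightarrow> u m = u m'" and dw: "\<And>m m'. (\<forall>i\<in>X. m i = m' i) \<Longrightarrow> w m = w m'"
    and max: "\<And>m. m \<in> psimplex X \<Longrightarrow> u m - w m \<le> u mb - w mb"
    and \<beta>: "0 < \<beta>"
    and Hsub: "\<And>m p P r. m \<in> psimplex X \<Longrightarrow> (\<And>i. i \<in> X \<Longrightarrow> 0 < m i) \<Longrightarrow> rsup X u m p P \<Longrightarrow> r \<in> Hs \<Longrightarrow>
       ereal (\<beta> * u m) \<le> c m r + ereal ((\<Sum>i\<in>X. \<Sum>j\<in>X. (\<rho> r i - (\<Sum>k\<in>X. \<rho> r k * m k)) * (\<rho> r j - (\<Sum>k\<in>X. \<rho> r k * m k)) * P i j) / 2)"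
    and Hsup: "\<And>m p P e. m \<in> psimplex X \<Longrightarrow> (\<And>i. i \<in> X \<Longrightarrow> 0 < m i) \<Longrightarrow> rsup X (\<lambda>m. - w m) m p P \<Longrightarrow> 0 < e \<Longrightarrow>
       \<exists>r\<in>Hs. c m r - ereal ((\<Sum>i\<in>X. \<Sum>j\<in>X. (\<rho> r i - (\<Sum>k\<in>X. \<rho> r k * m k)) * (\<rho> r j - (\<Sum>k\<in>X. \<rho> r k * m k)) * P i j) / 2)
          \<le> ereal (\<beta> * w m + e)"
    and Hc: "\<And>e. 0 < e \<Longrightarrow> \<exists>d>0. \<forall>m\<in>psimplex X. (\<forall>i\<in>X. \<bar>m i - mb i\<bar> < d) \<longrightarrow>
        (\<forall>r\<in>Hs. c m r = c mb r \<or> \<bar>c m r - c mb r\<bar> < ereal e)"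
    and cfin: "\<And>r. r \<in> Hs \<Longrightarrow> c mb r \<noteq> -\<infinity>"
    and bound: "\<And>r i. r \<in> Hs \<Longrightarrow> i \<in> X \<Longrightarrow> \<bar>\<rho> r i\<bar> \<le> B"
  shows "u mb \<le> w mb"
proof -
  \<comment> \<open>Of the three plain e, two come from moving the cost between mb and nearby points
    and one from the near optimality of r. The part \<open>2 * \<beta>\<close> comes from the
    oscillation of u and w, and \<open>4 * B\<^sup>2\<close> from the square penalty.\<close>
  have key: "\<beta> * u mb \<le> \<beta> * w mb + (3 + 2 * \<beta> + 4 * B\<^sup>2) * e" if e: "0 < e" for e
  proof -
    have near: "\<exists>d>0. \<forall>m\<in>psimplex X. (\<forall>i\<in>X. \<bar>m i - mb i\<bar> < d) \<longrightarrow> \<bar>f m - f mb\<bar> \<le> e"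
      if f: "seqcont X (psimplex X) f" for f
    proof (rule ccontr)
      assume "\<not> ?thesis"
      then have "\<exists>m. m \<in> psimplex X \<and> (\<forall>i\<in>X. \<bar>m i - mb i\<bar> < 1 / real (Suc n)) \<and> e < \<bar>f m - f mb\<bar>" for n
        by (auto simp: not_le elim!: allE[of _ "1 / real (Suc n)"])
      then obtain s where s: "\<And>n. s n \<in> psimplex X" "\<And>n i. i \<in> X \<Longrightarrow> \<bar>s n i - mb i\<bar> < 1 / real (Suc n)" "\<And>n. e < \<bar>f (s n) - f mb\<bar>"
        using choice[of "\<lambda>n m. m \<in> psimplex X \<and> (\<forall>i\<in>X. \<bar>m i - mb i\<bar> < 1 / real (Suc n)) \<and> e < \<bar>f m - f mb\<bar>"] by blast
      have "(\<lambda>n. s n i) \<longlonglongrightarrow> mb i" if "i \<in> X" for i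
      proof -
        have "(\<lambda>n. s n i - mb i) \<longlonglongrightarrow> 0"
        proof (rule Lim_null_comparison[of _ "\<lambda>n. 1 / real (Suc n)"])
          show "\<forall>\<^sub>F n in sequentially. norm (s n i - mb i) \<le> 1 / real (Suc n)"
            using s(2)[OF that] by (intro always_eventually allI) (simp only: real_norm_def less_imp_le)
          show "(\<lambda>n. 1 / real (Suc n)) \<longlonglongrightarrow> 0" using LIMSEQ_inverse_real_of_nat by (simp only: inverse_eq_divide)
        qed
        then show ?thesis by (simp add: LIM_zero_iff)
      qed
      then have "(\<lambda>n. f (s n)) \<longlonglongrightarrow> f mb" using s(1) mb(1) by (intro seqcont_D[OF f])
      then have "(\<lambda>n. \<bar>f (s n) - f mb\<bar>) \<longlonglongrightarrow> \<bar>f mb - f mb\<bar>" by (intro tendsto_intros)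
      then have "e \<le> \<bar>f mb - f mb\<bar>" using s(3) by (intro LIMSEQ_le_const) (auto intro: less_imp_le)
      then show False using e by simp
    qed
    obtain d1 where d1: "d1 > 0" "\<And>m. m \<in> psimplex X \<Longrightarrow> (\<And>i. i \<in> X \<Longrightarrow> \<bar>m i - mb i\<bar> < d1) \<Longrightarrow> \<bar>u m - u mb\<bar> \<le> e"
      using near[OF uc] by blast
    obtain d2 where d2: "d2 > 0" "\<And>m. m \<in> psimplex X \<Longrightarrow> (\<And>i. i \<in> X \<Longrightarrow> \<bar>m i - mb i\<bar> < d2) \<Longrightarrow> \<bar>w m - w mb\<bar> \<le> e"
      using near[OF wc] by blast
    obtain d3 where d3: "d3 > 0" "\<And>m r. m \<in> psimplex X \<Longrightarrow> (\<And>i. i \<in> X \<Longrightarrow> \<bar>m i - mb i\<bar> < d3) \<Longrightarrow> r \<in> Hs \<Longrightarrow>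
        c m r = c mb r \<or> \<bar>c m r - c mb r\<bar> < ereal e"
      using Hc[OF e] by blast
    define d where "d = min d1 (min d2 d3)"
    have d: "d > 0" "d \<le> d1" "d \<le> d2" "d \<le> d3" using d1(1) d2(1) d3(1) by (auto simp: d_def)
    define zb where "zb = (\<lambda>i. ln (mb i))"
    obtain R where R: "R > 0" "\<And>z i. z \<in> cube X zb R \<Longrightarrow> i \<in> X \<Longrightarrow> \<bar>mz X z i - mb i\<bar> < d"
      using mz_near[OF X mb d(1)] unfolding zb_def by blast
    define V where "V z = homog X u (\<lambda>i. clamp1 (zb i) R (z i))" for z
    have V: "ucont X V" unfolding V_def using R(1) by (intro ucont_clamped X seqcont_homog uc) auto
    obtain xs where xs: "distinct xs" "set xs = X" using finite_distinct_list[OF X(1)] by blast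
    have R4: "0 < R / 4" using R(1) by simp
    \<comment> \<open>A box in logarithmic coordinates, cut with the simplex: it is sequentially
      compact and its weights stay away from 0, so \<open>ln\<close> is continuous on it.\<close>
    define K where "K = {m \<in> psimplex X. \<forall>i\<in>X. mb i * exp (- (R / 4)) \<le> m i \<and> m i \<le> mb i * exp (R / 4)}"
    have Kpos: "0 < m i" if "m \<in> K" "i \<in> X" for m i
    proof -
      have "0 < mb i * exp (- (R / 4))" using mb(2)[OF that(2)] by simp
      then show ?thesis using that unfolding K_def by force
    qed
    have Kln: "\<bar>ln (m i) - zb i\<bar> \<le> R / 4" if "m \<in> K" "i \<in> X" for m i
    proof -
      have "mb i * exp (- (R / 4)) \<le> m i" "m i \<le> mb i * exp (R / 4)" using that by (auto simp: K_def)
      then have "ln (mb i * exp (- (R / 4))) \<le> ln (m i)" "ln (m i) \<le> ln (mb i * exp (R / 4))"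
        using mb(2)[OF that(2)] Kpos[OF that] by auto
      then have "ln (mb i) - R / 4 \<le> ln (m i)" "ln (m i) \<le> ln (mb i) + R / 4" using mb(2)[OF that(2)] by (simp_all add: ln_mult)
      then show ?thesis unfolding zb_def by linarith
    qed
    have lnK: "m \<in> K" if mS: "m \<in> psimplex X" and lm: "\<And>i. i \<in> X \<Longrightarrow> 0 < m i \<and> \<bar>ln (m i) - zb i\<bar> \<le> R / 4" for m
    proof -
      have "mb i * exp (- (R / 4)) \<le> m i \<and> m i \<le> mb i * exp (R / 4)" if i: "i \<in> X" for i
      proof -
        have "exp (ln (mb i) + - (R / 4)) \<le> exp (ln (m i))" "exp (ln (m i)) \<le> exp (ln (mb i) + R / 4)"
          using lm[OF i] unfolding zb_def exp_le_cancel_iff by linarith+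
        then show ?thesis using mb(2)[OF i] lm[OF i] by (simp only: exp_add exp_ln)
      qed
      then show ?thesis using mS by (simp add: K_def)
    qed
    have Kcube: "(\<lambda>i. ln (m i)) \<in> cube X zb (R / 4)" if "m \<in> K" for m
      using Kln[OF that] by (simp add: cube_def)
    have Kmz: "expsum X (\<lambda>i. ln (m i)) = 1" "\<And>i. i \<in> X \<Longrightarrow> mz X (\<lambda>i. ln (m i)) i = m i" if "m \<in> K" for m
    proof -
      have "expsum X (\<lambda>i. ln (m i)) = (\<Sum>i\<in>X. m i)" unfolding expsum_def using Kpos[OF that] by (intro sum.cong) auto
      then show 1: "expsum X (\<lambda>i. ln (m i)) = 1" using that by (simp add: K_def psimplex_def)
      show "mz X (\<lambda>i. ln (m i)) i = m i" if "i \<in> X" for i unfolding mz_def 1 using Kpos[OF \<open>m \<in> K\<close> that] by simp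
    qed
    have VK: "V (\<lambda>i. ln (m i)) = u m" if "m \<in> K" for m
    proof -
      have "V (\<lambda>i. ln (m i)) = homog X u (\<lambda>i. ln (m i))"
        unfolding V_def
      proof (intro homog_dep[OF du] clamp1_eq)
        fix i assume "i \<in> X"
        then show "\<bar>ln (m i) - zb i\<bar> \<le> R" using Kln[OF that, of i] R(1) by linarith
      qed simp_all
      also have "\<dots> = u m" unfolding homog_def Kmz(1)[OF that] using Kmz(2)[OF that] du[of "mz X (\<lambda>i. ln (m i))" m] by simp
      finally show ?thesis .
    qed
    define mu where "mu = Min (mb ` X)"
    have mu: "0 < mu" "\<And>i. i \<in> X \<Longrightarrow> mu \<le> mb i" using X mb(2) by (auto simp: mu_def)
    \<comment> \<open>A lower bound for the displacement of a coordinate that sits on a face of the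
      box. The lower faces decide, because \<open>1 - exp (- t) \<le> exp t - 1\<close>.\<close>
    define dd where "dd = mu * (1 - exp (- (R / 4)))"
    have dd: "0 < dd" using mu(1) R(1) by (simp add: dd_def)
    \<comment> \<open>On a face the penalty is at least \<open>4 * \<eta>\<close>, whereas replacing
      u by \<open>F / k\<close> at two points costs only \<open>2 * \<eta>\<close>; so the maximum
      is interior.\<close>
    define \<eta> where "\<eta> = e * dd\<^sup>2 / 4"
    have \<eta>: "0 < \<eta>" using e dd by (simp add: \<eta>_def)
    obtain \<epsilon> where \<epsilon>: "0 < \<epsilon>" "4 * (\<epsilon> * real (length xs)) \<le> R / 4"
        "\<And>z. \<bar>(steklovs \<epsilon> xs ^^ 4) V z / kap \<epsilon> ^ 4 - V z\<bar> \<le> \<eta>"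
      using mollified_approx[OF X(1) V xs R4 \<eta>] by blast
    define k where "k = kap \<epsilon> ^ 4"
    have k: "0 < k" unfolding k_def using kap_ge_1[OF \<epsilon>(1)] by (intro zero_less_power) linarith
    define F where "F = (steklovs \<epsilon> xs ^^ 4) V"
    \<comment> \<open>Four passes: two derivatives for the generator, and two more so that the
      generator is itself of class \<open>Ck X 2\<close>.\<close>
    have CkF: "Ck X (Suc (Suc 2)) F"
    proof -
      have "Ck X n ((steklovs \<epsilon> xs ^^ n) V)" for n
        by (induction n) (simp add: V, simp only: funpow.simps comp_apply, rule steklovs_Ck[OF X(1) \<epsilon>(1) _ xs])
      from this[of 4] show ?thesis unfolding F_def by (simp only: numeral_eq_Suc pred_numeral_simps BitM.simps)
    qed
    have uF: "ucont X F" by (rule Ck_ucont[OF CkF])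
    obtain G H where GH: "diff_on X X F G"
        "\<forall>i\<in>X. Ck X (Suc 2) (G i) \<and> diff_on X X (G i) (H i) \<and> (\<forall>j\<in>X. Ck X 2 (H i j))"
      using Ck2_derivs[OF CkF] by blast
    have GHs: "\<And>i. i \<in> X \<Longrightarrow> diff_on X X (G i) (H i)" "\<And>i j. i \<in> X \<Longrightarrow> j \<in> X \<Longrightarrow> Ck X 2 (H i j)"
      using GH(2) by auto
    have Ck_Suc: "Ck X n f" if "Ck X (Suc n) f" for n f
      using that by (induction n arbitrary: f) auto
    have G2: "\<And>i. i \<in> X \<Longrightarrow> Ck X 2 (G i)" using GH(2) Ck_Suc by blast
    define g where "g m = F (\<lambda>i. ln (m i)) / k - w m - e * (\<Sum>i\<in>X. (m i - mb i)\<^sup>2)" for m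
    have gc: "seqcont X K g"
      unfolding g_def
    proof (intro seqcont_diff seqcont_cmult)
      show "seqcont X K (\<lambda>m. F (\<lambda>i. ln (m i)) / k)"
        unfolding seqcont_def
      proof (intro allI impI)
        fix s l assume s: "range s \<subseteq> K" "l \<in> K" "\<forall>i\<in>X. (\<lambda>n. s n i) \<longlonglongrightarrow> l i"
        have "(\<lambda>n. ln (s n i)) \<longlonglongrightarrow> ln (l i)" if "i \<in> X" for i
          using s(3) Kpos[OF s(2) that] that by (intro tendsto_intros) auto
        then have "(\<lambda>n. F (\<lambda>i. ln (s n i))) \<longlonglongrightarrow> F (\<lambda>i. ln (l i))"
          by (intro seqcont_D[OF seqcont_ucont[OF uF X(1), of UNIV], where s = "\<lambda>n i. ln (s n i)"]) auto
        then show "(\<lambda>n. F (\<lambda>i. ln (s n i)) / k) \<longlonglongrightarrow> F (\<lambda>i. ln (l i)) / k" using k by (intro tendsto_intros) auto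
      qed
      show "seqcont X K w" using seqcont_subset[OF wc] by (auto simp: K_def)
      show "seqcont X K (\<lambda>m. \<Sum>i\<in>X. (m i - mb i)\<^sup>2)" by (intro seqcont_separable continuous_intros)
    qed
    have mbK: "mb \<in> K" using mb R(1) by (intro lnK) (auto simp: zb_def)
    have "seqcomp X K" unfolding K_def by (rule seqcomp_simplex_slice[OF X(1)])
    then obtain m where m: "m \<in> K" "\<And>y. y \<in> K \<Longrightarrow> g y \<le> g m"
      using seqcont_attains_sup[OF _ _ gc] mbK by blast
    have mS: "m \<in> psimplex X" using m(1) by (simp add: K_def)
    have int: "\<bar>ln (m i) - zb i\<bar> < R / 4" if i: "i \<in> X" for i
    proof (rule ccontr)
      assume "\<not> ?thesis"
      then have eq: "\<bar>ln (m i) - ln (mb i)\<bar> = R / 4" using Kln[OF m(1) i] by (simp add: zb_def)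
      have "dd \<le> \<bar>m i - mb i\<bar>"
      proof (cases "ln (m i) - ln (mb i) = R / 4")
        case True
        then have "exp (ln (m i)) = exp (ln (mb i) + R / 4)" by simp
        then have "m i = mb i * exp (R / 4)" using Kpos[OF m(1) i] mb(2)[OF i] by (simp only: exp_add exp_ln)
        then have "m i - mb i = mb i * (exp (R / 4) - 1)" by (simp add: algebra_simps)
        also have "\<dots> \<ge> mu * (1 - exp (- (R / 4)))"
        proof (rule mult_mono)
          have "1 + R / 4 \<le> exp (R / 4)" "1 + (- (R / 4)) \<le> exp (- (R / 4))" by (rule exp_ge_add_one_self)+
          then show "1 - exp (- (R / 4)) \<le> exp (R / 4) - 1" by linarith
        qed (use mu i mb(2)[OF i] R(1) in auto)
        finally show ?thesis unfolding dd_def by simp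
      next
        case False
        then have "ln (m i) = ln (mb i) + - (R / 4)" using eq by linarith
        then have "exp (ln (m i)) = exp (ln (mb i) + - (R / 4))" by simp
        then have "m i = mb i * exp (- (R / 4))" using Kpos[OF m(1) i] mb(2)[OF i] by (simp only: exp_add exp_ln)
        then have "mb i - m i = mb i * (1 - exp (- (R / 4)))" by (simp add: algebra_simps)
        also have "\<dots> \<ge> mu * (1 - exp (- (R / 4)))" using mu(2)[OF i] R(1) by (intro mult_right_mono) auto
        finally show ?thesis unfolding dd_def by simp
      qed
      then have "dd\<^sup>2 \<le> (m i - mb i)\<^sup>2" using power_mono[of dd "\<bar>m i - mb i\<bar>" 2] dd by simp
      also have "\<dots> \<le> (\<Sum>i\<in>X. (m i - mb i)\<^sup>2)" using X i by (intro member_le_sum) auto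
      finally have "e * dd\<^sup>2 \<le> e * (\<Sum>i\<in>X. (m i - mb i)\<^sup>2)" using e by simp
      then have p1: "4 * \<eta> \<le> e * (\<Sum>i\<in>X. (m i - mb i)\<^sup>2)" by (simp add: \<eta>_def)
      have "g mb \<ge> u mb - w mb - \<eta>"
        unfolding g_def using \<epsilon>(3)[of "\<lambda>i. ln (mb i)"] VK[OF mbK] by (simp add: F_def k_def abs_le_iff)
      moreover have "g m \<le> u m - w m + \<eta> - 4 * \<eta>"
        unfolding g_def using \<epsilon>(3)[of "\<lambda>i. ln (m i)"] VK[OF m(1)] p1 by (simp add: F_def k_def abs_le_iff)
      ultimately show False using m(2)[OF mbK] max[OF mS] \<eta> by linarith
    qed
    define z where "z = (\<lambda>i. ln (m i))"
    have zc: "z \<in> cube X zb (R / 4)" unfolding z_def by (rule Kcube[OF m(1)])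
    have zR: "z \<in> cube X zb R" using cube_mono[OF zc] R(1) by simp
    have mzm: "\<And>i. i \<in> X \<Longrightarrow> mz X z i = m i" "expsum X z = 1" unfolding z_def using Kmz[OF m(1)] by auto
    have mnear: "\<bar>m i - mb i\<bar> < d" if "i \<in> X" for i using R(2)[OF zR that] mzm(1)[OF that] by simp
    define P where "P i j = H i j z - (if i = j then G i z else 0)" for i j
    \<comment> \<open>Gradient and Hessian of the penalty minus \<open>F / k\<close> in the
      multiplicative perturbation x of m. F enters through \<open>log_jet\<close>, so P already
      contains the logarithmic correction.\<close>
    define p' where "p' i = - (G i z / k) + 2 * e * (m i * (m i - mb i))" for i
    define P' where "P' i j = - (P i j / k) + (if i = j then 2 * e * (m i)\<^sup>2 else 0)" for i j
    define A where "A x = F (z + (\<lambda>i. ln (1 + x i))) - F z - (\<Sum>i\<in>X. x i * G i z) - (\<Sum>i\<in>X. \<Sum>j\<in>X. x i * x j * P i j) / 2" for x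
    have Ao: "A \<in> o[nz X](\<lambda>x. (l1 X x)\<^sup>2)"
      unfolding A_def P_def by (rule log_jet[OF X(1) jet2_taylor[OF X(1) GH(1) GHs(1)]])
    have rs: "rsup X (\<lambda>m. - w m) m p' P'"
      unfolding rsup_def
    proof (intro exI[of _ "\<lambda>x. - (A x / k)"] conjI)
      show "(\<lambda>x. - (A x / k)) \<in> o[nz X](\<lambda>x. (l1 X x)\<^sup>2)" using Ao k by simp
      have "eventually (\<lambda>x. \<forall>i\<in>X. -1 < x i \<and> \<bar>ln (m i * (1 + x i)) - zb i\<bar> < R / 4) (nz X)"
      proof (rule eventually_ball_finite[OF X(1)], rule ballI, rule eventually_conj)
        fix i assume i: "i \<in> X"
        show "\<forall>\<^sub>F x in nz X. - 1 < x i" using coord_tendsto_nz[OF X(1) i] by (rule order_tendstoD(1)) simp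
        have "((\<lambda>x. \<bar>ln (m i * (1 + x i)) - zb i\<bar>) \<longlongrightarrow> \<bar>ln (m i * (1 + 0)) - zb i\<bar>) (nz X)"
          using Kpos[OF m(1) i] by (intro tendsto_intros coord_tendsto_nz X i) auto
        then show "\<forall>\<^sub>F x in nz X. \<bar>ln (m i * (1 + x i)) - zb i\<bar> < R / 4" using int[OF i] by (intro order_tendstoD(2)) auto
      qed
      then show "\<forall>\<^sub>F x in nz X. (\<Sum>i\<in>X. m i * x i) = 0 \<longrightarrow>
         - w (\<lambda>i. m i * (1 + x i)) \<le> - w m + (\<Sum>i\<in>X. x i * p' i) + (\<Sum>i\<in>X. \<Sum>j\<in>X. x i * x j * P' i j) / 2 + - (A x / k)"
      proof eventually_elim
        case (elim x)
        show ?case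
        proof
          assume x0: "(\<Sum>i\<in>X. m i * x i) = 0"
          let ?m = "\<lambda>i. m i * (1 + x i)"
          have pos: "0 < ?m i" if "i \<in> X" for i using elim Kpos[OF m(1)] that by force
          have mK: "?m \<in> K"
          proof (rule lnK)
            have "(\<Sum>i\<in>X. ?m i) = 1" using x0 mS by (simp add: distrib_left sum.distrib psimplex_def)
            then show "?m \<in> psimplex X" using pos by (auto simp: psimplex_def intro: less_imp_le)
            show "0 < ?m i \<and> \<bar>ln (?m i) - zb i\<bar> \<le> R / 4" if "i \<in> X" for i using pos[OF that] elim that by (auto intro: less_imp_le)
          qed
          have Feq: "F (\<lambda>i. ln (?m i)) = F (z + (\<lambda>i. ln (1 + x i)))"
          proof (rule ucont_dep[OF uF])
            fix i assume i: "i \<in> X"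
            then have "0 < 1 + x i" using elim by force
            then show "ln (?m i) = (z + (\<lambda>i. ln (1 + x i))) i" using Kpos[OF m(1) i] by (simp add: z_def ln_mult)
          qed
          have sq: "(\<Sum>i\<in>X. (?m i - mb i)\<^sup>2) = (\<Sum>i\<in>X. (m i - mb i)\<^sup>2) + (\<Sum>i\<in>X. x i * (2 * (m i * (m i - mb i)))) + (\<Sum>i\<in>X. (x i)\<^sup>2 * (m i)\<^sup>2)"
            unfolding sum.distrib[symmetric] by (intro sum.cong refl) (simp add: power2_eq_square algebra_simps)
          have esq: "e * (\<Sum>i\<in>X. (?m i - mb i)\<^sup>2) = e * (\<Sum>i\<in>X. (m i - mb i)\<^sup>2) + e * (\<Sum>i\<in>X. x i * (2 * (m i * (m i - mb i)))) + e * (\<Sum>i\<in>X. (x i)\<^sup>2 * (m i)\<^sup>2)"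
            unfolding sq by (simp only: distrib_left)
          have pl: "(\<Sum>i\<in>X. x i * p' i) = - ((\<Sum>i\<in>X. x i * G i z) / k) + e * (\<Sum>i\<in>X. x i * (2 * (m i * (m i - mb i))))"
            unfolding p'_def sum_distrib_left sum_divide_distrib sum_negf[symmetric] sum.distrib[symmetric]
            by (intro sum.cong refl) (simp add: algebra_simps)
          have pq: "(\<Sum>i\<in>X. \<Sum>j\<in>X. x i * x j * P' i j) / 2 = - ((\<Sum>i\<in>X. \<Sum>j\<in>X. x i * x j * P i j) / 2 / k) + e * (\<Sum>i\<in>X. (x i)\<^sup>2 * (m i)\<^sup>2)"
            unfolding P'_def by (rule quad_penalty[OF X(1)])
          have FA: "F (z + (\<lambda>i. ln (1 + x i))) / k - F z / k = A x / k + (\<Sum>i\<in>X. x i * G i z) / k + (\<Sum>i\<in>X. \<Sum>j\<in>X. x i * x j * P i j) / 2 / k"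
            unfolding A_def by (simp add: diff_divide_distrib add_divide_distrib)
          have "g ?m \<le> g m" by (rule m(2)[OF mK])
          then have "F (z + (\<lambda>i. ln (1 + x i))) / k - w ?m - e * (\<Sum>i\<in>X. (?m i - mb i)\<^sup>2) \<le> F z / k - w m - e * (\<Sum>i\<in>X. (m i - mb i)\<^sup>2)"
            unfolding g_def Feq z_def .
          then show "- w ?m \<le> - w m + (\<Sum>i\<in>X. x i * p' i) + (\<Sum>i\<in>X. \<Sum>j\<in>X. x i * x j * P' i j) / 2 + - (A x / k)"
            using FA esq unfolding pl pq by linarith
        qed
      qed
    qed
    have mpos: "\<And>i. i \<in> X \<Longrightarrow> 0 < m i" using Kpos[OF m(1)] .
    define mean where "mean r = (\<Sum>k\<in>X. \<rho> r k * m k)" for r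
    obtain r where r: "r \<in> Hs" "c m r - ereal ((\<Sum>i\<in>X. \<Sum>j\<in>X. (\<rho> r i - mean r) * (\<rho> r j - mean r) * P' i j) / 2) \<le> ereal (\<beta> * w m + e)"
      using Hsup[OF mS mpos rs e] unfolding mean_def by blast
    \<comment> \<open>Centring at the contact point provides the reference point that
      \<open>homog_local_subsol\<close> asks for; the quadratic forms see \<rho> only up to its mean
      and do not change.\<close>
    define \<rho>t where "\<rho>t i = \<rho> r i - mean r" for i
    have cclose: "c m' r = c mb r \<or> \<bar>c m' r - c mb r\<bar> < ereal e" if "m' \<in> psimplex X" "\<And>i. i \<in> X \<Longrightarrow> \<bar>m' i - mb i\<bar> < d" for m'
      using that d(4) by (intro d3(2) r(1)) force+
    \<comment> \<open>The supersolution inequality excludes the cost +\<infinity> at m. Closeness,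
      together with \<open>cfin\<close>, then makes the cost at mb a real number, at which it can be
      frozen.\<close>
    have cm: "c m r \<noteq> \<infinity>" using r(2) by (cases "c m r") auto
    have "\<bar>c mb r\<bar> \<noteq> \<infinity>"
      using cclose[OF mS mnear] cm cfin[OF r(1)] by (cases "c mb r"; cases "c m r") auto
    then obtain cb where cb: "c mb r = ereal cb" by (cases "c mb r") auto
    have cm_ge: "ereal (cb - e) \<le> c m r"
      using cclose[OF mS mnear] e unfolding cb by (cases "c m r") (auto simp: abs_real_def split: if_splits)
    \<comment> \<open>The cost minus \<open>\<beta> * u\<close>, with both frozen at mb and one
      tolerance for each of them.\<close>
    define Kc where "Kc = cb + e - \<beta> * u mb + \<beta> * e"
    have ms1: "(\<Sum>k\<in>X. m k) = 1" using mS by (simp add: psimplex_def)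
    have sub: "local_subsol X zb R \<rho>t Kc V"
      unfolding V_def
    proof (rule homog_local_subsol[OF X du, where ?z0.0 = z])
      show "(\<Sum>k\<in>X. \<rho>t k * mz X z k) = 0"
      proof -
        have "(\<Sum>k\<in>X. \<rho>t k * mz X z k) = (\<Sum>k\<in>X. \<rho> r k * m k) - mean r * (\<Sum>k\<in>X. m k)"
          using mzm(1) by (simp add: \<rho>t_def left_diff_distrib sum_subtractf sum_distrib_left)
        then show ?thesis using ms1 by (simp add: mean_def)
      qed
      fix y p P assume y: "y \<in> cube X zb R" and rsu: "rsup X u (mz X y) p P"
      define m' where "m' = mz X y"
      have m's: "m' \<in> psimplex X" "\<And>i. 0 < m' i" unfolding m'_def using mz_simplex[OF X] mz_pos[OF X] by auto
      have m'n: "\<And>i. i \<in> X \<Longrightarrow> \<bar>m' i - mb i\<bar> < d" unfolding m'_def using R(2)[OF y] .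
      define mn where "mn = (\<Sum>k\<in>X. \<rho> r k * m' k)"
      have mn: "\<rho>t i - (\<Sum>k\<in>X. \<rho>t k * m' k) = \<rho> r i - mn" for i
      proof -
        have "(\<Sum>k\<in>X. \<rho>t k * m' k) = mn - mean r * (\<Sum>k\<in>X. m' k)"
          by (simp add: \<rho>t_def left_diff_distrib sum_subtractf sum_distrib_left mn_def)
        then show ?thesis using m's(1) by (simp add: psimplex_def \<rho>t_def)
      qed
      have "ereal (\<beta> * u m') \<le> c m' r + ereal ((\<Sum>i\<in>X. \<Sum>j\<in>X. (\<rho> r i - mn) * (\<rho> r j - mn) * P i j) / 2)"
        unfolding mn_def using rsu by (intro Hsub m's r(1)) (auto simp: m'_def)
      moreover have "c m' r \<le> ereal (cb + e)"
        using cclose[OF m's(1) m'n] e unfolding cb by (cases "c m' r") (auto simp: abs_real_def split: if_splits)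
      ultimately have "ereal (\<beta> * u m') \<le> ereal (cb + e) + ereal ((\<Sum>i\<in>X. \<Sum>j\<in>X. (\<rho> r i - mn) * (\<rho> r j - mn) * P i j) / 2)"
        by (meson add_right_mono order_trans)
      then have "\<beta> * u m' \<le> cb + e + (\<Sum>i\<in>X. \<Sum>j\<in>X. (\<rho> r i - mn) * (\<rho> r j - mn) * P i j) / 2" by simp
      moreover have "\<beta> * u mb - \<beta> * e \<le> \<beta> * u m'"
      proof -
        have "\<bar>u m' - u mb\<bar> \<le> e" using m'n d(2) by (intro d1(2) m's(1)) force
        then have "\<beta> * (u mb - e) \<le> \<beta> * u m'" using \<beta> by (intro mult_left_mono) auto
        then show ?thesis by (simp add: right_diff_distrib)
      qed
      ultimately show "- Kc \<le> (\<Sum>i\<in>X. \<Sum>j\<in>X. (\<rho>t i - (\<Sum>k\<in>X. \<rho>t k * mz X y k)) * (\<rho>t j - (\<Sum>k\<in>X. \<rho>t k * mz X y k)) * P i j) / 2"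
        unfolding m'_def[symmetric] mn Kc_def by linarith
    qed
    have "- Kc * (kap \<epsilon> ^ 4 * expsum X z) \<le> gen X \<rho>t (\<lambda>i. G i z) (\<lambda>i j. H i j z)"
      by (rule smooth_subsolution[OF X(1) sub V R(1) xs \<epsilon>(1,2) GH(1)[unfolded F_def] GHs(1) G2 GHs(2) zc])
    then have "- Kc * k \<le> gen X \<rho>t (\<lambda>i. G i z) (\<lambda>i j. H i j z)" unfolding mzm(2) k_def by simp
    then have gk: "- Kc \<le> gen X \<rho>t (\<lambda>i. G i z) (\<lambda>i j. H i j z) / k" using k by (simp add: field_simps)
    have "(\<Sum>i\<in>X. \<Sum>j\<in>X. \<rho>t i * \<rho>t j * P' i j) / 2 = - (gen X \<rho>t (\<lambda>i. G i z) (\<lambda>i j. H i j z) / k) + e * (\<Sum>i\<in>X. (\<rho>t i)\<^sup>2 * (m i)\<^sup>2)"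
      unfolding P'_def quad_penalty[OF X(1)] gen_as_quad[OF X(1)] P_def ..
    \<comment> \<open>Centred directions are at most \<open>2 * B\<close>, and
      \<open>(m i)\<^sup>2 \<le> m i\<close>, where the weights sum to 1.\<close>
    moreover have "(\<Sum>i\<in>X. (\<rho>t i)\<^sup>2 * (m i)\<^sup>2) \<le> 4 * B\<^sup>2"
    proof -
      have mean_le: "\<bar>mean r\<bar> \<le> B"
      proof -
        have "\<bar>mean r\<bar> \<le> (\<Sum>k\<in>X. \<bar>\<rho> r k * m k\<bar>)" unfolding mean_def by (rule sum_abs)
        also have "\<dots> \<le> (\<Sum>k\<in>X. B * m k)"
        proof (rule sum_mono)
          fix k assume k: "k \<in> X"
          have "\<bar>\<rho> r k\<bar> * m k \<le> B * m k" using bound[OF r(1) k] mpos[OF k] by (intro mult_right_mono) auto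
          then show "\<bar>\<rho> r k * m k\<bar> \<le> B * m k" using mpos[OF k] by (simp add: abs_mult)
        qed
        also have "\<dots> = B" using ms1 by (simp add: sum_distrib_left[symmetric])
        finally show ?thesis .
      qed
      have "(\<rho>t i)\<^sup>2 * (m i)\<^sup>2 \<le> 4 * B\<^sup>2 * m i" if "i \<in> X" for i
      proof -
        have "\<bar>\<rho>t i\<bar> \<le> 2 * B" unfolding \<rho>t_def using bound[OF r(1) that] mean_le by linarith
        then have "(\<rho>t i)\<^sup>2 \<le> (2 * B)\<^sup>2" using power_mono[of "\<bar>\<rho>t i\<bar>" "2 * B" 2] by simp
        moreover have "(m i)\<^sup>2 \<le> m i * 1" unfolding power2_eq_square
          using mpos[OF that] simplex_le_1[OF X(1) mS that] by (intro mult_left_mono) auto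
        ultimately have "(\<rho>t i)\<^sup>2 * (m i)\<^sup>2 \<le> (2 * B)\<^sup>2 * (m i * 1)" by (intro mult_mono) auto
        then show ?thesis by (simp add: power_mult_distrib)
      qed
      then have "(\<Sum>i\<in>X. (\<rho>t i)\<^sup>2 * (m i)\<^sup>2) \<le> (\<Sum>i\<in>X. 4 * B\<^sup>2 * m i)" by (rule sum_mono)
      also have "\<dots> = 4 * B\<^sup>2" using ms1 by (simp add: sum_distrib_left[symmetric])
      finally show ?thesis .
    qed
    then have "e * (\<Sum>i\<in>X. (\<rho>t i)\<^sup>2 * (m i)\<^sup>2) \<le> e * (4 * B\<^sup>2)" using e by (intro mult_left_mono) auto
    ultimately have pl: "(\<Sum>i\<in>X. \<Sum>j\<in>X. \<rho>t i * \<rho>t j * P' i j) / 2 \<le> Kc + e * (4 * B\<^sup>2)" using gk by linarith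
    have "ereal (cb - e) - ereal ((\<Sum>i\<in>X. \<Sum>j\<in>X. \<rho>t i * \<rho>t j * P' i j) / 2) \<le> ereal (\<beta> * w m + e)"
      using r(2) cm_ge unfolding \<rho>t_def by (meson ereal_minus_mono order_refl order_trans)
    then have "cb - e - (\<Sum>i\<in>X. \<Sum>j\<in>X. \<rho>t i * \<rho>t j * P' i j) / 2 \<le> \<beta> * w m + e" by simp
    moreover have "\<beta> * w m \<le> \<beta> * w mb + \<beta> * e"
    proof -
      have "\<bar>w m - w mb\<bar> \<le> e" using mnear d(3) by (intro d2(2) mS) force
      then have "\<beta> * w m \<le> \<beta> * (w mb + e)" using \<beta> by (intro mult_left_mono) auto
      then show ?thesis by (simp add: distrib_left)
    qed
    ultimately have "\<beta> * u mb \<le> \<beta> * w mb + 3 * e + 2 * (\<beta> * e) + e * (4 * B\<^sup>2)"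
      using pl unfolding Kc_def by linarith
    then show ?thesis by (simp add: algebra_simps)
  qed
  have "\<beta> * u mb \<le> \<beta> * w mb"
  proof (rule field_le_epsilon)
    fix e :: real assume e: "e > 0"
    define q where "q = 3 + 2 * \<beta> + 4 * B\<^sup>2"
    have q: "q > 0" using \<beta> by (simp add: q_def add_pos_nonneg)
    show "\<beta> * u mb \<le> \<beta> * w mb + e" using key[of "e / q"] e q unfolding q_def[symmetric] by simp
  qed
  then show ?thesis using \<beta> by simp
qed

section \<open>Measures with finite support\<close>

lemma openin_TP: "openin (TP p) U \<longleftrightarrow> U \<subseteq> Pp p \<and>
   (\<forall>\<mu>s \<mu>. \<mu> \<in> U \<and> range \<mu>s \<subseteq> Pp p \<and> convP p \<mu>s \<mu> \<longrightarrow> (\<forall>\<^sub>F n in sequentially. \<mu>s n \<in> U))"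
proof -
  \<comment> \<open>\<open>topology\<close> is an abstraction function: the open sets can be read
    off only once the family is known to be a topology.\<close>
  have "istopology (\<lambda>U. U \<subseteq> Pp p \<and>
      (\<forall>\<mu>s \<mu>. \<mu> \<in> U \<and> range \<mu>s \<subseteq> Pp p \<and> convP p \<mu>s \<mu> \<longrightarrow> (\<forall>\<^sub>F n in sequentially. \<mu>s n \<in> U)))"
    (is "istopology ?L")
    unfolding istopology_def
  proof (rule conjI; intro allI impI)
    fix S T assume S: "?L S" and T: "?L T"
    have "\<forall>\<^sub>F n in sequentially. \<mu>s n \<in> S \<inter> T"
      if "\<mu> \<in> S \<inter> T" "range \<mu>s \<subseteq> Pp p" "convP p \<mu>s \<mu>" for \<mu>s \<mu>
    proof -
      have "\<forall>\<^sub>F n in sequentially. \<mu>s n \<in> S" "\<forall>\<^sub>F n in sequentially. \<mu>s n \<in> T" using S T that by blast+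
      then show ?thesis by eventually_elim blast
    qed
    then show "?L (S \<inter> T)" using S by blast
  next
    fix \<K> assume K: "\<forall>S\<in>\<K>. ?L S"
    have "\<forall>\<^sub>F n in sequentially. \<mu>s n \<in> \<Union>\<K>"
      if \<mu>: "\<mu> \<in> \<Union>\<K>" "range \<mu>s \<subseteq> Pp p" "convP p \<mu>s \<mu>" for \<mu>s \<mu>
    proof -
      obtain S where S: "S \<in> \<K>" "\<mu> \<in> S" using \<mu>(1) by blast
      then have "\<forall>\<^sub>F n in sequentially. \<mu>s n \<in> S" using K \<mu> by blast
      then show ?thesis by (rule eventually_mono) (use S in blast)
    qed
    then show "?L (\<Union>\<K>)" using K by blast
  qed
  from topology_inverse'[OF this] show ?thesis unfolding TP_def by (rule fun_cong)
qed

lemma topspace_TP [simp]: "topspace (TP p) = Pp p"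
proof -
  have "openin (TP p) (Pp p)" unfolding openin_TP by (auto intro!: always_eventually)
  then show ?thesis using openin_TP[of p "topspace (TP p)"] openin_subset[of "TP p" "Pp p"] openin_topspace[of "TP p"] by blast
qed

lemma continuous_TP_seq:
  fixes g :: "'a::euclidean_space measure \<Rightarrow> real"
  assumes g: "continuous_map (TP p) euclideanreal g" and \<mu>: "\<mu> \<in> Pp p" "range \<mu>s \<subseteq> Pp p" "convP p \<mu>s \<mu>"
  shows "(\<lambda>n. g (\<mu>s n)) \<longlonglongrightarrow> g \<mu>"
proof (rule topological_tendstoI)
  fix S :: "real set" assume "open S" "g \<mu> \<in> S"
  then have "openin (TP p) {\<nu> \<in> topspace (TP p). g \<nu> \<in> S}" using g by (auto simp: continuous_map_def)
  then have "\<forall>\<^sub>F n in sequentially. \<mu>s n \<in> {\<nu> \<in> topspace (TP p). g \<nu> \<in> S}"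
    using \<mu> \<open>g \<mu> \<in> S\<close> unfolding openin_TP topspace_TP by blast
  then show "\<forall>\<^sub>F n in sequentially. g (\<mu>s n) \<in> S" by (rule eventually_mono) simp
qed

lemma continuous_TP_I:
  fixes g :: "'a::euclidean_space measure \<Rightarrow> real"
  assumes "\<And>\<mu>s \<mu>. \<mu> \<in> Pp p \<Longrightarrow> range \<mu>s \<subseteq> Pp p \<Longrightarrow> convP p \<mu>s \<mu> \<Longrightarrow> (\<lambda>n. g (\<mu>s n)) \<longlonglongrightarrow> g \<mu>"
  shows "continuous_map (TP p) euclideanreal g"
  unfolding continuous_map_def
proof (intro conjI allI impI)
  fix S :: "real set" assume "openin euclideanreal S"
  then have S: "open S" by simp
  show "openin (TP p) {x \<in> topspace (TP p). g x \<in> S}"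
    unfolding openin_TP topspace_TP
  proof (intro conjI allI impI)
    fix \<mu>s \<mu> assume a: "\<mu> \<in> {x \<in> Pp p. g x \<in> S} \<and> range \<mu>s \<subseteq> Pp p \<and> convP p \<mu>s \<mu>"
    then have "(\<lambda>n. g (\<mu>s n)) \<longlonglongrightarrow> g \<mu>" using assms by blast
    then have "\<forall>\<^sub>F n in sequentially. g (\<mu>s n) \<in> S" using S a by (auto intro: topological_tendstoD)
    then show "\<forall>\<^sub>F n in sequentially. \<mu>s n \<in> {x \<in> Pp p. g x \<in> S}" by (rule eventually_mono) (use a in blast)
  qed blast
qed simp

lemma Prob_D: "\<mu> \<in> Prob \<Longrightarrow> prob_space \<mu>" "\<mu> \<in> Prob \<Longrightarrow> sets \<mu> = sets borel" "\<mu> \<in> Prob \<Longrightarrow> space \<mu> = UNIV"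
  unfolding Prob_def by (auto dest: sets_eq_imp_space_eq)

lemma Pp_Prob: "\<mu> \<in> Pp p \<Longrightarrow> \<mu> \<in> Prob"
  by (simp add: Pp_def)

lemma measurable_Prob: "\<mu> \<in> Prob \<Longrightarrow> borel_measurable \<mu> = borel_measurable borel"
  using Prob_D(2) by (metis measurable_cong_sets)

section \<open>Couplings and transport cost\<close>

lemma couplings_D:
  assumes "\<pi> \<in> couplings \<mu> \<nu>"
  shows "prob_space \<pi>" "fst \<in> \<pi> \<rightarrow>\<^sub>M borel" "snd \<in> \<pi> \<rightarrow>\<^sub>M borel" "distr \<pi> borel fst = \<mu>" "distr \<pi> borel snd = \<nu>"
    "borel_measurable \<pi> = borel_measurable (borel \<Otimes>\<^sub>M borel)"
  using assms measurable_cong_sets[of \<pi> "borel \<Otimes>\<^sub>M borel"] unfolding couplings_def by (auto simp: measurable_fst measurable_snd)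

lemma coupling_integrals:
  fixes \<phi> :: "'a::euclidean_space \<Rightarrow> real"
  assumes \<pi>: "\<pi> \<in> couplings \<mu> \<nu>" and \<phi>: "\<phi> \<in> borel_measurable borel" "\<And>x. \<bar>\<phi> x\<bar> \<le> B"
  shows "(\<integral>x. \<phi> x \<partial>\<mu>) - (\<integral>x. \<phi> x \<partial>\<nu>) = (\<integral>z. \<phi> (fst z) - \<phi> (snd z) \<partial>\<pi>)"
proof -
  interpret prob_space \<pi> by (rule couplings_D[OF \<pi>])
  note m = couplings_D(2,3)[OF \<pi>]
  have "(\<integral>x. \<phi> x \<partial>\<mu>) = (\<integral>z. \<phi> (fst z) \<partial>\<pi>)"
    unfolding couplings_D(4)[OF \<pi>, symmetric] by (rule integral_distr[OF m(1) \<phi>(1)])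
  moreover have "(\<integral>x. \<phi> x \<partial>\<nu>) = (\<integral>z. \<phi> (snd z) \<partial>\<pi>)"
    unfolding couplings_D(5)[OF \<pi>, symmetric] by (rule integral_distr[OF m(2) \<phi>(1)])
  moreover have "integrable \<pi> (\<lambda>z. \<phi> (fst z))" "integrable \<pi> (\<lambda>z. \<phi> (snd z))"
    using \<phi>(2) by (auto intro!: integrable_const_bound[of _ B] measurable_compose[OF m(1) \<phi>(1)] measurable_compose[OF m(2) \<phi>(1)])
  ultimately show ?thesis by simp
qed

lemma product_coupling:
  assumes "\<mu> \<in> Prob" "\<nu> \<in> Prob"
  shows "\<mu> \<Otimes>\<^sub>M \<nu> \<in> couplings \<mu> \<nu>"
proof -
  interpret M: prob_space \<mu> by (rule Prob_D[OF assms(1)])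
  interpret N: prob_space \<nu> by (rule Prob_D[OF assms(2)])
  interpret P: pair_prob_space \<mu> \<nu> ..
  have s: "sets (\<mu> \<Otimes>\<^sub>M \<nu>) = sets (borel \<Otimes>\<^sub>M borel)" using Prob_D(2)[OF assms(1)] Prob_D(2)[OF assms(2)] by (rule sets_pair_measure_cong)
  have f: "fst \<in> \<mu> \<Otimes>\<^sub>M \<nu> \<rightarrow>\<^sub>M borel" "snd \<in> \<mu> \<Otimes>\<^sub>M \<nu> \<rightarrow>\<^sub>M borel"
    using measurable_cong_sets[OF s refl] by (auto simp: measurable_fst measurable_snd)
  have sp: "space \<mu> = UNIV" "space \<nu> = UNIV" "space (\<mu> \<Otimes>\<^sub>M \<nu>) = UNIV" using Prob_D(3)[OF assms(1)] Prob_D(3)[OF assms(2)] by (auto simp: space_pair_measure)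
  have "distr (\<mu> \<Otimes>\<^sub>M \<nu>) borel fst = \<mu>"
  proof (rule measure_eqI)
    fix A assume "A \<in> sets (distr (\<mu> \<Otimes>\<^sub>M \<nu>) borel fst)"
    then have A: "A \<in> sets borel" "A \<in> sets \<mu>" using Prob_D(2)[OF assms(1)] by auto
    have "fst -` A \<inter> space (\<mu> \<Otimes>\<^sub>M \<nu>) = A \<times> space \<nu>" using sp by auto
    then show "emeasure (distr (\<mu> \<Otimes>\<^sub>M \<nu>) borel fst) A = emeasure \<mu> A"
      using A N.emeasure_pair_measure_Times[OF A(2), of "space \<nu>"] by (simp add: emeasure_distr[OF f(1) A(1)] N.emeasure_space_1)
  qed (simp add: Prob_D(2)[OF assms(1)])
  moreover have "distr (\<mu> \<Otimes>\<^sub>M \<nu>) borel snd = \<nu>"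
  proof (rule measure_eqI)
    fix A assume "A \<in> sets (distr (\<mu> \<Otimes>\<^sub>M \<nu>) borel snd)"
    then have A: "A \<in> sets borel" "A \<in> sets \<nu>" using Prob_D(2)[OF assms(2)] by auto
    have "snd -` A \<inter> space (\<mu> \<Otimes>\<^sub>M \<nu>) = space \<mu> \<times> A" using sp by auto
    then show "emeasure (distr (\<mu> \<Otimes>\<^sub>M \<nu>) borel snd) A = emeasure \<nu> A"
      using A N.emeasure_pair_measure_Times[of "space \<mu>" \<mu> A] by (simp add: emeasure_distr[OF f(2) A(1)] M.emeasure_space_1)
  qed (simp add: Prob_D(2)[OF assms(2)])
  ultimately show ?thesis unfolding couplings_def using s P.prob_space_axioms by simp
qed

lemma dist_powr_le:
  fixes x y :: "'a::real_normed_vector"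
  assumes "0 \<le> p"
  shows "dist x y powr p \<le> 2 powr p * (norm x powr p + norm y powr p)"
proof -
  have "dist x y \<le> 2 * max (norm x) (norm y)" using norm_triangle_ineq4[of x y] by (simp add: dist_norm max_def)
  then have "dist x y powr p \<le> (2 * max (norm x) (norm y)) powr p" using assms by (intro powr_mono2) auto
  also have "\<dots> = 2 powr p * (max (norm x) (norm y)) powr p" by (subst powr_mult) auto
  also have "\<dots> \<le> 2 powr p * (norm x powr p + norm y powr p)" by (intro mult_left_mono) (auto simp: max_def)
  finally show ?thesis .
qed

definition tcost :: "real \<Rightarrow> ('a::euclidean_space \<times> 'a) measure \<Rightarrow> ennreal" where
  "tcost p \<pi> = (\<integral>\<^sup>+ z. ennreal (dist (fst z) (snd z) powr p) \<partial>\<pi>)"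

lemma dist_powr_measurable: "(\<lambda>z. ennreal (dist (fst z) (snd z) powr p)) \<in> borel_measurable (borel \<Otimes>\<^sub>M (borel :: 'a::euclidean_space measure))"
  by measurable

text \<open>Makes the infimum that defines \<open>Wass\<close> finite, so that
  \<open>enn2real\<close> does not silently turn an infinite value into 0.\<close>

lemma tcost_product_finite:
  assumes "p \<ge> 1" "\<mu> \<in> Pp p" "\<nu> \<in> Pp p"
  shows "tcost p (\<mu> \<Otimes>\<^sub>M \<nu>) < \<infinity>"
proof -
  have c: "\<mu> \<Otimes>\<^sub>M \<nu> \<in> couplings \<mu> \<nu>" using assms Pp_Prob by (intro product_coupling) auto
  note m = couplings_D(2,3)[OF c]
  have n: "(\<lambda>x::'a. ennreal (norm x powr p)) \<in> borel_measurable borel" by measurable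
  have fm: "(\<lambda>z::'a \<times> 'a. ennreal (norm (fst z) powr p)) \<in> borel_measurable (\<mu> \<Otimes>\<^sub>M \<nu>)" "(\<lambda>z. ennreal (norm (snd z) powr p)) \<in> borel_measurable (\<mu> \<Otimes>\<^sub>M \<nu>)"
    using measurable_compose[OF m(1) n] measurable_compose[OF m(2) n] by auto
  have "tcost p (\<mu> \<Otimes>\<^sub>M \<nu>) \<le> (\<integral>\<^sup>+ z. ennreal (2 powr p) * (ennreal (norm (fst z) powr p) + ennreal (norm (snd z) powr p)) \<partial>(\<mu> \<Otimes>\<^sub>M \<nu>))"
    unfolding tcost_def
  proof (intro nn_integral_mono)
    fix z :: "'a \<times> 'a"
    have "ennreal (dist (fst z) (snd z) powr p) \<le> ennreal (2 powr p * (norm (fst z) powr p + norm (snd z) powr p))"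
      using assms(1) by (intro ennreal_leI dist_powr_le) auto
    then show "ennreal (dist (fst z) (snd z) powr p) \<le> ennreal (2 powr p) * (ennreal (norm (fst z) powr p) + ennreal (norm (snd z) powr p))"
      by (simp add: ennreal_mult ennreal_plus)
  qed
  also have "\<dots> = ennreal (2 powr p) * ((\<integral>\<^sup>+ z. ennreal (norm (fst z) powr p) \<partial>(\<mu> \<Otimes>\<^sub>M \<nu>)) + (\<integral>\<^sup>+ z. ennreal (norm (snd z) powr p) \<partial>(\<mu> \<Otimes>\<^sub>M \<nu>)))"
    using fm by (subst nn_integral_cmult) (auto simp: nn_integral_add)
  also have "(\<integral>\<^sup>+ z. ennreal (norm (fst z) powr p) \<partial>(\<mu> \<Otimes>\<^sub>M \<nu>)) = (\<integral>\<^sup>+ x. ennreal (norm x powr p) \<partial>\<mu>)"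
    using nn_integral_distr[OF m(1), of "\<lambda>x. ennreal (norm x powr p)"] n unfolding couplings_D(4)[OF c] measurable_Prob[OF Pp_Prob[OF assms(2)]] by simp
  also have "(\<integral>\<^sup>+ z. ennreal (norm (snd z) powr p) \<partial>(\<mu> \<Otimes>\<^sub>M \<nu>)) = (\<integral>\<^sup>+ x. ennreal (norm x powr p) \<partial>\<nu>)"
    using nn_integral_distr[OF m(2), of "\<lambda>x. ennreal (norm x powr p)"] n unfolding couplings_D(5)[OF c] measurable_Prob[OF Pp_Prob[OF assms(3)]] by simp
  also have "ennreal (2 powr p) * ((\<integral>\<^sup>+ x. ennreal (norm x powr p) \<partial>\<mu>) + (\<integral>\<^sup>+ x. ennreal (norm x powr p) \<partial>\<nu>)) < \<infinity>"
    using assms by (auto simp: Pp_def ennreal_mult_less_top)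
  finally show ?thesis .
qed

lemma Wass_powr: "p \<ge> 1 \<Longrightarrow> Wass p \<mu> \<nu> powr p = enn2real (INF \<pi>\<in>couplings \<mu> \<nu>. tcost p \<pi>)"
  unfolding Wass_def tcost_def by (simp add: powr_powr)

text \<open>Every distance t satisfies
  \<open>t \<le> \<delta> + \<delta> powr (1 - p) * t powr p\<close>: for t above \<delta> write t
  as \<open>t powr (1 - p) * t powr p\<close> and use that the exponent \<open>1 - p\<close> is not
  positive. Integrating this replaces the Hoelder inequality.\<close>

lemma Lipschitz_coupling_bound:
  fixes \<phi> :: "'a::euclidean_space \<Rightarrow> real"
  assumes p: "p \<ge> 1" and \<pi>: "\<pi> \<in> couplings \<mu> \<nu>" and c: "tcost p \<pi> \<le> ennreal r" "0 \<le> r"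
    and \<phi>: "\<And>x. \<bar>\<phi> x\<bar> \<le> B" "\<And>x y. \<bar>\<phi> x - \<phi> y\<bar> \<le> L * dist x y" and L: "0 \<le> L" and d: "0 < \<delta>"
  shows "\<bar>(\<integral>x. \<phi> x \<partial>\<mu>) - (\<integral>x. \<phi> x \<partial>\<nu>)\<bar> \<le> L * \<delta> + L * \<delta> powr (1 - p) * r"
proof -
  interpret prob_space \<pi> by (rule couplings_D[OF \<pi>])
  have "continuous_on UNIV \<phi>"
  proof (rule continuous_on_iff[THEN iffD2], intro ballI allI impI)
    fix x :: 'a and e :: real assume "e > 0"
    then have "dist (\<phi> y) (\<phi> x) < e" if "dist y x < e / (L + 1)" for y
    proof -
      have "\<bar>\<phi> y - \<phi> x\<bar> \<le> (L + 1) * dist y x" 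
        using \<phi>(2)[of y x] zero_le_dist[of y x] unfolding distrib_right by linarith
      also have "\<dots> < e" using that L by (simp add: field_simps)
      finally show ?thesis by (simp add: dist_real_def)
    qed
    then show "\<exists>d>0. \<forall>y\<in>UNIV. dist y x < d \<longrightarrow> dist (\<phi> y) (\<phi> x) < e"
      using \<open>e > 0\<close> L by (intro exI[of _ "e / (L + 1)"]) auto
  qed
  then have m\<phi>: "\<phi> \<in> borel_measurable borel" by (rule borel_measurable_continuous_onI)
  have dm: "(\<lambda>z. ennreal (dist (fst z) (snd z) powr p)) \<in> borel_measurable \<pi>"
    unfolding couplings_D(6)[OF \<pi>] by (rule dist_powr_measurable)
  have "ennreal \<bar>\<integral>z. \<phi> (fst z) - \<phi> (snd z) \<partial>\<pi>\<bar> \<le> (\<integral>\<^sup>+ z. ennreal \<bar>\<phi> (fst z) - \<phi> (snd z)\<bar> \<partial>\<pi>)"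
  proof (cases "integrable \<pi> (\<lambda>z. \<phi> (fst z) - \<phi> (snd z))")
    case True
    from integral_norm_bound_ennreal[OF this] show ?thesis by simp
  next
    case False
    then show ?thesis by (simp add: not_integrable_integral_eq)
  qed
  also have "\<dots> \<le> (\<integral>\<^sup>+ z. ennreal (L * \<delta>) + ennreal (L * \<delta> powr (1 - p)) * ennreal (dist (fst z) (snd z) powr p) \<partial>\<pi>)"
  proof (intro nn_integral_mono)
    fix z :: "'a \<times> 'a"
    define t where "t = dist (fst z) (snd z)"
    have "t \<le> \<delta> + \<delta> powr (1 - p) * t powr p"
    proof (cases "t \<le> \<delta>")
      case False
      then have t: "\<delta> \<le> t" "0 < t" using d by auto
      have "t = t powr (1 - p) * t powr p" using t by (simp add: powr_add[symmetric])
      also have "\<dots> \<le> \<delta> powr (1 - p) * t powr p" using t d p by (intro mult_right_mono powr_mono2') auto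
      finally show ?thesis using d by linarith
    qed (use d in \<open>auto intro: add_increasing2\<close>)
    from mult_left_mono[OF this L] have "L * t \<le> L * \<delta> + L * \<delta> powr (1 - p) * t powr p" by (simp add: distrib_left mult.assoc)
    then have "\<bar>\<phi> (fst z) - \<phi> (snd z)\<bar> \<le> L * \<delta> + L * \<delta> powr (1 - p) * t powr p" using \<phi>(2)[of "fst z" "snd z"] unfolding t_def by linarith
    then show "ennreal \<bar>\<phi> (fst z) - \<phi> (snd z)\<bar> \<le> ennreal (L * \<delta>) + ennreal (L * \<delta> powr (1 - p)) * ennreal (dist (fst z) (snd z) powr p)"
      using L d unfolding t_def by (simp add: ennreal_mult[symmetric] ennreal_plus[symmetric] ennreal_leI del: ennreal_plus)
  qed
  also have "\<dots> = ennreal (L * \<delta>) + ennreal (L * \<delta> powr (1 - p)) * tcost p \<pi>"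
    unfolding tcost_def using dm by (subst nn_integral_add) (auto simp: nn_integral_cmult emeasure_space_1)
  also have "\<dots> \<le> ennreal (L * \<delta>) + ennreal (L * \<delta> powr (1 - p)) * ennreal r" using c(1) by (intro add_left_mono mult_left_mono) auto
  also have "\<dots> = ennreal (L * \<delta> + L * \<delta> powr (1 - p) * r)"
    using L d c(2) by (simp add: ennreal_mult[symmetric] ennreal_plus[symmetric] del: ennreal_plus)
  finally have "\<bar>\<integral>z. \<phi> (fst z) - \<phi> (snd z) \<partial>\<pi>\<bar> \<le> L * \<delta> + L * \<delta> powr (1 - p) * r"
    using L d c(2) by (subst (asm) ennreal_le_iff) (auto intro!: add_nonneg_nonneg mult_nonneg_nonneg)
  then show ?thesis using coupling_integrals[OF \<pi> m\<phi> \<phi>(1)] by simp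
qed

text \<open>For p = 0 this is the definition of weak convergence. For p \<ge> 1 a nearly optimal
  coupling is inserted into \<open>Lipschitz_coupling_bound\<close>; \<delta> is fixed first, and
  then the cost tends to 0.\<close>

lemma continuous_TP_integral:
  fixes \<phi> :: "'a::euclidean_space \<Rightarrow> real"
  assumes p: "p = 0 \<or> p \<ge> 1"
    and \<phi>: "\<And>x. \<bar>\<phi> x\<bar> \<le> B" "\<And>x y. \<bar>\<phi> x - \<phi> y\<bar> \<le> L * dist x y" "continuous_on UNIV \<phi>" and L: "0 \<le> L"
  shows "continuous_map (TP p) euclideanreal (\<lambda>\<mu>. \<integral>x. \<phi> x \<partial>\<mu>)"
proof (rule continuous_TP_I)
  fix \<mu>s :: "nat \<Rightarrow> 'a measure" and \<mu>
  assume \<mu>: "\<mu> \<in> Pp p" "range \<mu>s \<subseteq> Pp p" and conv: "convP p \<mu>s \<mu>"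
  show "(\<lambda>n. \<integral>x. \<phi> x \<partial>\<mu>s n) \<longlonglongrightarrow> (\<integral>x. \<phi> x \<partial>\<mu>)"
  proof (cases "p = 0")
    case True
    have "bounded (range \<phi>)" using \<phi>(1) by (auto simp: bounded_iff)
    then show ?thesis using conv \<phi>(3) True unfolding convP_def by simp
  next
    case False
    then have p1: "p \<ge> 1" using p by simp
    have W: "(\<lambda>n. Wass p (\<mu>s n) \<mu>) \<longlonglongrightarrow> 0" using conv False by (simp add: convP_def)
    have bd: "\<bar>(\<integral>x. \<phi> x \<partial>\<mu>s n) - (\<integral>x. \<phi> x \<partial>\<mu>)\<bar> \<le> L * \<delta> + L * \<delta> powr (1 - p) * (Wass p (\<mu>s n) \<mu> powr p)" if d: "0 < \<delta>" for n \<delta>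
    proof -
      define I where "I = (INF \<pi>\<in>couplings (\<mu>s n) \<mu>. tcost p \<pi>)"
      have \<mu>n: "\<mu>s n \<in> Pp p" using \<mu>(2) by blast
      have "I \<le> tcost p (\<mu>s n \<Otimes>\<^sub>M \<mu>)" unfolding I_def using \<mu>n \<mu>(1) by (intro INF_lower product_coupling Pp_Prob)
      then have fin: "I < \<infinity>" using tcost_product_finite[OF p1 \<mu>n \<mu>(1)] by (rule le_less_trans)
      have WI: "Wass p (\<mu>s n) \<mu> powr p = enn2real I" unfolding I_def by (rule Wass_powr[OF p1])
      define k where "k = L * \<delta> powr (1 - p)"
      have k: "0 \<le> k" using L by (simp add: k_def)
      have "\<bar>(\<integral>x. \<phi> x \<partial>\<mu>s n) - (\<integral>x. \<phi> x \<partial>\<mu>)\<bar> \<le> L * \<delta> + k * enn2real I + e" if e: "e > 0" for e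
      proof -
        define \<eta> where "\<eta> = e / (k + 1)"
        have \<eta>: "0 < \<eta>" "k * \<eta> \<le> e" using e k by (auto simp: \<eta>_def field_simps)
        \<comment> \<open>Strict because I is finite; this yields a coupling whose cost is below
          \<open>I + \<eta>\<close>.\<close>
        have "I < I + ennreal \<eta>" using fin \<eta>(1) by (cases I) (auto simp: ennreal_plus[symmetric] ennreal_lessI simp del: ennreal_plus)
        then obtain \<pi> where \<pi>: "\<pi> \<in> couplings (\<mu>s n) \<mu>" "tcost p \<pi> < I + ennreal \<eta>" unfolding I_def INF_less_iff by blast
        have "I + ennreal \<eta> = ennreal (enn2real I + \<eta>)" using fin \<eta>(1) by (simp add: ennreal_plus)
        then have "tcost p \<pi> \<le> ennreal (enn2real I + \<eta>)" using \<pi>(2) by simp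
        then have "\<bar>(\<integral>x. \<phi> x \<partial>\<mu>s n) - (\<integral>x. \<phi> x \<partial>\<mu>)\<bar> \<le> L * \<delta> + L * \<delta> powr (1 - p) * (enn2real I + \<eta>)"
          using \<eta>(1) by (intro Lipschitz_coupling_bound[OF p1 \<pi>(1) _ _ \<phi>(1,2) L d]) auto
        then show ?thesis using \<eta>(2) unfolding k_def[symmetric] by (simp add: distrib_left)
      qed
      then show ?thesis unfolding WI k_def[symmetric] by (rule field_le_epsilon)
    qed
    have Wp: "(\<lambda>n. Wass p (\<mu>s n) \<mu> powr p) \<longlonglongrightarrow> 0"
      using tendsto_powr'[OF W tendsto_const[of p]] p1 by (simp add: Wass_def)
    show ?thesis
    proof (rule LIMSEQ_I)
      fix e :: real assume e: "e > 0"
      define \<delta> where "\<delta> = e / (2 * (L + 1))"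
      have \<delta>: "0 < \<delta>" "L * \<delta> < e / 2 + 0" using e L by (auto simp: \<delta>_def field_simps)
      have "(\<lambda>n. L * \<delta> + L * \<delta> powr (1 - p) * (Wass p (\<mu>s n) \<mu> powr p)) \<longlonglongrightarrow> L * \<delta> + L * \<delta> powr (1 - p) * 0"
        by (intro tendsto_intros Wp)
      then have "\<forall>\<^sub>F n in sequentially. L * \<delta> + L * \<delta> powr (1 - p) * (Wass p (\<mu>s n) \<mu> powr p) < e"
        using \<delta>(2) e by (intro order_tendstoD(2)[where y = "L * \<delta> + L * \<delta> powr (1 - p) * 0"]) auto
      then obtain n0 where "\<And>n. n \<ge> n0 \<Longrightarrow> L * \<delta> + L * \<delta> powr (1 - p) * (Wass p (\<mu>s n) \<mu> powr p) < e"
        unfolding eventually_sequentially by blast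
      then show "\<exists>n0. \<forall>n\<ge>n0. norm ((\<integral>x. \<phi> x \<partial>\<mu>s n) - (\<integral>x. \<phi> x \<partial>\<mu>)) < e"
        using bd[OF \<delta>(1)] by (intro exI[of _ n0]) (force intro: le_less_trans)
    qed
  qed
qed

section \<open>Finitely supported measures as points of a simplex\<close>

definition fm :: "'a::euclidean_space set \<Rightarrow> ('a \<Rightarrow> real) \<Rightarrow> 'a measure" where
  "fm X m = distr (point_measure X (\<lambda>x. ennreal (m x))) borel (\<lambda>x. x)"

lemma sets_fm [simp]: "sets (fm X m) = sets borel"
  and space_fm [simp]: "space (fm X m) = UNIV"
  by (simp_all add: fm_def)

lemma sum_ennreal_less_top: "finite X \<Longrightarrow> (\<Sum>x\<in>X. ennreal (f x) * ennreal (g x)) < top"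
  by (induction X rule: finite_induct) (auto simp: ennreal_mult_less_top ennreal_add_eq_top less_top)

lemma emeasure_fm:
  assumes "finite X" "A \<in> sets borel" "\<And>x. x \<in> X \<Longrightarrow> 0 \<le> m x"
  shows "emeasure (fm X m) A = ennreal (\<Sum>x\<in>X \<inter> A. m x)"
proof -
  have "emeasure (fm X m) A = emeasure (point_measure X (\<lambda>x. ennreal (m x))) (A \<inter> X)"
    unfolding fm_def using assms(2) by (subst emeasure_distr) (auto simp: space_point_measure)
  also have "\<dots> = (\<Sum>x\<in>A \<inter> X. ennreal (m x))" using assms(1) by (intro emeasure_point_measure_finite) auto
  also have "\<dots> = ennreal (\<Sum>x\<in>A \<inter> X. m x)" using assms(3) by (intro sum_ennreal) auto
  finally show ?thesis by (simp only: Int_commute)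
qed

lemma fm_cong: "(\<And>x. x \<in> X \<Longrightarrow> m x = m' x) \<Longrightarrow> fm X m = fm X m'"
  unfolding fm_def point_measure_def by (auto intro!: arg_cong[where f = "\<lambda>M. distr M borel (\<lambda>x. x)"] density_cong AE_I2)

lemma fm_Prob:
  assumes "finite X" "m \<in> psimplex X"
  shows "fm X m \<in> Prob"
proof -
  have "emeasure (fm X m) (space (fm X m)) = 1" using assms by (simp add: emeasure_fm psimplex_def)
  then show ?thesis unfolding Prob_def using prob_spaceI[of "fm X m"] by simp
qed

lemma nn_integral_fm:
  assumes "finite X" "g \<in> borel_measurable borel"
  shows "(\<integral>\<^sup>+ x. g x \<partial>fm X m) = (\<Sum>x\<in>X. ennreal (m x) * g x)"
  unfolding fm_def using assms by (subst nn_integral_distr) (auto simp: nn_integral_point_measure_finite)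

lemma integral_fm:
  fixes g :: "'a::euclidean_space \<Rightarrow> real"
  assumes "finite X" "g \<in> borel_measurable borel" "\<And>x. x \<in> X \<Longrightarrow> 0 \<le> m x"
  shows "(\<integral>x. g x \<partial>fm X m) = (\<Sum>x\<in>X. m x * g x)"
  unfolding fm_def using assms by (subst integral_distr) (auto simp: lebesgue_integral_point_measure_finite)

lemma integrable_fm:
  fixes g :: "'a::euclidean_space \<Rightarrow> real"
  assumes "finite X" "g \<in> borel_measurable borel"
  shows "integrable (fm X m) g"
proof (rule integrableI_bounded)
  show "g \<in> borel_measurable (fm X m)" using assms(2) by (simp add: fm_def)
  have "(\<lambda>x. ennreal (norm (g x))) \<in> borel_measurable borel" using assms(2) by measurable
  then show "(\<integral>\<^sup>+ x. ennreal (norm (g x)) \<partial>fm X m) < \<infinity>"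
    using sum_ennreal_less_top[OF assms(1)] by (subst nn_integral_fm[OF assms(1)]) simp_all
qed

lemma fm_Pp:
  assumes "finite X" "m \<in> psimplex X"
  shows "fm X m \<in> Pp p"
proof -
  have "(\<lambda>x::'a. ennreal (norm x powr p)) \<in> borel_measurable borel" by measurable
  then have "(\<integral>\<^sup>+ x. ennreal (norm x powr p) \<partial>fm X m) < \<infinity>"
    using sum_ennreal_less_top[OF assms(1)] by (subst nn_integral_fm[OF assms(1)]) simp_all
  then show ?thesis using fm_Prob[OF assms] by (simp add: Pp_def)
qed

lemma fm_PX:
  assumes "finite X" "m \<in> psimplex X"
  shows "fm X m \<in> PX X"
proof -
  have "UNIV - X \<in> sets borel" using assms(1) by (intro sets.Diff) (auto intro: borel_closed finite_imp_closed)
  then have "emeasure (fm X m) (UNIV - X) = 0" using assms by (simp add: emeasure_fm psimplex_def)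
  then show ?thesis unfolding PX_def using fm_Prob[OF assms] by simp
qed

lemma Prob_finite_support:
  assumes X: "finite X" and \<mu>: "\<mu> \<in> Prob" "emeasure \<mu> (UNIV - X) = 0"
  shows "(\<lambda>x. measure \<mu> {x}) \<in> psimplex X" "\<mu> = fm X (\<lambda>x. measure \<mu> {x})"
proof -
  interpret prob_space \<mu> by (rule Prob_D[OF \<mu>(1)])
  note s = Prob_D(2)[OF \<mu>(1)] and sp = Prob_D(3)[OF \<mu>(1)]
  have X': "X \<in> sets borel" using X by (auto intro: borel_closed finite_imp_closed)
  have e: "emeasure \<mu> A = ennreal (\<Sum>x\<in>X \<inter> A. measure \<mu> {x})" if A: "A \<in> sets borel" for A
  proof -
    have "emeasure \<mu> (A - X) \<le> emeasure \<mu> (UNIV - X)" using A X' s by (intro emeasure_mono) auto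
    then have "emeasure \<mu> (A - X) = 0" using \<mu>(2) by simp
    moreover have "emeasure \<mu> A = emeasure \<mu> (A \<inter> X) + emeasure \<mu> (A - X)"
      using A X' s plus_emeasure[of "A \<inter> X" \<mu> "A - X"] by (simp add: Int_Diff_Un Int_Diff_disjoint)
    moreover have "emeasure \<mu> (A \<inter> X) = (\<Sum>x\<in>A \<inter> X. emeasure \<mu> {x})"
      using X s by (intro emeasure_eq_sum_singleton) auto
    moreover have "(\<Sum>x\<in>A \<inter> X. emeasure \<mu> {x}) = ennreal (\<Sum>x\<in>A \<inter> X. measure \<mu> {x})"
      unfolding emeasure_eq_measure by (rule sum_ennreal) simp
    ultimately show ?thesis by (simp only: Int_commute add_0_right)
  qed
  have "ennreal (\<Sum>x\<in>X. measure \<mu> {x}) = 1" using e[of UNIV] emeasure_space_1 sp by simp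
  then have "(\<Sum>x\<in>X. measure \<mu> {x}) = 1" by (simp add: ennreal_eq_1)
  then show ps: "(\<lambda>x. measure \<mu> {x}) \<in> psimplex X" by (simp add: psimplex_def)
  show "\<mu> = fm X (\<lambda>x. measure \<mu> {x})"
  proof (rule measure_eqI)
    fix A assume "A \<in> sets \<mu>"
    then have A: "A \<in> sets borel" using s by simp
    show "emeasure \<mu> A = emeasure (fm X (\<lambda>x. measure \<mu> {x})) A" unfolding e[OF A] by (rule emeasure_fm[symmetric, OF X A]) simp
  qed (simp add: s)
qed

text \<open>Every point off the support has a null ball around it, and by Lindelof countably many of
  these balls cover the complement of X.\<close>

lemma supp_null:
  assumes X: "finite X" and \<mu>: "\<mu> \<in> Prob" and s: "supp \<mu> \<subseteq> X"
  shows "emeasure \<mu> (UNIV - X) = 0"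
proof -
  define \<F> where "\<F> = {ball x e |x e. 0 < e \<and> emeasure \<mu> (ball x e) = 0}"
  have op: "open S" if "S \<in> \<F>" for S using that unfolding \<F>_def by auto
  obtain \<F>' where F': "\<F>' \<subseteq> \<F>" "countable \<F>'" "\<Union>\<F>' = \<Union>\<F>" using op by (rule Lindelof)
  have "(\<Union>S\<in>\<F>'. S) \<in> null_sets \<mu>"
  proof (rule null_sets_UN'[OF F'(2)])
    fix S assume "S \<in> \<F>'"
    then have "S \<in> \<F>" using F'(1) by blast
    then obtain x e where "S = ball x e" "emeasure \<mu> (ball x e) = 0" unfolding \<F>_def by blast
    then show "S \<in> null_sets \<mu>" using Prob_D(2)[OF \<mu>] by (intro null_setsI) simp_all
  qed
  then have n: "\<Union>\<F> \<in> null_sets \<mu>" unfolding image_ident F'(3) .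
  have sub: "UNIV - X \<subseteq> \<Union>\<F>"
  proof
    fix x assume "x \<in> UNIV - X"
    then have "x \<notin> supp \<mu>" using s by blast
    then obtain e where "e > 0" "\<not> 0 < emeasure \<mu> (ball x e)" unfolding supp_def by blast
    then have "e > 0" "emeasure \<mu> (ball x e) = 0" by (simp_all add: zero_less_iff_neq_zero)
    then show "x \<in> \<Union>\<F>" unfolding \<F>_def by (intro UnionI[of "ball x e"]) auto
  qed
  have "UNIV - X \<in> sets borel" using X by (intro sets.Diff) (auto intro: borel_closed finite_imp_closed)
  then have "UNIV - X \<in> sets \<mu>" using Prob_D(2)[OF \<mu>] by simp
  from null_sets_subset[OF n this sub] show ?thesis by (rule null_setsD1)
qed

lemma supp_fm_subset:
  assumes X: "finite X" and m: "m \<in> psimplex X"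
  shows "supp (fm X m) \<subseteq> X"
proof
  fix x assume x: "x \<in> supp (fm X m)"
  show "x \<in> X"
  proof (rule ccontr)
    assume "x \<notin> X"
    then have "open (- X)" "x \<in> - X" using finite_imp_closed[OF X] by (simp_all add: open_Compl)
    then obtain e where e: "e > 0" "ball x e \<subseteq> - X" by (rule openE)
    then have "X \<inter> ball x e = {}" by blast
    then have "emeasure (fm X m) (ball x e) = 0" using X m by (simp add: emeasure_fm psimplex_def)
    then show False using x e(1) by (auto simp: supp_def)
  qed
qed

text \<open>At a finitely supported base point the measures on which test functions are compared
  form a simplex; this is what makes the viscosity conditions finite dimensional.\<close>

lemma Dset_fm:
  assumes X: "finite X" and m: "m \<in> psimplex X" and \<mu>: "\<mu> \<in> Dset p (fm X m)"
  shows "\<exists>m'\<in>psimplex X. \<mu> = fm X m'"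
proof -
  have P: "\<mu> \<in> Prob" "supp \<mu> \<subseteq> X" using \<mu> supp_fm_subset[OF X m] by (auto simp: Dset_def Pp_def)
  show ?thesis
    using Prob_finite_support[OF X P(1) supp_null[OF X P]] by (intro bexI[of _ "\<lambda>x. measure \<mu> {x}"])
qed

section \<open>Convergence and density of finitely supported measures\<close>

lemma Wass_tendsto_0:
  assumes p: "p \<ge> 1" and \<pi>: "\<And>n. \<pi> n \<in> couplings (\<mu>s n) \<mu>" and t: "(\<lambda>n. tcost p (\<pi> n)) \<longlonglongrightarrow> 0"
  shows "(\<lambda>n. Wass p (\<mu>s n) \<mu>) \<longlonglongrightarrow> 0"
proof -
  have ev: "\<forall>\<^sub>F n in sequentially. tcost p (\<pi> n) < 1" using t by (rule order_tendstoD(2)) simp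
  have e0: "(\<lambda>n. enn2real (tcost p (\<pi> n))) \<longlonglongrightarrow> 0" using tendsto_enn2real[of "\<lambda>n. tcost p (\<pi> n)" 0] t by simp
  have "(\<lambda>n. enn2real (tcost p (\<pi> n)) powr (1 / p)) \<longlonglongrightarrow> 0"
    using tendsto_powr'[OF e0 tendsto_const[of "1 / p"]] p by simp
  moreover have "\<forall>\<^sub>F n in sequentially. norm (Wass p (\<mu>s n) \<mu>) \<le> enn2real (tcost p (\<pi> n)) powr (1 / p)"
    using ev
  proof eventually_elim
    case (elim n)
    have "(INF \<pi>\<in>couplings (\<mu>s n) \<mu>. tcost p \<pi>) \<le> tcost p (\<pi> n)" by (rule INF_lower[OF \<pi>])
    moreover have "tcost p (\<pi> n) < top" using elim by (rule less_trans) simp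
    ultimately have "enn2real (INF \<pi>\<in>couplings (\<mu>s n) \<mu>. tcost p \<pi>) \<le> enn2real (tcost p (\<pi> n))" by (rule enn2real_mono)
    then show ?case unfolding Wass_def tcost_def[symmetric] using p by (auto intro!: powr_mono2)
  qed
  ultimately show ?thesis by (rule Lim_null_comparison[rotated])
qed

definition fm2 :: "'a::euclidean_space set \<Rightarrow> ('a \<times> 'a \<Rightarrow> real) \<Rightarrow> ('a \<times> 'a) measure" where
  "fm2 X P = distr (point_measure (X \<times> X) (\<lambda>z. ennreal (P z))) (borel \<Otimes>\<^sub>M borel) (\<lambda>z. z)"

lemma fm2_coupling:
  assumes X: "finite X" and P: "\<And>z. z \<in> X \<times> X \<Longrightarrow> 0 \<le> P z"
    and m1: "\<And>x. x \<in> X \<Longrightarrow> (\<Sum>y\<in>X. P (x, y)) = m x" and m2: "\<And>y. y \<in> X \<Longrightarrow> (\<Sum>x\<in>X. P (x, y)) = m' y"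
    and m: "m \<in> psimplex X" "m' \<in> psimplex X"
  shows "fm2 X P \<in> couplings (fm X m) (fm X m')"
proof -
  let ?Q = "point_measure (X \<times> X) (\<lambda>z. ennreal (P z))"
  have XX: "finite (X \<times> X)" using X by simp
  have id: "(\<lambda>z. z) \<in> ?Q \<rightarrow>\<^sub>M borel \<Otimes>\<^sub>M borel" by (simp add: space_pair_measure)
  have f: "distr (fm2 X P) borel fst = distr ?Q borel fst" "distr (fm2 X P) borel snd = distr ?Q borel snd"
    unfolding fm2_def by (subst distr_distr[OF _ id], simp_all add: o_def)+
  have sumP: "(\<Sum>z\<in>A \<times> B. P z) = (\<Sum>x\<in>A. \<Sum>y\<in>B. P (x, y))" for A B by (simp add: sum.cartesian_product)
  have d1: "distr ?Q borel fst = fm X m"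
  proof (rule measure_eqI)
    fix A assume "A \<in> sets (distr ?Q borel fst)"
    then have A: "A \<in> sets borel" by simp
    have "fst -` A \<inter> space ?Q = (X \<inter> A) \<times> X" by (auto simp: space_point_measure)
    then have "emeasure (distr ?Q borel fst) A = emeasure ?Q ((X \<inter> A) \<times> X)" using A by (subst emeasure_distr) auto
    also have "\<dots> = (\<Sum>z\<in>(X \<inter> A) \<times> X. ennreal (P z))" using XX by (intro emeasure_point_measure_finite) auto
    also have "\<dots> = ennreal (\<Sum>z\<in>(X \<inter> A) \<times> X. P z)" using P by (intro sum_ennreal) auto
    also have "(\<Sum>z\<in>(X \<inter> A) \<times> X. P z) = (\<Sum>x\<in>X \<inter> A. m x)" unfolding sumP using m1 by (intro sum.cong) auto
    finally show "emeasure (distr ?Q borel fst) A = emeasure (fm X m) A" using X A m by (simp add: emeasure_fm psimplex_def)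
  qed simp
  have d2: "distr ?Q borel snd = fm X m'"
  proof (rule measure_eqI)
    fix A assume "A \<in> sets (distr ?Q borel snd)"
    then have A: "A \<in> sets borel" by simp
    have "snd -` A \<inter> space ?Q = X \<times> (X \<inter> A)" by (auto simp: space_point_measure)
    then have "emeasure (distr ?Q borel snd) A = emeasure ?Q (X \<times> (X \<inter> A))" using A by (subst emeasure_distr) auto
    also have "\<dots> = (\<Sum>z\<in>X \<times> (X \<inter> A). ennreal (P z))" using XX by (intro emeasure_point_measure_finite) auto
    also have "\<dots> = ennreal (\<Sum>z\<in>X \<times> (X \<inter> A). P z)" using P by (intro sum_ennreal) auto
    also have "(\<Sum>z\<in>X \<times> (X \<inter> A). P z) = (\<Sum>y\<in>X \<inter> A. \<Sum>x\<in>X. P (x, y))" unfolding sumP by (rule sum.swap)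
    also have "\<dots> = (\<Sum>y\<in>X \<inter> A. m' y)" using m2 by (intro sum.cong) auto
    finally show "emeasure (distr ?Q borel snd) A = emeasure (fm X m') A" using X A m by (simp add: emeasure_fm psimplex_def)
  qed simp
  have "prob_space (fm2 X P)"
  proof (rule prob_spaceI)
    have "fst -` UNIV \<inter> space (fm2 X P) = space (fm2 X P)" by simp
    then have "emeasure (fm2 X P) (space (fm2 X P)) = emeasure (distr (fm2 X P) borel fst) UNIV"
      by (subst emeasure_distr) (auto simp: fm2_def)
    also have "\<dots> = 1" unfolding f d1 using X m by (simp add: emeasure_fm psimplex_def)
    finally show "emeasure (fm2 X P) (space (fm2 X P)) = 1" .
  qed
  then show ?thesis unfolding couplings_def using f d1 d2 by (simp add: fm2_def)
qed

lemma tcost_fm2: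
  assumes "finite X"
  shows "tcost p (fm2 X P) = (\<Sum>z\<in>X \<times> X. ennreal (P z) * ennreal (dist (fst z) (snd z) powr p))"
proof -
  have id: "(\<lambda>z. z) \<in> point_measure (X \<times> X) (\<lambda>z. ennreal (P z)) \<rightarrow>\<^sub>M borel \<Otimes>\<^sub>M borel" by (simp add: space_pair_measure)
  show ?thesis unfolding tcost_def fm2_def
    using assms dist_powr_measurable by (subst nn_integral_distr[OF id]) (auto simp: nn_integral_point_measure_finite)
qed

text \<open>The common mass stays in place and the excess masses are coupled independently
  (if there is no excess, the quotient below is 0 by convention).\<close>

lemma maximal_coupling:
  assumes X: "finite X" and m: "m \<in> psimplex X" and m': "m' \<in> psimplex X"
    and D: "\<And>x y. x \<in> X \<Longrightarrow> y \<in> X \<Longrightarrow> dist x y powr p \<le> D" and p: "0 < p"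
  shows "\<exists>\<pi>\<in>couplings (fm X m) (fm X m'). tcost p \<pi> \<le> ennreal (D * (\<Sum>x\<in>X. \<bar>m x - m' x\<bar>))"
proof -
  define mi where "mi x = min (m x) (m' x)" for x
  define \<tau> where "\<tau> = (\<Sum>x\<in>X. m x - mi x)"
  have s: "(\<Sum>x\<in>X. m x) = 1" "(\<Sum>x\<in>X. m' x) = 1" "\<And>x. x \<in> X \<Longrightarrow> 0 \<le> m x" "\<And>x. x \<in> X \<Longrightarrow> 0 \<le> m' x"
    using m m' by (auto simp: psimplex_def)
  \<comment> \<open>Both weight vectors have total 1, so the excess over the common part is the same
    on either side.\<close>
  have \<tau>': "\<tau> = (\<Sum>x\<in>X. m' x - mi x)" unfolding \<tau>_def sum_subtractf s(1,2) ..
  have nn: "0 \<le> m x - mi x" "0 \<le> m' x - mi x" for x by (auto simp: mi_def)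
  have \<tau>0: "0 \<le> \<tau>" unfolding \<tau>_def by (intro sum_nonneg nn)
  define P where "P z = (if fst z = snd z then mi (fst z) else 0) + (m (fst z) - mi (fst z)) * (m' (snd z) - mi (snd z)) / \<tau>" for z
  have Pn: "0 \<le> P z" if "z \<in> X \<times> X" for z
    unfolding P_def using that s nn \<tau>0 by (auto simp: mi_def intro!: add_nonneg_nonneg divide_nonneg_nonneg mult_nonneg_nonneg)
  have zero: "m x - mi x = 0" "m' x - mi x = 0" if "\<tau> = 0" "x \<in> X" for x
  proof -
    have "(\<Sum>x\<in>X. m x - mi x) = 0" "(\<Sum>x\<in>X. m' x - mi x) = 0" using that(1) \<tau>' \<tau>_def by auto
    then show "m x - mi x = 0" "m' x - mi x = 0" using that(2) X nn by (simp_all add: sum_nonneg_eq_0_iff)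
  qed
  have P1: "(\<Sum>y\<in>X. P (x, y)) = m x" if "x \<in> X" for x
  proof -
    have "(\<Sum>y\<in>X. P (x, y)) = mi x + (m x - mi x) * \<tau> / \<tau>"
      unfolding P_def using X that by (simp add: sum.distrib sum_divide_distrib[symmetric] sum_distrib_left[symmetric] \<tau>')
    then show ?thesis using zero(1)[OF _ that] by (cases "\<tau> = 0") auto
  qed
  have P2: "(\<Sum>x\<in>X. P (x, y)) = m' y" if "y \<in> X" for y
  proof -
    have "(\<Sum>x\<in>X. P (x, y)) = mi y + \<tau> * (m' y - mi y) / \<tau>"
      unfolding P_def using X that by (simp add: sum.distrib sum_divide_distrib[symmetric] sum_distrib_right[symmetric] \<tau>_def)
    then show ?thesis using zero(2)[OF _ that] by (cases "\<tau> = 0") auto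
  qed
  have c: "fm2 X P \<in> couplings (fm X m) (fm X m')" by (rule fm2_coupling[OF X Pn P1 P2 m m'])
  have D0: "0 \<le> D" if ne: "X \<noteq> {}"
  proof -
    obtain x where "x \<in> X" using ne by blast
    then show ?thesis using order_trans[OF powr_ge_zero D] by blast
  qed
  have "tcost p (fm2 X P) = (\<Sum>z\<in>X \<times> X. ennreal (P z * dist (fst z) (snd z) powr p))"
    unfolding tcost_fm2[OF X] using Pn by (intro sum.cong) (auto simp: ennreal_mult)
  also have "\<dots> = ennreal (\<Sum>z\<in>X \<times> X. P z * dist (fst z) (snd z) powr p)" using Pn by (intro sum_ennreal) auto
  also have "(\<Sum>z\<in>X \<times> X. P z * dist (fst z) (snd z) powr p) \<le> D * (\<Sum>x\<in>X. \<bar>m x - m' x\<bar>)"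
  proof -
    have "P z * dist (fst z) (snd z) powr p \<le> D * ((m (fst z) - mi (fst z)) * (m' (snd z) - mi (snd z)) / \<tau>)" if z: "z \<in> X \<times> X" for z
    proof (cases "fst z = snd z")
      case True
      then show ?thesis using nn \<tau>0 D0 z p by (auto intro!: mult_nonneg_nonneg divide_nonneg_nonneg)
    next
      case False
      define q where "q = (m (fst z) - mi (fst z)) * (m' (snd z) - mi (snd z)) / \<tau>"
      have "0 \<le> q" unfolding q_def using nn \<tau>0 by (intro divide_nonneg_nonneg mult_nonneg_nonneg)
      moreover have "dist (fst z) (snd z) powr p \<le> D" using z by (intro D) auto
      ultimately have "q * dist (fst z) (snd z) powr p \<le> q * D" by (intro mult_left_mono)
      then show ?thesis unfolding P_def q_def[symmetric] using False by (simp add: mult.commute)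
    qed
    then have "(\<Sum>z\<in>X \<times> X. P z * dist (fst z) (snd z) powr p) \<le> (\<Sum>z\<in>X \<times> X. D * ((m (fst z) - mi (fst z)) * (m' (snd z) - mi (snd z)) / \<tau>))" by (rule sum_mono)
    also have "\<dots> = (\<Sum>x\<in>X. \<Sum>y\<in>X. D * ((m x - mi x) * (m' y - mi y) / \<tau>))" by (simp add: sum.cartesian_product case_prod_beta)
    also have "\<dots> = D * (\<tau> * \<tau> / \<tau>)"
      unfolding sum_distrib_left[symmetric] sum_divide_distrib[symmetric] \<tau>'[symmetric]
      unfolding sum_distrib_right[symmetric] \<tau>_def[symmetric] ..
    also have "\<dots> = D * \<tau>" by simp
    also have "\<dots> \<le> D * (\<Sum>x\<in>X. \<bar>m x - m' x\<bar>)"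
    proof (cases "X = {}")
      case False
      have "\<tau> \<le> (\<Sum>x\<in>X. \<bar>m x - m' x\<bar>)" unfolding \<tau>_def by (intro sum_mono) (auto simp: mi_def)
      then show ?thesis using D0[OF False] by (intro mult_left_mono)
    qed (simp add: \<tau>_def)
    finally show ?thesis .
  qed
  finally have "tcost p (fm2 X P) \<le> ennreal (D * (\<Sum>x\<in>X. \<bar>m x - m' x\<bar>))" by (simp add: ennreal_leI)
  then show ?thesis using c by blast
qed

text \<open>For p \<ge> 1 the maximal coupling costs at most a constant times the sum of the
  differences of the weights, which tends to 0.\<close>

lemma fm_convP:
  assumes X: "finite X" and ms: "\<And>n. ms n \<in> psimplex X" and m: "m \<in> psimplex X" and p: "p = 0 \<or> p \<ge> 1"
    and lim: "\<And>x. x \<in> X \<Longrightarrow> (\<lambda>n. ms n x) \<longlonglongrightarrow> m x"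
  shows "convP p (\<lambda>n. fm X (ms n)) (fm X m)"
proof (cases "p = 0")
  case True
  have "(\<lambda>n. \<integral>x. f x \<partial>fm X (ms n)) \<longlonglongrightarrow> (\<integral>x. f x \<partial>fm X m)" if "continuous_on UNIV f" for f :: "'a \<Rightarrow> real"
  proof -
    have fm: "f \<in> borel_measurable borel" using that by (rule borel_measurable_continuous_onI)
    have "(\<lambda>n. \<Sum>x\<in>X. ms n x * f x) \<longlonglongrightarrow> (\<Sum>x\<in>X. m x * f x)" by (intro tendsto_intros lim)
    moreover have "(\<integral>x. f x \<partial>fm X (ms n)) = (\<Sum>x\<in>X. ms n x * f x)" for n using ms[of n] by (intro integral_fm[OF X fm]) (auto simp: psimplex_def)
    moreover have "(\<integral>x. f x \<partial>fm X m) = (\<Sum>x\<in>X. m x * f x)" using m by (intro integral_fm[OF X fm]) (auto simp: psimplex_def)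
    ultimately show ?thesis by simp
  qed
  then show ?thesis using True by (simp add: convP_def)
next
  case False
  then have p1: "p \<ge> 1" using p by simp
  define D where "D = (\<Sum>z\<in>X \<times> X. dist (fst z) (snd z) powr p)"
  have D: "dist x y powr p \<le> D" if "x \<in> X" "y \<in> X" for x y
    unfolding D_def using X that member_le_sum[of "(x, y)" "X \<times> X" "\<lambda>z. dist (fst z) (snd z) powr p"] by auto
  have "\<exists>\<pi>. \<pi> \<in> couplings (fm X (ms n)) (fm X m) \<and> tcost p \<pi> \<le> ennreal (D * (\<Sum>x\<in>X. \<bar>ms n x - m x\<bar>))" for n
    using maximal_coupling[OF X ms m D] p1 by auto
  then obtain \<pi> where \<pi>: "\<And>n. \<pi> n \<in> couplings (fm X (ms n)) (fm X m)" "\<And>n. tcost p (\<pi> n) \<le> ennreal (D * (\<Sum>x\<in>X. \<bar>ms n x - m x\<bar>))"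
    using choice[of "\<lambda>n \<pi>. \<pi> \<in> couplings (fm X (ms n)) (fm X m) \<and> tcost p \<pi> \<le> ennreal (D * (\<Sum>x\<in>X. \<bar>ms n x - m x\<bar>))"] by blast
  have "(\<lambda>n. D * (\<Sum>x\<in>X. \<bar>ms n x - m x\<bar>)) \<longlonglongrightarrow> D * (\<Sum>x\<in>X. \<bar>m x - m x\<bar>)" by (intro tendsto_intros lim)
  then have "(\<lambda>n. ennreal (D * (\<Sum>x\<in>X. \<bar>ms n x - m x\<bar>))) \<longlonglongrightarrow> ennreal 0" by (intro tendsto_ennrealI) simp
  then have "(\<lambda>n. tcost p (\<pi> n)) \<longlonglongrightarrow> 0"
    using \<pi>(2) by (intro tendsto_sandwich[of "\<lambda>n. 0" "\<lambda>n. tcost p (\<pi> n)" _ "\<lambda>n. ennreal (D * (\<Sum>x\<in>X. \<bar>ms n x - m x\<bar>))"]) auto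
  then show ?thesis using Wass_tendsto_0[OF p1 \<pi>(1)] False by (simp add: convP_def)
qed

text \<open>Push \<mu> forward by simple functions \<open>T n\<close> that tend to the identity with
  \<open>norm (T n x) \<le> 2 * norm x\<close>. For p \<ge> 1 the law of \<open>(T n x, x)\<close>
  is a coupling whose cost density is dominated by \<open>3 powr p * norm x powr p\<close>, so
  dominated convergence applies.\<close>

lemma finite_measures_dense:
  fixes \<mu> :: "'a::euclidean_space measure"
  assumes p: "p = 0 \<or> p \<ge> 1" and \<mu>: "\<mu> \<in> Pp p"
  shows "\<exists>\<mu>s. (\<forall>n. \<exists>X m. finite X \<and> m \<in> psimplex X \<and> \<mu>s n = fm X m) \<and> convP p \<mu>s \<mu>"
proof -
  have P: "\<mu> \<in> Prob" by (rule Pp_Prob[OF \<mu>])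
  interpret prob_space \<mu> by (rule Prob_D[OF P])
  note s = Prob_D(2)[OF P] and sp = Prob_D(3)[OF P]
  have id: "(\<lambda>x::'a. x) \<in> borel_measurable \<mu>" unfolding measurable_Prob[OF P] by simp
  obtain T where T: "\<And>i. simple_function \<mu> (T i)" "\<And>x. (\<lambda>i. T i x) \<longlonglongrightarrow> x" "\<And>i x. norm (T i x) \<le> 2 * norm x"
    using borel_measurable_implies_sequence_metric[OF id, of 0] sp by auto
  have Tm: "T i \<in> \<mu> \<rightarrow>\<^sub>M borel" for i by (rule borel_measurable_simple_function[OF T(1)])
  define \<mu>s where "\<mu>s i = distr \<mu> borel (T i)" for i
  have fin: "\<exists>X m. finite X \<and> m \<in> psimplex X \<and> \<mu>s i = fm X m" for i
  proof -
    have X: "finite (range (T i))" using T(1)[of i] sp by (simp add: simple_function_def)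
    have Pi: "\<mu>s i \<in> Prob" unfolding Prob_def \<mu>s_def using prob_space_distr[OF Tm] by simp
    have "UNIV - range (T i) \<in> sets borel" using X by (intro sets.Diff) (auto intro: borel_closed finite_imp_closed)
    then have "emeasure (\<mu>s i) (UNIV - range (T i)) = emeasure \<mu> (T i -` (UNIV - range (T i)) \<inter> space \<mu>)"
      unfolding \<mu>s_def by (rule emeasure_distr[OF Tm])
    also have "T i -` (UNIV - range (T i)) \<inter> space \<mu> = {}" by auto
    finally have "emeasure (\<mu>s i) (UNIV - range (T i)) = 0" by simp
    then show ?thesis using Prob_finite_support[OF X Pi] X
      by (intro exI[of _ "range (T i)"] exI[of _ "\<lambda>x. measure (\<mu>s i) {x}"] conjI)
  qed
  have "convP p \<mu>s \<mu>"
  proof (cases "p = 0")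
    case True
    have "(\<lambda>n. \<integral>x. f x \<partial>\<mu>s n) \<longlonglongrightarrow> (\<integral>x. f x \<partial>\<mu>)" if f: "continuous_on UNIV f" "bounded (range f)" for f :: "'a \<Rightarrow> real"
    proof -
      have fm: "f \<in> borel_measurable borel" using f(1) by (rule borel_measurable_continuous_onI)
      obtain B where B: "\<And>x. norm (f x) \<le> B" using f(2) by (auto simp: bounded_iff)
      have "(\<lambda>n. \<integral>x. f (T n x) \<partial>\<mu>) \<longlonglongrightarrow> (\<integral>x. f x \<partial>\<mu>)"
      proof (rule integral_dominated_convergence[where w = "\<lambda>x. B"])
        show "AE x in \<mu>. (\<lambda>n. f (T n x)) \<longlonglongrightarrow> f x"
          using f(1) T(2) by (intro AE_I2 continuous_on_tendsto_compose[OF f(1)]) auto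
        show "\<And>n. (\<lambda>x. f (T n x)) \<in> borel_measurable \<mu>" by (rule measurable_compose[OF Tm fm])
        show "f \<in> borel_measurable \<mu>" using fm unfolding measurable_Prob[OF P] .
      qed (use B in auto)
      moreover have "(\<integral>x. f x \<partial>\<mu>s n) = (\<integral>x. f (T n x) \<partial>\<mu>)" for n unfolding \<mu>s_def by (rule integral_distr[OF Tm fm])
      ultimately show ?thesis by simp
    qed
    then show ?thesis using True by (simp add: convP_def)
  next
    case False
    then have p1: "p \<ge> 1" using p by simp
    define \<pi> where "\<pi> n = distr \<mu> (borel \<Otimes>\<^sub>M borel) (\<lambda>x. (T n x, x))" for n
    have pm: "(\<lambda>x. (T n x, x)) \<in> \<mu> \<rightarrow>\<^sub>M borel \<Otimes>\<^sub>M borel" for n using Tm id by (intro measurable_Pair)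
    have \<pi>: "\<pi> n \<in> couplings (\<mu>s n) \<mu>" for n
    proof -
      have "distr (\<pi> n) borel fst = \<mu>s n" unfolding \<pi>_def \<mu>s_def by (subst distr_distr[OF _ pm]) (auto simp: o_def)
      moreover have "distr (\<pi> n) borel snd = \<mu>" unfolding \<pi>_def using distr_id2[OF s[symmetric]] by (subst distr_distr[OF _ pm]) (auto simp: o_def)
      ultimately show ?thesis unfolding couplings_def \<pi>_def using prob_space_distr[OF pm] by simp
    qed
    have tc: "tcost p (\<pi> n) = (\<integral>\<^sup>+ x. ennreal (dist (T n x) x powr p) \<partial>\<mu>)" for n
      unfolding tcost_def \<pi>_def using dist_powr_measurable by (subst nn_integral_distr[OF pm]) auto
    have "(\<lambda>n. \<integral>\<^sup>+ x. ennreal (dist (T n x) x powr p) \<partial>\<mu>) \<longlonglongrightarrow> (\<integral>\<^sup>+ x. 0 \<partial>\<mu>)"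
    proof (rule nn_integral_dominated_convergence[where w = "\<lambda>x. ennreal (3 powr p) * ennreal (norm x powr p)"])
      show "(\<lambda>x. ennreal (dist (T n x) x powr p)) \<in> borel_measurable \<mu>" for n
        using measurable_compose[OF pm dist_powr_measurable, of n p] by simp
      have n: "(\<lambda>x::'a. ennreal (norm x powr p)) \<in> borel_measurable \<mu>" unfolding measurable_Prob[OF P] by measurable
      then show "(\<lambda>x. ennreal (3 powr p) * ennreal (norm x powr p)) \<in> borel_measurable \<mu>" by measurable
      show "(\<integral>\<^sup>+ x. ennreal (3 powr p) * ennreal (norm x powr p) \<partial>\<mu>) < \<infinity>"
        using \<mu> False n by (subst nn_integral_cmult) (auto simp: Pp_def ennreal_mult_less_top)
      show "AE x in \<mu>. ennreal (dist (T n x) x powr p) \<le> ennreal (3 powr p) * ennreal (norm x powr p)" for n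
      proof (rule AE_I2)
        fix x
        have "dist (T n x) x \<le> 3 * norm x" using T(3)[of n x] norm_triangle_ineq4[of "T n x" x] by (simp add: dist_norm)
        then have "dist (T n x) x powr p \<le> (3 * norm x) powr p" using p1 by (intro powr_mono2) auto
        also have "\<dots> = 3 powr p * norm x powr p" by (rule powr_mult)
        finally show "ennreal (dist (T n x) x powr p) \<le> ennreal (3 powr p) * ennreal (norm x powr p)" by (simp add: ennreal_mult[symmetric] ennreal_leI)
      qed
      show "AE x in \<mu>. (\<lambda>n. ennreal (dist (T n x) x powr p)) \<longlonglongrightarrow> 0"
      proof (rule AE_I2)
        fix x
        have "(\<lambda>n. dist (T n x) x) \<longlonglongrightarrow> 0" using tendsto_dist[OF T(2)[of x] tendsto_const[of x]] by simp
        then have "(\<lambda>n. dist (T n x) x powr p) \<longlonglongrightarrow> 0 powr p" using p1 by (intro tendsto_powr') auto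
        then have "(\<lambda>n. ennreal (dist (T n x) x powr p)) \<longlonglongrightarrow> ennreal 0" by (intro tendsto_ennrealI) simp
        then show "(\<lambda>n. ennreal (dist (T n x) x powr p)) \<longlonglongrightarrow> 0" by simp
      qed
    qed simp
    then have "(\<lambda>n. tcost p (\<pi> n)) \<longlonglongrightarrow> 0" unfolding tc by simp
    then show ?thesis using Wass_tendsto_0[OF p1 \<pi>] False by (simp add: convP_def)
  qed
  then show ?thesis using fin by (intro exI[of _ \<mu>s] conjI allI) assumption+
qed

section \<open>Mixtures of two measures\<close>

lemma emeasure_mixm:
  assumes \<mu>: "\<mu> \<in> Prob" and \<nu>: "\<nu> \<in> Prob" and A: "A \<in> sets borel"
  shows "emeasure (mixm t \<nu> \<mu>) A = ennreal t * emeasure \<nu> A + ennreal (1 - t) * emeasure \<mu> A"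
  unfolding mixm_def
\<comment> \<open>\<open>measure_of\<close> yields the zero measure for a set function that is not
  countably additive, so this must be proved before the formula can be read off.\<close>
proof (rule emeasure_measure_of_sigma)
  show "sigma_algebra UNIV (sets (borel :: 'a measure))" using sets.sigma_algebra_axioms[of "borel :: 'a measure"] by simp
  show "positive (sets borel) (\<lambda>A. ennreal t * emeasure \<nu> A + ennreal (1 - t) * emeasure \<mu> A)" by (simp add: positive_def)
  show "countably_additive (sets borel) (\<lambda>A. ennreal t * emeasure \<nu> A + ennreal (1 - t) * emeasure \<mu> A)"
  proof (rule countably_additiveI)
    fix B :: "nat \<Rightarrow> 'a set" assume B: "range B \<subseteq> sets borel" "disjoint_family B"
    have "(\<Sum>i. emeasure \<nu> (B i)) = emeasure \<nu> (\<Union>i. B i)" "(\<Sum>i. emeasure \<mu> (B i)) = emeasure \<mu> (\<Union>i. B i)"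
      using B Prob_D(2)[OF \<mu>] Prob_D(2)[OF \<nu>] by (intro suminf_emeasure; simp)+
    then show "(\<Sum>i. ennreal t * emeasure \<nu> (B i) + ennreal (1 - t) * emeasure \<mu> (B i))
       = ennreal t * emeasure \<nu> (\<Union>i. B i) + ennreal (1 - t) * emeasure \<mu> (\<Union>i. B i)"
      by (simp add: suminf_add[symmetric])
  qed
qed (rule A)

lemma sets_mixm [simp]: "sets (mixm t \<nu> \<mu>) = sets borel"
  unfolding mixm_def using sets.sigma_sets_eq[of "borel :: 'a measure"] by (simp add: sets_measure_of)

lemma nn_integral_mixm:
  assumes \<mu>: "\<mu> \<in> Prob" and \<nu>: "\<nu> \<in> Prob" and g: "g \<in> borel_measurable borel"
  shows "(\<integral>\<^sup>+ x. g x \<partial>mixm t \<nu> \<mu>) = ennreal t * (\<integral>\<^sup>+ x. g x \<partial>\<nu>) + ennreal (1 - t) * (\<integral>\<^sup>+ x. g x \<partial>\<mu>)"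
proof -
  have mm: "h \<in> borel_measurable \<mu>" "h \<in> borel_measurable \<nu>" "h \<in> borel_measurable (mixm t \<nu> \<mu>)"
    if "h \<in> borel_measurable borel" for h :: "'a \<Rightarrow> ennreal"
    using that measurable_Prob[OF \<mu>, where 'b = ennreal] measurable_Prob[OF \<nu>, where 'b = ennreal]
      measurable_cong_sets[OF sets_mixm[of t \<nu> \<mu>] refl, of "borel :: ennreal measure"] by simp_all
  show ?thesis using g
proof (induction g rule: borel_measurable_induct)
  case (cong f g)
  then show ?case by (simp add: fun_eq_iff[symmetric, of f g] cong: nn_integral_cong)
next
  case (set A)
  then show ?case using Prob_D(2)[OF \<mu>] Prob_D(2)[OF \<nu>] by (simp add: emeasure_mixm[OF \<mu> \<nu>])
next
  case (mult f c)
  note m = mm[OF mult.hyps(2)]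
  show ?case unfolding nn_integral_cmult[OF m(1)] nn_integral_cmult[OF m(2)] nn_integral_cmult[OF m(3)] mult.IH
    by (simp add: distrib_left mult.left_commute)
next
  case (add f g)
  note m = mm[OF add.hyps(1)] mm[OF add.hyps(3)]
  have ih: "(\<integral>\<^sup>+ x. f x \<partial>mixm t \<nu> \<mu>) = ennreal t * (\<integral>\<^sup>+ x. f x \<partial>\<nu>) + ennreal (1 - t) * (\<integral>\<^sup>+ x. f x \<partial>\<mu>)"
    "(\<integral>\<^sup>+ x. g x \<partial>mixm t \<nu> \<mu>) = ennreal t * (\<integral>\<^sup>+ x. g x \<partial>\<nu>) + ennreal (1 - t) * (\<integral>\<^sup>+ x. g x \<partial>\<mu>)"
    by (rule add.IH)+
  show ?case
    unfolding nn_integral_add[OF m(4) m(1)] nn_integral_add[OF m(5) m(2)] nn_integral_add[OF m(6) m(3)] ih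
    by (simp add: distrib_left ac_simps)
next
  case (seq U)
  note m = mm[OF seq.hyps(1)]
  have S: "(\<Squnion>i. U i) = (\<lambda>x. \<Squnion>i. U i x)" by (auto simp: fun_eq_iff image_comp)
  have inc: "incseq (\<lambda>i. \<integral>\<^sup>+ x. U i x \<partial>M)" for M using seq.hyps(3) by (auto simp: incseq_def le_fun_def intro!: nn_integral_mono)
  have e: "(\<integral>\<^sup>+ x. (\<Squnion>i. U i) x \<partial>M) = (\<Squnion>i. \<integral>\<^sup>+ x. U i x \<partial>M)" if "\<And>i. U i \<in> borel_measurable M" for M
    unfolding S by (rule nn_integral_monotone_convergence_SUP[OF seq.hyps(3) that])
  have "(\<Squnion>i. ennreal t * (\<integral>\<^sup>+ x. U i x \<partial>\<nu>) + ennreal (1 - t) * (\<integral>\<^sup>+ x. U i x \<partial>\<mu>))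
     = (\<Squnion>i. ennreal t * (\<integral>\<^sup>+ x. U i x \<partial>\<nu>)) + (\<Squnion>i. ennreal (1 - t) * (\<integral>\<^sup>+ x. U i x \<partial>\<mu>))"
    using inc by (intro ennreal_SUP_add) (auto simp: incseq_def intro!: mult_left_mono)
  also have "\<dots> = ennreal t * (\<Squnion>i. \<integral>\<^sup>+ x. U i x \<partial>\<nu>) + ennreal (1 - t) * (\<Squnion>i. \<integral>\<^sup>+ x. U i x \<partial>\<mu>)"
    by (simp add: SUP_mult_left_ennreal)
  finally show ?case unfolding e[OF m(1)] e[OF m(2)] e[OF m(3)] seq.IH .
qed
qed

lemma integral_mixm:
  fixes g :: "'a::euclidean_space \<Rightarrow> real"
  assumes \<mu>: "\<mu> \<in> Prob" and \<nu>: "\<nu> \<in> Prob" and g: "g \<in> borel_measurable borel" "\<And>x. \<bar>g x\<bar> \<le> B" and t: "0 \<le> t" "t \<le> 1"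
  shows "(\<integral>x. g x \<partial>mixm t \<nu> \<mu>) = t * (\<integral>x. g x \<partial>\<nu>) + (1 - t) * (\<integral>x. g x \<partial>\<mu>)"
proof -
  interpret M: prob_space \<mu> by (rule Prob_D[OF \<mu>])
  interpret N: prob_space \<nu> by (rule Prob_D[OF \<nu>])
  have sp: "space (mixm t \<nu> \<mu>) = UNIV" using sets_eq_imp_space_eq[OF sets_mixm[of t \<nu> \<mu>]] by simp
  have "emeasure (mixm t \<nu> \<mu>) UNIV = 1"
    using emeasure_mixm[OF \<mu> \<nu>, of UNIV t] M.emeasure_space_1 N.emeasure_space_1 t
    by (simp add: Prob_D(3)[OF \<mu>] Prob_D(3)[OF \<nu>] ennreal_plus[symmetric] del: ennreal_plus)
  then have pm: "prob_space (mixm t \<nu> \<mu>)" using sp by (intro prob_spaceI) simp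
  interpret X: prob_space "mixm t \<nu> \<mu>" by (rule pm)
  have P: "mixm t \<nu> \<mu> \<in> Prob" unfolding Prob_def using pm by simp
  \<comment> \<open>Adding B makes g nonnegative, so the formula for \<open>nn_integral\<close>
    applies; the constant drops out again because all three measures are probabilities.\<close>
  define h where "h x = g x + B" for x
  have h0: "0 \<le> h x" "\<bar>h x\<bar> \<le> 2 * B" for x using g(2)[of x] by (auto simp: h_def abs_le_iff)
  have hm: "h \<in> borel_measurable borel" unfolding h_def using g(1) by measurable
  have int: "integrable \<kappa> g" "integrable \<kappa> h" "(\<integral>x. h x \<partial>\<kappa>) = (\<integral>x. g x \<partial>\<kappa>) + B" "(\<integral>\<^sup>+ x. ennreal (h x) \<partial>\<kappa>) = ennreal (\<integral>x. h x \<partial>\<kappa>)"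
    "0 \<le> (\<integral>x. h x \<partial>\<kappa>)"
    if \<kappa>: "\<kappa> \<in> Prob" for \<kappa>
  proof -
    interpret K: prob_space \<kappa> by (rule Prob_D[OF \<kappa>])
    show 1: "integrable \<kappa> g" using g measurable_Prob[OF \<kappa>] by (intro K.integrable_const_bound[of _ B]) auto
    show 2: "integrable \<kappa> h" using hm h0 measurable_Prob[OF \<kappa>] by (intro K.integrable_const_bound[of _ "2 * B"]) auto
    show "(\<integral>x. h x \<partial>\<kappa>) = (\<integral>x. g x \<partial>\<kappa>) + B" unfolding h_def using 1 K.prob_space by simp
    show "(\<integral>\<^sup>+ x. ennreal (h x) \<partial>\<kappa>) = ennreal (\<integral>x. h x \<partial>\<kappa>)" using 2 h0 by (intro nn_integral_eq_integral) auto
    show "0 \<le> (\<integral>x. h x \<partial>\<kappa>)" using h0 by (intro integral_nonneg_AE) auto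
  qed
  have hm': "(\<lambda>x. ennreal (h x)) \<in> borel_measurable borel" using hm by measurable
  have "ennreal (\<integral>x. h x \<partial>mixm t \<nu> \<mu>) = ennreal t * ennreal (\<integral>x. h x \<partial>\<nu>) + ennreal (1 - t) * ennreal (\<integral>x. h x \<partial>\<mu>)"
    using nn_integral_mixm[OF \<mu> \<nu> hm', of t] unfolding int(4)[OF P] int(4)[OF \<mu>] int(4)[OF \<nu>] .
  also have "\<dots> = ennreal (t * (\<integral>x. h x \<partial>\<nu>) + (1 - t) * (\<integral>x. h x \<partial>\<mu>))"
    using t int(5)[OF \<mu>] int(5)[OF \<nu>] by (simp add: ennreal_mult[symmetric] ennreal_plus[symmetric] del: ennreal_plus)
  finally have "(\<integral>x. h x \<partial>mixm t \<nu> \<mu>) = t * (\<integral>x. h x \<partial>\<nu>) + (1 - t) * (\<integral>x. h x \<partial>\<mu>)"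
    using int(5)[OF P] t int(5)[OF \<mu>] int(5)[OF \<nu>] by (subst (asm) ennreal_inj) (auto intro!: add_nonneg_nonneg mult_nonneg_nonneg)
  then show ?thesis unfolding int(3)[OF P] int(3)[OF \<mu>] int(3)[OF \<nu>] by (simp add: algebra_simps)
qed

section \<open>Cylindrical test functions\<close>

text \<open>A quadratic polynomial plus a separable quartic, to be evaluated at the relative
  perturbation of the weights. For symmetric \<Gamma> the functions \<open>cpol1\<close> and
  \<open>cpol2\<close> below are its first and second partial derivatives.\<close>

definition cpol :: "'i set \<Rightarrow> real \<Rightarrow> ('i \<Rightarrow> real) \<Rightarrow> ('i \<Rightarrow> 'i \<Rightarrow> real) \<Rightarrow> real \<Rightarrow> ('i \<Rightarrow> real) \<Rightarrow> real" where
  "cpol X \<alpha> b \<Gamma> K a = \<alpha> + (\<Sum>k\<in>X. b k * a k) + (\<Sum>k\<in>X. \<Sum>l\<in>X. \<Gamma> k l * a k * a l) / 2 + K * (\<Sum>k\<in>X. (a k) ^ 4)"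

definition cpol1 :: "'i set \<Rightarrow> ('i \<Rightarrow> real) \<Rightarrow> ('i \<Rightarrow> 'i \<Rightarrow> real) \<Rightarrow> real \<Rightarrow> 'i \<Rightarrow> ('i \<Rightarrow> real) \<Rightarrow> real" where
  "cpol1 X b \<Gamma> K k a = b k + (\<Sum>l\<in>X. \<Gamma> k l * a l) + 4 * K * (a k) ^ 3"

definition cpol2 :: "('i \<Rightarrow> 'i \<Rightarrow> real) \<Rightarrow> real \<Rightarrow> 'i \<Rightarrow> 'i \<Rightarrow> ('i \<Rightarrow> real) \<Rightarrow> real" where
  "cpol2 \<Gamma> K k l a = \<Gamma> k l + (if k = l then 12 * K * (a k)\<^sup>2 else 0)"

lemma cpol_deriv:
  assumes X: "finite X" and sym: "\<And>k l. k \<in> X \<Longrightarrow> l \<in> X \<Longrightarrow> \<Gamma> k l = \<Gamma> l k"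
  shows "((\<lambda>t. cpol X \<alpha> b \<Gamma> K (\<lambda>k. a k + t * d k)) has_real_derivative
     (\<Sum>k\<in>X. d k * cpol1 X b \<Gamma> K k (\<lambda>k. a k + t * d k))) (at t)"
proof -
  have "((\<lambda>t. cpol X \<alpha> b \<Gamma> K (\<lambda>k. a k + t * d k)) has_real_derivative
    ((\<Sum>k\<in>X. b k * d k) + (\<Sum>k\<in>X. \<Sum>l\<in>X. \<Gamma> k l * d k * (a l + t * d l) + \<Gamma> k l * (a k + t * d k) * d l) / 2
       + K * (\<Sum>k\<in>X. 4 * (a k + t * d k) ^ 3 * d k))) (at t)"
    unfolding cpol_def by (auto intro!: derivative_eq_intros sum.cong simp: algebra_simps)
  moreover have "(\<Sum>k\<in>X. \<Sum>l\<in>X. \<Gamma> k l * d k * (a l + t * d l) + \<Gamma> k l * (a k + t * d k) * d l) / 2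
     = (\<Sum>k\<in>X. d k * (\<Sum>l\<in>X. \<Gamma> k l * (a l + t * d l)))"
  proof -
    have "(\<Sum>k\<in>X. \<Sum>l\<in>X. \<Gamma> k l * (a k + t * d k) * d l) = (\<Sum>l\<in>X. \<Sum>k\<in>X. \<Gamma> k l * (a k + t * d k) * d l)" by (rule sum.swap)
    also have "\<dots> = (\<Sum>k\<in>X. \<Sum>l\<in>X. \<Gamma> k l * d k * (a l + t * d l))" using sym by (intro sum.cong refl) (simp add: ac_simps)
    finally have "(\<Sum>k\<in>X. \<Sum>l\<in>X. \<Gamma> k l * d k * (a l + t * d l) + \<Gamma> k l * (a k + t * d k) * d l)
       = 2 * (\<Sum>k\<in>X. \<Sum>l\<in>X. \<Gamma> k l * d k * (a l + t * d l))" by (simp add: sum.distrib)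
    then show ?thesis by (simp add: sum_distrib_left ac_simps)
  qed
  moreover have "(\<Sum>k\<in>X. d k * cpol1 X b \<Gamma> K k (\<lambda>k. a k + t * d k)) = (\<Sum>k\<in>X. b k * d k)
      + (\<Sum>k\<in>X. d k * (\<Sum>l\<in>X. \<Gamma> k l * (a l + t * d l))) + K * (\<Sum>k\<in>X. 4 * (a k + t * d k) ^ 3 * d k)"
    unfolding cpol1_def sum_distrib_left[of K] sum.distrib[symmetric] by (intro sum.cong refl) (simp add: algebra_simps)
  ultimately show ?thesis by simp
qed

lemma cpol1_deriv:
  assumes X: "finite X"
  shows "((\<lambda>t. \<Sum>k\<in>X. d k * cpol1 X b \<Gamma> K k (\<lambda>k. a k + t * d k)) has_real_derivative
     (\<Sum>k\<in>X. \<Sum>l\<in>X. d k * d l * cpol2 \<Gamma> K k l (\<lambda>k. a k + t * d k))) (at t)"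
proof -
  have "((\<lambda>t. \<Sum>k\<in>X. d k * cpol1 X b \<Gamma> K k (\<lambda>k. a k + t * d k)) has_real_derivative
     (\<Sum>k\<in>X. d k * ((\<Sum>l\<in>X. \<Gamma> k l * d l) + 12 * K * (a k + t * d k)\<^sup>2 * d k))) (at t)"
    unfolding cpol1_def
    by (auto intro!: derivative_eq_intros sum.cong simp: algebra_simps power2_eq_square numeral_eq_Suc)
  moreover have "(\<Sum>l\<in>X. d k * d l * cpol2 \<Gamma> K k l (\<lambda>k. a k + t * d k)) = d k * ((\<Sum>l\<in>X. \<Gamma> k l * d l) + 12 * K * (a k + t * d k)\<^sup>2 * d k)"
    if "k \<in> X" for k
  proof -
    have "(\<Sum>l\<in>X. d k * d l * cpol2 \<Gamma> K k l (\<lambda>k. a k + t * d k))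
       = (\<Sum>l\<in>X. d k * (\<Gamma> k l * d l) + (if k = l then d k * (12 * K * (a k + t * d k)\<^sup>2 * d k) else 0))"
      unfolding cpol2_def by (intro sum.cong refl) (simp add: algebra_simps)
    also have "\<dots> = (\<Sum>l\<in>X. d k * (\<Gamma> k l * d l)) + d k * (12 * K * (a k + t * d k)\<^sup>2 * d k)"
      using X that unfolding sum.distrib by simp
    finally show ?thesis by (simp add: distrib_left sum_distrib_left)
  qed
  ultimately show ?thesis by (simp cong: sum.cong)
qed

text \<open>The shift by 1 is tied to the bumps used later: with \<open>\<psi> k\<close> equal to
  \<open>1 / mh k\<close> at k and to 0 at the other points of X, the value at \<open>fm X m\<close>
  is \<open>m k / mh k - 1\<close>, the relative perturbation of mh.\<close>

definition cyl_a :: "('i \<Rightarrow> 'a::euclidean_space \<Rightarrow> real) \<Rightarrow> 'a measure \<Rightarrow> 'i \<Rightarrow> real" where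
  "cyl_a \<psi> \<mu> k = (\<integral>x. \<psi> k x \<partial>\<mu>) - 1"

definition cyl_D1 where
  "cyl_D1 X b \<Gamma> K \<psi> x \<mu> = (\<Sum>k\<in>X. cpol1 X b \<Gamma> K k (cyl_a \<psi> \<mu>) * \<psi> k x)"

definition cyl_D2 where
  "cyl_D2 X \<Gamma> K \<psi> x y \<mu> = (\<Sum>k\<in>X. \<Sum>l\<in>X. cpol2 \<Gamma> K k l (cyl_a \<psi> \<mu>) * \<psi> k x * \<psi> l y)"

text \<open>Along a segment of measures every coordinate \<open>cyl_a\<close> is affine, so f
  restricts to a polynomial whose first two derivatives are the pairings of \<open>cyl_D1\<close>
  and \<open>cyl_D2\<close> with the difference of the end points. Both integral formulas are then
  the fundamental theorem of calculus. The growth bounds come from the boundedness of the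
  \<open>\<psi> k\<close>.\<close>

lemma cyl_C2:
  fixes \<psi> :: "'i \<Rightarrow> 'a::euclidean_space \<Rightarrow> real"
  assumes X: "finite X" and sym: "\<And>k l. k \<in> X \<Longrightarrow> l \<in> X \<Longrightarrow> \<Gamma> k l = \<Gamma> l k" and q: "q = 0 \<or> q \<ge> 1"
    and \<psi>: "\<And>k x. k \<in> X \<Longrightarrow> \<bar>\<psi> k x\<bar> \<le> B" "\<And>k x y. k \<in> X \<Longrightarrow> \<bar>\<psi> k x - \<psi> k y\<bar> \<le> L * dist x y"
      "\<And>k. k \<in> X \<Longrightarrow> continuous_on UNIV (\<psi> k)" and L: "0 \<le> L"
  shows "C2 q (\<lambda>\<mu>. cpol X \<alpha> b \<Gamma> K (cyl_a \<psi> \<mu>)) (cyl_D1 X b \<Gamma> K \<psi>) (cyl_D2 X \<Gamma> K \<psi>)"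
proof -
  have m\<psi>: "\<psi> k \<in> borel_measurable borel" if "k \<in> X" for k using \<psi>(3)[OF that] by (rule borel_measurable_continuous_onI)
  have int\<psi>: "integrable \<mu> (\<psi> k)" if "\<mu> \<in> Prob" "k \<in> X" for \<mu> k
  proof -
    interpret prob_space \<mu> by (rule Prob_D[OF that(1)])
    show ?thesis using \<psi>(1)[OF that(2)] m\<psi>[OF that(2)] measurable_Prob[OF that(1)] by (intro integrable_const_bound[of _ B]) auto
  qed
  have ca: "continuous_map (TP q) euclideanreal (\<lambda>\<mu>. cyl_a \<psi> \<mu> k)" if "k \<in> X" for k
    unfolding cyl_a_def using that \<psi> L q
    by (intro continuous_map_diff continuous_TP_integral[of q _ B L]) auto
  have c1: "continuous_map (TP q) euclideanreal (\<lambda>\<mu>. cpol1 X b \<Gamma> K k (cyl_a \<psi> \<mu>))" if "k \<in> X" for k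
    unfolding cpol1_def
    by (intro continuous_map_add continuous_map_sum continuous_map_real_mult continuous_map_real_pow ca that X continuous_map_const[THEN iffD2]) auto
  have c2: "continuous_map (TP q) euclideanreal (\<lambda>\<mu>. cpol2 \<Gamma> K k l (cyl_a \<psi> \<mu>))" if "k \<in> X" for k l
  proof (cases "k = l")
    case True
    then show ?thesis unfolding cpol2_def using that
      by (simp, intro continuous_map_add continuous_map_real_mult continuous_map_real_pow ca continuous_map_const[THEN iffD2]) auto
  qed (simp add: cpol2_def)
  have cpsi: "continuous_map euclidean euclideanreal (\<psi> k)" if "k \<in> X" for k using \<psi>(3)[OF that] by simp
  have T1: "continuous_map (prod_topology euclidean (TP q)) euclideanreal (\<lambda>(x, \<mu>). cyl_D1 X b \<Gamma> K \<psi> x \<mu>)"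
    unfolding cyl_D1_def case_prod_beta
    by (intro continuous_map_sum X continuous_map_real_mult continuous_map_compose[OF continuous_map_snd c1, unfolded o_def]
        continuous_map_compose[OF continuous_map_fst cpsi, unfolded o_def])
  have T2: "continuous_map (prod_topology (prod_topology euclidean euclidean) (TP q)) euclideanreal (\<lambda>((x, y), \<mu>). cyl_D2 X \<Gamma> K \<psi> x y \<mu>)"
    unfolding cyl_D2_def case_prod_beta
    by (intro continuous_map_sum X continuous_map_real_mult continuous_map_compose[OF continuous_map_snd c2, unfolded o_def]
        continuous_map_compose[OF continuous_map_compose[OF continuous_map_fst continuous_map_fst] cpsi, unfolded o_def]
        continuous_map_compose[OF continuous_map_compose[OF continuous_map_fst continuous_map_snd] cpsi, unfolded o_def])
  have symD: "cyl_D2 X \<Gamma> K \<psi> x y \<mu> = cyl_D2 X \<Gamma> K \<psi> y x \<mu>" for x y \<mu>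
  proof -
    have "cyl_D2 X \<Gamma> K \<psi> x y \<mu> = (\<Sum>l\<in>X. \<Sum>k\<in>X. cpol2 \<Gamma> K k l (cyl_a \<psi> \<mu>) * \<psi> k x * \<psi> l y)" unfolding cyl_D2_def by (rule sum.swap)
    also have "\<dots> = cyl_D2 X \<Gamma> K \<psi> y x \<mu>" unfolding cyl_D2_def using sym by (intro sum.cong refl) (auto simp: cpol2_def)
    finally show ?thesis .
  qed
  have B0: "0 \<le> B" if ne: "X \<noteq> {}"
  proof -
    obtain k where "k \<in> X" using ne by blast
    then show ?thesis using order_trans[OF abs_ge_zero \<psi>(1)] by blast
  qed
  have ab: "\<bar>cyl_a \<psi> \<mu> k\<bar> \<le> B + 1" if "\<mu> \<in> Prob" "k \<in> X" for \<mu> k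
  proof -
    interpret prob_space \<mu> by (rule Prob_D[OF that(1)])
    have "\<bar>\<integral>x. \<psi> k x \<partial>\<mu>\<bar> \<le> (\<integral>x. \<bar>\<psi> k x\<bar> \<partial>\<mu>)" by (rule integral_abs_bound)
    also have "\<dots> \<le> (\<integral>x. B \<partial>\<mu>)" using int\<psi>[OF that] \<psi>(1)[OF that(2)] by (intro integral_mono) auto
    also have "\<dots> = B" using prob_space by simp
    finally show ?thesis unfolding cyl_a_def by linarith
  qed
  have pw: "0 \<le> pw x q" for x :: 'a by (simp add: pw_def)
  define A1 where "A1 k = \<bar>b k\<bar> + (\<Sum>l\<in>X. \<bar>\<Gamma> k l\<bar> * (B + 1)) + \<bar>4 * K\<bar> * (B + 1) ^ 3" for k
  have A1: "\<bar>cpol1 X b \<Gamma> K k (cyl_a \<psi> \<mu>)\<bar> \<le> A1 k" if "\<mu> \<in> Prob" "k \<in> X" for \<mu> k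
  proof -
    have "\<bar>\<Sum>l\<in>X. \<Gamma> k l * cyl_a \<psi> \<mu> l\<bar> \<le> (\<Sum>l\<in>X. \<bar>\<Gamma> k l\<bar> * (B + 1))"
      using ab[OF that(1)] by (intro order_trans[OF sum_abs] sum_mono) (auto simp: abs_mult intro: mult_left_mono)
    moreover have "\<bar>4 * K * (cyl_a \<psi> \<mu> k) ^ 3\<bar> \<le> \<bar>4 * K\<bar> * (B + 1) ^ 3"
      unfolding abs_mult[of "4 * K"] power_abs using ab[OF that] by (intro mult_left_mono power_mono) auto
    ultimately show ?thesis unfolding cpol1_def A1_def by linarith
  qed
  define A2 where "A2 k l = \<bar>\<Gamma> k l\<bar> + \<bar>12 * K\<bar> * (B + 1)\<^sup>2" for k l
  have A2: "\<bar>cpol2 \<Gamma> K k l (cyl_a \<psi> \<mu>)\<bar> \<le> A2 k l" if "\<mu> \<in> Prob" "k \<in> X" for \<mu> k l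
  proof -
    have "\<bar>12 * K * (cyl_a \<psi> \<mu> k)\<^sup>2\<bar> \<le> \<bar>12 * K\<bar> * (B + 1)\<^sup>2"
      unfolding abs_mult[of "12 * K"] power_abs using ab[OF that] by (intro mult_left_mono power_mono) auto
    moreover have "0 \<le> \<bar>12 * K\<bar> * (B + 1)\<^sup>2" by simp
    ultimately show ?thesis unfolding cpol2_def A2_def by (cases "k = l") (simp_all only: if_True if_False simp_thms; linarith)+
  qed
  have bd1: "\<exists>C. \<forall>\<mu>\<in>KK. \<forall>x. \<bar>cyl_D1 X b \<Gamma> K \<psi> x \<mu>\<bar> \<le> C * (1 + pw x q)" if "KK \<subseteq> Prob" for KK
  proof (intro exI[of _ "\<Sum>k\<in>X. A1 k * B"] ballI allI)
    fix \<mu> x assume "\<mu> \<in> KK"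
    then have P: "\<mu> \<in> Prob" using that by blast
    have "\<bar>cyl_D1 X b \<Gamma> K \<psi> x \<mu>\<bar> \<le> (\<Sum>k\<in>X. A1 k * B)"
      unfolding cyl_D1_def using A1[OF P] \<psi>(1)
      by (intro order_trans[OF sum_abs] sum_mono) (simp add: abs_mult, intro mult_mono, auto intro: order_trans[OF abs_ge_zero])
    also have "\<dots> \<le> (\<Sum>k\<in>X. A1 k * B) * (1 + pw x q)"
    proof -
      have "0 \<le> (\<Sum>k\<in>X. A1 k * B)" using \<open>\<bar>cyl_D1 X b \<Gamma> K \<psi> x \<mu>\<bar> \<le> (\<Sum>k\<in>X. A1 k * B)\<close> by linarith
      then show ?thesis using pw[of x] mult_left_mono[of 1 "1 + pw x q" "\<Sum>k\<in>X. A1 k * B"] by simp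
    qed
    finally show "\<bar>cyl_D1 X b \<Gamma> K \<psi> x \<mu>\<bar> \<le> (\<Sum>k\<in>X. A1 k * B) * (1 + pw x q)" .
  qed
  have bd2: "\<exists>C. \<forall>\<mu>\<in>KK. \<forall>x y. \<bar>cyl_D2 X \<Gamma> K \<psi> x y \<mu>\<bar> \<le> C * (1 + pw x q + pw y q)" if "KK \<subseteq> Prob" for KK
  proof (intro exI[of _ "\<Sum>k\<in>X. \<Sum>l\<in>X. A2 k l * B * B"] ballI allI)
    fix \<mu> x y assume "\<mu> \<in> KK"
    then have P: "\<mu> \<in> Prob" using that by blast
    have le: "\<bar>cyl_D2 X \<Gamma> K \<psi> x y \<mu>\<bar> \<le> (\<Sum>k\<in>X. \<Sum>l\<in>X. A2 k l * B * B)"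
      unfolding cyl_D2_def
    proof (rule order_trans[OF sum_abs], rule sum_mono, rule order_trans[OF sum_abs], rule sum_mono)
      fix k l assume kl: "k \<in> X" "l \<in> X"
      show "\<bar>cpol2 \<Gamma> K k l (cyl_a \<psi> \<mu>) * \<psi> k x * \<psi> l y\<bar> \<le> A2 k l * B * B"
        unfolding abs_mult using A2[OF P kl(1), of l] \<psi>(1)[OF kl(1), of x] \<psi>(1)[OF kl(2), of y] B0 kl
        by (intro mult_mono mult_nonneg_nonneg) (auto intro: order_trans[OF abs_ge_zero])
    qed
    have "0 \<le> (\<Sum>k\<in>X. \<Sum>l\<in>X. A2 k l * B * B)" using le by linarith
    then have "(\<Sum>k\<in>X. \<Sum>l\<in>X. A2 k l * B * B) \<le> (\<Sum>k\<in>X. \<Sum>l\<in>X. A2 k l * B * B) * (1 + pw x q + pw y q)"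
      using pw[of x] pw[of y] mult_left_mono[of 1 "1 + pw x q + pw y q" "\<Sum>k\<in>X. \<Sum>l\<in>X. A2 k l * B * B"] by simp
    then show "\<bar>cyl_D2 X \<Gamma> K \<psi> x y \<mu>\<bar> \<le> (\<Sum>k\<in>X. \<Sum>l\<in>X. A2 k l * B * B) * (1 + pw x q + pw y q)" using le by linarith
  qed
  have form: "cpol X \<alpha> b \<Gamma> K (cyl_a \<psi> \<nu>) - cpol X \<alpha> b \<Gamma> K (cyl_a \<psi> \<mu>)
        = integral {0..1} (\<lambda>t. sint \<mu> \<nu> (\<lambda>x. cyl_D1 X b \<Gamma> K \<psi> x (mixm t \<nu> \<mu>)))"
     "cpol X \<alpha> b \<Gamma> K (cyl_a \<psi> \<nu>) - cpol X \<alpha> b \<Gamma> K (cyl_a \<psi> \<mu>) - sint \<mu> \<nu> (\<lambda>x. cyl_D1 X b \<Gamma> K \<psi> x \<mu>)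
        = integral {0..1} (\<lambda>t. integral {0..t} (\<lambda>s. sint \<mu> \<nu> (\<lambda>x. sint \<mu> \<nu> (\<lambda>y. cyl_D2 X \<Gamma> K \<psi> x y (mixm s \<nu> \<mu>)))))"
    if \<mu>: "\<mu> \<in> Prob" and \<nu>: "\<nu> \<in> Prob" for \<mu> \<nu>
  proof -
    define a where "a = cyl_a \<psi> \<mu>"
    define d where "d k = (\<integral>x. \<psi> k x \<partial>\<nu>) - (\<integral>x. \<psi> k x \<partial>\<mu>)" for k
    have mix: "cyl_a \<psi> (mixm t \<nu> \<mu>) k = a k + t * d k" if "t \<in> {0..1}" "k \<in> X" for t k
      unfolding cyl_a_def a_def d_def using integral_mixm[OF \<mu> \<nu> m\<psi>[OF that(2)] \<psi>(1)[OF that(2)]] that(1)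
      by (simp add: algebra_simps)
    have sl: "sint \<mu> \<nu> (\<lambda>x. \<Sum>k\<in>X. f k * \<psi> k x) = (\<Sum>k\<in>X. d k * f k)" for f
    proof -
      have "(\<integral>x. (\<Sum>k\<in>X. f k * \<psi> k x) \<partial>\<kappa>) = (\<Sum>k\<in>X. f k * (\<integral>x. \<psi> k x \<partial>\<kappa>))" if "\<kappa> \<in> Prob" for \<kappa>
        using int\<psi>[OF that] by (simp add: Bochner_Integration.integral_sum)
      then show ?thesis unfolding sint_def d_def using \<mu> \<nu> by (simp add: sum_subtractf[symmetric] algebra_simps)
    qed
    have cong1: "cpol1 X b \<Gamma> K k a' = cpol1 X b \<Gamma> K k a''" if "\<And>k. k \<in> X \<Longrightarrow> a' k = a'' k" "k \<in> X" for k a' a''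
      unfolding cpol1_def using that by simp
    have cong2: "cpol2 \<Gamma> K k l a' = cpol2 \<Gamma> K k l a''" if "\<And>k. k \<in> X \<Longrightarrow> a' k = a'' k" "k \<in> X" for k l a' a''
      unfolding cpol2_def using that(1)[OF that(2)] by auto
    define \<phi> where "\<phi> t = cpol X \<alpha> b \<Gamma> K (\<lambda>k. a k + t * d k)" for t
    define \<phi>1 where "\<phi>1 t = (\<Sum>k\<in>X. d k * cpol1 X b \<Gamma> K k (\<lambda>k. a k + t * d k))" for t
    define \<phi>2 where "\<phi>2 t = (\<Sum>k\<in>X. \<Sum>l\<in>X. d k * d l * cpol2 \<Gamma> K k l (\<lambda>k. a k + t * d k))" for t
    have s1: "sint \<mu> \<nu> (\<lambda>x. cyl_D1 X b \<Gamma> K \<psi> x \<kappa>) = (\<Sum>k\<in>X. d k * cpol1 X b \<Gamma> K k (cyl_a \<psi> \<kappa>))" for \<kappa>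
      unfolding cyl_D1_def by (rule sl)
    have s1': "sint \<mu> \<nu> (\<lambda>x. cyl_D1 X b \<Gamma> K \<psi> x (mixm t \<nu> \<mu>)) = \<phi>1 t" if "t \<in> {0..1}" for t
      unfolding s1 \<phi>1_def using mix[OF that] by (intro sum.cong refl arg_cong2[where f = "(*)"] cong1) auto
    have s2: "sint \<mu> \<nu> (\<lambda>x. sint \<mu> \<nu> (\<lambda>y. cyl_D2 X \<Gamma> K \<psi> x y (mixm t \<nu> \<mu>))) = \<phi>2 t" if "t \<in> {0..1}" for t
    proof -
      let ?c = "\<lambda>k l. cpol2 \<Gamma> K k l (cyl_a \<psi> (mixm t \<nu> \<mu>))"
      have "cyl_D2 X \<Gamma> K \<psi> x y (mixm t \<nu> \<mu>) = (\<Sum>l\<in>X. (\<Sum>k\<in>X. ?c k l * \<psi> k x) * \<psi> l y)" for x y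
        unfolding cyl_D2_def sum_distrib_right by (rule sum.swap)
      then have inner: "sint \<mu> \<nu> (\<lambda>y. cyl_D2 X \<Gamma> K \<psi> x y (mixm t \<nu> \<mu>)) = (\<Sum>k\<in>X. (\<Sum>l\<in>X. d l * ?c k l) * \<psi> k x)" for x
      proof -
        have "sint \<mu> \<nu> (\<lambda>y. cyl_D2 X \<Gamma> K \<psi> x y (mixm t \<nu> \<mu>)) = (\<Sum>l\<in>X. d l * (\<Sum>k\<in>X. ?c k l * \<psi> k x))"
          using \<open>\<And>x y. cyl_D2 X \<Gamma> K \<psi> x y (mixm t \<nu> \<mu>) = (\<Sum>l\<in>X. (\<Sum>k\<in>X. ?c k l * \<psi> k x) * \<psi> l y)\<close> sl by simp
        also have "\<dots> = (\<Sum>l\<in>X. \<Sum>k\<in>X. d l * ?c k l * \<psi> k x)" by (simp only: sum_distrib_left mult.assoc)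
        also have "\<dots> = (\<Sum>k\<in>X. \<Sum>l\<in>X. d l * ?c k l * \<psi> k x)" by (rule sum.swap)
        finally show ?thesis by (simp only: sum_distrib_right)
      qed
      have "sint \<mu> \<nu> (\<lambda>x. sint \<mu> \<nu> (\<lambda>y. cyl_D2 X \<Gamma> K \<psi> x y (mixm t \<nu> \<mu>))) = (\<Sum>k\<in>X. d k * (\<Sum>l\<in>X. d l * ?c k l))"
        unfolding inner by (rule sl)
      also have "\<dots> = \<phi>2 t" unfolding \<phi>2_def sum_distrib_left
      proof (intro sum.cong refl)
        fix k l assume "k \<in> X" "l \<in> X"
        then have "?c k l = cpol2 \<Gamma> K k l (\<lambda>k. a k + t * d k)" using mix[OF that] by (intro cong2) auto
        then show "d k * (d l * ?c k l) = d k * d l * cpol2 \<Gamma> K k l (\<lambda>k. a k + t * d k)" by simp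
      qed
      finally show ?thesis .
    qed
    have der: "(\<phi> has_real_derivative \<phi>1 t) (at t)" "(\<phi>1 has_real_derivative \<phi>2 t) (at t)" for t
      unfolding \<phi>_def \<phi>1_def \<phi>2_def by (rule cpol_deriv[OF X], rule sym, assumption+) (rule cpol1_deriv[OF X])
    have ftc1: "(\<phi>1 has_integral \<phi> 1 - \<phi> 0) {0..1}"
      using der(1) by (intro fundamental_theorem_of_calculus) (auto simp: has_real_derivative_iff_has_vector_derivative[symmetric] intro: DERIV_subset)
    have ftc2: "(\<phi>2 has_integral \<phi>1 t - \<phi>1 0) {0..t}" if "0 \<le> t" for t
      using der(2) that by (intro fundamental_theorem_of_calculus) (auto simp: has_real_derivative_iff_has_vector_derivative[symmetric] intro: DERIV_subset)
    have \<phi>0: "\<phi> 0 = cpol X \<alpha> b \<Gamma> K (cyl_a \<psi> \<mu>)" unfolding \<phi>_def a_def by simp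
    have \<phi>1': "\<phi> 1 = cpol X \<alpha> b \<Gamma> K (cyl_a \<psi> \<nu>)" unfolding \<phi>_def a_def cyl_a_def d_def by simp
    have "integral {0..1} (\<lambda>t. sint \<mu> \<nu> (\<lambda>x. cyl_D1 X b \<Gamma> K \<psi> x (mixm t \<nu> \<mu>))) = integral {0..1} \<phi>1"
      using s1' by (intro integral_cong)
    also have "\<dots> = \<phi> 1 - \<phi> 0" using ftc1 by (rule integral_unique)
    finally show "cpol X \<alpha> b \<Gamma> K (cyl_a \<psi> \<nu>) - cpol X \<alpha> b \<Gamma> K (cyl_a \<psi> \<mu>)
        = integral {0..1} (\<lambda>t. sint \<mu> \<nu> (\<lambda>x. cyl_D1 X b \<Gamma> K \<psi> x (mixm t \<nu> \<mu>)))" unfolding \<phi>0 \<phi>1' by simp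
    have "integral {0..t} (\<lambda>s. sint \<mu> \<nu> (\<lambda>x. sint \<mu> \<nu> (\<lambda>y. cyl_D2 X \<Gamma> K \<psi> x y (mixm s \<nu> \<mu>)))) = \<phi>1 t - \<phi>1 0" if "t \<in> {0..1}" for t
    proof -
      have "integral {0..t} (\<lambda>s. sint \<mu> \<nu> (\<lambda>x. sint \<mu> \<nu> (\<lambda>y. cyl_D2 X \<Gamma> K \<psi> x y (mixm s \<nu> \<mu>)))) = integral {0..t} \<phi>2"
        using s2 that by (intro integral_cong) auto
      also have "\<dots> = \<phi>1 t - \<phi>1 0" using ftc2[of t] that by (intro integral_unique) auto
      finally show ?thesis .
    qed
    then have "integral {0..1} (\<lambda>t. integral {0..t} (\<lambda>s. sint \<mu> \<nu> (\<lambda>x. sint \<mu> \<nu> (\<lambda>y. cyl_D2 X \<Gamma> K \<psi> x y (mixm s \<nu> \<mu>)))))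
       = integral {0..1} (\<lambda>t. \<phi>1 t - \<phi>1 0)" by (intro integral_cong)
    also have "\<dots> = (\<phi> 1 - \<phi> 0) - \<phi>1 0"
    proof -
      have "((\<lambda>t. \<phi>1 t - \<phi>1 0) has_integral (\<phi> 1 - \<phi> 0) - \<phi>1 0) {0..1}"
        using has_integral_diff[OF ftc1 has_integral_const_real[of "\<phi>1 0" 0 1]] by simp
      then show ?thesis by (rule integral_unique)
    qed
    also have "\<phi>1 0 = sint \<mu> \<nu> (\<lambda>x. cyl_D1 X b \<Gamma> K \<psi> x \<mu>)" unfolding s1 \<phi>1_def a_def by simp
    finally show "cpol X \<alpha> b \<Gamma> K (cyl_a \<psi> \<nu>) - cpol X \<alpha> b \<Gamma> K (cyl_a \<psi> \<mu>) - sint \<mu> \<nu> (\<lambda>x. cyl_D1 X b \<Gamma> K \<psi> x \<mu>)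
        = integral {0..1} (\<lambda>t. integral {0..t} (\<lambda>s. sint \<mu> \<nu> (\<lambda>x. sint \<mu> \<nu> (\<lambda>y. cyl_D2 X \<Gamma> K \<psi> x y (mixm s \<nu> \<mu>)))))"
      unfolding \<phi>0 \<phi>1' by simp
  qed
  have KP: "KK \<subseteq> Prob" if "compactin (TP q) KK" for KK :: "'a measure set"
    using compactin_subset_topspace[OF that] Pp_Prob by auto
  show ?thesis unfolding C2_def
  proof (intro conjI ballI)
    show "continuous_map (prod_topology euclidean (TP q)) euclideanreal (\<lambda>(x, \<mu>). cyl_D1 X b \<Gamma> K \<psi> x \<mu>)" by (rule T1)
    show "continuous_map (prod_topology (prod_topology euclidean euclidean) (TP q)) euclideanreal (\<lambda>((x, y), \<mu>). cyl_D2 X \<Gamma> K \<psi> x y \<mu>)" by (rule T2)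
    show "\<forall>x y. cyl_D2 X \<Gamma> K \<psi> x y \<mu> = cyl_D2 X \<Gamma> K \<psi> y x \<mu>" for \<mu> by (intro allI symD)
    show "\<forall>KK. compactin (TP q) KK \<longrightarrow>
        (\<exists>C. \<forall>\<mu>\<in>KK. \<forall>x. \<bar>cyl_D1 X b \<Gamma> K \<psi> x \<mu>\<bar> \<le> C * (1 + pw x q)) \<and>
        (\<exists>C. \<forall>\<mu>\<in>KK. \<forall>x y. \<bar>cyl_D2 X \<Gamma> K \<psi> x y \<mu>\<bar> \<le> C * (1 + pw x q + pw y q))"
      by (intro allI impI conjI bd1 bd2 KP)
  qed (rule form[OF Pp_Prob Pp_Prob], assumption+)+
qed

section \<open>The operator on finitely supported measures\<close>

lemma integral_fm_pair:
  fixes g :: "'a::euclidean_space \<times> 'a \<Rightarrow> real"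
  assumes X: "finite X" and m: "m \<in> psimplex X" and g: "g \<in> borel_measurable (borel \<Otimes>\<^sub>M borel)"
  shows "integrable (fm X m \<Otimes>\<^sub>M fm X m) g" "(\<integral>z. g z \<partial>(fm X m \<Otimes>\<^sub>M fm X m)) = (\<Sum>x\<in>X. \<Sum>y\<in>X. m x * m y * g (x, y))"
proof -
  have P: "fm X m \<in> Prob" by (rule fm_Prob[OF X m])
  interpret M: prob_space "fm X m" by (rule Prob_D[OF P])
  interpret PP: pair_sigma_finite "fm X m" "fm X m" ..
  have sm: "sets (fm X m \<Otimes>\<^sub>M fm X m) = sets (borel \<Otimes>\<^sub>M borel)" by (rule sets_pair_measure_cong) simp_all
  have gm: "g \<in> borel_measurable (fm X m \<Otimes>\<^sub>M fm X m)" using g measurable_cong_sets[OF sm refl, of "borel :: real measure"] by simp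
  have n: "\<And>x. x \<in> X \<Longrightarrow> 0 \<le> m x" using m by (auto simp: psimplex_def)
  have gx: "(\<lambda>y. g (x, y)) \<in> borel_measurable borel" for x using measurable_compose[OF measurable_Pair1' g, of x] by simp
  show int: "integrable (fm X m \<Otimes>\<^sub>M fm X m) g"
  proof (rule integrableI_bounded[OF gm])
    have gn: "(\<lambda>z. ennreal (norm (g z))) \<in> borel_measurable (fm X m \<Otimes>\<^sub>M fm X m)" using gm by measurable
    have gxn: "(\<lambda>y. ennreal (norm (g (x, y)))) \<in> borel_measurable borel" for x using gx[of x] by measurable
    have "(\<integral>\<^sup>+ z. ennreal (norm (g z)) \<partial>(fm X m \<Otimes>\<^sub>M fm X m)) = (\<integral>\<^sup>+ x. \<integral>\<^sup>+ y. ennreal (norm (g (x, y))) \<partial>fm X m \<partial>fm X m)"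
      by (rule M.nn_integral_fst[OF gn, symmetric])
    also have "\<dots> = (\<integral>\<^sup>+ x. (\<Sum>y\<in>X. ennreal (m y) * ennreal (norm (g (x, y)))) \<partial>fm X m)"
      using gxn by (simp add: nn_integral_fm[OF X])
    also have "\<dots> = (\<Sum>x\<in>X. ennreal (m x) * (\<Sum>y\<in>X. ennreal (m y) * ennreal (norm (g (x, y)))))"
    proof (rule nn_integral_fm[OF X])
      have "(\<lambda>x. g (x, y)) \<in> borel_measurable borel" for y using measurable_compose[OF measurable_Pair2' g, of y] by simp
      then show "(\<lambda>x. \<Sum>y\<in>X. ennreal (m y) * ennreal (norm (g (x, y)))) \<in> borel_measurable borel" by measurable
    qed
    also have "\<dots> = (\<Sum>x\<in>X. ennreal (m x) * ennreal (\<Sum>y\<in>X. m y * norm (g (x, y))))"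
      using n by (simp add: ennreal_mult[symmetric] sum_ennreal)
    also have "\<dots> < top" by (rule sum_ennreal_less_top[OF X])
    finally show "(\<integral>\<^sup>+ z. ennreal (norm (g z)) \<partial>(fm X m \<Otimes>\<^sub>M fm X m)) < \<infinity>" by simp
  qed
  have "(\<integral>z. g z \<partial>(fm X m \<Otimes>\<^sub>M fm X m)) = (\<integral>x. (\<integral>y. g (x, y) \<partial>fm X m) \<partial>fm X m)"
    by (rule PP.integral_fst'[OF int, symmetric])
  also have "\<dots> = (\<integral>x. (\<Sum>y\<in>X. m y * g (x, y)) \<partial>fm X m)" using gx n by (simp add: integral_fm[OF X])
  also have "\<dots> = (\<Sum>x\<in>X. m x * (\<Sum>y\<in>X. m y * g (x, y)))"
  proof (rule integral_fm[OF X])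
    have "(\<lambda>x. g (x, y)) \<in> borel_measurable borel" for y using measurable_compose[OF measurable_Pair2' g, of y] by simp
    then show "(\<lambda>x. \<Sum>y\<in>X. m y * g (x, y)) \<in> borel_measurable borel" by measurable
  qed (rule n)
  finally show "(\<integral>z. g z \<partial>(fm X m \<Otimes>\<^sub>M fm X m)) = (\<Sum>x\<in>X. \<Sum>y\<in>X. m x * m y * g (x, y))" by (simp add: sum_distrib_left mult.assoc)
qed

text \<open>On a finite support every Borel function is integrable, which excludes the infinite
  branch of \<open>Lop\<close>. The duality of \<psi> with the points of X collapses the fourfold
  sum to the two indices of \<open>cpol2\<close>.\<close>

lemma Lop_fm:
  fixes \<rho> m mh :: "'a::euclidean_space \<Rightarrow> real"
  assumes X: "finite X" and m: "m \<in> psimplex X" and \<rho>: "\<rho> \<in> borel_measurable borel"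
    and \<psi>: "\<And>k. k \<in> X \<Longrightarrow> \<psi> k \<in> borel_measurable borel"
    and dual: "\<And>k j. k \<in> X \<Longrightarrow> j \<in> X \<Longrightarrow> \<psi> k j = (if j = k then 1 / mh k else 0)"
  defines "s \<equiv> \<lambda>k. m k / mh k * (\<rho> k - (\<Sum>j\<in>X. \<rho> j * m j))"
  shows "Lop (cyl_D2 X \<Gamma> K \<psi>) (fm X m) \<rho> = ereal ((\<Sum>k\<in>X. \<Sum>l\<in>X. cpol2 \<Gamma> K k l (cyl_a \<psi> (fm X m)) * s k * s l) / 2)"
proof -
  define M where "M = (\<Sum>j\<in>X. \<rho> j * m j)"
  have n: "\<And>x. x \<in> X \<Longrightarrow> 0 \<le> m x" using m by (auto simp: psimplex_def)
  have Mi: "(\<integral>x. \<rho> x \<partial>fm X m) = M" using integral_fm[OF X \<rho> n] by (simp add: M_def mult.commute)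
  let ?c = "\<lambda>k l. cpol2 \<Gamma> K k l (cyl_a \<psi> (fm X m))"
  define g where "g = (\<lambda>(x, y). cyl_D2 X \<Gamma> K \<psi> x y (fm X m) * (\<rho> x - M) * (\<rho> y - M))"
  have gm: "g \<in> borel_measurable (borel \<Otimes>\<^sub>M borel)"
    unfolding g_def cyl_D2_def case_prod_beta
    by (intro borel_measurable_times borel_measurable_sum borel_measurable_diff borel_measurable_const
        measurable_compose[OF measurable_fst \<psi>] measurable_compose[OF measurable_snd \<psi>]
        measurable_compose[OF measurable_fst \<rho>] measurable_compose[OF measurable_snd \<rho>])
  have s: "(\<Sum>x\<in>X. m x * \<psi> k x * (\<rho> x - M)) = s k" if "k \<in> X" for k
  proof -
    have "(\<Sum>x\<in>X. m x * \<psi> k x * (\<rho> x - M)) = (\<Sum>x\<in>X. if x = k then s k else 0)"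
      using dual[OF that] by (intro sum.cong refl) (auto simp: s_def M_def)
    then show ?thesis using X that by simp
  qed
  have "(\<Sum>x\<in>X. \<Sum>y\<in>X. m x * m y * g (x, y)) = (\<Sum>x\<in>X. \<Sum>y\<in>X. \<Sum>k\<in>X. \<Sum>l\<in>X. ?c k l * (m x * \<psi> k x * (\<rho> x - M)) * (m y * \<psi> l y * (\<rho> y - M)))"
    unfolding g_def cyl_D2_def case_prod_beta fst_conv snd_conv sum_distrib_left sum_distrib_right
    by (intro sum.cong refl) (simp add: ac_simps)
  also have "\<dots> = (\<Sum>x\<in>X. \<Sum>k\<in>X. \<Sum>y\<in>X. \<Sum>l\<in>X. ?c k l * (m x * \<psi> k x * (\<rho> x - M)) * (m y * \<psi> l y * (\<rho> y - M)))"
    by (rule sum.cong[OF refl], rule sum.swap)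
  also have "\<dots> = (\<Sum>k\<in>X. \<Sum>x\<in>X. \<Sum>y\<in>X. \<Sum>l\<in>X. ?c k l * (m x * \<psi> k x * (\<rho> x - M)) * (m y * \<psi> l y * (\<rho> y - M)))" by (rule sum.swap)
  also have "\<dots> = (\<Sum>k\<in>X. \<Sum>x\<in>X. \<Sum>l\<in>X. \<Sum>y\<in>X. ?c k l * (m x * \<psi> k x * (\<rho> x - M)) * (m y * \<psi> l y * (\<rho> y - M)))"
    by (rule sum.cong[OF refl], rule sum.cong[OF refl], rule sum.swap)
  also have "\<dots> = (\<Sum>k\<in>X. \<Sum>x\<in>X. \<Sum>l\<in>X. ?c k l * (m x * \<psi> k x * (\<rho> x - M)) * s l)"
    using s by (simp add: sum_distrib_left[symmetric])
  also have "\<dots> = (\<Sum>k\<in>X. \<Sum>l\<in>X. \<Sum>x\<in>X. ?c k l * (m x * \<psi> k x * (\<rho> x - M)) * s l)" by (rule sum.cong[OF refl], rule sum.swap)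
  also have "\<dots> = (\<Sum>k\<in>X. \<Sum>l\<in>X. ?c k l * s k * s l)"
    using s by (simp add: sum_distrib_left[symmetric] sum_distrib_right[symmetric])
  finally have "(\<integral>z. g z \<partial>(fm X m \<Otimes>\<^sub>M fm X m)) = (\<Sum>k\<in>X. \<Sum>l\<in>X. ?c k l * s k * s l)"
    using integral_fm_pair(2)[OF X m gm] by simp
  then show ?thesis
    unfolding Lop_def Let_def Mi g_def[symmetric] using integrable_fm[OF X \<rho>, of m] integral_fm_pair(1)[OF X m gm] by simp
qed

text \<open>Tent functions whose radius at k is at most the distance from k to the other points of
  X, so that all of these lie where the tent is 0.\<close>

lemma dual_bumps:
  fixes X :: "'a::euclidean_space set"
  assumes X: "finite X" and mh: "\<And>i. i \<in> X \<Longrightarrow> 0 < mh i"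
  shows "\<exists>\<psi> B L. 0 \<le> L \<and> (\<forall>k\<in>X. (\<forall>x. \<bar>\<psi> k x\<bar> \<le> B) \<and> (\<forall>x y. \<bar>\<psi> k x - \<psi> k y\<bar> \<le> L * dist x y) \<and> continuous_on UNIV (\<psi> k)
     \<and> (\<forall>j\<in>X. \<psi> k j = (if j = k then 1 / mh k else 0)))"
proof -
  have "\<exists>r. 0 < r \<and> (\<forall>x\<in>X. x \<noteq> k \<longrightarrow> r \<le> dist k x)" for k using finite_set_avoid[OF X, of k] by blast
  then obtain r where r: "\<And>k. 0 < r k" "\<And>k x. x \<in> X \<Longrightarrow> x \<noteq> k \<Longrightarrow> r k \<le> dist k x"
    using choice[of "\<lambda>k r. 0 < r \<and> (\<forall>x\<in>X. x \<noteq> k \<longrightarrow> r \<le> dist k x)"] by blast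
  define \<psi> where "\<psi> k x = max 0 (1 - dist k x / r k) / mh k" for k x
  define B where "B = (\<Sum>k\<in>X. 1 / mh k)"
  define L where "L = (\<Sum>k\<in>X. 1 / (r k * mh k))"
  have L0: "0 \<le> L" unfolding L_def using r(1) mh by (intro sum_nonneg) (auto simp: less_imp_le)
  have "(\<forall>x. \<bar>\<psi> k x\<bar> \<le> B) \<and> (\<forall>x y. \<bar>\<psi> k x - \<psi> k y\<bar> \<le> L * dist x y) \<and> continuous_on UNIV (\<psi> k)
     \<and> (\<forall>j\<in>X. \<psi> k j = (if j = k then 1 / mh k else 0))" if k: "k \<in> X" for k
  proof (intro conjI allI ballI)
    fix x
    have "\<bar>\<psi> k x\<bar> \<le> 1 / mh k" unfolding \<psi>_def using mh[OF k] r(1)[of k] by (auto simp: max_def divide_right_mono)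
    also have "\<dots> \<le> B" unfolding B_def using X k mh by (intro member_le_sum) (auto simp: less_imp_le)
    finally show "\<bar>\<psi> k x\<bar> \<le> B" .
  next
    fix x y
    have "\<bar>max 0 (1 - dist k x / r k) - max 0 (1 - dist k y / r k)\<bar> \<le> \<bar>dist k x / r k - dist k y / r k\<bar>" by linarith
    also have "\<dots> = \<bar>dist k x - dist k y\<bar> / r k" using r(1)[of k] by (simp add: diff_divide_distrib[symmetric])
    also have "\<dots> \<le> dist x y / r k"
    proof (rule divide_right_mono)
      show "\<bar>dist k x - dist k y\<bar> \<le> dist x y" using dist_triangle[of k x y] dist_triangle[of k y x] by (simp add: dist_commute)
    qed (use r(1)[of k] in simp)
    finally have "\<bar>max 0 (1 - dist k x / r k) - max 0 (1 - dist k y / r k)\<bar> / mh k \<le> dist x y / r k / mh k"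
      using mh[OF k] by (intro divide_right_mono) auto
    then have "\<bar>\<psi> k x - \<psi> k y\<bar> \<le> 1 / (r k * mh k) * dist x y" unfolding \<psi>_def diff_divide_distrib[symmetric] abs_divide using mh[OF k] by simp
    also have "\<dots> \<le> L * dist x y"
    proof (rule mult_right_mono)
      show "1 / (r k * mh k) \<le> L" unfolding L_def using X k mh r(1) by (intro member_le_sum) (auto simp: less_imp_le)
    qed simp
    finally show "\<bar>\<psi> k x - \<psi> k y\<bar> \<le> L * dist x y" .
  next
    have "mh k \<noteq> 0" "r k \<noteq> 0" using mh[OF k] r(1)[of k] by auto
    then show "continuous_on UNIV (\<psi> k)" unfolding \<psi>_def by (intro continuous_intros) auto
  next
    fix j assume j: "j \<in> X"
    show "\<psi> k j = (if j = k then 1 / mh k else 0)"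
      using r(2)[OF j, of k] r(1)[of k] by (auto simp: \<psi>_def max_def field_simps)
  qed
  then show ?thesis using L0 by blast
qed

lemma cyl_a_fm:
  assumes X: "finite X" and m: "m \<in> psimplex X" and k: "k \<in> X"
    and \<psi>: "\<psi> k \<in> borel_measurable borel" and dual: "\<And>j. j \<in> X \<Longrightarrow> \<psi> k j = (if j = k then 1 / mh k else 0)"
  shows "cyl_a \<psi> (fm X m) k = m k / mh k - 1"
proof -
  have "(\<integral>x. \<psi> k x \<partial>fm X m) = (\<Sum>x\<in>X. m x * \<psi> k x)" using m by (intro integral_fm[OF X \<psi>]) (auto simp: psimplex_def)
  also have "\<dots> = (\<Sum>x\<in>X. if x = k then m k / mh k else 0)" using dual by (intro sum.cong refl) auto
  finally show ?thesis unfolding cyl_a_def using X k by simp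
qed

text \<open>The quartic term makes the quadratic majorant global, at no cost in the second derivative at the contact point.\<close>

lemma jet_majorant:
  assumes X: "finite X" "X \<noteq> {}" and mh: "mh \<in> psimplex X" "\<And>i. i \<in> X \<Longrightarrow> 0 < mh i"
    and v: "seqcont X (psimplex X) v" and dep: "\<And>m m'. (\<forall>i\<in>X. m i = m' i) \<Longrightarrow> v m = v m'"
    and j: "rsup X v mh p P" and e: "0 < e"
  shows "\<exists>\<Gamma> K. (\<forall>k l. \<Gamma> k l = \<Gamma> l k) \<and> (\<forall>x. (\<Sum>k\<in>X. \<Sum>l\<in>X. \<Gamma> k l * x k * x l) = (\<Sum>k\<in>X. \<Sum>l\<in>X. x k * x l * P k l) + 2 * e * (\<Sum>k\<in>X. (x k)\<^sup>2))
     \<and> (\<forall>m\<in>psimplex X. v m \<le> cpol X (v mh) p \<Gamma> K (\<lambda>k. m k / mh k - 1))"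
proof -
  \<comment> \<open>Symmetrising leaves the quadratic form unchanged and is required of a second
    derivative in \<open>C2\<close>; the added diagonal is the margin that absorbs the
    remainder.\<close>
  define \<Gamma> where "\<Gamma> k l = (P k l + P l k) / 2 + (if k = l then 2 * e else 0)" for k l
  have sym: "\<Gamma> k l = \<Gamma> l k" for k l by (simp add: \<Gamma>_def)
  have quad: "(\<Sum>k\<in>X. \<Sum>l\<in>X. \<Gamma> k l * x k * x l) = (\<Sum>k\<in>X. \<Sum>l\<in>X. x k * x l * P k l) + 2 * e * (\<Sum>k\<in>X. (x k)\<^sup>2)" for x
  proof -
    have "(\<Sum>k\<in>X. \<Sum>l\<in>X. \<Gamma> k l * x k * x l) = (\<Sum>k\<in>X. \<Sum>l\<in>X. x k * x l * P k l / 2 + x k * x l * P l k / 2 + (if k = l then 2 * e * (x k)\<^sup>2 else 0))"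
      unfolding \<Gamma>_def by (intro sum.cong refl) (simp add: power2_eq_square field_simps)
    also have "\<dots> = (\<Sum>k\<in>X. \<Sum>l\<in>X. x k * x l * P k l / 2) + (\<Sum>k\<in>X. \<Sum>l\<in>X. x k * x l * P l k / 2) + (\<Sum>k\<in>X. 2 * e * (x k)\<^sup>2)"
      using X(1) by (simp add: sum.distrib)
    also have "(\<Sum>k\<in>X. \<Sum>l\<in>X. x k * x l * P l k / 2) = (\<Sum>l\<in>X. \<Sum>k\<in>X. x k * x l * P l k / 2)" by (rule sum.swap)
    also have "\<dots> = (\<Sum>k\<in>X. \<Sum>l\<in>X. x k * x l * P k l / 2)" by (intro sum.cong refl) simp
    also have "(\<Sum>k\<in>X. \<Sum>l\<in>X. x k * x l * P k l / 2) + (\<Sum>k\<in>X. \<Sum>l\<in>X. x k * x l * P k l / 2) = (\<Sum>k\<in>X. \<Sum>l\<in>X. x k * x l * P k l)"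
      unfolding sum.distrib[symmetric] by (simp add: mult.assoc)
    finally show ?thesis by (simp add: sum_distrib_left)
  qed
  define N where "N = real (card X)"
  have N: "N > 0" using X by (simp add: N_def card_gt_0_iff)
  define G where "G m = v mh + (\<Sum>k\<in>X. p k * (m k / mh k - 1)) + (\<Sum>k\<in>X. \<Sum>l\<in>X. \<Gamma> k l * (m k / mh k - 1) * (m l / mh l - 1)) / 2" for m
  obtain r where r: "r \<in> o[nz X](\<lambda>x. (l1 X x)\<^sup>2)" and ev: "eventually (\<lambda>x. (\<Sum>i\<in>X. mh i * x i) = 0 \<longrightarrow>
        v (\<lambda>i. mh i * (1 + x i)) \<le> v mh + (\<Sum>i\<in>X. x i * p i) + (\<Sum>i\<in>X. \<Sum>j\<in>X. x i * x j * P i j) / 2 + r x) (nz X)"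
    using j unfolding rsup_def by blast
  have "e / N > 0" using e N by simp
  then obtain d1 where d1: "d1 > 0" "\<And>x. l1 X x < d1 \<Longrightarrow> \<bar>r x\<bar> \<le> e / N * (l1 X x)\<^sup>2"
    using r[unfolded smallo_nz_iff] by blast
  obtain d2 where d2: "d2 > 0" "\<And>x. l1 X x < d2 \<Longrightarrow> (\<Sum>i\<in>X. mh i * x i) = 0 \<Longrightarrow>
        v (\<lambda>i. mh i * (1 + x i)) \<le> v mh + (\<Sum>i\<in>X. x i * p i) + (\<Sum>i\<in>X. \<Sum>j\<in>X. x i * x j * P i j) / 2 + r x"
    using ev unfolding eventually_nz by blast
  define d where "d = min d1 d2"
  have d: "d > 0" using d1 d2 by (simp add: d_def)
  have near: "v m \<le> G m" if m: "m \<in> psimplex X" and l: "l1 X (\<lambda>k. m k / mh k - 1) < d" for m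
  proof -
    define x where "x k = m k / mh k - 1" for k
    have mx: "mh i * (1 + x i) = m i" if "i \<in> X" for i using mh(2)[OF that] by (simp add: x_def)
    have "(\<Sum>i\<in>X. mh i * x i) = (\<Sum>i\<in>X. m i) - (\<Sum>i\<in>X. mh i)"
      unfolding sum_subtractf[symmetric] using mh(2) by (intro sum.cong refl) (force simp: x_def field_simps)
    then have x0: "(\<Sum>i\<in>X. mh i * x i) = 0" using m mh(1) by (simp add: psimplex_def)
    have lx: "l1 X x < d1" "l1 X x < d2" using l unfolding x_def[symmetric] d_def by auto
    have "v m = v (\<lambda>i. mh i * (1 + x i))" using mx by (intro dep) simp
    also have "\<dots> \<le> v mh + (\<Sum>i\<in>X. x i * p i) + (\<Sum>i\<in>X. \<Sum>j\<in>X. x i * x j * P i j) / 2 + r x" by (rule d2(2)[OF lx(2) x0])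
    also have "r x \<le> e * (\<Sum>k\<in>X. (x k)\<^sup>2)"
    proof -
      \<comment> \<open>Cauchy-Schwarz turns a remainder that is small against
        \<open>(l1 X x)\<^sup>2\<close> into one that the added diagonal controls; this is why e was
        divided by N.\<close>
      have "(l1 X x)\<^sup>2 \<le> (\<Sum>k\<in>X. \<bar>x k\<bar>\<^sup>2) * N" unfolding l1_def N_def by (rule sum_squared_le_sum_of_squares)
      then have "e / N * (l1 X x)\<^sup>2 \<le> e / N * ((\<Sum>k\<in>X. (x k)\<^sup>2) * N)" using e N by (intro mult_left_mono) auto
      also have "\<dots> = e * (\<Sum>k\<in>X. (x k)\<^sup>2)" using N by simp
      finally show ?thesis using d1(2)[OF lx(1)] by linarith
    qed
    finally have "v m \<le> v mh + (\<Sum>i\<in>X. x i * p i) + ((\<Sum>i\<in>X. \<Sum>j\<in>X. x i * x j * P i j) + 2 * e * (\<Sum>k\<in>X. (x k)\<^sup>2)) / 2"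
      by (simp add: add_divide_distrib)
    then show ?thesis unfolding quad[symmetric] G_def x_def[symmetric] by (simp add: mult.commute)
  qed
  have Gc: "seqcont X (psimplex X) (\<lambda>m. v m - G m)"
  proof (rule seqcont_diff[OF v])
    show "seqcont X (psimplex X) G" unfolding seqcont_def G_def
    proof (intro allI impI)
      fix s :: "nat \<Rightarrow> 'a \<Rightarrow> real" and l assume s: "\<forall>i\<in>X. (\<lambda>n. s n i) \<longlonglongrightarrow> l i"
      have "(\<lambda>n. s n k / mh k - 1) \<longlonglongrightarrow> l k / mh k - 1" if "k \<in> X" for k
        using s mh(2)[OF that] that by (intro tendsto_intros) auto
      then show "(\<lambda>n. v mh + (\<Sum>k\<in>X. p k * (s n k / mh k - 1)) + (\<Sum>k\<in>X. \<Sum>l\<in>X. \<Gamma> k l * (s n k / mh k - 1) * (s n l / mh l - 1)) / 2)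
        \<longlonglongrightarrow> v mh + (\<Sum>k\<in>X. p k * (l k / mh k - 1)) + (\<Sum>k\<in>X. \<Sum>la\<in>X. \<Gamma> k la * (l k / mh k - 1) * (l la / mh la - 1)) / 2"
        by (intro tendsto_add tendsto_const tendsto_sum tendsto_mult tendsto_divide) auto
    qed
  qed
  obtain M where M: "\<And>m. m \<in> psimplex X \<Longrightarrow> \<bar>v m - G m\<bar> \<le> M" using seqcont_bounded[OF seqcomp_simplex[OF X(1)] Gc] by blast
  have M0: "0 \<le> M" using M[OF mh(1)] by linarith
  \<comment> \<open>Outside the ball of radius d in \<open>l1 X\<close> some coordinate is at least
    d / N in absolute value, so there the quartic term alone reaches M.\<close>
  define K where "K = M / (d / N) ^ 4"
  have K0: "0 \<le> K" using M0 d N by (simp add: K_def)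
  have "v m \<le> cpol X (v mh) p \<Gamma> K (\<lambda>k. m k / mh k - 1)" if m: "m \<in> psimplex X" for m
  proof -
    define x where "x k = m k / mh k - 1" for k
    have eq: "cpol X (v mh) p \<Gamma> K x = G m + K * (\<Sum>k\<in>X. (x k) ^ 4)" unfolding cpol_def G_def x_def by simp
    have s0: "0 \<le> K * (\<Sum>k\<in>X. (x k) ^ 4)" using K0 by (intro mult_nonneg_nonneg sum_nonneg) auto
    have "v m \<le> G m + K * (\<Sum>k\<in>X. (x k) ^ 4)"
    proof (cases "l1 X x < d")
      case True
      then show ?thesis using near[OF m, folded x_def] s0 by linarith
    next
      case False
      have "\<exists>k\<in>X. d / N \<le> \<bar>x k\<bar>"
      proof (rule ccontr)
        assume "\<not> ?thesis"
        then have "(\<Sum>k\<in>X. \<bar>x k\<bar>) < (\<Sum>k\<in>X. d / N)" using X by (intro sum_strict_mono) (auto simp: not_le)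
        then show False using False N unfolding l1_def by (simp add: N_def)
      qed
      then obtain k where k: "k \<in> X" "d / N \<le> \<bar>x k\<bar>" by blast
      have "(d / N) ^ 4 \<le> \<bar>x k\<bar> ^ 4" using k d N by (intro power_mono) auto
      also have "\<dots> = (x k) ^ 4" by simp
      also have "\<dots> \<le> (\<Sum>k\<in>X. (x k) ^ 4)" using X k by (intro member_le_sum) auto
      finally have "K * (d / N) ^ 4 \<le> K * (\<Sum>k\<in>X. (x k) ^ 4)" using K0 by (intro mult_left_mono)
      moreover have "K * (d / N) ^ 4 = M" using d N by (simp add: K_def)
      ultimately show ?thesis using M[OF m] by linarith
    qed
    then show ?thesis unfolding x_def[symmetric] eq .
  qed
  then show ?thesis using sym quad by (intro exI[of _ \<Gamma>] exI[of _ K] conjI allI ballI)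
qed

lemma tendsto_null_bounded:
  fixes a b :: "nat \<Rightarrow> real"
  assumes "a \<longlonglongrightarrow> 0" "\<And>n. \<bar>b n\<bar> \<le> C"
  shows "(\<lambda>n. a n * b n) \<longlonglongrightarrow> 0"
proof (rule Lim_null_comparison)
  show "\<forall>\<^sub>F n in sequentially. norm (a n * b n) \<le> \<bar>a n\<bar> * C"
    using assms(2) by (intro always_eventually allI) (auto simp: abs_mult intro: mult_left_mono)
  show "(\<lambda>n. \<bar>a n\<bar> * C) \<longlonglongrightarrow> 0" using tendsto_mult_right[OF tendsto_rabs[OF assms(1)], of C] by simp
qed

text \<open>The directions \<open>r n\<close> may vary with n as long as they stay bounded. The
  supersolution needs this uniformity, because its nearly optimal direction depends on the nearby
  measure.\<close>

lemma Lop_limit: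
  fixes x r :: "nat \<Rightarrow> 'i \<Rightarrow> real" and mh :: "'i \<Rightarrow> real"
  assumes X: "finite X" and x: "\<And>k. k \<in> X \<Longrightarrow> (\<lambda>n. x n k) \<longlonglongrightarrow> 0" and r: "\<And>n k. k \<in> X \<Longrightarrow> \<bar>r n k\<bar> \<le> B"
  defines "s \<equiv> \<lambda>n k. (1 + x n k) * (r n k - (\<Sum>j\<in>X. r n j * (mh j * (1 + x n j))))"
    and "t \<equiv> \<lambda>n k. r n k - (\<Sum>j\<in>X. r n j * mh j)"
  shows "(\<lambda>n. (\<Sum>k\<in>X. \<Sum>l\<in>X. cpol2 \<Gamma> K k l (x n) * s n k * s n l) / 2 - (\<Sum>k\<in>X. \<Sum>l\<in>X. \<Gamma> k l * t n k * t n l) / 2) \<longlonglongrightarrow> 0"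
proof -
  have tb: "\<exists>C. \<forall>n. \<bar>t n k\<bar> \<le> C" if k: "k \<in> X" for k
  proof (intro exI allI)
    fix n
    have "\<bar>\<Sum>j\<in>X. r n j * mh j\<bar> \<le> (\<Sum>j\<in>X. B * \<bar>mh j\<bar>)"
      using r by (intro order_trans[OF sum_abs] sum_mono) (auto simp: abs_mult intro: mult_right_mono)
    then show "\<bar>t n k\<bar> \<le> B + (\<Sum>j\<in>X. B * \<bar>mh j\<bar>)" unfolding t_def using r[OF k, of n] by linarith
  qed
  have q0: "(\<lambda>n. \<Sum>j\<in>X. x n j * (mh j * r n j)) \<longlonglongrightarrow> 0"
  proof (rule tendsto_null_sum)
    fix j assume j: "j \<in> X"
    have "\<bar>mh j * r n j\<bar> \<le> \<bar>mh j\<bar> * B" for n unfolding abs_mult using r[OF j, of n] by (intro mult_left_mono) auto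
    then show "(\<lambda>n. x n j * (mh j * r n j)) \<longlonglongrightarrow> 0" by (rule tendsto_null_bounded[OF x[OF j]])
  qed
  have st: "(\<lambda>n. s n k - t n k) \<longlonglongrightarrow> 0" if k: "k \<in> X" for k
  proof -
    obtain C where C: "\<And>n. \<bar>t n k\<bar> \<le> C" using tb[OF k] by blast
    have "s n k - t n k = x n k * t n k - (1 + x n k) * (\<Sum>j\<in>X. x n j * (mh j * r n j))" for n
    proof -
      have "(\<Sum>j\<in>X. r n j * (mh j * (1 + x n j))) = (\<Sum>j\<in>X. r n j * mh j) + (\<Sum>j\<in>X. x n j * (mh j * r n j))"
        unfolding sum.distrib[symmetric] by (intro sum.cong refl) (simp add: algebra_simps)
      then show ?thesis unfolding s_def t_def by (simp add: algebra_simps)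
    qed
    moreover have "(\<lambda>n. x n k * t n k - (1 + x n k) * (\<Sum>j\<in>X. x n j * (mh j * r n j))) \<longlonglongrightarrow> 0 - (1 + 0) * 0"
      by (intro tendsto_diff tendsto_mult tendsto_add tendsto_const q0 x k tendsto_null_bounded[OF x[OF k] C])
    ultimately show ?thesis by simp
  qed
  have sb: "\<exists>C. \<forall>n. \<bar>s n k\<bar> \<le> C" if k: "k \<in> X" for k
  proof -
    obtain C where C: "\<And>n. \<bar>t n k\<bar> \<le> C" using tb[OF k] by blast
    obtain D where D: "\<And>n. \<bar>s n k - t n k\<bar> \<le> D"
      using convergent_imp_Bseq[OF convergentI[OF st[OF k]]] unfolding Bseq_def real_norm_def by blast
    have "\<bar>s n k\<bar> \<le> C + D" for n using C[of n] D[of n] by linarith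
    then show ?thesis by blast
  qed
  have trm: "(\<lambda>n. cpol2 \<Gamma> K k l (x n) * s n k * s n l - \<Gamma> k l * t n k * t n l) \<longlonglongrightarrow> 0" if k: "k \<in> X" and l: "l \<in> X" for k l
  proof -
    obtain C1 where C1: "\<And>n. \<bar>t n k\<bar> \<le> C1" using tb[OF k] by blast
    obtain C2 where C2: "\<And>n. \<bar>s n l\<bar> \<le> C2" using sb[OF l] by blast
    obtain C3 where C3: "\<And>n. \<bar>s n k\<bar> \<le> C3" using sb[OF k] by blast
    have "(\<lambda>n. (if k = l then 12 * K * (x n k)\<^sup>2 else 0)) \<longlonglongrightarrow> 0"
    proof (cases "k = l")
      case True
      have "(\<lambda>n. 12 * K * (x n k)\<^sup>2) \<longlonglongrightarrow> 12 * K * 0\<^sup>2" by (intro tendsto_intros x k)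
      then show ?thesis using True by simp
    qed simp
    then have f: "(\<lambda>n. cpol2 \<Gamma> K k l (x n) - \<Gamma> k l) \<longlonglongrightarrow> 0" unfolding cpol2_def by simp
    have "(\<lambda>n. (cpol2 \<Gamma> K k l (x n) - \<Gamma> k l) * s n k * s n l + \<Gamma> k l * ((s n k - t n k) * s n l) + \<Gamma> k l * ((s n l - t n l) * t n k)) \<longlonglongrightarrow> 0 + \<Gamma> k l * 0 + \<Gamma> k l * 0"
      by (intro tendsto_add tendsto_mult_left tendsto_null_bounded[OF tendsto_null_bounded[OF f C3] C2]
          tendsto_null_bounded[OF st[OF k] C2] tendsto_null_bounded[OF st[OF l] C1])
    moreover have "(cpol2 \<Gamma> K k l (x n) - \<Gamma> k l) * s n k * s n l + \<Gamma> k l * ((s n k - t n k) * s n l) + \<Gamma> k l * ((s n l - t n l) * t n k)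
       = cpol2 \<Gamma> K k l (x n) * s n k * s n l - \<Gamma> k l * t n k * t n l" for n by (simp add: algebra_simps)
    ultimately show ?thesis by simp
  qed
  have "(\<lambda>n. (\<Sum>k\<in>X. \<Sum>l\<in>X. cpol2 \<Gamma> K k l (x n) * s n k * s n l - \<Gamma> k l * t n k * t n l) / 2) \<longlonglongrightarrow> 0 / 2"
    by (intro tendsto_divide tendsto_const tendsto_null_sum trm) auto
  then show ?thesis by (simp add: sum_subtractf diff_divide_distrib)
qed

text \<open>The value of \<open>Lop\<close> on a cylindrical test function at the measure with
  weights \<open>mh k * (1 + x k)\<close>, in the form given by \<open>Lop_fm\<close>.\<close>

definition Lx :: "'i set \<Rightarrow> ('i \<Rightarrow> real) \<Rightarrow> ('i \<Rightarrow> 'i \<Rightarrow> real) \<Rightarrow> real \<Rightarrow> ('i \<Rightarrow> real) \<Rightarrow> ('i \<Rightarrow> real) \<Rightarrow> real" where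
  "Lx X mh \<Gamma> K x r = (\<Sum>k\<in>X. \<Sum>l\<in>X. cpol2 \<Gamma> K k l x
      * ((1 + x k) * (r k - (\<Sum>j\<in>X. r j * (mh j * (1 + x j)))))
      * ((1 + x l) * (r l - (\<Sum>j\<in>X. r j * (mh j * (1 + x j)))))) / 2"

lemma Lx_limit:
  fixes x r :: "nat \<Rightarrow> 'i \<Rightarrow> real"
  assumes "finite X" "\<And>k. k \<in> X \<Longrightarrow> (\<lambda>n. x n k) \<longlonglongrightarrow> 0" "\<And>n k. k \<in> X \<Longrightarrow> \<bar>r n k\<bar> \<le> B"
  shows "(\<lambda>n. Lx X mh \<Gamma> K (x n) (r n) - (\<Sum>k\<in>X. \<Sum>l\<in>X. \<Gamma> k l * (r n k - (\<Sum>j\<in>X. r n j * mh j)) * (r n l - (\<Sum>j\<in>X. r n j * mh j))) / 2) \<longlonglongrightarrow> 0"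
  unfolding Lx_def by (rule Lop_limit[OF assms])

text \<open>The operator sees a direction only up to constants. As only the differences
  \<open>\<rho> k - \<rho> 0\<close> are bounded over Hs, this is what makes the limit above
  applicable to them.\<close>

lemma Lx_shift:
  assumes "(\<Sum>j\<in>X. mh j * (1 + x j)) = 1"
  shows "Lx X mh \<Gamma> K x (\<lambda>k. r k - a) = Lx X mh \<Gamma> K x r"
proof -
  have "(\<Sum>j\<in>X. (r j - a) * (mh j * (1 + x j))) = (\<Sum>j\<in>X. r j * (mh j * (1 + x j))) - a * (\<Sum>j\<in>X. mh j * (1 + x j))"
    unfolding left_diff_distrib sum_subtractf sum_distrib_left by simp
  then show ?thesis unfolding Lx_def using assms by simp
qed

lemma cpol_cong: "(\<And>k. k \<in> X \<Longrightarrow> a k = a' k) \<Longrightarrow> cpol X \<alpha> b \<Gamma> K a = cpol X \<alpha> b \<Gamma> K a'"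
  unfolding cpol_def by (simp cong: sum.cong)

lemma cpol_tendsto:
  assumes "\<And>k. k \<in> X \<Longrightarrow> (\<lambda>n. x n k) \<longlonglongrightarrow> 0"
  shows "(\<lambda>n. cpol X \<alpha> b \<Gamma> K (x n)) \<longlonglongrightarrow> \<alpha>"
proof -
  have "(\<lambda>n. cpol X \<alpha> b \<Gamma> K (x n)) \<longlonglongrightarrow> \<alpha> + (\<Sum>k\<in>X. b k * 0) + (\<Sum>k\<in>X. \<Sum>l\<in>X. \<Gamma> k l * 0 * 0) / 2 + K * (\<Sum>k\<in>X. 0 ^ 4)"
    unfolding cpol_def by (intro tendsto_add tendsto_const tendsto_sum tendsto_mult tendsto_divide tendsto_power assms) auto
  then show ?thesis by simp
qed

section \<open>Upper and lower limits, and the family of test functions\<close>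

lemma ulimsup_continuous:
  assumes u: "continuous_map (TP p) euclideanreal u" and \<mu>: "\<mu> \<in> D" "\<mu> \<in> Pp p"
  shows "ulimsup p D (\<lambda>\<mu>. ereal (u \<mu>)) \<mu> = ereal (u \<mu>)"
proof (rule antisym)
  show "ulimsup p D (\<lambda>\<mu>. ereal (u \<mu>)) \<mu> \<le> ereal (u \<mu>)"
  proof (rule ereal_le_epsilon2)
    fix e :: real assume e: "0 < e"
    let ?U = "{\<nu> \<in> topspace (TP p). u \<nu> \<in> {..<u \<mu> + e}}"
    have U: "openin (TP p) ?U" using u by (rule openin_continuous_map_preimage) simp
    have "ulimsup p D (\<lambda>\<mu>. ereal (u \<mu>)) \<mu> \<le> (SUP \<nu>\<in>?U \<inter> D. ereal (u \<nu>))"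
      unfolding ulimsup_def using U e \<mu> by (intro INF_lower) auto
    also have "\<dots> \<le> ereal (u \<mu>) + ereal e" by (intro SUP_least) auto
    finally show "ulimsup p D (\<lambda>\<mu>. ereal (u \<mu>)) \<mu> \<le> ereal (u \<mu>) + ereal e" .
  qed
  show "ereal (u \<mu>) \<le> ulimsup p D (\<lambda>\<mu>. ereal (u \<mu>)) \<mu>"
    unfolding ulimsup_def using \<mu>(1) by (intro INF_greatest SUP_upper) auto
qed

lemma uliminf_continuous:
  assumes u: "continuous_map (TP p) euclideanreal u" and \<mu>: "\<mu> \<in> D" "\<mu> \<in> Pp p"
  shows "uliminf p D (\<lambda>\<mu>. ereal (u \<mu>)) \<mu> = ereal (u \<mu>)"
proof (rule antisym)
  show "ereal (u \<mu>) \<le> uliminf p D (\<lambda>\<mu>. ereal (u \<mu>)) \<mu>"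
  proof (rule ereal_le_epsilon2)
    fix e :: real assume e: "0 < e"
    let ?U = "{\<nu> \<in> topspace (TP p). u \<nu> \<in> {u \<mu> - e<..}}"
    have U: "openin (TP p) ?U" using u by (rule openin_continuous_map_preimage) simp
    have "ereal (u \<mu> - e) \<le> (INF \<nu>\<in>?U \<inter> D. ereal (u \<nu>))" by (intro INF_greatest) auto
    also have "\<dots> \<le> uliminf p D (\<lambda>\<mu>. ereal (u \<mu>)) \<mu>"
      unfolding uliminf_def using U e \<mu> by (intro SUP_upper) auto
    finally have "ereal (u \<mu> - e) + ereal e \<le> uliminf p D (\<lambda>\<mu>. ereal (u \<mu>)) \<mu> + ereal e" by (rule add_right_mono)
    then show "ereal (u \<mu>) \<le> uliminf p D (\<lambda>\<mu>. ereal (u \<mu>)) \<mu> + ereal e" by simp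
  qed
  show "uliminf p D (\<lambda>\<mu>. ereal (u \<mu>)) \<mu> \<le> ereal (u \<mu>)"
    unfolding uliminf_def using \<mu>(1) by (intro SUP_least INF_lower) auto
qed

lemma uliminf_le_0D:
  assumes "uliminf p D g \<mu> \<le> 0" "openin (TP p) U" "\<mu> \<in> U" "0 < \<tau>"
  shows "\<exists>\<nu>\<in>U \<inter> D. g \<nu> < ereal \<tau>"
proof -
  have "(INF \<nu>\<in>U \<inter> D. g \<nu>) \<le> uliminf p D g \<mu>" unfolding uliminf_def using assms by (intro SUP_upper) auto
  also have "\<dots> < ereal \<tau>" using assms(1,4) by (auto intro: le_less_trans)
  finally show ?thesis unfolding INF_less_iff .
qed

lemma ulimsup_ge_0D:
  assumes "0 \<le> ulimsup p D g \<mu>" "openin (TP p) U" "\<mu> \<in> U" "0 < \<tau>"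
  shows "\<exists>\<nu>\<in>U \<inter> D. ereal (- \<tau>) < g \<nu>"
proof -
  have "ereal (- \<tau>) < 0" using assms(4) by simp
  also have "0 \<le> ulimsup p D g \<mu>" by (rule assms(1))
  also have "\<dots> \<le> (SUP \<nu>\<in>U \<inter> D. g \<nu>)" unfolding ulimsup_def using assms by (intro INF_lower) auto
  finally show ?thesis unfolding less_SUP_iff .
qed

text \<open>Collects what both viscosity arguments need from one choice of bumps: membership in
  \<open>C2\<close>, coordinates on the simplex, the operator, and neighbourhoods in
  \<open>TP p\<close> on which the weights stay close to mh.\<close>

lemma test_family:
  fixes X :: "'a::euclidean_space set"
  assumes X: "finite X" and mh: "mh \<in> psimplex X" "\<And>i. i \<in> X \<Longrightarrow> 0 < mh i"
    and p: "p = 0 \<or> p \<ge> 1" and q: "q = 0 \<or> q \<ge> 1"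
  obtains \<psi> where "\<And>\<alpha> b \<Gamma> K. (\<And>k l. \<Gamma> k l = \<Gamma> l k) \<Longrightarrow> C2 q (\<lambda>\<mu>. cpol X \<alpha> b \<Gamma> K (cyl_a \<psi> \<mu>)) (cyl_D1 X b \<Gamma> K \<psi>) (cyl_D2 X \<Gamma> K \<psi>)"
    and "\<And>m k. m \<in> psimplex X \<Longrightarrow> k \<in> X \<Longrightarrow> cyl_a \<psi> (fm X m) k = m k / mh k - 1"
    and "\<And>\<Gamma> K m \<rho>. m \<in> psimplex X \<Longrightarrow> \<rho> \<in> borel_measurable borel \<Longrightarrow> Lop (cyl_D2 X \<Gamma> K \<psi>) (fm X m) \<rho> = ereal (Lx X mh \<Gamma> K (\<lambda>k. m k / mh k - 1) \<rho>)"
    and "\<And>\<tau>. 0 < \<tau> \<Longrightarrow> \<exists>U. openin (TP p) U \<and> fm X mh \<in> U \<and> (\<forall>m\<in>psimplex X. fm X m \<in> U \<longrightarrow> (\<forall>k\<in>X. \<bar>m k / mh k - 1\<bar> < \<tau>))"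
proof -
  obtain \<psi> B L where L: "0 \<le> L" and \<psi>: "\<forall>k\<in>X. (\<forall>x. \<bar>\<psi> k x\<bar> \<le> B) \<and> (\<forall>x y. \<bar>\<psi> k x - \<psi> k y\<bar> \<le> L * dist x y) \<and> continuous_on UNIV (\<psi> k)
     \<and> (\<forall>j\<in>X. \<psi> k j = (if j = k then 1 / mh k else 0))"
    using dual_bumps[of X mh, OF X mh(2)] by blast
  have \<psi>1: "\<And>k x. k \<in> X \<Longrightarrow> \<bar>\<psi> k x\<bar> \<le> B" and \<psi>2: "\<And>k x y. k \<in> X \<Longrightarrow> \<bar>\<psi> k x - \<psi> k y\<bar> \<le> L * dist x y"
    and \<psi>3: "\<And>k. k \<in> X \<Longrightarrow> continuous_on UNIV (\<psi> k)" and dual: "\<And>k j. k \<in> X \<Longrightarrow> j \<in> X \<Longrightarrow> \<psi> k j = (if j = k then 1 / mh k else 0)"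
    using \<psi> by blast+
  have m\<psi>: "\<And>k. k \<in> X \<Longrightarrow> \<psi> k \<in> borel_measurable borel" using \<psi>3 by (rule borel_measurable_continuous_onI)
  have a: "cyl_a \<psi> (fm X m) k = m k / mh k - 1" if "m \<in> psimplex X" "k \<in> X" for m k
    by (rule cyl_a_fm[where \<psi> = \<psi> and k = k and mh = mh, OF X that m\<psi>[OF that(2)] dual[OF that(2)]])
  show thesis
  proof (rule that[of \<psi>])
    fix \<alpha> b K and \<Gamma> :: "'a \<Rightarrow> 'a \<Rightarrow> real" assume "\<And>k l. \<Gamma> k l = \<Gamma> l k"
    then show "C2 q (\<lambda>\<mu>. cpol X \<alpha> b \<Gamma> K (cyl_a \<psi> \<mu>)) (cyl_D1 X b \<Gamma> K \<psi>) (cyl_D2 X \<Gamma> K \<psi>)"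
      by (intro cyl_C2[OF X _ q \<psi>1 \<psi>2 \<psi>3 L]) auto
  next
    fix m k assume "m \<in> psimplex X" "k \<in> X"
    then show "cyl_a \<psi> (fm X m) k = m k / mh k - 1" by (rule a)
  next
    fix \<Gamma> K m and \<rho> :: "'a \<Rightarrow> real" assume m: "m \<in> psimplex X" and \<rho>: "\<rho> \<in> borel_measurable borel"
    have e: "1 + (m k / mh k - 1) = m k / mh k" "mh k * (m k / mh k) = m k" if "k \<in> X" for k using mh(2)[OF that] by auto
    have c: "cpol2 \<Gamma> K k l (cyl_a \<psi> (fm X m)) = cpol2 \<Gamma> K k l (\<lambda>k. m k / mh k - 1)" if "k \<in> X" for k l
      unfolding cpol2_def a[OF m that] ..
    have M: "(\<Sum>j\<in>X. \<rho> j * (mh j * (1 + (m j / mh j - 1)))) = (\<Sum>j\<in>X. \<rho> j * m j)" using e by (intro sum.cong refl) simp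
    have "Lop (cyl_D2 X \<Gamma> K \<psi>) (fm X m) \<rho> = ereal ((\<Sum>k\<in>X. \<Sum>l\<in>X. cpol2 \<Gamma> K k l (cyl_a \<psi> (fm X m)) *
        (m k / mh k * (\<rho> k - (\<Sum>j\<in>X. \<rho> j * m j))) * (m l / mh l * (\<rho> l - (\<Sum>j\<in>X. \<rho> j * m j)))) / 2)"
      by (rule Lop_fm[where \<psi> = \<psi> and mh = mh, OF X m \<rho> m\<psi> dual])
    also have "\<dots> = ereal (Lx X mh \<Gamma> K (\<lambda>k. m k / mh k - 1) \<rho>)"
      unfolding Lx_def M by (intro arg_cong[where f = ereal] arg_cong[where f = "\<lambda>x. x / 2"] sum.cong refl) (simp add: c e(1))
    finally show "Lop (cyl_D2 X \<Gamma> K \<psi>) (fm X m) \<rho> = ereal (Lx X mh \<Gamma> K (\<lambda>k. m k / mh k - 1) \<rho>)" .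
  next
    fix \<tau> :: real assume \<tau>: "0 < \<tau>"
    let ?g = "\<lambda>\<mu>. \<Sum>k\<in>X. \<bar>cyl_a \<psi> \<mu> k\<bar>"
    have "continuous_map (TP p) euclideanreal (\<lambda>\<mu>. cyl_a \<psi> \<mu> k)" if "k \<in> X" for k
      unfolding cyl_a_def using that by (intro continuous_map_diff continuous_map_const[THEN iffD2] continuous_TP_integral[OF p \<psi>1 \<psi>2 \<psi>3 L]) auto
    then have g: "continuous_map (TP p) euclideanreal ?g" using X by (intro continuous_map_sum continuous_map_real_abs) auto
    let ?U = "{\<nu> \<in> topspace (TP p). ?g \<nu> \<in> {..<\<tau>}}"
    have "openin (TP p) ?U" using g by (rule openin_continuous_map_preimage) simp
    moreover have "fm X mh \<in> ?U"
    proof -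
      have "cyl_a \<psi> (fm X mh) k = 0" if "k \<in> X" for k using a[OF mh(1) that] mh(2)[OF that] by simp
      then show ?thesis using fm_Pp[OF X mh(1)] \<tau> by simp
    qed
    moreover have "\<bar>m k / mh k - 1\<bar> < \<tau>" if m: "m \<in> psimplex X" and U: "fm X m \<in> ?U" and k: "k \<in> X" for m k
    proof -
      have "\<bar>cyl_a \<psi> (fm X m) k\<bar> \<le> ?g (fm X m)" using X k by (intro member_le_sum) auto
      then show ?thesis using U a[OF m k] by auto
    qed
    ultimately show "\<exists>U. openin (TP p) U \<and> fm X mh \<in> U \<and> (\<forall>m\<in>psimplex X. fm X m \<in> U \<longrightarrow> (\<forall>k\<in>X. \<bar>m k / mh k - 1\<bar> < \<tau>))"
      by (intro exI[of _ ?U] conjI ballI impI)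
  qed
qed

text \<open>Two equal infinite costs do not have a small difference, so closeness is stated with
  equality as an alternative. If one side is finite, so is the other.\<close>

lemma ereal_close:
  fixes x y :: ereal
  assumes "x = y \<or> \<bar>x - y\<bar> < ereal e" "0 < e" "x = ereal a"
  shows "\<exists>b. y = ereal b \<and> \<bar>a - b\<bar> < e"
  using assms by (cases y) auto

lemma ereal_close':
  fixes x y :: ereal
  assumes "x = y \<or> \<bar>x - y\<bar> < ereal e" "0 < e" "y = ereal b"
  shows "\<exists>a. x = ereal a \<and> \<bar>a - b\<bar> < e"
  using assms by (cases x) auto

lemma seqcont_fm:
  assumes X: "finite X" and p: "p = 0 \<or> p \<ge> 1" and u: "continuous_map (TP p) euclideanreal u"
  shows "seqcont X (psimplex X) (\<lambda>m. u (fm X m))"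
  unfolding seqcont_def
proof (intro allI impI)
  fix s l assume s: "range s \<subseteq> psimplex X" and l: "l \<in> psimplex X" and lim: "\<forall>i\<in>X. (\<lambda>n. s n i) \<longlonglongrightarrow> l i"
  have sn: "s n \<in> psimplex X" for n using s by blast
  show "(\<lambda>n. u (fm X (s n))) \<longlonglongrightarrow> u (fm X l)"
  proof (rule continuous_TP_seq[OF u fm_Pp[OF X l]])
    show "range (\<lambda>n. fm X (s n)) \<subseteq> Pp p" using fm_Pp[OF X sn] by blast
    show "convP p (\<lambda>n. fm X (s n)) (fm X l)" using lim by (intro fm_convP[OF X sn l p]) auto
  qed
qed

lemma null_sequence_le:
  assumes "\<And>n. \<bar>x n\<bar> < inverse (real (Suc n))"
  shows "x \<longlonglongrightarrow> 0"
  by (rule Lim_null_comparison[OF _ LIMSEQ_inverse_real_of_nat]) (use assms in \<open>auto intro!: always_eventually less_imp_le\<close>)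

lemma psimplex_recenter:
  assumes "m \<in> psimplex X" "\<And>i. i \<in> X \<Longrightarrow> 0 < mh i"
  shows "(\<Sum>j\<in>X. mh j * (1 + (m j / mh j - 1))) = 1"
proof -
  have "(\<Sum>j\<in>X. mh j * (1 + (m j / mh j - 1))) = (\<Sum>j\<in>X. m j)" using assms(2) by (intro sum.cong refl) force
  then show ?thesis using assms(1) by (simp add: psimplex_def)
qed

section \<open>Passing from the viscosity inequalities to jets on the simplex\<close>

text \<open>The jet majorant is a test function from above. Along weights tending to mh the
  Hamiltonian is almost nonpositive, and being a supremum it bounds the term of the given \<rho>. In
  the limit the polynomial contributes its quadratic form, and the margin e is removed last. An
  infinite cost makes the claim trivial.\<close>

lemma visc_sub_jet:
  fixes X :: "'a::euclidean_space set"
  assumes p: "p = 0 \<or> p \<ge> 1" and q: "q = 0 \<or> q \<ge> 1" and X: "finite X" "X \<noteq> {}"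
    and mh: "mh \<in> psimplex X" "\<And>i. i \<in> X \<Longrightarrow> 0 < mh i"
    and meas: "\<And>\<rho>. \<rho> \<in> Hs \<Longrightarrow> \<rho> \<in> borel_measurable borel"
    and cc: "\<And>e. 0 < e \<Longrightarrow> \<exists>U. openin (TP p) U \<and> fm X mh \<in> U \<and>
        (\<forall>\<nu>\<in>U \<inter> PX X. \<forall>\<rho>\<in>Hs. c \<nu> \<rho> = c (fm X mh) \<rho> \<or> \<bar>c \<nu> \<rho> - c (fm X mh) \<rho>\<bar> < ereal e)"
    and cfin: "\<And>\<mu> \<rho>. \<mu> \<in> Pp p \<Longrightarrow> \<rho> \<in> Hs \<Longrightarrow> c \<mu> \<rho> \<noteq> -\<infinity>"
    and u: "continuous_map (TP p) euclideanreal u" and sub: "visc_sub p q c Hs \<beta> (\<lambda>\<mu>. ereal (u \<mu>))"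
    and j: "rsup X (\<lambda>m. u (fm X m)) mh b P" and \<rho>: "\<rho> \<in> Hs"
  defines "t \<equiv> \<lambda>k. \<rho> k - (\<Sum>j\<in>X. \<rho> j * mh j)"
  shows "ereal (\<beta> * u (fm X mh)) \<le> c (fm X mh) \<rho> + ereal ((\<Sum>i\<in>X. \<Sum>j\<in>X. t i * t j * P i j) / 2)"
proof (cases "c (fm X mh) \<rho>")
  case (real c0)
  have P: "fm X mh \<in> Pp p" by (rule fm_Pp[OF X(1) mh(1)])
  have D: "fm X mh \<in> Dset p (fm X mh)" using P by (simp add: Dset_def)
  define Q where "Q = (\<Sum>i\<in>X. \<Sum>j\<in>X. t i * t j * P i j)"
  define S where "S = (\<Sum>k\<in>X. (t k)\<^sup>2)"
  have S0: "0 \<le> S" unfolding S_def by (intro sum_nonneg) auto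
  have dep: "\<And>m m'. \<forall>i\<in>X. m i = m' i \<Longrightarrow> u (fm X m) = u (fm X m')" by (intro arg_cong[where f = u] fm_cong) simp
  have main: "\<beta> * u (fm X mh) \<le> c0 + Q / 2 + e * S" if e: "0 < e" for e
  proof -
    obtain \<Gamma> K where sym: "\<forall>k l. \<Gamma> k l = \<Gamma> l k"
      and quad: "\<forall>x. (\<Sum>k\<in>X. \<Sum>l\<in>X. \<Gamma> k l * x k * x l) = (\<Sum>k\<in>X. \<Sum>l\<in>X. x k * x l * P k l) + 2 * e * (\<Sum>k\<in>X. (x k)\<^sup>2)"
      and maj: "\<forall>m\<in>psimplex X. u (fm X m) \<le> cpol X (u (fm X mh)) b \<Gamma> K (\<lambda>k. m k / mh k - 1)"
      using jet_majorant[OF X mh seqcont_fm[OF X(1) p u] dep j e] by blast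
    obtain \<psi> where C: "\<And>\<alpha> b \<Gamma> K. (\<And>k l. \<Gamma> k l = \<Gamma> l k) \<Longrightarrow> C2 q (\<lambda>\<mu>. cpol X \<alpha> b \<Gamma> K (cyl_a \<psi> \<mu>)) (cyl_D1 X b \<Gamma> K \<psi>) (cyl_D2 X \<Gamma> K \<psi>)"
      and a: "\<And>m k. m \<in> psimplex X \<Longrightarrow> k \<in> X \<Longrightarrow> cyl_a \<psi> (fm X m) k = m k / mh k - 1"
      and Lf: "\<And>\<Gamma> K m \<rho>. m \<in> psimplex X \<Longrightarrow> \<rho> \<in> borel_measurable borel \<Longrightarrow> Lop (cyl_D2 X \<Gamma> K \<psi>) (fm X m) \<rho> = ereal (Lx X mh \<Gamma> K (\<lambda>k. m k / mh k - 1) \<rho>)"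
      and nb: "\<And>\<tau>. 0 < \<tau> \<Longrightarrow> \<exists>U. openin (TP p) U \<and> fm X mh \<in> U \<and> (\<forall>m\<in>psimplex X. fm X m \<in> U \<longrightarrow> (\<forall>k\<in>X. \<bar>m k / mh k - 1\<bar> < \<tau>))"
      using test_family[OF X(1) mh p q] by blast
    define f where "f \<mu> = cpol X (u (fm X mh)) b \<Gamma> K (cyl_a \<psi> \<mu>)" for \<mu>
    have fe: "f (fm X m) = cpol X (u (fm X mh)) b \<Gamma> K (\<lambda>k. m k / mh k - 1)" if "m \<in> psimplex X" for m
      unfolding f_def using a[OF that] by (rule cpol_cong)
    have "mh k / mh k - 1 = 0" if "k \<in> X" for k using mh(2)[OF that] by simp
    then have f0: "f (fm X mh) = u (fm X mh)" unfolding fe[OF mh(1)] cpol_def by simp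
    have fu: "ereal (u \<mu>) \<le> ereal (f \<mu>)" if "\<mu> \<in> Dset p (fm X mh)" for \<mu>
      using Dset_fm[OF X(1) mh(1) that] maj fe by auto
    have "uliminf p (Dset p (fm X mh)) (Ham c Hs \<beta> f (cyl_D2 X \<Gamma> K \<psi>)) (fm X mh) \<le> 0"
    proof (rule sub[unfolded visc_sub_def, rule_format, OF P], intro conjI ballI)
      show "C2 q f (cyl_D1 X b \<Gamma> K \<psi>) (cyl_D2 X \<Gamma> K \<psi>)" unfolding f_def by (rule C) (use sym in blast)
      show "ereal (f (fm X mh)) = ulimsup p (Dset p (fm X mh)) (\<lambda>\<mu>. ereal (u \<mu>)) (fm X mh)" unfolding ulimsup_continuous[OF u D P] f0 ..
    qed (rule fu)
    note low = uliminf_le_0D[OF this]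
    have "\<exists>m. m \<in> psimplex X \<and> (\<forall>k\<in>X. \<bar>m k / mh k - 1\<bar> < inverse (real (Suc n)))
        \<and> \<beta> * f (fm X m) - c0 - Lx X mh \<Gamma> K (\<lambda>k. m k / mh k - 1) \<rho> \<le> 2 * inverse (real (Suc n))" for n
    proof -
      define \<tau> where "\<tau> = inverse (real (Suc n))"
      have \<tau>: "0 < \<tau>" by (simp add: \<tau>_def)
      obtain U where U: "openin (TP p) U" "fm X mh \<in> U" "\<forall>m\<in>psimplex X. fm X m \<in> U \<longrightarrow> (\<forall>k\<in>X. \<bar>m k / mh k - 1\<bar> < \<tau>)" using nb[OF \<tau>] by blast
      obtain V where V: "openin (TP p) V" "fm X mh \<in> V" "\<forall>\<nu>\<in>V \<inter> PX X. \<forall>\<rho>\<in>Hs. c \<nu> \<rho> = c (fm X mh) \<rho> \<or> \<bar>c \<nu> \<rho> - c (fm X mh) \<rho>\<bar> < ereal \<tau>"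
        using cc[OF \<tau>] by blast
      obtain \<nu> where \<nu>: "\<nu> \<in> (U \<inter> V) \<inter> Dset p (fm X mh)" "Ham c Hs \<beta> f (cyl_D2 X \<Gamma> K \<psi>) \<nu> < ereal \<tau>"
        using low[OF openin_Int[OF U(1) V(1)] _ \<tau>] U(2) V(2) by blast
      obtain m where m: "m \<in> psimplex X" "\<nu> = fm X m" using Dset_fm[OF X(1) mh(1), of \<nu> p] \<nu>(1) by blast
      have "c (fm X m) \<rho> = c (fm X mh) \<rho> \<or> \<bar>c (fm X m) \<rho> - c (fm X mh) \<rho>\<bar> < ereal \<tau>"
        using V(3) \<nu>(1) m fm_PX[OF X(1) m(1)] \<rho> by blast
      from ereal_close'[OF this \<tau> real] obtain c1 where c1: "c (fm X m) \<rho> = ereal c1" "\<bar>c1 - c0\<bar> < \<tau>" by blast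
      have "ereal (\<beta> * f (fm X m)) + (- c (fm X m) \<rho> - Lop (cyl_D2 X \<Gamma> K \<psi>) (fm X m) \<rho>) \<le> Ham c Hs \<beta> f (cyl_D2 X \<Gamma> K \<psi>) \<nu>"
        unfolding Ham_def m(2) using \<rho> by (intro add_left_mono SUP_upper)
      from le_less_trans[OF this \<nu>(2)] have "\<beta> * f (fm X m) + (- c1 - Lx X mh \<Gamma> K (\<lambda>k. m k / mh k - 1) \<rho>) < \<tau>"
        unfolding c1(1) Lf[OF m(1) meas[OF \<rho>]] by simp
      then show ?thesis using m(1) U(3) \<nu>(1) c1(2) unfolding m(2) \<tau>_def[symmetric] by (intro exI[of _ m]) auto
    qed
    then obtain ms where ms: "\<And>n. ms n \<in> psimplex X" "\<And>n k. k \<in> X \<Longrightarrow> \<bar>ms n k / mh k - 1\<bar> < inverse (real (Suc n))"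
      "\<And>n. \<beta> * f (fm X (ms n)) - c0 - Lx X mh \<Gamma> K (\<lambda>k. ms n k / mh k - 1) \<rho> \<le> 2 * inverse (real (Suc n))"
      using choice[of "\<lambda>n m. m \<in> psimplex X \<and> (\<forall>k\<in>X. \<bar>m k / mh k - 1\<bar> < inverse (real (Suc n)))
        \<and> \<beta> * f (fm X m) - c0 - Lx X mh \<Gamma> K (\<lambda>k. m k / mh k - 1) \<rho> \<le> 2 * inverse (real (Suc n))"] by blast
    define x where "x n k = ms n k / mh k - 1" for n k
    have x0: "(\<lambda>n. x n k) \<longlonglongrightarrow> 0" if "k \<in> X" for k unfolding x_def using ms(2)[OF that] by (rule null_sequence_le)
    have fl: "(\<lambda>n. f (fm X (ms n))) \<longlonglongrightarrow> u (fm X mh)" unfolding fe[OF ms(1)] x_def[symmetric] by (rule cpol_tendsto[OF x0])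
    have "\<bar>\<rho> k\<bar> \<le> (\<Sum>k\<in>X. \<bar>\<rho> k\<bar>)" if "k \<in> X" for k using X that by (intro member_le_sum) auto
    then have "(\<lambda>n. Lx X mh \<Gamma> K (x n) \<rho> - (\<Sum>k\<in>X. \<Sum>l\<in>X. \<Gamma> k l * t k * t l) / 2) \<longlonglongrightarrow> 0"
      unfolding t_def by (intro Lx_limit[where r = "\<lambda>n. \<rho>", OF X(1) x0])
    then have "(\<lambda>n. Lx X mh \<Gamma> K (x n) \<rho> - (Q + 2 * e * S) / 2) \<longlonglongrightarrow> 0"
      unfolding quad[rule_format, of t] Q_def S_def .
    from tendsto_add[OF this tendsto_const[of "(Q + 2 * e * S) / 2"]]
    have Ll: "(\<lambda>n. Lx X mh \<Gamma> K (x n) \<rho>) \<longlonglongrightarrow> (Q + 2 * e * S) / 2" by simp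
    have "\<beta> * u (fm X mh) - c0 - (Q + 2 * e * S) / 2 \<le> 2 * 0"
    proof (rule LIMSEQ_le)
      show "(\<lambda>n. \<beta> * f (fm X (ms n)) - c0 - Lx X mh \<Gamma> K (x n) \<rho>) \<longlonglongrightarrow> \<beta> * u (fm X mh) - c0 - (Q + 2 * e * S) / 2"
        by (intro tendsto_diff tendsto_mult_left fl tendsto_const Ll)
      show "(\<lambda>n. 2 * inverse (real (Suc n))) \<longlonglongrightarrow> 2 * 0" by (intro tendsto_mult_left LIMSEQ_inverse_real_of_nat)
      show "\<exists>N. \<forall>n\<ge>N. \<beta> * f (fm X (ms n)) - c0 - Lx X mh \<Gamma> K (x n) \<rho> \<le> 2 * inverse (real (Suc n))"
        using ms(3) unfolding x_def by blast
    qed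
    then show ?thesis by (simp add: add_divide_distrib)
  qed
  have "\<beta> * u (fm X mh) \<le> c0 + Q / 2"
  proof (rule field_le_epsilon)
    fix e :: real assume e: "0 < e"
    have "e / (S + 1) * S \<le> e" using e S0 by (simp add: field_simps)
    then show "\<beta> * u (fm X mh) \<le> c0 + Q / 2 + e" using main[of "e / (S + 1)"] e S0 by simp
  qed
  then show ?thesis unfolding real Q_def by simp
next
  case MInf
  then show ?thesis using cfin[OF fm_Pp[OF X(1) mh(1)] \<rho>] by simp
qed simp

text \<open>The test function is the negated majorant of -w. The supremum now only yields some
  \<rho> for each nearby measure, so all estimates must be uniform over Hs: after subtracting
  \<open>\<rho> 0\<close> the directions are bounded, and the cost returns to mh by its uniform
  continuity. No limit of the directions is taken; that of one sufficiently large index is the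
  witness.\<close>

lemma visc_super_jet:
  fixes X :: "'a::euclidean_space set"
  assumes p: "p = 0 \<or> p \<ge> 1" and q: "q = 0 \<or> q \<ge> 1" and X: "finite X" "X \<noteq> {}"
    and mh: "mh \<in> psimplex X" "\<And>i. i \<in> X \<Longrightarrow> 0 < mh i"
    and meas: "\<And>\<rho>. \<rho> \<in> Hs \<Longrightarrow> \<rho> \<in> borel_measurable borel"
    and cc: "\<And>e. 0 < e \<Longrightarrow> \<exists>U. openin (TP p) U \<and> fm X mh \<in> U \<and>
        (\<forall>\<nu>\<in>U \<inter> PX X. \<forall>\<rho>\<in>Hs. c \<nu> \<rho> = c (fm X mh) \<rho> \<or> \<bar>c \<nu> \<rho> - c (fm X mh) \<rho>\<bar> < ereal e)"
    and cfin: "\<And>\<mu> \<rho>. \<mu> \<in> Pp p \<Longrightarrow> \<rho> \<in> Hs \<Longrightarrow> c \<mu> \<rho> \<noteq> -\<infinity>"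
    and bd: "\<And>\<rho> k. \<rho> \<in> Hs \<Longrightarrow> k \<in> X \<Longrightarrow> \<bar>\<rho> k - \<rho> 0\<bar> \<le> B"
    and w: "continuous_map (TP p) euclideanreal w" and super: "visc_super p q c Hs \<beta> (\<lambda>\<mu>. ereal (w \<mu>))"
    and j: "rsup X (\<lambda>m. - w (fm X m)) mh b P" and \<epsilon>: "0 < \<epsilon>"
  shows "\<exists>\<rho>\<in>Hs. c (fm X mh) \<rho> - ereal ((\<Sum>i\<in>X. \<Sum>j\<in>X. (\<rho> i - (\<Sum>k\<in>X. \<rho> k * mh k)) * (\<rho> j - (\<Sum>k\<in>X. \<rho> k * mh k)) * P i j) / 2) \<le> ereal (\<beta> * w (fm X mh) + \<epsilon>)"
proof -
  have Pp: "fm X mh \<in> Pp p" by (rule fm_Pp[OF X(1) mh(1)])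
  have D: "fm X mh \<in> Dset p (fm X mh)" using Pp by (simp add: Dset_def)
  define T where "T \<rho> k = \<rho> k - (\<Sum>j\<in>X. \<rho> j * mh j)" for \<rho> k
  define Q where "Q \<rho> = (\<Sum>i\<in>X. \<Sum>j\<in>X. T \<rho> i * T \<rho> j * P i j)" for \<rho>
  define S where "S \<rho> = (\<Sum>k\<in>X. (T \<rho> k)\<^sup>2)" for \<rho>
  define M where "M = real (card X) * (2 * B)\<^sup>2"
  have M0: "0 \<le> M" by (simp add: M_def)
  \<comment> \<open>M bounds the squared norm of every centred direction, so the margin of the
    majorant costs at most \<epsilon> / 2; the other half pays for stopping at a finite
    index.\<close>
  define e where "e = \<epsilon> / (2 * (M + 1))"
  have e: "0 < e" "e * M \<le> \<epsilon> / 2" using \<epsilon> M0 by (auto simp: e_def field_simps)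
  have Tshift: "T (\<lambda>k. \<rho> k - \<rho> 0) = T \<rho>" for \<rho>
  proof
    fix k
    have "(\<Sum>j\<in>X. (\<rho> j - \<rho> 0) * mh j) = (\<Sum>j\<in>X. \<rho> j * mh j) - \<rho> 0 * (\<Sum>j\<in>X. mh j)"
      unfolding left_diff_distrib sum_subtractf sum_distrib_left by simp
    then show "T (\<lambda>k. \<rho> k - \<rho> 0) k = T \<rho> k" unfolding T_def using mh(1) by (simp add: psimplex_def)
  qed
  have Tb: "\<bar>T \<rho> k\<bar> \<le> 2 * B" if \<rho>: "\<rho> \<in> Hs" and k: "k \<in> X" for \<rho> k
  proof -
    have "\<bar>\<Sum>j\<in>X. (\<rho> j - \<rho> 0) * mh j\<bar> \<le> (\<Sum>j\<in>X. B * mh j)"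
      using bd[OF \<rho>] mh(2) by (intro order_trans[OF sum_abs] sum_mono) (auto simp: abs_mult less_imp_le intro: mult_right_mono)
    also have "\<dots> = B" using mh(1) by (simp add: sum_distrib_left[symmetric] psimplex_def)
    finally have "\<bar>\<Sum>j\<in>X. (\<rho> j - \<rho> 0) * mh j\<bar> \<le> B" .
    moreover have "T \<rho> k = (\<rho> k - \<rho> 0) - (\<Sum>j\<in>X. (\<rho> j - \<rho> 0) * mh j)" unfolding Tshift[of \<rho>, symmetric] by (simp add: T_def)
    ultimately show ?thesis using bd[OF \<rho> k] by linarith
  qed
  have SM: "e * S \<rho> \<le> \<epsilon> / 2" if \<rho>: "\<rho> \<in> Hs" for \<rho>
  proof -
    have "(T \<rho> k)\<^sup>2 \<le> (2 * B)\<^sup>2" if "k \<in> X" for k using power_mono[OF Tb[OF \<rho> that], of 2] by simp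
    then have "S \<rho> \<le> M" unfolding S_def M_def using sum_bounded_above[of X "\<lambda>k. (T \<rho> k)\<^sup>2" "(2 * B)\<^sup>2"] by simp
    then have "e * S \<rho> \<le> e * M" using e(1) by (intro mult_left_mono) auto
    then show ?thesis using e(2) by linarith
  qed
  have vc: "seqcont X (psimplex X) (\<lambda>m. - w (fm X m))"
    using seqcont_fm[OF X(1) p, of "\<lambda>\<mu>. - w \<mu>"] w by (simp add: continuous_map_minus)
  have dep: "\<And>m m'. \<forall>i\<in>X. m i = m' i \<Longrightarrow> - w (fm X m) = - w (fm X m')" by (intro arg_cong[where f = "\<lambda>\<mu>. - w \<mu>"] fm_cong) simp
  obtain \<Gamma>' K' where sym': "\<forall>k l. \<Gamma>' k l = \<Gamma>' l k"
    and quad: "\<forall>x. (\<Sum>k\<in>X. \<Sum>l\<in>X. \<Gamma>' k l * x k * x l) = (\<Sum>k\<in>X. \<Sum>l\<in>X. x k * x l * P k l) + 2 * e * (\<Sum>k\<in>X. (x k)\<^sup>2)"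
    and maj: "\<forall>m\<in>psimplex X. - w (fm X m) \<le> cpol X (- w (fm X mh)) b \<Gamma>' K' (\<lambda>k. m k / mh k - 1)"
    using jet_majorant[OF X mh vc dep j e(1)] by blast
  define b1 where "b1 k = - b k" for k
  define \<Gamma> where "\<Gamma> k l = - \<Gamma>' k l" for k l
  define K where "K = - K'"
  have sym: "\<forall>k l. \<Gamma> k l = \<Gamma> l k" unfolding \<Gamma>_def using sym' by simp
  have neg: "cpol X (w (fm X mh)) b1 \<Gamma> K y = - cpol X (- w (fm X mh)) b \<Gamma>' K' y" for y
    unfolding cpol_def b1_def \<Gamma>_def K_def by (simp add: sum_negf)
  obtain \<psi> where C: "\<And>\<alpha> b \<Gamma> K. (\<And>k l. \<Gamma> k l = \<Gamma> l k) \<Longrightarrow> C2 q (\<lambda>\<mu>. cpol X \<alpha> b \<Gamma> K (cyl_a \<psi> \<mu>)) (cyl_D1 X b \<Gamma> K \<psi>) (cyl_D2 X \<Gamma> K \<psi>)"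
    and a: "\<And>m k. m \<in> psimplex X \<Longrightarrow> k \<in> X \<Longrightarrow> cyl_a \<psi> (fm X m) k = m k / mh k - 1"
    and Lf: "\<And>\<Gamma> K m \<rho>. m \<in> psimplex X \<Longrightarrow> \<rho> \<in> borel_measurable borel \<Longrightarrow> Lop (cyl_D2 X \<Gamma> K \<psi>) (fm X m) \<rho> = ereal (Lx X mh \<Gamma> K (\<lambda>k. m k / mh k - 1) \<rho>)"
    and nb: "\<And>\<tau>. 0 < \<tau> \<Longrightarrow> \<exists>U. openin (TP p) U \<and> fm X mh \<in> U \<and> (\<forall>m\<in>psimplex X. fm X m \<in> U \<longrightarrow> (\<forall>k\<in>X. \<bar>m k / mh k - 1\<bar> < \<tau>))"
    using test_family[OF X(1) mh p q] by blast
  define f where "f \<mu> = cpol X (w (fm X mh)) b1 \<Gamma> K (cyl_a \<psi> \<mu>)" for \<mu>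
  have fe: "f (fm X m) = cpol X (w (fm X mh)) b1 \<Gamma> K (\<lambda>k. m k / mh k - 1)" if "m \<in> psimplex X" for m
    unfolding f_def using a[OF that] by (rule cpol_cong)
  have "mh k / mh k - 1 = 0" if "k \<in> X" for k using mh(2)[OF that] by simp
  then have f0: "f (fm X mh) = w (fm X mh)" unfolding fe[OF mh(1)] cpol_def by simp
  have fw: "ereal (f \<mu>) \<le> ereal (w \<mu>)" if \<mu>: "\<mu> \<in> Dset p (fm X mh)" for \<mu>
  proof -
    obtain m where m: "m \<in> psimplex X" "\<mu> = fm X m" using Dset_fm[OF X(1) mh(1) \<mu>] by blast
    have "- w (fm X m) \<le> cpol X (- w (fm X mh)) b \<Gamma>' K' (\<lambda>k. m k / mh k - 1)" using maj m(1) by blast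
    then show ?thesis unfolding m(2) fe[OF m(1)] neg by simp
  qed
  have "0 \<le> ulimsup p (Dset p (fm X mh)) (Ham c Hs \<beta> f (cyl_D2 X \<Gamma> K \<psi>)) (fm X mh)"
  proof (rule super[unfolded visc_super_def, rule_format, OF Pp], intro conjI ballI)
    show "C2 q f (cyl_D1 X b1 \<Gamma> K \<psi>) (cyl_D2 X \<Gamma> K \<psi>)" unfolding f_def by (rule C) (use sym in blast)
    show "ereal (f (fm X mh)) = uliminf p (Dset p (fm X mh)) (\<lambda>\<mu>. ereal (w \<mu>)) (fm X mh)" unfolding uliminf_continuous[OF w D Pp] f0 ..
  qed (rule fw)
  note high = ulimsup_ge_0D[OF this]
  have "\<exists>y. fst y \<in> psimplex X \<and> snd y \<in> Hs \<and> (\<forall>k\<in>X. \<bar>fst y k / mh k - 1\<bar> < inverse (real (Suc n)))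
      \<and> c (fm X mh) (snd y) \<le> ereal (\<beta> * f (fm X (fst y)) - Lx X mh \<Gamma> K (\<lambda>k. fst y k / mh k - 1) (snd y) + 2 * inverse (real (Suc n)))" for n
  proof -
    define \<tau> where "\<tau> = inverse (real (Suc n))"
    have \<tau>: "0 < \<tau>" by (simp add: \<tau>_def)
    obtain U where U: "openin (TP p) U" "fm X mh \<in> U" "\<forall>m\<in>psimplex X. fm X m \<in> U \<longrightarrow> (\<forall>k\<in>X. \<bar>m k / mh k - 1\<bar> < \<tau>)" using nb[OF \<tau>] by blast
    obtain V where V: "openin (TP p) V" "fm X mh \<in> V" "\<forall>\<nu>\<in>V \<inter> PX X. \<forall>\<rho>\<in>Hs. c \<nu> \<rho> = c (fm X mh) \<rho> \<or> \<bar>c \<nu> \<rho> - c (fm X mh) \<rho>\<bar> < ereal \<tau>"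
      using cc[OF \<tau>] by blast
    obtain \<nu> where \<nu>: "\<nu> \<in> (U \<inter> V) \<inter> Dset p (fm X mh)" "ereal (- \<tau>) < Ham c Hs \<beta> f (cyl_D2 X \<Gamma> K \<psi>) \<nu>"
      using high[OF openin_Int[OF U(1) V(1)] _ \<tau>] U(2) V(2) by blast
    obtain m where m: "m \<in> psimplex X" "\<nu> = fm X m" using Dset_fm[OF X(1) mh(1), of \<nu> p] \<nu>(1) by blast
    have "ereal (- \<tau> - \<beta> * f (fm X m)) < (SUP \<rho>\<in>Hs. - c (fm X m) \<rho> - Lop (cyl_D2 X \<Gamma> K \<psi>) (fm X m) \<rho>)"
      using \<nu>(2) unfolding Ham_def m(2) by (cases "SUP \<rho>\<in>Hs. - c (fm X m) \<rho> - Lop (cyl_D2 X \<Gamma> K \<psi>) (fm X m) \<rho>") auto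
    then obtain \<rho> where \<rho>: "\<rho> \<in> Hs" "ereal (- \<tau> - \<beta> * f (fm X m)) < - c (fm X m) \<rho> - Lop (cyl_D2 X \<Gamma> K \<psi>) (fm X m) \<rho>"
      unfolding less_SUP_iff by blast
    \<comment> \<open>With -\<infinity> excluded, the strict lower bound also excludes +\<infinity>,
      so the cost is a real number.\<close>
    have cm: "c (fm X m) \<rho> \<noteq> -\<infinity>" by (rule cfin[OF fm_Pp[OF X(1) m(1)] \<rho>(1)])
    then obtain c1 where c1: "c (fm X m) \<rho> = ereal c1" "c1 < \<tau> + \<beta> * f (fm X m) - Lx X mh \<Gamma> K (\<lambda>k. m k / mh k - 1) \<rho>"
      using \<rho>(2) unfolding Lf[OF m(1) meas[OF \<rho>(1)]] by (cases "c (fm X m) \<rho>") auto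
    have "c (fm X m) \<rho> = c (fm X mh) \<rho> \<or> \<bar>c (fm X m) \<rho> - c (fm X mh) \<rho>\<bar> < ereal \<tau>"
      using V(3) \<nu>(1) m fm_PX[OF X(1) m(1)] \<rho> by blast
    from ereal_close[OF this \<tau> c1(1)] obtain c0 where c0: "c (fm X mh) \<rho> = ereal c0" "\<bar>c1 - c0\<bar> < \<tau>" by blast
    have "c (fm X mh) \<rho> \<le> ereal (\<beta> * f (fm X m) - Lx X mh \<Gamma> K (\<lambda>k. m k / mh k - 1) \<rho> + 2 * \<tau>)"
      unfolding c0(1) ereal_less_eq using c1(2) c0(2) by linarith
    then show ?thesis using m(1) \<rho>(1) U(3) \<nu>(1) unfolding m(2) \<tau>_def[symmetric] by (intro exI[of _ "(m, \<rho>)"]) auto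
  qed
  then obtain y where y: "\<And>n. fst (y n) \<in> psimplex X \<and> snd (y n) \<in> Hs \<and> (\<forall>k\<in>X. \<bar>fst (y n) k / mh k - 1\<bar> < inverse (real (Suc n)))
      \<and> c (fm X mh) (snd (y n)) \<le> ereal (\<beta> * f (fm X (fst (y n))) - Lx X mh \<Gamma> K (\<lambda>k. fst (y n) k / mh k - 1) (snd (y n)) + 2 * inverse (real (Suc n)))"
    using choice[of "\<lambda>n y. fst y \<in> psimplex X \<and> snd y \<in> Hs \<and> (\<forall>k\<in>X. \<bar>fst y k / mh k - 1\<bar> < inverse (real (Suc n)))
      \<and> c (fm X mh) (snd y) \<le> ereal (\<beta> * f (fm X (fst y)) - Lx X mh \<Gamma> K (\<lambda>k. fst y k / mh k - 1) (snd y) + 2 * inverse (real (Suc n)))"] by blast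
  define ms where "ms n = fst (y n)" for n
  define rs where "rs n = snd (y n)" for n
  have ms: "ms n \<in> psimplex X" and rs: "rs n \<in> Hs" and close: "k \<in> X \<Longrightarrow> \<bar>ms n k / mh k - 1\<bar> < inverse (real (Suc n))"
    and le: "c (fm X mh) (rs n) \<le> ereal (\<beta> * f (fm X (ms n)) - Lx X mh \<Gamma> K (\<lambda>k. ms n k / mh k - 1) (rs n) + 2 * inverse (real (Suc n)))" for n k
    using y[of n] unfolding ms_def rs_def by auto
  define x where "x n k = ms n k / mh k - 1" for n k
  have x0: "(\<lambda>n. x n k) \<longlonglongrightarrow> 0" if "k \<in> X" for k unfolding x_def using close[OF that] by (rule null_sequence_le)
  have fl: "(\<lambda>n. f (fm X (ms n))) \<longlonglongrightarrow> w (fm X mh)" unfolding fe[OF ms] x_def[symmetric] by (rule cpol_tendsto[OF x0])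
  have xs: "(\<Sum>j\<in>X. mh j * (1 + x n j)) = 1" for n unfolding x_def by (rule psimplex_recenter[OF ms mh(2)])
  have gq: "(\<Sum>k\<in>X. \<Sum>l\<in>X. \<Gamma> k l * T r k * T r l) = - (Q r + 2 * e * S r)" for r
    using quad[rule_format, of "T r"] unfolding \<Gamma>_def Q_def S_def by (simp add: sum_negf)
  \<comment> \<open>The bound over Hs concerns the shifted directions, so the limit is taken for
    these and then read back for the original ones.\<close>
  have "(\<lambda>n. Lx X mh \<Gamma> K (x n) (\<lambda>k. rs n k - rs n 0) - (\<Sum>k\<in>X. \<Sum>l\<in>X. \<Gamma> k l * T (\<lambda>k. rs n k - rs n 0) k * T (\<lambda>k. rs n k - rs n 0) l) / 2) \<longlonglongrightarrow> 0"
    unfolding T_def by (rule Lx_limit[OF X(1) x0 bd[OF rs]])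
  then have Ll: "(\<lambda>n. Lx X mh \<Gamma> K (x n) (rs n) - - (Q (rs n) + 2 * e * S (rs n)) / 2) \<longlonglongrightarrow> 0"
    unfolding Lx_shift[OF xs] Tshift gq .
  have "(\<lambda>n. \<beta> * f (fm X (ms n)) - (Lx X mh \<Gamma> K (x n) (rs n) - - (Q (rs n) + 2 * e * S (rs n)) / 2) + 2 * inverse (real (Suc n)))
      \<longlonglongrightarrow> \<beta> * w (fm X mh) - 0 + 2 * 0"
    by (intro tendsto_add tendsto_diff tendsto_mult_left fl Ll LIMSEQ_inverse_real_of_nat)
  then have "\<forall>\<^sub>F n in sequentially. \<beta> * f (fm X (ms n)) - (Lx X mh \<Gamma> K (x n) (rs n) - - (Q (rs n) + 2 * e * S (rs n)) / 2) + 2 * inverse (real (Suc n)) < \<beta> * w (fm X mh) + \<epsilon> / 2"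
    using \<epsilon> by (intro order_tendstoD(2)[where y = "\<beta> * w (fm X mh) - 0 + 2 * 0"]) auto
  then obtain n where n: "\<beta> * f (fm X (ms n)) - (Lx X mh \<Gamma> K (x n) (rs n) - - (Q (rs n) + 2 * e * S (rs n)) / 2) + 2 * inverse (real (Suc n)) < \<beta> * w (fm X mh) + \<epsilon> / 2"
    unfolding eventually_sequentially by blast
  obtain c0 where c0: "c (fm X mh) (rs n) = ereal c0" "c0 \<le> \<beta> * f (fm X (ms n)) - Lx X mh \<Gamma> K (x n) (rs n) + 2 * inverse (real (Suc n))"
    using le[of n] cfin[OF Pp rs[of n]] unfolding x_def[symmetric] by (cases "c (fm X mh) (rs n)") auto
  have "- (Q (rs n) + 2 * e * S (rs n)) / 2 = - (Q (rs n) / 2) - e * S (rs n)" by (simp add: add_divide_distrib)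
  then have "c0 - Q (rs n) / 2 \<le> \<beta> * w (fm X mh) + \<epsilon>" using n c0(2) SM[OF rs[of n]] by linarith
  then have "c (fm X mh) (rs n) - ereal (Q (rs n) / 2) \<le> ereal (\<beta> * w (fm X mh) + \<epsilon>)" unfolding c0(1) by simp
  then show ?thesis using rs[of n] unfolding Q_def T_def by blast
qed

text \<open>Open sets of \<open>TP p\<close> are sequentially open, so a failing sequence of weights
  would contradict \<open>fm_convP\<close>. This transports the continuity of the cost to the
  coordinates.\<close>

lemma fm_nbhd:
  assumes X: "finite X" and p: "p = 0 \<or> p \<ge> 1" and mb: "mb \<in> psimplex X" and U: "openin (TP p) U" "fm X mb \<in> U"
  shows "\<exists>d>0. \<forall>m\<in>psimplex X. (\<forall>i\<in>X. \<bar>m i - mb i\<bar> < d) \<longrightarrow> fm X m \<in> U"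
proof (rule ccontr)
  assume "\<not> ?thesis"
  then have ne: "\<exists>m. m \<in> psimplex X \<and> (\<forall>i\<in>X. \<bar>m i - mb i\<bar> < d) \<and> fm X m \<notin> U" if "0 < d" for d using that by blast
  have "\<exists>m. m \<in> psimplex X \<and> (\<forall>i\<in>X. \<bar>m i - mb i\<bar> < inverse (real (Suc n))) \<and> fm X m \<notin> U" for n by (rule ne) simp
  then obtain ms where ms: "\<And>n. ms n \<in> psimplex X" "\<And>n i. i \<in> X \<Longrightarrow> \<bar>ms n i - mb i\<bar> < inverse (real (Suc n))" "\<And>n. fm X (ms n) \<notin> U"
    using choice[of "\<lambda>n m. m \<in> psimplex X \<and> (\<forall>i\<in>X. \<bar>m i - mb i\<bar> < inverse (real (Suc n))) \<and> fm X m \<notin> U"] by blast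
  have "(\<lambda>n. ms n i) \<longlonglongrightarrow> mb i" if "i \<in> X" for i
    using null_sequence_le[OF ms(2)[OF that]] by (rule LIM_zero_cancel)
  then have "convP p (\<lambda>n. fm X (ms n)) (fm X mb)" by (intro fm_convP[OF X ms(1) mb p])
  moreover have "range (\<lambda>n. fm X (ms n)) \<subseteq> Pp p" using fm_Pp[OF X ms(1)] by blast
  ultimately have "\<forall>\<^sub>F n in sequentially. fm X (ms n) \<in> U" using U unfolding openin_TP by blast
  then show False using ms(3) by simp
qed

lemma fm_extend:
  assumes X: "finite X" and X': "X' \<subseteq> X" and m: "\<And>x. x \<in> X' \<Longrightarrow> 0 \<le> m x"
  shows "fm X (\<lambda>x. if x \<in> X' then m x else 0) = fm X' m"
proof (rule measure_eqI)
  fix A assume "A \<in> sets (fm X (\<lambda>x. if x \<in> X' then m x else 0))"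
  then have A: "A \<in> sets borel" by simp
  have fin: "finite X'" using X X' by (rule rev_finite_subset)
  have "(\<Sum>x\<in>X \<inter> A. if x \<in> X' then m x else 0) = (\<Sum>x\<in>(X \<inter> A) \<inter> X'. m x)" using X by (simp add: sum.inter_restrict)
  also have "(X \<inter> A) \<inter> X' = X' \<inter> A" using X' by blast
  finally show "emeasure (fm X (\<lambda>x. if x \<in> X' then m x else 0)) A = emeasure (fm X' m) A"
    using emeasure_fm[OF X A, of "\<lambda>x. if x \<in> X' then m x else 0"] emeasure_fm[OF fin A, of m] m by simp
qed simp

lemma psimplex_extend:
  assumes "finite X" "X' \<subseteq> X" "m \<in> psimplex X'"
  shows "(\<lambda>x. if x \<in> X' then m x else 0) \<in> psimplex X"
proof -
  have "(\<Sum>x\<in>X. if x \<in> X' then m x else 0) = (\<Sum>x\<in>X \<inter> X'. m x)" using assms(1) by (simp add: sum.inter_restrict)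
  also have "X \<inter> X' = X'" using assms(2) by blast
  finally show ?thesis using assms(3) by (auto simp: psimplex_def)
qed

section \<open>From the simplex to all measures\<close>

theorem theorem9p1:
  fixes p q \<beta> :: real
    and Hs :: "('a::euclidean_space \<Rightarrow> real) set"
    and TH :: "('a \<Rightarrow> real) topology"
    and c :: "'a measure \<Rightarrow> ('a \<Rightarrow> real) \<Rightarrow> ereal"
    and u w :: "'a measure \<Rightarrow> real"
  assumes p: "p = 0 \<or> p \<ge> 1"
    and H_polish: "Polish TH" "topspace TH = Hs"
    and H_meas: "\<forall>\<rho>\<in>Hs. \<rho> \<in> borel_measurable borel"
    and c_meas: "(\<lambda>(\<mu>, \<rho>). c \<mu> \<rho>) \<in> borel_of (prod_topology (TP p) TH) \<rightarrow>\<^sub>M borel"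
    and c_not_minf: "\<forall>\<mu>\<in>Pp p. \<forall>\<rho>\<in>Hs. c \<mu> \<rho> \<noteq> -\<infinity>"
    and beta: "\<beta> > 0"
    and cont_c: "\<forall>X. finite X \<longrightarrow> (\<forall>\<mu>\<in>PX X. \<forall>\<epsilon>>0. \<exists>U. openin (TP p) U \<and> \<mu> \<in> U \<and>
                   (\<forall>\<nu>\<in>U \<inter> PX X. \<forall>\<rho>\<in>Hs. c \<nu> \<rho> = c \<mu> \<rho> \<or> \<bar>c \<nu> \<rho> - c \<mu> \<rho>\<bar> < ereal \<epsilon>))"
    and bdd_H: "\<forall>x. bounded {\<rho> x - \<rho> 0 | \<rho>. \<rho> \<in> Hs}"
    and q: "q = 0 \<or> (1 \<le> q \<and> q \<le> p)"
    and u_cont: "continuous_map (TP p) euclideanreal u"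
    and w_cont: "continuous_map (TP p) euclideanreal w"
    and u_sub: "visc_sub p q c Hs \<beta> (\<lambda>\<mu>. ereal (u \<mu>))"
    and w_super: "visc_super p q c Hs \<beta> (\<lambda>\<mu>. ereal (w \<mu>))"
  shows "\<forall>\<mu>\<in>Pp p. u \<mu> \<le> w \<mu>"
proof -
  have q': "q = 0 \<or> q \<ge> 1" using q by auto
  have meas: "\<And>\<rho>. \<rho> \<in> Hs \<Longrightarrow> \<rho> \<in> borel_measurable borel" using H_meas by blast
  have cfin: "\<And>\<mu> \<rho>. \<mu> \<in> Pp p \<Longrightarrow> \<rho> \<in> Hs \<Longrightarrow> c \<mu> \<rho> \<noteq> -\<infinity>" using c_not_minf by blast
  have cc: "\<exists>U. openin (TP p) U \<and> fm X m \<in> U \<and>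
        (\<forall>\<nu>\<in>U \<inter> PX X. \<forall>\<rho>\<in>Hs. c \<nu> \<rho> = c (fm X m) \<rho> \<or> \<bar>c \<nu> \<rho> - c (fm X m) \<rho>\<bar> < ereal e)"
    if "finite X" "m \<in> psimplex X" "0 < e" for X m e
    using cont_c[rule_format, OF that(1) fm_PX[OF that(1,2)] that(3)] .
  have full: "u (fm X mb) \<le> w (fm X mb)"
    if X: "finite X" "X \<noteq> {}" and mb: "mb \<in> psimplex X" "\<And>i. i \<in> X \<Longrightarrow> 0 < mb i"
      and max: "\<And>m. m \<in> psimplex X \<Longrightarrow> u (fm X m) - w (fm X m) \<le> u (fm X mb) - w (fm X mb)" for X mb
  proof -
    have "\<forall>k. \<exists>B. \<forall>\<rho>\<in>Hs. \<bar>\<rho> k - \<rho> 0\<bar> \<le> B"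
    proof
      fix k
      show "\<exists>B. \<forall>\<rho>\<in>Hs. \<bar>\<rho> k - \<rho> 0\<bar> \<le> B" using bdd_H[rule_format, of k] unfolding bounded_iff by auto
    qed
    then obtain Bk where Bk: "\<And>k \<rho>. \<rho> \<in> Hs \<Longrightarrow> \<bar>\<rho> k - \<rho> 0\<bar> \<le> Bk k" using choice[of "\<lambda>k B. \<forall>\<rho>\<in>Hs. \<bar>\<rho> k - \<rho> 0\<bar> \<le> B"] by blast
    define B where "B = (\<Sum>k\<in>X. \<bar>Bk k\<bar>)"
    have B0: "0 \<le> B" unfolding B_def by (intro sum_nonneg) auto
    have bd: "\<bar>\<rho> k - \<rho> 0\<bar> \<le> B" if "\<rho> \<in> Hs" "k \<in> X" for \<rho> k
    proof -
      have "\<bar>Bk k\<bar> \<le> B" unfolding B_def using X(1) that(2) by (intro member_le_sum) auto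
      then show ?thesis using Bk[OF that(1), of k] by linarith
    qed
    \<comment> \<open>Only the differences \<open>\<rho> k - \<rho> 0\<close> are bounded over Hs,
      so they replace \<rho>. The quadratic forms contain \<rho> minus its mean and do not
      change.\<close>
    define R where "R \<rho> k = (if \<rho> \<in> Hs \<and> k \<in> X then \<rho> k - \<rho> 0 else 0)" for \<rho> :: "'a \<Rightarrow> real" and k
    have Rb: "\<bar>R \<rho> k\<bar> \<le> B" for \<rho> k using bd B0 by (simp add: R_def)
    have RT: "R \<rho> i - (\<Sum>k\<in>X. R \<rho> k * m k) = \<rho> i - (\<Sum>k\<in>X. \<rho> k * m k)" if "\<rho> \<in> Hs" "i \<in> X" "m \<in> psimplex X" for \<rho> i m
    proof -
      have "(\<Sum>k\<in>X. R \<rho> k * m k) = (\<Sum>k\<in>X. \<rho> k * m k) - \<rho> 0 * (\<Sum>k\<in>X. m k)"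
        unfolding sum_distrib_left sum_subtractf[symmetric] using that(1) by (intro sum.cong refl) (simp add: R_def left_diff_distrib)
      then show ?thesis using that by (simp add: psimplex_def R_def)
    qed
    have RQ: "(\<Sum>i\<in>X. \<Sum>j\<in>X. (R \<rho> i - (\<Sum>k\<in>X. R \<rho> k * m k)) * (R \<rho> j - (\<Sum>k\<in>X. R \<rho> k * m k)) * P i j)
        = (\<Sum>i\<in>X. \<Sum>j\<in>X. (\<rho> i - (\<Sum>k\<in>X. \<rho> k * m k)) * (\<rho> j - (\<Sum>k\<in>X. \<rho> k * m k)) * P i j)" if "\<rho> \<in> Hs" "m \<in> psimplex X" for \<rho> m P
      using RT[OF that(1) _ that(2)] by (intro sum.cong refl) simp
    show ?thesis
    proof (rule simplex_comparison[OF X mb, where u = "\<lambda>m. u (fm X m)" and w = "\<lambda>m. w (fm X m)" and c = "\<lambda>m. c (fm X m)" and \<rho> = R and Hs = Hs and B = B and \<beta> = \<beta>])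
      show "seqcont X (psimplex X) (\<lambda>m. u (fm X m))" by (rule seqcont_fm[OF X(1) p u_cont])
      show "seqcont X (psimplex X) (\<lambda>m. w (fm X m))" by (rule seqcont_fm[OF X(1) p w_cont])
      show "\<And>m m'. \<forall>i\<in>X. m i = m' i \<Longrightarrow> u (fm X m) = u (fm X m')" by (intro arg_cong[where f = u] fm_cong) simp
      show "\<And>m m'. \<forall>i\<in>X. m i = m' i \<Longrightarrow> w (fm X m) = w (fm X m')" by (intro arg_cong[where f = w] fm_cong) simp
      show "\<And>m. m \<in> psimplex X \<Longrightarrow> u (fm X m) - w (fm X m) \<le> u (fm X mb) - w (fm X mb)" by (rule max)
      show "\<beta> > 0" by (rule beta)
      fix m b P r assume m: "m \<in> psimplex X" "\<And>i. i \<in> X \<Longrightarrow> 0 < m i" and j: "rsup X (\<lambda>m. u (fm X m)) m b P" and r: "r \<in> Hs"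
      show "ereal (\<beta> * u (fm X m)) \<le> c (fm X m) r + ereal ((\<Sum>i\<in>X. \<Sum>j\<in>X. (R r i - (\<Sum>k\<in>X. R r k * m k)) * (R r j - (\<Sum>k\<in>X. R r k * m k)) * P i j) / 2)"
        unfolding RQ[OF r m(1)] by (rule visc_sub_jet[OF p q' X m meas cc[OF X(1) m(1)] cfin u_cont u_sub j r])
    next
      fix m b P and e :: real assume m: "m \<in> psimplex X" "\<And>i. i \<in> X \<Longrightarrow> 0 < m i" and j: "rsup X (\<lambda>m. - w (fm X m)) m b P" and e: "0 < e"
      obtain r where r: "r \<in> Hs" "c (fm X m) r - ereal ((\<Sum>i\<in>X. \<Sum>j\<in>X. (r i - (\<Sum>k\<in>X. r k * m k)) * (r j - (\<Sum>k\<in>X. r k * m k)) * P i j) / 2) \<le> ereal (\<beta> * w (fm X m) + e)"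
        using visc_super_jet[OF p q' X m meas cc[OF X(1) m(1)] cfin bd w_cont w_super j e] by blast
      show "\<exists>r\<in>Hs. c (fm X m) r - ereal ((\<Sum>i\<in>X. \<Sum>j\<in>X. (R r i - (\<Sum>k\<in>X. R r k * m k)) * (R r j - (\<Sum>k\<in>X. R r k * m k)) * P i j) / 2) \<le> ereal (\<beta> * w (fm X m) + e)"
        by (rule bexI[OF _ r(1)]) (use r(2) in \<open>simp only: RQ[OF r(1) m(1)]\<close>)
    next
      fix e :: real assume e: "0 < e"
      obtain U where U: "openin (TP p) U" "fm X mb \<in> U" "\<forall>\<nu>\<in>U \<inter> PX X. \<forall>\<rho>\<in>Hs. c \<nu> \<rho> = c (fm X mb) \<rho> \<or> \<bar>c \<nu> \<rho> - c (fm X mb) \<rho>\<bar> < ereal e"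
        using cc[OF X(1) mb(1) e] by blast
      obtain d where d: "d > 0" "\<forall>m\<in>psimplex X. (\<forall>i\<in>X. \<bar>m i - mb i\<bar> < d) \<longrightarrow> fm X m \<in> U"
        using fm_nbhd[OF X(1) p mb(1) U(1,2)] by blast
      have "c (fm X m) r = c (fm X mb) r \<or> \<bar>c (fm X m) r - c (fm X mb) r\<bar> < ereal e"
        if "m \<in> psimplex X" "\<forall>i\<in>X. \<bar>m i - mb i\<bar> < d" "r \<in> Hs" for m r
      proof -
        have "fm X m \<in> U \<inter> PX X" using d(2) that(1,2) fm_PX[OF X(1) that(1)] by simp
        then show ?thesis using U(3) that(3) by blast
      qed
      then show "\<exists>d>0. \<forall>m\<in>psimplex X. (\<forall>i\<in>X. \<bar>m i - mb i\<bar> < d) \<longrightarrow> (\<forall>r\<in>Hs. c (fm X m) r = c (fm X mb) r \<or> \<bar>c (fm X m) r - c (fm X mb) r\<bar> < ereal e)"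
        using d(1) by blast
    next
      show "\<And>r. r \<in> Hs \<Longrightarrow> c (fm X mb) r \<noteq> - \<infinity>" by (rule cfin[OF fm_Pp[OF X(1) mb(1)]])
      show "\<And>r i. \<bar>R r i\<bar> \<le> B" by (rule Rb)
    qed
  qed
  have fin: "u (fm X m) \<le> w (fm X m)" if X: "finite X" and m: "m \<in> psimplex X" for X m
  proof -
    have "psimplex X \<noteq> {}" using m by blast
    from seqcont_attains_sup[OF seqcomp_simplex[OF X] this seqcont_diff[OF seqcont_fm[OF X p u_cont] seqcont_fm[OF X p w_cont]]]
    obtain m0 where m0: "m0 \<in> psimplex X" "\<And>m. m \<in> psimplex X \<Longrightarrow> u (fm X m) - w (fm X m) \<le> u (fm X m0) - w (fm X m0)" by blast
    \<comment> \<open>Restricting to the atoms of the maximiser makes it interior. It stays a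
      maximiser, because measures on X' extend by weight 0 to measures on X.\<close>
    define X' where "X' = {x \<in> X. 0 < m0 x}"
    have X': "X' \<subseteq> X" "finite X'" using X by (auto simp: X'_def)
    have z: "m0 x = 0" if "x \<in> X - X'" for x using that m0(1) by (force simp: X'_def psimplex_def)
    have s: "(\<Sum>x\<in>X'. m0 x) = 1" using sum.mono_neutral_right[OF X X'(1), of m0] z m0(1) by (simp add: psimplex_def)
    then have ne: "X' \<noteq> {}" by auto
    have m0': "m0 \<in> psimplex X'" "\<And>i. i \<in> X' \<Longrightarrow> 0 < m0 i" using s by (auto simp: psimplex_def X'_def)
    have eq: "fm X' m0 = fm X m0"
    proof -
      have "fm X' m0 = fm X (\<lambda>x. if x \<in> X' then m0 x else 0)" using fm_extend[OF X X'(1), of m0] m0'(2) by (simp add: less_imp_le)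
      also have "\<dots> = fm X m0" using z by (intro fm_cong) auto
      finally show ?thesis .
    qed
    have "u (fm X' m0) \<le> w (fm X' m0)"
    proof (rule full[OF X'(2) ne m0'])
      fix m' assume m': "m' \<in> psimplex X'"
      have "fm X' m' = fm X (\<lambda>x. if x \<in> X' then m' x else 0)" using fm_extend[OF X X'(1), of m'] m' by (simp add: psimplex_def)
      then show "u (fm X' m') - w (fm X' m') \<le> u (fm X' m0) - w (fm X' m0)"
        using m0(2)[OF psimplex_extend[OF X X'(1) m']] unfolding eq by simp
    qed
    \<comment> \<open>The largest value of u - w on the simplex is not positive, so no value
      is.\<close>
    then show ?thesis using m0(2)[OF m] unfolding eq by linarith
  qed
  show ?thesis
  proof
    fix \<mu> :: "'a measure" assume \<mu>: "\<mu> \<in> Pp p"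
    \<comment> \<open>Both functions are continuous, so the inequality passes from finitely
      supported measures to their limits.\<close>
    obtain \<mu>s where \<mu>s: "\<And>n. \<exists>X m. finite X \<and> m \<in> psimplex X \<and> \<mu>s n = fm X m" "convP p \<mu>s \<mu>"
      using finite_measures_dense[OF p \<mu>] by blast
    have "\<mu>s n \<in> Pp p" for n using \<mu>s(1)[of n] fm_Pp by auto
    then have r: "range \<mu>s \<subseteq> Pp p" by blast
    have "u (\<mu>s n) \<le> w (\<mu>s n)" for n using \<mu>s(1)[of n] fin by auto
    then show "u \<mu> \<le> w \<mu>"
      by (intro LIMSEQ_le[OF continuous_TP_seq[OF u_cont \<mu> r \<mu>s(2)] continuous_TP_seq[OF w_cont \<mu> r \<mu>s(2)]]) blast
  qed
qed

end
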